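(* Let $\Bbbk$ be an algebraically closed field of characteristic $p>0$, and let $\lambda_1(u),\lambda_2(u)\in\Bbbk[u^{-1}]$ be restricted polynomials in $u^{-1}$. Then the simple $Y_2^{[p]}$-module $L^{[p]}(\lambda_1(u),\lambda_2(u))$ is isomorphic to some tensor product of evaluation modules $L(a,b)$, $a,b\in\mathbb{F}_p$. In particular, $L^{[p]}(\lambda_1(u),\lambda_2(u))$ is finite dimensional.
   Context: **Yangian.** $\Bbbk$ is an algebraically closed field of characteristic $p>0$. $Y_2$ is the associative unital $\Bbbk$-algebra with generators $t_{i,j}^{(r)}$ ($1\le i,j\le 2$, $r>0$) and relations $$[t_{i,j}^{(r)},t_{k,l}^{(s)}]=\sum_{t=0}^{\min(r,s)-1}\left(t_{k,j}^{(t)}t_{i,l}^{(r+s-1-t)}-t_{k,j}^{(r+s-1-t)}t_{i,l}^{(t)}\right),\qquad t_{i,j}^{(0)}:=\delta_{i,j}.$$ Put $t_{i,j}(u)=\sum_{r\ge0}t_{i,j}^{(r)}u^{-r}$. The Drinfeld generators are defined by $t_{1,1}(u)=d_1(u)$, $t_{1,2}(u)=d_1(u)e(u)$, $t_{2,1}(u)=f(u)d_1(u)$, $t_{2,2}(u)=f(u)d_1(u)e(u)+d_2(u)$, with $d_i(u)=\sum_{r\ge0}d_i^{(r)}u^{-r}$, $e(u)=\sum_{r>0}e^{(r)}u^{-r}$, $f(u)=\sum_{r>0}f^{(r)}u^{-r}$. **Restricted Yangian.** Let $b_i(u)=\sum_{r\ge0}b_i^{(r)}u^{-r}:=d_i(u)d_i(u-1)\cdots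 d_i(u-p+1)$. The elements $b_i^{(rp)}$ ($i=1,2$, $r>0$), $(e^{(r)})^p$, $(f^{(r)})^p$ ($r>0$) are central; they generate the $p$-center $Z_p(Y_2)$, and $Z_p(Y_2)_+$ is the ideal of $Z_p(Y_2)$ generated by them. Put $Y_2^{[p]}:=Y_2/Y_2Z_p(Y_2)_+$; the same symbols denote images of generators. The comultiplication $\Delta(t_{i,j}(u))=\sum_{k=1}^2t_{i,k}(u)\otimes t_{k,j}(u)$ of $Y_2$ descends to $Y_2^{[p]}$, and tensor products of $Y_2^{[p]}$-modules are $Y_2^{[p]}$-modules via $\Delta$. **Restricted series.** $g(u)\in\Bbbk[[u^{-1}]]$ is restricted if $g(u)g(u-1)\cdots g(u-p+1)=1$. A tuple $\lambda(u)=(\lambda_1(u),\lambda_2(u))$, $\lambda_i(u)=1+\sum_{r>0}\lambda_i^{(r)}u^{-r}$, is restricted if both components are. **Baby Verma and simple modules.** For restricted $\lambda(u)$, $Z^{[p]}(\lambda(u))$ is the quotient of $Y_2^{[p]}$ by the left ideal generated by all $e^{(r)}$ and all $d_i^{(r)}-\lambda_i^{(r)}$ ($i=1,2$, $r>0$). It has a unique maximal proper submodule; $L^{[p]}(\lambda(u))=L^{[p]}(\lambda_1(u),\lambda_2(u))$ is the corresponding simple quotient. **Evaluation modules.** For $a,b\in\mathbb{F}_p$, $L(a,b)$ is the irreducible module over the restricted enveloping algebra $U_0(\mathfrak{gl}_2)=U(\mathfrak{gl}_2)/(x^p-x^{[p]};\,x\in\mathfrak{gl}_2)$ ($x^{[p]}$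 = $p$th matrix power) generated by a vector $\xi$ with $e_{1,1}\xi=a\xi$, $e_{2,2}\xi=b\xi$, $e_{1,2}\xi=0$. It is a $Y_2^{[p]}$-module with $t_{i,j}^{(1)}$ acting as the matrix unit $e_{i,j}$ and $t_{i,j}^{(r)}$ acting as $0$ for $r\ge2$. *)

theory Defs
  imports
    "HOL-Analysis.Cartesian_Space"
    "HOL-Computational_Algebra.Polynomial_FPS"
    "HOL-Library.Poly_Mapping"
    "HOL-Algebra.Module"
    "HOL-Algebra.AbelCoset"
begin

section \<open>Free associative algebras and two-sided ideals\<close>

text \<open>
  The free monoid on \<open>'g\<close>, written additively so that the convolution product of
  finitely supported functions on it is the product of the free associative algebra.
\<close>

datatype 'g word = Word "'g list"

instantiation word :: (type) monoid_add
begin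

definition zero_word :: "'g word" where "zero_word = Word []"

fun plus_word :: "'g word \<Rightarrow> 'g word \<Rightarrow> 'g word" where
  "plus_word (Word xs) (Word ys) = Word (xs @ ys)"

instance
proof
  fix a b c :: "'g word"
  show "a + b + c = a + (b + c)" by (cases a; cases b; cases c) simp
  show "0 + a = a" "a + 0 = a" by (cases a; simp add: zero_word_def)+
qed

end

type_synonym ('g, 'k) free_algebra = "'g word \<Rightarrow>\<^sub>0 'k"

definition fgen :: "'g \<Rightarrow> ('g, 'k::field) free_algebra" where
  "fgen g = Poly_Mapping.single (Word [g]) 1"

definition fscal :: "'k::field \<Rightarrow> ('g, 'k) free_algebra" where
  "fscal c = Poly_Mapping.single 0 c"

inductive_set two_sided_ideal :: "'a::{ring, monoid_mult} set \<Rightarrow> 'a set" for S where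
  zero: "0 \<in> two_sided_ideal S"
| gen: "s \<in> S \<Longrightarrow> a * s * b \<in> two_sided_ideal S"
| add: "x \<in> two_sided_ideal S \<Longrightarrow> y \<in> two_sided_ideal S \<Longrightarrow> x + y \<in> two_sided_ideal S"

lemma two_sided_ideal_mult:
  assumes "x \<in> two_sided_ideal S"
  shows "a * x * b \<in> two_sided_ideal S"
  using assms
proof induction
  case (gen s a' b')
  have "a * (a' * s * b') * b = (a * a') * s * (b' * b)"
    by (simp add: mult.assoc)
  with gen show ?case
    by (metis two_sided_ideal.gen)
qed (auto simp: distrib_left distrib_right intro: two_sided_ideal.intros)

lemma two_sided_ideal_uminus: "x \<in> two_sided_ideal S \<Longrightarrow> - x \<in> two_sided_ideal S"
  using two_sided_ideal_mult[of x S "- 1" 1] by simp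

lemma two_sided_ideal_cong_refl: "x - x \<in> two_sided_ideal S"
  by (simp add: two_sided_ideal.zero)

lemma two_sided_ideal_cong_sym:
  "x - y \<in> two_sided_ideal S \<Longrightarrow> y - x \<in> two_sided_ideal S"
  using two_sided_ideal_uminus[of "x - y" S] by simp

lemma two_sided_ideal_cong_trans:
  "x - y \<in> two_sided_ideal S \<Longrightarrow> y - z \<in> two_sided_ideal S \<Longrightarrow> x - z \<in> two_sided_ideal S"
  using two_sided_ideal.add[of "x - y" S "y - z"] by simp

lemma two_sided_ideal_equivp: "equivp (\<lambda>x y. x - y \<in> two_sided_ideal S)"
  by (intro equivpI reflpI sympI transpI)
     (blast intro: two_sided_ideal_cong_refl two_sided_ideal_cong_sym two_sided_ideal_cong_trans)+

lemma two_sided_ideal_cong_add: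
  "x - x' \<in> two_sided_ideal S \<Longrightarrow> y - y' \<in> two_sided_ideal S
   \<Longrightarrow> (x + y) - (x' + y') \<in> two_sided_ideal S"
  using two_sided_ideal.add[of "x - x'" S "y - y'"] by (simp add: algebra_simps)

lemma two_sided_ideal_cong_uminus:
  "x - x' \<in> two_sided_ideal S \<Longrightarrow> - x - - x' \<in> two_sided_ideal S"
  using two_sided_ideal_cong_sym[of x x' S] by simp

lemma two_sided_ideal_cong_minus:
  "x - x' \<in> two_sided_ideal S \<Longrightarrow> y - y' \<in> two_sided_ideal S
   \<Longrightarrow> (x - y) - (x' - y') \<in> two_sided_ideal S"
  using two_sided_ideal_cong_add[of x x' S "- y" "- y'"] two_sided_ideal_cong_uminus[of y y' S]
  by simp

lemma two_sided_ideal_cong_mult: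
  assumes "x - x' \<in> two_sided_ideal S" "y - y' \<in> two_sided_ideal S"
  shows "x * y - x' * y' \<in> two_sided_ideal S"
proof -
  have "x * y - x' * y' = 1 * (x - x') * y + x' * (y - y') * 1"
    by (simp add: algebra_simps)
  then show ?thesis
    using assms by (metis two_sided_ideal_mult two_sided_ideal.add)
qed


section \<open>The Yangian \<open>Y\<^sub>2\<close>\<close>

text \<open>
  Matrix indices are the elements \<open>1\<close> and \<open>2\<close> of the two-element type \<open>2\<close>.
  The generator symbol \<open>(i, j, n)\<close> stands for \<open>t\<^sub>i\<^sub>,\<^sub>j\<close> of superscript \<open>n + 1\<close>, so that superscript
  \<open>0\<close> is the scalar \<open>\<delta>\<^sub>i\<^sub>,\<^sub>j\<close> and not a generator.
\<close>

type_synonym ygen = "2 \<times> 2 \<times> nat"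

definition tsym :: "2 \<Rightarrow> 2 \<Rightarrow> nat \<Rightarrow> (ygen, 'k::field) free_algebra" where
  "tsym i j r = (case r of 0 \<Rightarrow> (if i = j then 1 else 0) | Suc n \<Rightarrow> fgen (i, j, n))"

definition yangian_relations :: "(ygen, 'k::field) free_algebra set" where
  "yangian_relations =
     {(tsym i j r * tsym k l s - tsym k l s * tsym i j r)
        - (\<Sum>t<min r s. tsym k j t * tsym i l (r + s - 1 - t)
                        - tsym k j (r + s - 1 - t) * tsym i l t)
      | i j k l r s. 0 < r \<and> 0 < s}"

quotient_type (overloaded) 'k yangian = "(ygen, 'k::field) free_algebra" /
    "\<lambda>x y. x - y \<in> two_sided_ideal yangian_relations"
  by (rule two_sided_ideal_equivp)

text \<open>
  The augmentation (constant term) of the free algebra kills the relations; hence the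
  quotient is nontrivial.
\<close>

lemma word_eq_single_plus_iff: "0 = a + (b :: 'g word) \<longleftrightarrow> a = 0 \<and> b = 0"
  by (cases a; cases b) (auto simp: zero_word_def)

lemma lookup_mult_0:
  fixes x y :: "('g, 'k::field) free_algebra"
  shows "Poly_Mapping.lookup (x * y) 0 = Poly_Mapping.lookup x 0 * Poly_Mapping.lookup y 0"
proof -
  have "Sum_any (\<lambda>q. Poly_Mapping.lookup y q when 0 = l + q)
      = (Poly_Mapping.lookup y 0 when l = 0)"
    for l :: "'g word"
    by (cases "l = 0") (simp_all add: word_eq_single_plus_iff)
  then have "Poly_Mapping.lookup (x * y) 0
      = Sum_any (\<lambda>l. Poly_Mapping.lookup x l * (Poly_Mapping.lookup y 0 when l = 0))"
    by (simp add: times_poly_mapping.rep_eq prod_fun_def)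
  also have "\<dots> = Sum_any (\<lambda>l. Poly_Mapping.lookup x l * Poly_Mapping.lookup y 0 when l = 0)"
    by (simp add: mult_when)
  finally show ?thesis by simp
qed

lemma lookup_tsym_0: "Poly_Mapping.lookup (tsym i j r :: (ygen, 'k::field) free_algebra) 0
    = (if r = 0 \<and> i = j then 1 else 0)"
  by (auto simp: tsym_def fgen_def lookup_single zero_word_def lookup_one split: nat.splits)

lemma lookup_two_sided_ideal_0:
  assumes "x \<in> two_sided_ideal (yangian_relations :: (ygen, 'k::field) free_algebra set)"
  shows "Poly_Mapping.lookup x 0 = 0"
  using assms
proof induction
  case (gen s a b)
  have "Poly_Mapping.lookup s 0 = 0"
    using gen by (auto simp: yangian_relations_def lookup_minus lookup_sum lookup_mult_0
        lookup_tsym_0 intro!: sum.neutral)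
  then show ?case by (simp add: lookup_mult_0)
qed (simp_all add: lookup_add)

instantiation yangian :: (field) ring_1
begin

lift_definition zero_yangian :: "'a yangian" is 0 .
lift_definition one_yangian :: "'a yangian" is 1 .
lift_definition plus_yangian :: "'a yangian \<Rightarrow> 'a yangian \<Rightarrow> 'a yangian" is "(+)"
  by (rule two_sided_ideal_cong_add)
lift_definition uminus_yangian :: "'a yangian \<Rightarrow> 'a yangian" is uminus
  by (rule two_sided_ideal_cong_uminus)
lift_definition minus_yangian :: "'a yangian \<Rightarrow> 'a yangian \<Rightarrow> 'a yangian" is "(-)"
  by (rule two_sided_ideal_cong_minus)
lift_definition times_yangian :: "'a yangian \<Rightarrow> 'a yangian \<Rightarrow> 'a yangian" is "(*)"
  by (rule two_sided_ideal_cong_mult)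

instance
proof
  show "(0 :: 'a yangian) \<noteq> 1"
    by transfer (auto dest: lookup_two_sided_ideal_0 simp: lookup_minus lookup_one)
qed (transfer; simp add: algebra_simps two_sided_ideal.zero)+

end

lift_definition yscal :: "'k::field \<Rightarrow> 'k yangian" is fscal .

lift_definition yt :: "2 \<Rightarrow> 2 \<Rightarrow> nat \<Rightarrow> 'k::field yangian" is tsym .

text \<open>All formal power series are in the indeterminate \<open>u\<^sup>-\<^sup>1\<close>.\<close>

definition yt_series :: "2 \<Rightarrow> 2 \<Rightarrow> 'k::field yangian fps" where
  "yt_series i j = Abs_fps (yt i j)"

text \<open>
  The constant term of \<open>t\<^sub>1\<^sub>,\<^sub>1(u)\<close> is \<open>1\<close>, so its right inverse is its two-sided inverse.
\<close>

definition d1_inv_series :: "'k::field yangian fps" where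
  "d1_inv_series = fps_right_inverse (yt_series 1 1) 1"

definition e_series :: "'k::field yangian fps" where
  "e_series = d1_inv_series * yt_series 1 2"

definition f_series :: "'k::field yangian fps" where
  "f_series = yt_series 2 1 * d1_inv_series"

definition d_series :: "2 \<Rightarrow> 'k::field yangian fps" where
  "d_series i =
     (if i = 1 then yt_series 1 1
      else yt_series 2 2 - f_series * yt_series 1 1 * e_series)"

lemma drinfeld_factorisation:
  "yt_series 1 1 = (d_series 1 :: 'k::field yangian fps)"
  "yt_series 1 2 = (d_series 1 * e_series :: 'k::field yangian fps)"
  "yt_series 2 1 = (f_series * d_series 1 :: 'k::field yangian fps)"
  "yt_series 2 2 = (f_series * d_series 1 * e_series + d_series 2 :: 'k::field yangian fps)"
  "fps_nth (e_series :: 'k yangian fps) 0 = 0"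
  "fps_nth (f_series :: 'k yangian fps) 0 = 0"
proof -
  have t0: "yt i j 0 = (if i = j then 1 else 0 :: 'k yangian)" for i j
    by transfer (simp add: tsym_def two_sided_ideal.zero)
  have r: "yt_series 1 1 * d1_inv_series = (1 :: 'k yangian fps)"
    unfolding d1_inv_series_def by (rule fps_right_inverse) (simp add: yt_series_def t0)
  have l: "d1_inv_series * yt_series 1 1 = (1 :: 'k yangian fps)"
    unfolding d1_inv_series_def
    by (rule fps_left_inverse'[where x = 1]) (simp_all add: yt_series_def t0)
  show "yt_series 1 1 = (d_series 1 :: 'k yangian fps)"
    "yt_series 2 2 = (f_series * d_series 1 * e_series + d_series 2 :: 'k yangian fps)"
    by (simp_all add: d_series_def)
  show "yt_series 1 2 = (d_series 1 * e_series :: 'k yangian fps)"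
    by (simp add: d_series_def e_series_def mult.assoc[symmetric] r)
  show "yt_series 2 1 = (f_series * d_series 1 :: 'k yangian fps)"
    by (simp add: d_series_def f_series_def mult.assoc l)
  show "fps_nth (e_series :: 'k yangian fps) 0 = 0" "fps_nth (f_series :: 'k yangian fps) 0 = 0"
    by (simp_all add: e_series_def f_series_def yt_series_def t0)
qed


section \<open>Restricted series and the restricted Yangian\<close>

text \<open>
  \<open>fps_shift_arg c g\<close> is \<open>g(u - c)\<close>: the substitution sends \<open>u\<^sup>-\<^sup>1\<close> to
  \<open>(u - c)\<^sup>-\<^sup>1 = u\<^sup>-\<^sup>1 + c u\<^sup>-\<^sup>2 + c\<^sup>2 u\<^sup>-\<^sup>3 + \<dots>\<close>.
\<close>

definition fps_shift_arg :: "nat \<Rightarrow> 'a::ring_1 fps \<Rightarrow> 'a fps" where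
  "fps_shift_arg c g = g oo Abs_fps (\<lambda>n. if n = 0 then 0 else of_nat c ^ (n - 1))"

text \<open>The product \<open>g(u) g(u - 1) \<cdots> g(u - p + 1)\<close>, with the factors in this order.\<close>

definition shifted_product :: "nat \<Rightarrow> 'a::ring_1 fps \<Rightarrow> 'a fps" where
  "shifted_product p g = prod_list (map (\<lambda>c. fps_shift_arg c g) [0..<p])"

definition restricted_series :: "'k::field fps \<Rightarrow> bool" where
  "restricted_series g \<longleftrightarrow> shifted_product CHAR('k) g = 1"

definition restricted_weight :: "'k::field fps \<Rightarrow> 'k fps \<Rightarrow> bool" where
  "restricted_weight l1 l2 \<longleftrightarrow>
     fps_nth l1 0 = 1 \<and> fps_nth l2 0 = 1 \<and> restricted_series l1 \<and> restricted_series l2"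

definition b_series :: "2 \<Rightarrow> 'k::field yangian fps" where
  "b_series i = shifted_product CHAR('k) (d_series i)"

definition p_center_gens :: "'k::field yangian set" where
  "p_center_gens =
     {fps_nth (b_series i) (r * CHAR('k)) | i r. 0 < r}
     \<union> {fps_nth e_series r ^ CHAR('k) | r. 0 < r}
     \<union> {fps_nth f_series r ^ CHAR('k) | r. 0 < r}"

inductive_set p_center :: "'k::field yangian set" where
  gen: "z \<in> p_center_gens \<Longrightarrow> z \<in> p_center"
| scal: "yscal c \<in> p_center"
| add: "x \<in> p_center \<Longrightarrow> y \<in> p_center \<Longrightarrow> x + y \<in> p_center"
| mult: "x \<in> p_center \<Longrightarrow> y \<in> p_center \<Longrightarrow> x * y \<in> p_center"

inductive_set p_center_plus :: "'k::field yangian set" where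
  zero: "0 \<in> p_center_plus"
| gen: "z \<in> p_center \<Longrightarrow> g \<in> p_center_gens \<Longrightarrow> z * g \<in> p_center_plus"
| add: "x \<in> p_center_plus \<Longrightarrow> y \<in> p_center_plus \<Longrightarrow> x + y \<in> p_center_plus"

text \<open>
  Since the \<open>p\<close>-center is central, the span of the products \<open>y z\<close> below is already a
  two-sided ideal; passing to the generated two-sided ideal adds nothing, but makes the quotient
  ring available without proving centrality first.
\<close>

quotient_type (overloaded) 'k restricted_yangian = "'k::field yangian" /
    "\<lambda>x y. x - y \<in> two_sided_ideal {y * z | y z. z \<in> p_center_plus}"
  by (rule two_sided_ideal_equivp)

instantiation restricted_yangian :: (field) "{ring, monoid_mult}"
begin

lift_definition zero_restricted_yangian :: "'a restricted_yangian" is 0 .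
lift_definition one_restricted_yangian :: "'a restricted_yangian" is 1 .
lift_definition plus_restricted_yangian ::
  "'a restricted_yangian \<Rightarrow> 'a restricted_yangian \<Rightarrow> 'a restricted_yangian" is "(+)"
  by (rule two_sided_ideal_cong_add)
lift_definition uminus_restricted_yangian ::
  "'a restricted_yangian \<Rightarrow> 'a restricted_yangian" is uminus
  by (rule two_sided_ideal_cong_uminus)
lift_definition minus_restricted_yangian ::
  "'a restricted_yangian \<Rightarrow> 'a restricted_yangian \<Rightarrow> 'a restricted_yangian" is "(-)"
  by (rule two_sided_ideal_cong_minus)
lift_definition times_restricted_yangian ::
  "'a restricted_yangian \<Rightarrow> 'a restricted_yangian \<Rightarrow> 'a restricted_yangian" is "(*)"
  by (rule two_sided_ideal_cong_mult)

instance
  by standard (transfer; simp add: algebra_simps two_sided_ideal.zero)+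

end

lift_definition rscal :: "'k::field \<Rightarrow> 'k restricted_yangian" is yscal .

lift_definition rt :: "2 \<Rightarrow> 2 \<Rightarrow> nat \<Rightarrow> 'k::field restricted_yangian" is yt .

lift_definition rd :: "2 \<Rightarrow> nat \<Rightarrow> 'k::field restricted_yangian" is
  "\<lambda>i. fps_nth (d_series i)" .

lift_definition re :: "nat \<Rightarrow> 'k::field restricted_yangian" is "fps_nth e_series" .


section \<open>Left modules\<close>

text \<open>
  The library locale \<open>module\<close> requires a commutative ring of scalars; here scalars form a
  possibly noncommutative ring given as a type, and modules have explicit carriers. The
  fields \<open>mult\<close> and \<open>one\<close> of the library record are unused.
\<close>

locale left_module = abelian_group M
  for M :: "('r::{ring, monoid_mult}, 'v) module" (structure) +
  assumes smult_closed: "x \<in> carrier M \<Longrightarrow> a \<odot> x \<in> carrier M"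
    and smult_l_distr: "x \<in> carrier M \<Longrightarrow> (a + b) \<odot> x = a \<odot> x \<oplus> b \<odot> x"
    and smult_r_distr: "x \<in> carrier M \<Longrightarrow> y \<in> carrier M \<Longrightarrow> a \<odot> (x \<oplus> y) = a \<odot> x \<oplus> a \<odot> y"
    and smult_assoc: "x \<in> carrier M \<Longrightarrow> (a * b) \<odot> x = a \<odot> (b \<odot> x)"
    and smult_one: "x \<in> carrier M \<Longrightarrow> 1 \<odot> x = x"

definition left_submodule :: "'v set \<Rightarrow> ('r, 'v) module \<Rightarrow> bool" where
  "left_submodule N M \<longleftrightarrow> additive_subgroup N M \<and> (\<forall>a. \<forall>x\<in>N. a \<odot>\<^bsub>M\<^esub> x \<in> N)"

definition generated_submodule :: "('r, 'v) module \<Rightarrow> 'v set \<Rightarrow> 'v set" where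
  "generated_submodule M S = \<Inter>{N. left_submodule N M \<and> S \<subseteq> N}"

definition maximal_submodule :: "'v set \<Rightarrow> ('r, 'v) module \<Rightarrow> bool" where
  "maximal_submodule N M \<longleftrightarrow>
     left_submodule N M \<and> N \<noteq> carrier M \<and>
     (\<forall>N'. left_submodule N' M \<longrightarrow> N \<subseteq> N' \<longrightarrow> N' = N \<or> N' = carrier M)"

definition simple_module :: "('r::{ring, monoid_mult}, 'v) module \<Rightarrow> bool" where
  "simple_module M \<longleftrightarrow>
     left_module M \<and> carrier M \<noteq> {\<zero>\<^bsub>M\<^esub>} \<and>
     (\<forall>N. left_submodule N M \<longrightarrow> N = {\<zero>\<^bsub>M\<^esub>} \<or> N = carrier M)"

definition quotient_module :: "('r, 'v) module \<Rightarrow> 'v set \<Rightarrow> ('r, 'v set) module" where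
  "quotient_module M N =
     \<lparr>carrier = a_rcosets\<^bsub>M\<^esub> N, mult = undefined, one = undefined,
      zero = N, add = (\<lambda>X Y. X <+>\<^bsub>M\<^esub> Y),
      smult = (\<lambda>a X. \<Union>x\<in>X. N +>\<^bsub>M\<^esub> (a \<odot>\<^bsub>M\<^esub> x))\<rparr>"

definition regular_module :: "('r::{ring, monoid_mult}, 'r) module" where
  "regular_module =
     \<lparr>carrier = UNIV, mult = undefined, one = undefined,
      zero = 0, add = (+), smult = (*)\<rparr>"

definition module_isomorphic :: "('r, 'v) module \<Rightarrow> ('r, 'w) module \<Rightarrow> bool" where
  "module_isomorphic M N \<longleftrightarrow>
     (\<exists>\<phi>. bij_betw \<phi> (carrier M) (carrier N) \<and>
        (\<forall>x\<in>carrier M. \<forall>y\<in>carrier M. \<phi> (x \<oplus>\<^bsub>M\<^esub> y) = \<phi> x \<oplus>\<^bsub>N\<^esub> \<phi> y) \<and>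
        (\<forall>a. \<forall>x\<in>carrier M. \<phi> (a \<odot>\<^bsub>M\<^esub> x) = a \<odot>\<^bsub>N\<^esub> \<phi> x))"

definition finite_dimensional :: "('k::field restricted_yangian, 'v) module \<Rightarrow> bool" where
  "finite_dimensional M \<longleftrightarrow>
     (\<exists>B. finite B \<and> B \<subseteq> carrier M \<and>
        (\<forall>x\<in>carrier M. \<exists>c. x = (\<Oplus>\<^bsub>M\<^esub>b\<in>B. rscal (c b) \<odot>\<^bsub>M\<^esub> b)))"


section \<open>Baby Verma modules and their simple quotients\<close>

definition baby_verma ::
  "'k::field fps \<Rightarrow> 'k fps \<Rightarrow> ('k restricted_yangian, 'k restricted_yangian set) module" where
  "baby_verma l1 l2 = quotient_module regular_module
     (generated_submodule regular_module
        ({re r | r. 0 < r}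
         \<union> {rd 1 r - rscal (fps_nth l1 r) | r. 0 < r}
         \<union> {rd 2 r - rscal (fps_nth l2 r) | r. 0 < r}))"

definition simple_quotient ::
  "'k::field fps \<Rightarrow> 'k fps \<Rightarrow> ('k restricted_yangian, 'k restricted_yangian set set) module" where
  "simple_quotient l1 l2 = quotient_module (baby_verma l1 l2)
     (THE N. maximal_submodule N (baby_verma l1 l2))"


section \<open>Evaluation modules\<close>

text \<open>
  A generator symbol \<open>(i, j)\<close> stands for the matrix unit \<open>e\<^sub>i\<^sub>,\<^sub>j\<close>, and \<open>gl2_elem A\<close> is the
  image of the matrix \<open>A\<close>.
\<close>

definition gl2_elem :: "'k::field^2^2 \<Rightarrow> (2 \<times> 2, 'k) free_algebra" where
  "gl2_elem A = (\<Sum>i\<in>UNIV. \<Sum>j\<in>UNIV. fscal (A $ i $ j) * fgen (i, j))"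

definition gl2_relations :: "(2 \<times> 2, 'k::field) free_algebra set" where
  "gl2_relations =
     {gl2_elem A * gl2_elem B - gl2_elem B * gl2_elem A - gl2_elem (A ** B - B ** A) | A B. True}
     \<union> {gl2_elem A ^ CHAR('k) - gl2_elem (((\<lambda>X. A ** X) ^^ CHAR('k)) (mat 1)) | A. True}"

quotient_type (overloaded) 'k restricted_gl2 = "(2 \<times> 2, 'k::field) free_algebra" /
    "\<lambda>x y. x - y \<in> two_sided_ideal gl2_relations"
  by (rule two_sided_ideal_equivp)

instantiation restricted_gl2 :: (field) "{ring, monoid_mult}"
begin

lift_definition zero_restricted_gl2 :: "'a restricted_gl2" is 0 .
lift_definition one_restricted_gl2 :: "'a restricted_gl2" is 1 .
lift_definition plus_restricted_gl2 ::
  "'a restricted_gl2 \<Rightarrow> 'a restricted_gl2 \<Rightarrow> 'a restricted_gl2" is "(+)"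
  by (rule two_sided_ideal_cong_add)
lift_definition uminus_restricted_gl2 :: "'a restricted_gl2 \<Rightarrow> 'a restricted_gl2" is uminus
  by (rule two_sided_ideal_cong_uminus)
lift_definition minus_restricted_gl2 ::
  "'a restricted_gl2 \<Rightarrow> 'a restricted_gl2 \<Rightarrow> 'a restricted_gl2" is "(-)"
  by (rule two_sided_ideal_cong_minus)
lift_definition times_restricted_gl2 ::
  "'a restricted_gl2 \<Rightarrow> 'a restricted_gl2 \<Rightarrow> 'a restricted_gl2" is "(*)"
  by (rule two_sided_ideal_cong_mult)

instance
  by standard (transfer; simp add: algebra_simps two_sided_ideal.zero)+

end

lift_definition gscal :: "'k::field \<Rightarrow> 'k restricted_gl2" is fscal .

lift_definition ge :: "2 \<Rightarrow> 2 \<Rightarrow> 'k::field restricted_gl2" is "\<lambda>i j. fgen (i, j)" .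

definition prime_subfield :: "'k::field set" where
  "prime_subfield = of_nat ` {..<CHAR('k)}"

definition is_gl2_simple ::
  "'k::field \<Rightarrow> 'k \<Rightarrow> ('k restricted_gl2, 'v) module \<Rightarrow> bool" where
  "is_gl2_simple a b U \<longleftrightarrow>
     simple_module U \<and>
     (\<exists>\<xi>\<in>carrier U. generated_submodule U {\<xi>} = carrier U \<and>
        ge 1 1 \<odot>\<^bsub>U\<^esub> \<xi> = gscal a \<odot>\<^bsub>U\<^esub> \<xi> \<and>
        ge 2 2 \<odot>\<^bsub>U\<^esub> \<xi> = gscal b \<odot>\<^bsub>U\<^esub> \<xi> \<and>
        ge 1 2 \<odot>\<^bsub>U\<^esub> \<xi> = \<zero>\<^bsub>U\<^esub>)"

text \<open>
  \<open>M\<close> is (a copy of) \<open>L(a, b)\<close>, regarded as a module over the restricted Yangian on the same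
  vector space; the last two conditions determine the action since the \<open>t\<^sub>i\<^sub>,\<^sub>j\<close> generate.
\<close>

definition is_evaluation_module ::
  "'k::field \<Rightarrow> 'k \<Rightarrow> ('k restricted_yangian, 'v) module \<Rightarrow> bool" where
  "is_evaluation_module a b M \<longleftrightarrow>
     left_module M \<and>
     (\<exists>U. is_gl2_simple a b U \<and>
        carrier M = carrier U \<and> \<zero>\<^bsub>M\<^esub> = \<zero>\<^bsub>U\<^esub> \<and>
        (\<forall>x\<in>carrier U. \<forall>y\<in>carrier U. x \<oplus>\<^bsub>M\<^esub> y = x \<oplus>\<^bsub>U\<^esub> y) \<and>
        (\<forall>c. \<forall>x\<in>carrier U. rscal c \<odot>\<^bsub>M\<^esub> x = gscal c \<odot>\<^bsub>U\<^esub> x) \<and>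
        (\<forall>i j. \<forall>x\<in>carrier U. rt i j 1 \<odot>\<^bsub>M\<^esub> x = ge i j \<odot>\<^bsub>U\<^esub> x) \<and>
        (\<forall>i j r. \<forall>x\<in>carrier U. 2 \<le> r \<longrightarrow> rt i j r \<odot>\<^bsub>M\<^esub> x = \<zero>\<^bsub>U\<^esub>))"


section \<open>Tensor products\<close>

text \<open>
  The tensor product over the base field of a list \<open>[M\<^sub>1, \<dots>, M\<^sub>n]\<close> of modules is the vector
  space freely spanned by the tuples \<open>[v\<^sub>1, \<dots>, v\<^sub>n]\<close> with \<open>v\<^sub>m \<in> M\<^sub>m\<close>, modulo multilinearity.
\<close>

definition tuples :: "('r, 'v) module list \<Rightarrow> 'v list set" where
  "tuples Ms = {vs. length vs = length Ms \<and> (\<forall>m<length Ms. vs ! m \<in> carrier (Ms ! m))}"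

definition free_space :: "('r, 'v) module list \<Rightarrow> ('k::field, 'v list \<Rightarrow>\<^sub>0 'k) module" where
  "free_space Ms =
     \<lparr>carrier = {f. Poly_Mapping.keys f \<subseteq> tuples Ms}, mult = undefined, one = undefined,
      zero = 0, add = (+), smult = (\<lambda>c. Poly_Mapping.map ((*) c))\<rparr>"

definition multilinear_relations ::
  "('k::field restricted_yangian, 'v) module list \<Rightarrow> ('v list \<Rightarrow>\<^sub>0 'k) set" where
  "multilinear_relations Ms =
     {Poly_Mapping.single (vs[m := x \<oplus>\<^bsub>Ms ! m\<^esub> y]) 1
        - Poly_Mapping.single (vs[m := x]) 1 - Poly_Mapping.single (vs[m := y]) 1
      | vs m x y. vs \<in> tuples Ms \<and> m < length Ms \<and>
                  x \<in> carrier (Ms ! m) \<and> y \<in> carrier (Ms ! m)}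
     \<union> {Poly_Mapping.single (vs[m := rscal c \<odot>\<^bsub>Ms ! m\<^esub> x]) 1 - Poly_Mapping.single (vs[m := x]) c
        | vs m c x. vs \<in> tuples Ms \<and> m < length Ms \<and> x \<in> carrier (Ms ! m)}"

definition tensor_null ::
  "('k::field restricted_yangian, 'v) module list \<Rightarrow> ('v list \<Rightarrow>\<^sub>0 'k) set" where
  "tensor_null Ms = generated_submodule (free_space Ms) (multilinear_relations Ms)"

definition tensor_space ::
  "('k::field restricted_yangian, 'v) module list \<Rightarrow> ('k, ('v list \<Rightarrow>\<^sub>0 'k) set) module" where
  "tensor_space Ms = quotient_module (free_space Ms) (tensor_null Ms)"

definition tensor_class ::
  "('k::field restricted_yangian, 'v) module list \<Rightarrow> ('v list \<Rightarrow>\<^sub>0 'k) \<Rightarrow> ('v list \<Rightarrow>\<^sub>0 'k) set" where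
  "tensor_class Ms f = tensor_null Ms +>\<^bsub>free_space Ms :: ('k, _) module\<^esub> f"

text \<open>
  Iterating \<open>\<Delta>(t\<^sub>i\<^sub>,\<^sub>j(u)) = \<Sum>\<^sub>k t\<^sub>i\<^sub>,\<^sub>k(u) \<otimes> t\<^sub>k\<^sub>,\<^sub>j(u)\<close> (which is coassociative), the series
  \<open>t\<^sub>i\<^sub>,\<^sub>j(u)\<close> acts on an \<open>n\<close>-fold tensor product through the sum of
  \<open>t\<^sub>k\<^sub>0\<^sub>,\<^sub>k\<^sub>1(u) \<otimes> \<cdots> \<otimes> t\<^sub>k\<^sub>n\<^sub>-\<^sub>1\<^sub>,\<^sub>k\<^sub>n(u)\<close> over all index paths with \<open>k\<^sub>0 = i\<close> and \<open>k\<^sub>n = j\<close>.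
  Below, \<open>ks\<close> is the index path and \<open>rs\<close> distributes the superscript \<open>r\<close> over the factors.
\<close>

definition comult_action ::
  "('k::field restricted_yangian, 'v) module list \<Rightarrow> 2 \<Rightarrow> 2 \<Rightarrow> nat \<Rightarrow> 'v list \<Rightarrow> ('v list \<Rightarrow>\<^sub>0 'k)" where
  "comult_action Ms i j r vs =
     (\<Sum>ks\<in>{ks. length ks = Suc (length Ms) \<and> hd ks = i \<and> last ks = j}.
      \<Sum>rs\<in>{rs. length rs = length Ms \<and> sum_list rs = r}.
        Poly_Mapping.single
          (map (\<lambda>m. rt (ks ! m) (ks ! Suc m) (rs ! m) \<odot>\<^bsub>Ms ! m\<^esub> (vs ! m)) [0..<length Ms]) 1)"

text \<open>
  \<open>T\<close> is the tensor product of the modules \<open>Ms\<close>: its underlying vector space is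
  \<open>tensor_space Ms\<close>, and the generators act on pure tensors through the comultiplication.
  These conditions determine the action on the carrier.
\<close>

definition is_tensor_product ::
  "('k::field restricted_yangian, 'v) module list
    \<Rightarrow> ('k restricted_yangian, ('v list \<Rightarrow>\<^sub>0 'k) set) module \<Rightarrow> bool" where
  "is_tensor_product Ms T \<longleftrightarrow>
     left_module T \<and>
     carrier T = carrier (tensor_space Ms) \<and>
     \<zero>\<^bsub>T\<^esub> = \<zero>\<^bsub>tensor_space Ms\<^esub> \<and>
     (\<forall>X\<in>carrier T. \<forall>Y\<in>carrier T. X \<oplus>\<^bsub>T\<^esub> Y = X \<oplus>\<^bsub>tensor_space Ms\<^esub> Y) \<and>
     (\<forall>c. \<forall>X\<in>carrier T. rscal c \<odot>\<^bsub>T\<^esub> X = c \<odot>\<^bsub>tensor_space Ms\<^esub> X) \<and>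
     (\<forall>i j r. \<forall>vs\<in>tuples Ms.
        rt i j r \<odot>\<^bsub>T\<^esub> tensor_class Ms (Poly_Mapping.single vs 1)
          = tensor_class Ms (comult_action Ms i j r vs))"

end

theory Submission
  imports Defs "HOL-Library.Function_Algebras"
begin

text \<open>
  Over an algebraically closed field, a restricted polynomial in \<open>u\<^sup>-\<^sup>1\<close> is a product of factors \<open>1 + x u\<^sup>-\<^sup>1\<close>
  with \<open>x\<close> in the prime field. Pair the factors \<open>a\<^sub>s\<close> of \<open>\<lambda>\<^sub>1\<close> with the factors \<open>b\<^sub>s\<close> of \<open>\<lambda>\<^sub>2\<close>, each time choosing
  a pair for which the residue of \<open>a\<^sub>s - b\<^sub>s\<close> is minimal among those of the remaining pairs. Let \<open>W\<close> be the tensor product of the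
  \<open>L(a\<^sub>s, b\<^sub>s)\<close>, realised as the space of functions on a box of exponents. Minimality forces every vector of \<open>W\<close> killed
  by \<open>t\<^sub>1\<^sub>2(u)\<close> to be a multiple of the highest weight vector, and the same argument for the dual of \<open>W\<close> shows that this
  vector generates \<open>W\<close>; so \<open>W\<close> is simple.

  The generators of the \<open>p\<close>-center commute with all \<open>f\<^sup>(\<^sup>r\<^sup>)\<close>, which generate \<open>W\<close> from its highest weight vector, and
  kill that vector; so they act on \<open>W\<close> by zero. Conversely, modulo a left ideal containing the
  relations of the baby Verma module, the algebra is spanned by words in the \<open>f\<^sup>(\<^sup>r\<^sup>)\<close>, and modulo the \<open>p\<close>-center
  these are nilpotent. Hence the sum of two proper such ideals is proper, and the annihilator of
  the highest weight vector of \<open>W\<close> is the unique maximal one.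
\<close>

section \<open>Series in two variables and the defining relations\<close>

text \<open>The obstacle is the characteristic: the exponents at site s stop at m s < p, and
  products of factors such as b j - a s + k have to stay nonzero in the field. Here m s is the
  residue of a s - b s, and L(a, b) is the space of binary forms of degree m s twisted by a
  character. An equation b j = a s - k with k < m s says that a s - b j has residue k, smaller than
  m s, which is what the choice of the pairs excludes. For the dual of W, again a chain but with
  highest weights -b s and -a s, the corresponding equation concerns a j - b s. Both mixed
  differences are among the remaining pairs, so one minimal choice controls the two cases.

  The prime p enters the commutation statements through a coefficient: passing \<open>f^(r)\<close>
  through the p shifted factors of \<open>b_i\<close> collects p times one series, and p brackets
  with \<open>f^(r)\<close> collect the factor p!.\<close>

definition in_u :: "'a::ring_1 fps \<Rightarrow> 'a fps fps" where
  "in_u x = fps_const x"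

definition in_v :: "'a::ring_1 fps \<Rightarrow> 'a fps fps" where
  "in_v x = Abs_fps (\<lambda>n. fps_const (fps_nth x n))"

definition uv_swap :: "'a::ring_1 fps fps \<Rightarrow> 'a fps fps" where
  "uv_swap x = Abs_fps (\<lambda>n. Abs_fps (\<lambda>m. fps_nth (fps_nth x m) n))"

text \<open>With the outer variable read as 1/v and the inner one as 1/u, this is 1/v - 1/u = (u -
  v)/(uv). Multiplying the relations by \<open>uv_prod\<close> = 1/(uv) keeps them inside power
  series.\<close>

definition uv_diff :: "'a::ring_1 fps fps" where
  "uv_diff = fps_X - fps_const fps_X"

definition uv_prod :: "'a::ring_1 fps fps" where
  "uv_prod = fps_const fps_X * fps_X"

lemma in_u_simps:
  "in_u (x + y) = in_u x + in_u y" "in_u (x - y) = in_u x - in_u y"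
  "in_u (x * y) = in_u x * in_u y" "in_u 0 = 0" "in_u 1 = 1" "in_u (- x) = - in_u x"
  by (simp_all add: in_u_def)

lemma in_v_simps:
  "in_v (x + y) = in_v x + in_v y" "in_v (x - y) = in_v x - in_v y"
  "in_v (x * y) = in_v x * in_v y" "in_v 0 = 0" "in_v 1 = 1" "in_v (- x) = - in_v x"
  by (simp_all add: in_v_def fps_eq_iff fps_mult_nth fps_sum_nth if_distrib
      cong: if_cong)

lemma uv_nth:
  "fps_nth (fps_nth (in_u x * in_v y) s) r = fps_nth x r * fps_nth y s"
  "fps_nth (fps_nth (in_v y * in_u x) s) r = fps_nth y s * fps_nth x r"
  by (simp_all add: in_u_def in_v_def)

lemma in_u_nth: "fps_nth (fps_nth (in_u x) s) r = (if s = 0 then fps_nth x r else 0)"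
  by (simp add: in_u_def)

lemma in_v_nth: "fps_nth (fps_nth (in_v x) s) r = (if r = 0 then fps_nth x s else 0)"
  by (simp add: in_v_def)

lemma uv_swap_mult: "uv_swap (x * y) = uv_swap x * uv_swap y"
  by (simp add: uv_swap_def fps_eq_iff fps_mult_nth fps_sum_nth) (intro allI sum.swap)

lemma uv_swap_simps:
  "uv_swap (x + y) = uv_swap x + uv_swap y" "uv_swap (x - y) = uv_swap x - uv_swap y"
  "uv_swap (- x) = - uv_swap x"
  "uv_swap (in_u a) = in_v a" "uv_swap (in_v a) = in_u a"
  "uv_swap uv_diff = - uv_diff" "uv_swap uv_prod = uv_prod"
  by (auto simp: uv_swap_def fps_eq_iff in_u_def in_v_def uv_diff_def uv_prod_def)

lemma uv_prod_commute: "uv_prod * x = x * (uv_prod :: 'a::ring_1 fps fps)"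
proof -
  have "fps_const fps_X * x = x * fps_const (fps_X :: 'a fps)"
    by (simp add: fps_eq_iff)
  then show ?thesis
    unfolding uv_prod_def mult.assoc fps_mult_fps_X_commute[of x]
    by (simp only: mult.assoc[symmetric])
qed

lemma uv_diff_commute: "uv_diff * x = x * (uv_diff :: 'a::ring_1 fps fps)"
  by (simp add: uv_diff_def fps_eq_iff algebra_simps)

text \<open>The coefficient of order n in the outer variable expresses 1/u times the n-th
  coefficient of x through the previous one, and 1/u can be cancelled; so all coefficients vanish in
  turn. The choice a = 1 gives u - v and a = 1 - 1/u gives u - v - 1, each up to the factor
  1/(uv).\<close>

lemma uv_cancel:
  assumes "(fps_X * fps_const a - fps_const fps_X) * x = (0 :: 'a::ring_1 fps fps)"
  shows "x = 0"
proof -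
  have X0: "y = 0" if "fps_X * y = 0" for y :: "'a fps"
  proof (rule fps_ext)
    fix n
    have "fps_nth (fps_X * y) (Suc n) = 0" by (simp only: that) simp
    then show "fps_nth y n = fps_nth 0 n" by simp
  qed
  have eq: "fps_nth ((fps_X * fps_const a - fps_const fps_X) * x) n = 0" for n
    by (simp only: assms) simp
  have "fps_nth x n = 0" for n
  proof (induction n)
    case 0
    show ?case using eq[of 0] by - (rule X0, simp add: algebra_simps)
  next
    case (Suc n)
    have "fps_nth (fps_X * (fps_const a * x)) (Suc n) = 0" using Suc by simp
    then show ?case using eq[of "Suc n"]
      by - (rule X0, simp add: algebra_simps mult.assoc)
  qed
  then show ?thesis by (simp add: fps_eq_iff)
qed

lemma uv_diff_cancel: "uv_diff * x = 0 \<Longrightarrow> x = 0"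
  using uv_cancel[of 1 x] by (simp add: uv_diff_def)

text \<open>Cancels u - v - 1. When a relation returns the same commutator on its right-hand side,
  this forces the commutator to vanish.\<close>

lemma uv_diff_cancel': "uv_diff * x = uv_prod * x \<Longrightarrow> x = 0"
proof (rule uv_cancel[of "1 - fps_X"])
  assume "uv_diff * x = uv_prod * x"
  then have "(uv_diff - uv_prod) * x = 0" by (simp add: left_diff_distrib)
  moreover have "fps_X * fps_const (1 - fps_X) - fps_const fps_X = uv_diff - (uv_prod :: 'a fps fps)"
    by (simp add: fps_eq_iff uv_diff_def uv_prod_def)
  ultimately show "(fps_X * fps_const (1 - fps_X) - fps_const fps_X) * x = 0" by simp
qed

lemma uv_diff_nth_Suc:
  "fps_nth (fps_nth (uv_diff * x) (Suc s)) (Suc r)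
     = fps_nth (fps_nth x s) (Suc r) - fps_nth (fps_nth x (Suc s)) r"
  by (simp add: uv_diff_def algebra_simps)

lemma uv_diff_nth_0:
  "fps_nth (fps_nth (uv_diff * x) 0) 0 = 0"
  "fps_nth (fps_nth (uv_diff * x) 0) (Suc r) = - fps_nth (fps_nth x 0) r"
  "fps_nth (fps_nth (uv_diff * x) (Suc r)) 0 = fps_nth (fps_nth x r) 0"
  by (simp_all add: uv_diff_def algebra_simps)

lemma uv_prod_nth:
  "fps_nth (fps_nth (uv_prod * x) (Suc s)) (Suc r) = fps_nth (fps_nth x s) r"
  "fps_nth (fps_nth (uv_prod * x) 0) r = 0"
  "fps_nth (fps_nth (uv_prod * x) s) 0 = 0"
  by (simp_all add: uv_prod_def mult.assoc)

lemma uv_eq_iff: "x = y \<longleftrightarrow> (\<forall>r s. fps_nth (fps_nth x s) r = fps_nth (fps_nth y s) r)"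
  by (auto simp: fps_eq_iff)

text \<open>Stated for an arbitrary ring because there are three kinds of instances: the Yangian
  itself, an opposite ring with transposed indices, and operators on states.\<close>

locale rtt =
  fixes t :: "2 \<Rightarrow> 2 \<Rightarrow> nat \<Rightarrow> 'a::ring_1"
  assumes t_0: "t i j 0 = (if i = j then 1 else 0)"
    and t_rel: "0 < r \<Longrightarrow> 0 < s \<Longrightarrow> t i j r * t k l s - t k l s * t i j r =
      (\<Sum>q<min r s. t k j q * t i l (r + s - 1 - q) - t k j (r + s - 1 - q) * t i l q)"

text \<open>Moving one unit from one superscript to the other keeps the total r + s, so only the
  cutoff of the sum changes; antisymmetry accounts for the term gained or lost. This turns the
  truncated sum in the relations into the difference form of \<open>rtt_iff\<close>.\<close>

lemma rtt_sum_Suc: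
  fixes \<phi> :: "nat \<Rightarrow> nat \<Rightarrow> 'b::ab_group_add"
  assumes anti: "\<And>a b. \<phi> a b = - \<phi> b a" and refl: "\<And>a. \<phi> a a = 0"
  shows "(\<Sum>q<min (Suc r) s. \<phi> q (r + s - q)) = (\<Sum>q<min r (Suc s). \<phi> q (r + s - q)) + \<phi> r s"
proof -
  consider "r < s" | "r = s" | "s < r" by linarith
  then show ?thesis
  proof cases
    case 1
    then have "min (Suc r) s = Suc r" "min r (Suc s) = r" by auto
    then show ?thesis by simp
  next
    case 2
    then show ?thesis by (simp add: refl)
  next
    case 3
    then have "min (Suc r) s = s" "min r (Suc s) = Suc s" by auto
    then show ?thesis using anti[of s r] by simp
  qed
qed

text \<open>The relations are equivalent to \<open>(u - v) [t\<^sub>i\<^sub>j(u), t\<^sub>k\<^sub>l(v)] = t\<^sub>k\<^sub>j(u) t\<^sub>i\<^sub>l(v) - t\<^sub>k\<^sub>j(v) t\<^sub>i\<^sub>l(u)\<close>,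
  multiplied here by \<open>u\<^sup>-\<^sup>1 v\<^sup>-\<^sup>1\<close>.\<close>

lemma rtt_iff:
  fixes t :: "2 \<Rightarrow> 2 \<Rightarrow> nat \<Rightarrow> 'a::ring_1"
  assumes t0: "\<And>i j. t i j 0 = (if i = j then 1 else 0)"
  shows "rtt t \<longleftrightarrow> (\<forall>i j k l r s. (t i j (Suc r) * t k l s - t k l s * t i j (Suc r))
     - (t i j r * t k l (Suc s) - t k l (Suc s) * t i j r) = t k j r * t i l s - t k j s * t i l r)"
    (is "_ \<longleftrightarrow> (\<forall>i j k l r s. ?C i j k l (Suc r) s - ?C i j k l r (Suc s) = ?\<phi> i j k l r s)")
proof -
  define S where "S i j k l r s = (\<Sum>q<min r s. ?\<phi> i j k l q (r + s - 1 - q))" for i j k l r s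
  have S: "S i j k l (Suc r) s = S i j k l r (Suc s) + ?\<phi> i j k l r s" for i j k l r s
    using rtt_sum_Suc[of "?\<phi> i j k l" r s] by (simp add: S_def)
  show ?thesis
  proof safe
    fix i j k l r s
    assume "rtt t"
    then have "?C i j k l r s = S i j k l r s" for i j k l r s
      using rtt.t_rel[of t r s i j k l] t0
      by (cases "r = 0"; cases "s = 0") (auto simp: S_def)
    then show "?C i j k l (Suc r) s - ?C i j k l r (Suc s) = ?\<phi> i j k l r s"
      using S[of i j k l r s] by simp
  next
    assume H: "\<forall>i j k l r s. ?C i j k l (Suc r) s - ?C i j k l r (Suc s) = ?\<phi> i j k l r s"
    have "?C i j k l r s = S i j k l r s" for i j k l r s
    proof (induction r arbitrary: s)
      case 0
      show ?case by (simp add: S_def t0)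
    next
      case (Suc r)
      have "?C i j k l (Suc r) s = ?C i j k l r (Suc s) + ?\<phi> i j k l r s"
        using H[rule_format, of i j r k l s] by (metis diff_eq_eq add.commute)
      then show ?case by (simp only: Suc S)
    qed
    then show "rtt t"
      by unfold_locales (simp_all add: t0 S_def)
  qed
qed

lemma rtt_uv_iff:
  fixes t :: "2 \<Rightarrow> 2 \<Rightarrow> nat \<Rightarrow> 'a::ring_1"
  assumes t0: "\<And>i j. t i j 0 = (if i = j then 1 else 0)"
  defines "T \<equiv> \<lambda>i j. Abs_fps (t i j)"
  shows "rtt t \<longleftrightarrow> (\<forall>i j k l. uv_diff * (in_u (T i j) * in_v (T k l) - in_v (T k l) * in_u (T i j))
     = uv_prod * (in_u (T k j) * in_v (T i l) - in_v (T k j) * in_u (T i l)))"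
proof -
  have eq: "(uv_diff * (in_u (T i j) * in_v (T k l) - in_v (T k l) * in_u (T i j))
     = uv_prod * (in_u (T k j) * in_v (T i l) - in_v (T k j) * in_u (T i l))) \<longleftrightarrow>
     (\<forall>r s. (t i j (Suc r) * t k l s - t k l s * t i j (Suc r))
     - (t i j r * t k l (Suc s) - t k l (Suc s) * t i j r) = t k j r * t i l s - t k j s * t i l r)"
    (is "?L = ?R \<longleftrightarrow> ?A") for i j k l
  proof
    assume "?L = ?R"
    then have "fps_nth (fps_nth ?L (Suc s)) (Suc r) = fps_nth (fps_nth ?R (Suc s)) (Suc r)" for r s
      by simp
    then show ?A
      by (simp add: uv_diff_nth_Suc uv_prod_nth uv_nth T_def)
  next
    assume A: ?A
    have "fps_nth (fps_nth ?L s) r = fps_nth (fps_nth ?R s) r" for r s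
      using A by (cases r; cases s)
        (simp_all add: uv_diff_nth_Suc uv_diff_nth_0 uv_prod_nth uv_nth T_def t0 del: fps_mult_nth_0)
    then show "?L = ?R" by (simp add: uv_eq_iff)
  qed
  have "rtt t \<longleftrightarrow> (\<forall>i j k l r s. (t i j (Suc r) * t k l s - t k l s * t i j (Suc r))
     - (t i j r * t k l (Suc s) - t k l (Suc s) * t i j r) = t k j r * t i l s - t k j s * t i l r)"
    by (rule rtt_iff) (rule t0)
  then show ?thesis unfolding eq .
qed

section \<open>Drinfeld generators\<close>

locale central_pair =
  fixes D P :: "'b::ring_1"
  assumes D_comm: "D * x = x * D" and P_comm: "P * x = x * P"
    and D_cancel: "D * x = 0 \<Longrightarrow> x = 0"
begin

lemma D_left: "x * (D * y) = D * (x * y)" by (metis D_comm mult.assoc)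
lemma P_left: "x * (P * y) = P * (x * y)" by (metis P_comm mult.assoc)

text \<open>As i commutes with a, the bracket of a with y i is the bracket with y multiplied by i,
  and x i = 1 simplifies the result.\<close>

lemma bracket_quotient:
  assumes "D * (a * y - y * a) = P * (t * x - y * t0)" "x * i = 1" "a * i = i * a"
  shows "D * (a * (y * i) - (y * i) * a) = P * (t - y * t0 * i)"
proof -
  have "a * (y * i) - (y * i) * a = (a * y - y * a) * i"
    by (simp add: left_diff_distrib mult.assoc assms(3))
  then have "D * (a * (y * i) - (y * i) * a) = P * (t * x - y * t0) * i"
    by (metis assms(1) mult.assoc)
  also have "\<dots> = P * (t - y * t0 * i)"
    by (simp add: left_diff_distrib mult.assoc assms(2))
  finally show ?thesis .
qed

text \<open>The products f d and f' d' commute. Moving d past f' in one order and d' past f in the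
  other leaves two equal expressions followed by d d', which j cancels.\<close>

lemma bracket_ff:
  assumes df: "D * (d * f' - f' * d) = P * ((f - f') * d)"
    and d'f: "D * (d' * f - f * d') = P * ((f - f') * d')"
    and comm: "d * d' = d' * d" "f * d * (f' * d') = f' * d' * (f * d)"
    and inv: "d * d' * j = 1"
  shows "D * (f * f' - f' * f) = - (P * ((f - f') * (f - f')))"
proof -
  have 1: "D * (d * f') = D * (f' * d) + P * ((f - f') * d)"
    using df by (simp add: algebra_simps)
  have 2: "D * (d' * f) = D * (f * d') + P * ((f - f') * d')"
    using d'f by (simp add: algebra_simps)
  have "D * (f * d * (f' * d')) = f * (D * (d * f')) * d'"
    by (simp add: D_left mult.assoc)
  also have "\<dots> = D * (f * f' * (d * d')) + P * (f * (f - f') * (d * d'))"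
    unfolding 1 by (simp add: D_left P_left distrib_left distrib_right mult.assoc)
  finally have 3: "D * (f * d * (f' * d')) = \<dots>" .
  have "D * (f' * d' * (f * d)) = f' * (D * (d' * f)) * d"
    by (simp add: D_left mult.assoc)
  also have "\<dots> = D * (f' * f * (d * d')) + P * (f' * (f - f') * (d * d'))"
    unfolding 2 by (simp add: D_left P_left distrib_left distrib_right mult.assoc comm(1))
  finally have "D * (f * f' * (d * d')) + P * (f * (f - f') * (d * d')) =
      D * (f' * f * (d * d')) + P * (f' * (f - f') * (d * d'))"
    using 3 comm(2) by simp
  then have "(D * (f * f') + P * (f * (f - f'))) * (d * d') = (D * (f' * f) + P * (f' * (f - f'))) * (d * d')"
    by (simp add: distrib_right mult.assoc)
  then have "(D * (f * f') + P * (f * (f - f'))) * (d * d') * j = (D * (f' * f) + P * (f' * (f - f'))) * (d * d') * j"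
    by simp
  then have "D * (f * f') + P * (f * (f - f')) = D * (f' * f) + P * (f' * (f - f'))"
    by (simp add: mult.assoc inv[unfolded mult.assoc])
  then show ?thesis by (simp add: algebra_simps)
qed

text \<open>If g is inverse to d, then [d, f] = d [f, g] d, so a bracket with the inverse is
  converted into one with d.\<close>

lemma bracket_conj:
  assumes "D * (f * g - g * f) = - (P * (g * (f - f')))" "g * d = 1" "d * g = 1"
  shows "D * (d * f - f * d) = - (P * ((f - f') * d))"
proof -
  have "d * f - f * d = d * (f * g - g * f) * d"
    by (simp add: algebra_simps assms(2) mult.assoc[of _ g d])
       (simp add: assms(3) mult.assoc[symmetric])
  then have "D * (d * f - f * d) = d * (D * (f * g - g * f)) * d"
    by (simp add: D_left mult.assoc)
  also have "\<dots> = - (P * (d * g * (f - f') * d))"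
    unfolding assms(1) by (simp add: P_left mult.assoc)
  finally show ?thesis by (simp add: assms(3) mult.assoc)
qed

end

lemma uv_central_pair: "central_pair uv_diff (uv_prod :: 'a::ring_1 fps fps)"
  by unfold_locales (fact uv_diff_commute uv_prod_commute uv_diff_cancel)+

interpretation uv: central_pair uv_diff "uv_prod :: 'a::ring_1 fps fps"
  by (rule uv_central_pair)

lemma rtt_bracket_uv:
  assumes "rtt t"
  shows "uv_diff * (in_u (Abs_fps (t i j)) * in_v (Abs_fps (t k l)) - in_v (Abs_fps (t k l)) * in_u (Abs_fps (t i j)))
     = uv_prod * (in_u (Abs_fps (t k j)) * in_v (Abs_fps (t i l)) - in_v (Abs_fps (t k j)) * in_u (Abs_fps (t i l)))"
  using rtt_uv_iff[of t] rtt.t_0[OF assms] assms by metis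

context rtt
begin

definition "T i j = Abs_fps (t i j)"
definition "d1 = T 1 1"
definition "d1i = fps_right_inverse d1 1"
definition "e = d1i * T 1 2"
definition "f = T 2 1 * d1i"
definition "d2 = T 2 2 - f * d1 * e"
definition "d2i = fps_right_inverse d2 1"
text \<open>In \<open>e_f\<close> the bracket of e(u) and f(v) is the divided difference of this
  series.\<close>

definition "h = d1i * d2"

lemma T_0: "fps_nth (T i j) 0 = (if i = j then 1 else 0)"
  by (simp add: T_def t_0)

lemma d1i: "d1 * d1i = 1" "d1i * d1 = 1"
  by (auto simp: d1i_def d1_def T_0 intro!: fps_right_inverse fps_left_inverse'[where x = 1])

lemma T_12: "T 1 2 = d1 * e" and T_21: "T 2 1 = f * d1" and T_22: "T 2 2 = d2 + f * d1 * e"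
  and T_11: "T 1 1 = d1"
  by (simp_all add: e_def f_def d2_def d1i mult.assoc d1_def[symmetric])
     (simp_all add: mult.assoc[symmetric] d1i)

lemma e_f_0: "fps_nth e 0 = 0" "fps_nth f 0 = 0"
  by (simp_all add: e_def f_def T_0)

lemma d_0: "fps_nth d1 0 = 1" "fps_nth d2 0 = 1"
  by (simp_all add: d2_def e_f_0 T_0 d1_def)

lemma d2i: "d2 * d2i = 1" "d2i * d2 = 1"
  by (auto simp: d2i_def d_0 intro!: fps_right_inverse fps_left_inverse'[where x = 1])

lemma T_bracket:
  "uv_diff * (in_u (T i j) * in_v (T k l) - in_v (T k l) * in_u (T i j))
     = uv_prod * (in_u (T k j) * in_v (T i l) - in_v (T k j) * in_u (T i l))"
  unfolding T_def by (rule rtt_bracket_uv) unfold_locales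

lemma uv_commute_iff:
  "in_u x * in_v y = in_v y * in_u x \<longleftrightarrow> (\<forall>a b. fps_nth x a * fps_nth y b = fps_nth y b * fps_nth x a)"
  by (simp add: uv_eq_iff uv_nth)

lemma uv_commute_diff: "uv_diff * (in_u x * in_v y - in_v y * in_u x) = 0 \<Longrightarrow> in_u x * in_v y = in_v y * in_u x"
  using uv_diff_cancel by fastforce

lemma uv_commute_imp_commute:
  assumes "in_u x * in_v y = in_v y * in_u x"
  shows "x * y = y * (x :: 'a fps)"
proof (rule fps_ext)
  fix n
  have "fps_nth (x * y) n = (\<Sum>i=0..n. fps_nth y (n - i) * fps_nth x i)"
    using assms by (simp add: fps_mult_nth uv_commute_iff)
  also have "\<dots> = fps_nth (y * x) n"
    unfolding fps_mult_nth by (rule sum.reindex_bij_witness[of _ "\<lambda>i. n - i" "\<lambda>i. n - i"]) auto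
  finally show "fps_nth (x * y) n = fps_nth (y * x) n" .
qed

lemma uv_commute_sym: "in_u x * in_v y = in_v y * in_u x \<Longrightarrow> in_u y * in_v x = in_v x * in_u y"
  using uv_commute_iff by metis

lemma uv_commute_inverse:
  assumes "in_u x * in_v y = in_v y * in_u x" "y * z = 1" "z * y = 1"
  shows "in_u x * in_v z = in_v z * in_u x"
proof -
  have yz: "in_v y * in_v z = 1" "in_v z * in_v y = 1"
    using assms(2,3) by (simp_all flip: in_v_simps(3) add: in_v_simps(5))
  have "in_u x * in_v z = in_v z * (in_v y * in_u x) * in_v z"
    by (simp add: yz(2) mult.assoc[symmetric])
  also have "\<dots> = in_v z * in_u x"
    by (simp add: assms(1)[symmetric] mult.assoc yz)
  finally show ?thesis .
qed

lemma d1_d1: "in_u d1 * in_v d1 = in_v d1 * in_u d1"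
  using uv_diff_cancel'[OF T_bracket[of 1 1 1 1]] by (simp add: T_11)

lemma d1_d1i: "in_u d1 * in_v d1i = in_v d1i * in_u d1"
  by (rule uv_commute_inverse[OF d1_d1 d1i])

text \<open>The relation for t_11(u) and t_21(v), divided on the right by d_1(v), which commutes
  with d_1(u).\<close>

lemma d1_f: "uv_diff * (in_u d1 * in_v f - in_v f * in_u d1) = uv_prod * ((in_u f - in_v f) * in_u d1)"
proof -
  have "uv_diff * (in_u d1 * (in_v (T 2 1) * in_v d1i) - (in_v (T 2 1) * in_v d1i) * in_u d1)
      = uv_prod * (in_u (T 2 1) - in_v (T 2 1) * in_u d1 * in_v d1i)"
    by (rule uv.bracket_quotient[where x = "in_v d1"])
       (use T_bracket[of 1 1 2 1] in \<open>simp_all add: T_11 d1_d1i flip: in_v_simps(3)\<close>, simp add: d1i in_v_simps)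
  also have "in_u (T 2 1) - in_v (T 2 1) * in_u d1 * in_v d1i = (in_u f - in_v f) * in_u d1"
    by (simp add: T_21 in_u_simps in_v_simps mult.assoc d1_d1i left_diff_distrib)
       (simp add: mult.assoc[symmetric], simp add: mult.assoc d1i flip: in_v_simps(3))
  finally show ?thesis by (simp add: f_def in_v_simps(3))
qed

lemma uv_swap_bracket:
  assumes "uv_diff * (in_u a * in_v b - in_v b * in_u a) = uv_prod * x"
  shows "uv_diff * (in_u b * in_v a - in_v a * in_u b) = uv_prod * uv_swap x"
proof -
  have "uv_swap (uv_diff * (in_u a * in_v b - in_v b * in_u a)) = uv_swap (uv_prod * x)"
    using assms by simp
  then show ?thesis
    by (simp add: uv_swap_mult uv_swap_simps algebra_simps)
qed

lemma f_d1: "uv_diff * (in_u f * in_v d1 - in_v d1 * in_u f) = uv_prod * ((in_v f - in_u f) * in_v d1)"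
  using uv_swap_bracket[OF d1_f] by (simp add: uv_swap_mult uv_swap_simps)

lemma T21_T21: "in_u (T 2 1) * in_v (T 2 1) = in_v (T 2 1) * in_u (T 2 1)"
  using uv_diff_cancel'[OF T_bracket[of 2 1 2 1]] by simp

lemma f_f: "uv_diff * (in_u f * in_v f - in_v f * in_u f)
    = - (uv_prod * ((in_u f - in_v f) * (in_u f - in_v f)))"
proof (rule uv.bracket_ff[OF d1_f])
  show "uv_diff * (in_v d1 * in_u f - in_u f * in_v d1) = uv_prod * ((in_u f - in_v f) * in_v d1)"
    using f_d1 by (simp add: algebra_simps)
  show "in_u f * in_u d1 * (in_v f * in_v d1) = in_v f * in_v d1 * (in_u f * in_u d1)"
    using T21_T21 by (simp add: T_21 in_u_simps in_v_simps)
  show "in_u d1 * in_v d1 * (in_v d1i * in_u d1i) = 1"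
    by (simp add: mult.assoc, simp add: mult.assoc[symmetric, of "in_v d1"] d1i in_v_simps flip: in_v_simps(3))
       (simp add: d1i in_u_simps flip: in_u_simps(3))
qed (rule d1_d1)

text \<open>The inverse of the matrix T(u), read off from its Gauss decomposition. It is introduced
  for its entry (2,2), which is the inverse of d_2(u), whereas d_2(u) is no entry of T(u)
  itself.\<close>

definition "Ti (i::2) (j::2) = (if i = 1 then if j = 1 then d1i + e * d2i * f else - (e * d2i)
  else if j = 1 then - (d2i * f) else d2i)"

lemma T_Ti:
  "(\<Sum>a\<in>UNIV. T k a * Ti a l) = (if k = l then 1 else 0)"
  "(\<Sum>a\<in>UNIV. Ti k a * T a l) = (if k = l then 1 else 0)"
proof -
  have simps: "d1 * (d1i * x) = x" "d1i * (d1 * x) = x" "d2 * (d2i * x) = x" "d2i * (d2 * x) = x" for x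
    by (simp_all add: mult.assoc[symmetric] d1i d2i)
  show "(\<Sum>a\<in>UNIV. T k a * Ti a l) = (if k = l then 1 else 0)"
    "(\<Sum>a\<in>UNIV. Ti k a * T a l) = (if k = l then 1 else 0)"
    using exhaust_2[of k] exhaust_2[of l]
    by (auto simp: sum_2 Ti_def T_11 T_12 T_21 T_22 algebra_simps simps d1i d2i)
qed

text \<open>For A = t_ij(u) and the matrix Z = T(v) with inverse Y, one has A Y - Y A = Y (Z A - A
  Z) Y. Inserting the relation for Z A - A Z leaves the products Y Z and Z Y, which collapse to
  Kronecker deltas.\<close>

lemma Ti_bracket:
  "uv_diff * (in_u (T i j) * in_v (Ti k l) - in_v (Ti k l) * in_u (T i j)) =
   uv_prod * ((if k = j then \<Sum>b\<in>UNIV. in_u (T i b) * in_v (Ti b l) else 0)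
     - (if i = l then \<Sum>a\<in>UNIV. in_v (Ti k a) * in_u (T a j) else 0))"
proof -
  define A Y Z where "A = in_u (T i j)" and "Y = (\<lambda>(k::2) (l::2). in_v (Ti k l))" and "Z = (\<lambda>(k::2) (l::2). in_v (T k l))"
  define B where "B = (\<lambda>k l. in_u (T k l))"
  have YZ: "(\<Sum>a\<in>UNIV. Y k a * Z a l) = (if k = l then 1 else 0)" for k l
    using arg_cong[OF T_Ti(2), of in_v k l] by (simp add: Y_def Z_def sum_2 in_v_simps split: if_splits)
  have ZY: "(\<Sum>a\<in>UNIV. Z k a * Y a l) = (if k = l then 1 else 0)" for k l
    using arg_cong[OF T_Ti(1), of in_v k l] by (simp add: Y_def Z_def sum_2 in_v_simps split: if_splits)
  have YZc: "(\<Sum>a\<in>UNIV. \<Sum>b\<in>UNIV. Y k a * Z a (c b) * x b) = (\<Sum>b\<in>UNIV. if k = c b then x b else 0)"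
    for k and c :: "2 \<Rightarrow> 2" and x :: "2 \<Rightarrow> 'a fps fps"
    by (subst sum.swap) (auto simp: sum_distrib_right[symmetric] YZ intro!: sum.cong)
  have ZYc: "(\<Sum>a\<in>UNIV. \<Sum>b\<in>UNIV. x a * (Z (c a) b * Y b l)) = (\<Sum>b\<in>UNIV. if c b = l then x b else 0)"
    for l and c :: "2 \<Rightarrow> 2" and x :: "2 \<Rightarrow> 'a fps fps"
    by (auto simp: sum_distrib_left[symmetric] ZY intro!: sum.cong)
  have 1: "A * Y k l = (\<Sum>a\<in>UNIV. \<Sum>b\<in>UNIV. Y k a * Z a b * (A * Y b l))"
    using YZc[of k "\<lambda>b. b" "\<lambda>b. A * Y b l"] by simp
  have 2: "Y k l * A = (\<Sum>a\<in>UNIV. \<Sum>b\<in>UNIV. Y k a * A * (Z a b * Y b l))"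
    using ZYc[of "\<lambda>a. Y k a * A" "\<lambda>a. a" l] by simp
  have br: "uv_diff * (Z a b * A - A * Z a b) = uv_prod * (Z a j * B i b - B a j * Z i b)" for a b
    using T_bracket[of i j a b] unfolding A_def Z_def B_def by (simp add: algebra_simps)
  have "uv_diff * (A * Y k l - Y k l * A)
      = (\<Sum>a\<in>UNIV. \<Sum>b\<in>UNIV. Y k a * (uv_diff * (Z a b * A - A * Z a b)) * Y b l)"
    unfolding 1 2 by (simp add: sum_subtractf[symmetric] sum_distrib_left uv.D_left mult.assoc algebra_simps)
  also have "\<dots> = uv_prod * ((\<Sum>a\<in>UNIV. \<Sum>b\<in>UNIV. Y k a * Z a j * (B i b * Y b l))
       - (\<Sum>a\<in>UNIV. \<Sum>b\<in>UNIV. Y k a * B a j * (Z i b * Y b l)))"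
    unfolding br by (simp add: sum_subtractf[symmetric] sum_distrib_left uv.P_left mult.assoc algebra_simps)
  also have "\<dots> = uv_prod * ((if k = j then \<Sum>b\<in>UNIV. B i b * Y b l else 0)
     - (if i = l then \<Sum>a\<in>UNIV. Y k a * B a j else 0))"
    using YZc[of k "\<lambda>_. j" "\<lambda>b. B i b * Y b l"] ZYc[of "\<lambda>a. Y k a * B a j" "\<lambda>_. i" l] by simp
  finally show ?thesis by (simp add: A_def Y_def B_def)
qed

lemma d1_d2i: "in_u d1 * in_v d2i = in_v d2i * in_u d1"
  using Ti_bracket[of 1 1 2 2] by (intro uv_commute_diff) (simp add: Ti_def T_11)

lemma d1_d2: "in_u d1 * in_v d2 = in_v d2 * in_u d1"
  by (rule uv_commute_inverse[OF d1_d2i d2i(2,1)])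

lemma d2_d1: "in_u d2 * in_v d1 = in_v d1 * in_u d2"
  by (rule uv_commute_sym[OF d1_d2])

lemma f_d2i: "uv_diff * (in_u f * in_v d2i - in_v d2i * in_u f) = - (uv_prod * (in_v d2i * (in_u f - in_v f)))"
proof -
  have "uv_diff * (in_u f * in_v d2i - in_v d2i * in_u f) * in_u d1 =
     uv_diff * (in_u (T 2 1) * in_v (Ti 2 2) - in_v (Ti 2 2) * in_u (T 2 1))"
    by (simp add: T_21 Ti_def in_u_simps left_diff_distrib mult.assoc d1_d2i)
  also have "\<dots> = - (uv_prod * (in_v d2i * (in_u f - in_v f))) * in_u d1"
    unfolding Ti_bracket by (simp add: sum_2 T_11 T_21 Ti_def in_u_simps in_v_simps algebra_simps)
  finally have "uv_diff * (in_u f * in_v d2i - in_v d2i * in_u f) * in_u d1 * in_u d1i =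
     - (uv_prod * (in_v d2i * (in_u f - in_v f))) * in_u d1 * in_u d1i" by simp
  then show ?thesis by (simp add: mult.assoc d1i in_u_simps flip: in_u_simps(3))
qed

lemma f_d2: "uv_diff * (in_u d2 * in_v f - in_v f * in_u d2) = - (uv_prod * ((in_u f - in_v f) * in_u d2))"
proof -
  have "uv_diff * (in_v d2 * in_u f - in_u f * in_v d2) = - (uv_prod * ((in_u f - in_v f) * in_v d2))"
    by (rule uv.bracket_conj[OF f_d2i]) (simp_all add: d2i in_v_simps flip: in_v_simps(3))
  then have "uv_swap (uv_diff * (in_v d2 * in_u f - in_u f * in_v d2)) = uv_swap (- (uv_prod * ((in_u f - in_v f) * in_v d2)))"
    by simp
  then show ?thesis by (simp add: uv_swap_simps uv_swap_mult algebra_simps)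
qed

text \<open>With g the inverse of d_2(v), the commutator of d_2(u) = t_22 - f t_12 with g is
  computed from the brackets of its constituents. The three contributions recombine to the same
  commutator on the side of \<open>uv_prod\<close>, and u - v - 1 is cancelled.\<close>

lemma d2_d2: "in_u d2 * in_v d2 = in_v d2 * in_u d2"
proof -
  define g where "g = in_v d2i"
  have a: "uv_diff * (in_u (T 2 2) * g - g * in_u (T 2 2)) = uv_prod *
     (in_u (T 2 2) * g - in_u (T 2 1) * in_v e * g - (g * in_u (T 2 2) - g * in_v f * in_u (T 1 2)))"
    using Ti_bracket[of 2 2 2 2] by (simp add: g_def sum_2 Ti_def in_v_simps algebra_simps)
  have b: "uv_diff * (in_u (T 1 2) * g - g * in_u (T 1 2)) = uv_prod *
     (in_u (T 1 2) * g - in_u d1 * in_v e * g)"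
    using Ti_bracket[of 1 2 2 2] by (simp add: g_def sum_2 Ti_def in_v_simps algebra_simps T_11)
  have c: "uv_diff * (in_u f * g - g * in_u f) = - (uv_prod * (g * (in_u f - in_v f)))"
    using f_d2i by (simp add: g_def)
  have d2: "in_u d2 = in_u (T 2 2) - in_u f * in_u (T 1 2)"
    by (simp add: d2_def T_12 in_u_simps mult.assoc)
  have "uv_diff * (in_u d2 * g - g * in_u d2) = uv_diff * (in_u (T 2 2) * g - g * in_u (T 2 2))
     - in_u f * (uv_diff * (in_u (T 1 2) * g - g * in_u (T 1 2)))
     - uv_diff * (in_u f * g - g * in_u f) * in_u (T 1 2)"
    by (simp add: d2 uv.D_left algebra_simps)
  also have "\<dots> = uv_prod * (in_u d2 * g - g * in_u d2)"
    unfolding a b c by (simp add: d2 T_21 in_u_simps uv.P_left algebra_simps)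
  finally have "in_u d2 * in_v d2i = in_v d2i * in_u d2"
    using uv_diff_cancel' unfolding g_def by fastforce
  then show ?thesis by (rule uv_commute_inverse[OF _ d2i(2,1)])
qed

lemma d1i_d2: "in_u d1i * in_v d2 = in_v d2 * in_u d1i"
  using uv_commute_sym[OF uv_commute_inverse[OF d2_d1 d1i]] .

lemma h_alt: "h = d2 * d1i"
  unfolding h_def by (rule uv_commute_imp_commute[OF d1i_d2])

text \<open>The relation for t_12(u) and t_21(v) is divided by d_1(v) on the right, which turns t_21
  into f, and by d_1(u) on the left, which turns t_12 into e.\<close>

lemma e_f: "uv_diff * (in_u e * in_v f - in_v f * in_u e) = uv_prod * (in_u h - in_v h)"
proof -
  have i: "uv_diff * (in_u (T 1 2) * in_v d1i - in_v d1i * in_u (T 1 2))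
      = - (in_v d1i * (uv_prod * (in_u (T 1 2) * in_v d1 - in_v (T 1 2) * in_u d1)) * in_v d1i)"
  proof -
    have "in_u (T 1 2) * in_v d1i - in_v d1i * in_u (T 1 2)
       = - (in_v d1i * (in_u (T 1 2) * in_v d1 - in_v d1 * in_u (T 1 2)) * in_v d1i)"
      by (simp add: algebra_simps d1i flip: in_v_simps(3))
         (simp add: in_v_simps(5) d1i mult.assoc[symmetric] flip: in_v_simps(3))
    then have "uv_diff * (in_u (T 1 2) * in_v d1i - in_v d1i * in_u (T 1 2))
       = - (in_v d1i * (uv_diff * (in_u (T 1 2) * in_v d1 - in_v d1 * in_u (T 1 2))) * in_v d1i)"
      by (simp add: uv.D_left mult.assoc)
    then show ?thesis using T_bracket[of 1 2 1 1] by (simp add: T_11)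
  qed
  have t: "uv_diff * (in_u (T 1 2) * in_v (T 2 1) - in_v (T 2 1) * in_u (T 1 2))
     = uv_prod * (in_u (T 2 2) * in_v d1 - in_v (T 2 2) * in_u d1)"
    using T_bracket[of 1 2 2 1] by (simp add: T_11)
  have inv: "in_v d1 * in_v d1i = 1" "in_u d1i * in_u d1 = 1"
    by (simp_all add: d1i in_v_simps in_u_simps flip: in_v_simps(3) in_u_simps(3))
  have "uv_diff * (in_u (T 1 2) * in_v f - in_v f * in_u (T 1 2))
      = uv_diff * (in_u (T 1 2) * in_v (T 2 1) - in_v (T 2 1) * in_u (T 1 2)) * in_v d1i
        + in_v (T 2 1) * (uv_diff * (in_u (T 1 2) * in_v d1i - in_v d1i * in_u (T 1 2)))"
    by (simp add: f_def in_v_simps uv.D_left algebra_simps)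
  also have "\<dots> = uv_prod * (in_u (T 2 2) - in_v f * in_u (T 1 2)
      - (in_v (T 2 2) - in_v f * in_v (T 1 2)) * in_u d1 * in_v d1i)"
    unfolding i t by (simp add: f_def in_v_simps uv.P_left algebra_simps inv)
  also have "(in_v (T 2 2) - in_v f * in_v (T 1 2)) = in_v d2"
    by (simp add: d2_def T_12 in_v_simps mult.assoc)
  finally have 1: "uv_diff * (in_u (T 1 2) * in_v f - in_v f * in_u (T 1 2))
     = uv_prod * (in_u (T 2 2) - in_v f * in_u (T 1 2) - in_v d2 * in_u d1 * in_v d1i)" .
  have "in_u d1 * (uv_diff * (in_u e * in_v f - in_v f * in_u e))
     = uv_diff * (in_u (T 1 2) * in_v f - in_v f * in_u (T 1 2)) - uv_diff * (in_u d1 * in_v f - in_v f * in_u d1) * in_u e"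
    by (simp add: T_12 in_u_simps uv.D_left algebra_simps)
  also have "\<dots> = uv_prod * (in_u d2 - in_u d1 * in_v d2 * in_v d1i)"
    unfolding 1 d1_f by (simp add: T_22 T_12 in_u_simps d1_d2 algebra_simps)
  finally have "in_u d1i * (in_u d1 * (uv_diff * (in_u e * in_v f - in_v f * in_u e)))
     = in_u d1i * (uv_prod * (in_u d2 - in_u d1 * in_v d2 * in_v d1i))" by simp
  moreover have "in_u d1i * (in_u d1 * x) = x" for x
    by (simp add: mult.assoc[symmetric] inv)
  moreover have "in_u h = in_u d1i * in_u d2" "in_v h = in_v d2 * in_v d1i"
    by (simp add: h_def in_u_simps, simp add: h_alt in_v_simps)
  ultimately show ?thesis
    by (simp add: uv.P_left right_diff_distrib mult.assoc)
qed

end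

section \<open>Powers of the Drinfeld generators\<close>

text \<open>The coefficients of g from the r-th on, reindexed to start at order 1. Up to sign, this
  is the series that appears when the r-th coefficient of f is moved past d_1(u) or d_2(u).\<close>

definition tail_series :: "'a::ring_1 fps \<Rightarrow> nat \<Rightarrow> 'a fps" where
  "tail_series g r = Abs_fps (\<lambda>j. if j = 0 then 0 else fps_nth g (r + j - 1))"

text \<open>Comparing coefficients, each unit of superscript moved from d to g costs one product of
  coefficients of g and c, and the commutator with superscript 0 on d vanishes; the costs add up to
  a convolution. The series c is d itself for d_1 and -d for d_2.\<close>

lemma tail_series_bracket:
  assumes "uv_diff * (in_u d * in_v g - in_v g * in_u d) = uv_prod * ((in_u g - in_v g) * in_u c)"
    and "0 < r"
  shows "d * fps_const (fps_nth g r) - fps_const (fps_nth g r) * d = - (tail_series g r * c)"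
proof -
  define C where "C a b = fps_nth d a * fps_nth g b - fps_nth g b * fps_nth d a" for a b
  have A: "fps_nth (fps_nth (uv_diff * (in_u d * in_v g - in_v g * in_u d)) s) r
     = fps_nth (fps_nth (uv_prod * ((in_u g - in_v g) * in_u c)) s) r" for r s
    by (simp only: assms(1))
  have 0: "C 0 b = 0" for b
    using A[of "Suc b" 0] by (simp add: uv_diff_nth_0 uv_prod_nth uv_nth C_def)
  have CSuc: "C (Suc a) b = C a (Suc b) - fps_nth g b * fps_nth c a" if "0 < b" for a b
  proof -
    have "C (Suc a) b - C a (Suc b) = - (fps_nth g b * fps_nth c a)"
      using A[of "Suc b" "Suc a"] that
      by (simp add: uv_diff_nth_Suc uv_prod_nth uv_nth C_def left_diff_distrib)
         (simp add: in_u_simps(3)[symmetric] in_u_nth)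
    then show ?thesis by (simp add: algebra_simps)
  qed
  have "C a b = - (\<Sum>q<a. fps_nth g (b + a - 1 - q) * fps_nth c q)" if "0 < b" for a b
    using that
  proof (induction a arbitrary: b)
    case (Suc a)
    then show ?case using Suc.IH[of "Suc b"] by (simp add: CSuc)
  qed (simp add: 0)
  moreover have "fps_nth (tail_series g r * c) a = (\<Sum>q<a. fps_nth g (r + a - 1 - q) * fps_nth c q)" for a
  proof -
    have "fps_nth (tail_series g r * c) a = (\<Sum>i\<in>{1..a}. fps_nth g (r + i - 1) * fps_nth c (a - i))"
      unfolding fps_mult_nth by (rule sum.mono_neutral_cong_right) (auto simp: tail_series_def)
    also have "\<dots> = (\<Sum>q<a. fps_nth g (r + a - 1 - q) * fps_nth c q)"
      by (rule sum.reindex_bij_witness[of _ "\<lambda>q. a - q" "\<lambda>i. a - i"]) auto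
    finally show ?thesis .
  qed
  ultimately show ?thesis using assms(2)
    by (auto simp: fps_eq_iff C_def)
qed

definition ad :: "'a::ring \<Rightarrow> 'a \<Rightarrow> 'a" where
  "ad c y = c * y - y * c"

lemma ad_simps:
  "ad c (x + y) = ad c x + ad c y" "ad c (x * y) = ad c x * y + x * ad c y"
  "ad c 0 = 0" "ad c (- x) = - ad c x"
  by (simp_all add: ad_def algebra_simps)

lemma of_nat_left_commute: "c * (of_nat n * x) = of_nat n * (c * (x :: 'a::semiring_1))"
  by (metis mult.assoc mult_of_nat_commute)

lemma ad_of_nat: "ad c (of_nat n * x) = of_nat n * ad c (x :: 'a::ring_1)"
  by (simp add: ad_def right_diff_distrib of_nat_left_commute mult.assoc)

text \<open>Left multiplication by c is the sum of \<open>ad c\<close> and right multiplication by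
  c, and these commute; this is the binomial theorem for that sum.\<close>

lemma power_mult_ad:
  fixes c :: "'a::ring_1"
  shows "c ^ n * y = (\<Sum>k\<le>n. of_nat (n choose k) * ((ad c ^^ k) y * c ^ (n - k)))"
proof (induction n)
  case 0
  show ?case by simp
next
  case (Suc n)
  define z where "z k = (ad c ^^ k) y" for k
  have z: "c * z k = z k * c + z (Suc k)" for k
    by (simp add: z_def ad_def)
  have "c ^ Suc n * y = (\<Sum>k\<le>n. of_nat (n choose k) * (c * z k * c ^ (n - k)))"
    by (simp add: Suc mult.assoc z_def sum_distrib_left mult_of_nat_commute)
  also have "\<dots> = (\<Sum>k\<le>n. of_nat (n choose k) * (z k * c ^ (Suc n - k)))
      + (\<Sum>k\<le>n. of_nat (n choose k) * (z (Suc k) * c ^ (n - k)))"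
    by (simp add: z distrib_left distrib_right sum.distrib Suc_diff_le mult.assoc)
  also have "(\<Sum>k\<le>n. of_nat (n choose k) * (z k * c ^ (Suc n - k)))
      = (\<Sum>k\<le>Suc n. of_nat (n choose k) * (z k * c ^ (Suc n - k)))"
    by (simp add: binomial_eq_0)
  also have "\<dots> = z 0 * c ^ Suc n + (\<Sum>k\<le>n. of_nat (n choose Suc k) * (z (Suc k) * c ^ (n - k)))"
    by (subst sum.atMost_Suc_shift) simp
  also have "\<dots> + (\<Sum>k\<le>n. of_nat (n choose k) * (z (Suc k) * c ^ (n - k))) =
      z 0 * c ^ Suc n + (\<Sum>k\<le>n. of_nat (Suc n choose Suc k) * (z (Suc k) * c ^ (n - k)))"
    by (simp add: sum.distrib[symmetric] distrib_right add.commute)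
  also have "\<dots> = (\<Sum>k\<le>Suc n. of_nat (Suc n choose k) * (z k * c ^ (Suc n - k)))"
    by (subst sum.atMost_Suc_shift) simp
  finally show ?case by (simp add: z_def)
qed

text \<open>The inner binomial coefficients are divisible by p, so bracketing with the p-th power of
  c is the p-th iterate of \<open>ad c\<close>.\<close>

lemma prime_power_ad:
  fixes c :: "'a::ring_1"
  assumes "prime p" "of_nat p = (0 :: 'a)"
  shows "c ^ p * y = y * c ^ p + (ad c ^^ p) y"
proof -
  have "of_nat (p choose k) = (0 :: 'a)" if "k \<noteq> 0" "k \<noteq> p" "k \<le> p" for k
  proof -
    have "p dvd (p choose k)" using assms(1) that by (intro dvd_choose_prime) auto
    then show ?thesis using assms(2) by (auto simp: dvd_def)
  qed
  then have "(\<Sum>k\<le>p. of_nat (p choose k) * ((ad c ^^ k) y * c ^ (p - k)))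
     = (\<Sum>k\<in>{0, p}. of_nat (p choose k) * ((ad c ^^ k) y * c ^ (p - k)))"
    by (intro sum.mono_neutral_right) auto
  also have "\<dots> = y * c ^ p + (ad c ^^ p) y"
    using assms(1) by (auto simp: prime_gt_0_nat dest: prime_gt_0_nat)
  finally show ?thesis by (simp add: power_mult_ad)
qed

lemma ad_const_nth: "fps_nth ((ad (fps_const c) ^^ k) x) n = (ad c ^^ k) (fps_nth x n)"
  by (induction k) (simp_all add: ad_def)

lemma ad_const_nth_1: "fps_nth (ad (fps_const c) x) n = ad c (fps_nth x n)"
  by (simp add: ad_def)

lemma fps_mult_eq_upto:
  fixes x y x' y' :: "'a::ring_1 fps"
  assumes "\<And>j. j < M \<Longrightarrow> fps_nth x j = fps_nth x' j" "\<And>j. j < M \<Longrightarrow> fps_nth y j = fps_nth y' j"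
    and "j < M"
  shows "fps_nth (x * y) j = fps_nth (x' * y') j"
  using assms by (auto simp: fps_mult_nth intro!: sum.cong)

text \<open>Iterating a derivation with \<open>G \<mapsto> G\<^sup>2\<close> gives \<open>G \<mapsto> k! G\<^bsup>k+1\<^esup>\<close>, which vanishes for \<open>k = p\<close>;
  the bound \<open>M\<close> allows for series on which this holds only up to a given order.\<close>

lemma ad_power_riccati:
  fixes c :: "'a::ring_1"
  assumes G: "\<And>j. j < M \<Longrightarrow> fps_nth (ad (fps_const c) G) j = fps_nth (G * G) j" and "j < M"
  shows "fps_nth (ad (fps_const c) (G ^ k)) j = fps_nth (of_nat k * G ^ Suc k) j"
    and "fps_nth ((ad (fps_const c) ^^ k) G) j = fps_nth (of_nat (fact k) * G ^ Suc k) j"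
proof -
  let ?c = "fps_const c"
  have pow: "fps_nth (ad ?c (G ^ k)) j = fps_nth (of_nat k * G ^ Suc k) j" if "j < M" for k j
    using that
  proof (induction k arbitrary: j)
    case 0
    show ?case by (simp add: ad_def)
  next
    case (Suc k)
    have "fps_nth (ad ?c (G ^ Suc k)) j = fps_nth (ad ?c G * G ^ k) j + fps_nth (G * ad ?c (G ^ k)) j"
      by (simp add: ad_simps)
    also have "fps_nth (ad ?c G * G ^ k) j = fps_nth (G * G * G ^ k) j"
      by (rule fps_mult_eq_upto[OF _ _ Suc.prems]) (auto intro: G)
    also have "fps_nth (G * ad ?c (G ^ k)) j = fps_nth (G * (of_nat k * G ^ Suc k)) j"
      by (rule fps_mult_eq_upto[OF _ _ Suc.prems]) (auto simp only: Suc.IH)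
    also have "fps_nth (G * G * G ^ k) j + \<dots> = fps_nth (of_nat (Suc k) * G ^ Suc (Suc k)) j"
      by (simp add: of_nat_left_commute distrib_right mult.assoc)
    finally show ?case .
  qed
  have "fps_nth ((ad ?c ^^ k) G) j = fps_nth (of_nat (fact k) * G ^ Suc k) j" if "j < M" for j
    using that
  proof (induction k arbitrary: j)
    case (Suc k)
    have "fps_nth ((ad ?c ^^ Suc k) G) j = fps_nth (ad ?c (of_nat (fact k) * G ^ Suc k)) j"
      using Suc.IH[OF Suc.prems]
      by (simp only: ad_const_nth ad_const_nth_1 funpow.simps o_apply)
    also have "\<dots> = fps_nth (of_nat (fact k) * (of_nat (Suc k) * G ^ Suc (Suc k))) j"
      unfolding ad_of_nat by (rule fps_mult_eq_upto[OF _ _ Suc.prems]) (auto simp only: pow)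
    finally show ?case
      by (simp only: fact_Suc of_nat_mult mult.assoc[symmetric] of_nat_id mult.commute[of "Suc k"])
  qed simp
  then show "fps_nth ((ad ?c ^^ k) G) j = fps_nth (of_nat (fact k) * G ^ Suc k) j"
    "fps_nth (ad ?c (G ^ k)) j = fps_nth (of_nat k * G ^ Suc k) j"
    using pow assms(2) by blast+
qed

lemma of_nat_fact_prime: "of_nat p = (0::'a::ring_1) \<Longrightarrow> 0 < p \<Longrightarrow> of_nat (fact p) = (0::'a)"
  by (cases p) (simp_all only: fact_Suc of_nat_mult of_nat_id mult_zero_left)

context rtt
begin

lemma d1_tail: "0 < r \<Longrightarrow> d1 * fps_const (fps_nth f r) - fps_const (fps_nth f r) * d1 = - (tail_series f r * d1)"
  by (rule tail_series_bracket[OF d1_f])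

lemma d2_tail: "0 < r \<Longrightarrow> d2 * fps_const (fps_nth f r) - fps_const (fps_nth f r) * d2 = tail_series f r * d2"
  using tail_series_bracket[of d2 f "- d2" r] f_d2 by (simp add: in_u_simps)

text \<open>Both superscripts on the right lie between b and a - 1. The form is chosen for ordering
  words: moving the letter of largest index to the right creates only letters of smaller
  index.\<close>

lemma f_f_nth:
  assumes "0 < b" "b \<le> a"
  shows "fps_nth f a * fps_nth f b - fps_nth f b * fps_nth f a
     = (\<Sum>x\<in>{b..<a}. fps_nth f x * fps_nth f (a + b - 1 - x))"
proof -
  define C where "C a b = fps_nth f a * fps_nth f b - fps_nth f b * fps_nth f a" for a b
  have A: "fps_nth (fps_nth (uv_diff * (in_u f * in_v f - in_v f * in_u f)) s) r
     = fps_nth (fps_nth (- (uv_prod * ((in_u f - in_v f) * (in_u f - in_v f)))) s) r" for r s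
    by (simp only: f_f)
  have CSuc: "C (Suc a) b = C a (Suc b) + fps_nth f a * fps_nth f b + fps_nth f b * fps_nth f a
     - (if a = 0 then fps_nth (f * f) b else 0)" if "0 < b" for a b
  proof -
    have "C (Suc a) b - C a (Suc b) = fps_nth f a * fps_nth f b + fps_nth f b * fps_nth f a
     - (if a = 0 then fps_nth (f * f) b else 0)"
      using A[of "Suc b" "Suc a"] that
      by (simp add: uv_diff_nth_Suc uv_prod_nth uv_nth C_def algebra_simps del: fps_mult_nth_0)
         (simp add: in_u_simps(3)[symmetric] in_v_simps(3)[symmetric] in_u_nth in_v_nth algebra_simps e_f_0 split: if_splits del: fps_mult_nth_0)
    then show ?thesis by (simp add: algebra_simps)
  qed
  have C: "C (Suc a) b = (\<Sum>q<Suc a. fps_nth f q * fps_nth f (a + b - q) + fps_nth f (a + b - q) * fps_nth f q)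
      - fps_nth (f * f) (a + b)" if "0 < b" for a b
    using that
  proof (induction a arbitrary: b)
    case 0
    have "C 0 (Suc b) = 0" by (simp add: C_def e_f_0)
    then show ?case using 0 by (simp add: CSuc e_f_0)
  next
    case (Suc a)
    show ?case
      using Suc.IH[of "Suc b"] Suc.prems by (simp add: CSuc algebra_simps)
  qed
  obtain a' where a: "a = Suc a'" using assms by (cases a) auto
  let ?g = "\<lambda>x. fps_nth f x * fps_nth f (a' + b - x)"
  have "C a b = (\<Sum>q<a. ?g q) + (\<Sum>q<a. fps_nth f (a' + b - q) * fps_nth f q) - (\<Sum>q\<in>{..a' + b}. ?g q)"
    unfolding a C[OF assms(1)] by (simp add: sum.distrib fps_mult_nth atLeast0AtMost)
  also have "(\<Sum>q<a. fps_nth f (a' + b - q) * fps_nth f q) = (\<Sum>q\<in>{b..a' + b}. ?g q)"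
    by (rule sum.reindex_bij_witness[of _ "\<lambda>q. a' + b - q" "\<lambda>q. a' + b - q"]) (auto simp: a)
  also have "(\<Sum>q\<in>{..a' + b}. ?g q) = (\<Sum>q<b. ?g q) + (\<Sum>q\<in>{b..a' + b}. ?g q)"
    by (subst sum.union_disjoint[symmetric]) (auto intro!: sum.cong)
  also have "(\<Sum>q<a. ?g q) = (\<Sum>q<b. ?g q) + (\<Sum>q\<in>{b..<a}. ?g q)"
    using assms by (subst sum.union_disjoint[symmetric]) (auto intro!: sum.cong)
  finally show ?thesis by (simp add: C_def a)
qed

lemma e_f_nth:
  assumes "0 < a" "0 < b"
  shows "fps_nth e a * fps_nth f b - fps_nth f b * fps_nth e a = - fps_nth h (a + b - 1)"
proof -
  define C where "C a b = fps_nth e a * fps_nth f b - fps_nth f b * fps_nth e a" for a b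
  have A: "fps_nth (fps_nth (uv_diff * (in_u e * in_v f - in_v f * in_u e)) s) r
     = fps_nth (fps_nth (uv_prod * (in_u h - in_v h)) s) r" for r s
    by (simp only: e_f)
  have CSuc: "C (Suc a) b = C a (Suc b) - (if a = 0 then fps_nth h b else 0)" if "0 < b" for a b
  proof -
    have "C (Suc a) b - C a (Suc b) = - (if a = 0 then fps_nth h b else 0)"
      using A[of "Suc b" "Suc a"] that
      by (simp add: uv_diff_nth_Suc uv_prod_nth uv_nth C_def algebra_simps in_u_nth in_v_nth del: fps_mult_nth_0)
    then show ?thesis by (simp add: algebra_simps)
  qed
  have "C (Suc a) b = - fps_nth h (a + b)" if "0 < b" for a b
    using that
  proof (induction a arbitrary: b)
    case 0
    have "C 0 (Suc b) = 0" by (simp add: C_def e_f_0)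
    then show ?case using 0 by (simp add: CSuc)
  qed (simp add: CSuc)
  then show ?thesis using assms by (cases a) (auto simp: C_def)
qed

text \<open>The sum in \<open>f_f_nth\<close> with b = r is a coefficient of the square of the tail.
  The sign makes minus the tail a solution of G' = G^2 for the derivation \<open>ad\<close> of the
  r-th coefficient of f.\<close>

lemma tail_tail:
  assumes "0 < r"
  shows "ad (fps_const (fps_nth f r)) (- tail_series f r) = tail_series f r * tail_series f r"
proof (rule fps_ext)
  fix j
  let ?F = "tail_series f r"
  show "fps_nth (ad (fps_const (fps_nth f r)) (- ?F)) j = fps_nth (?F * ?F) j"
  proof (cases "j = 0")
    case False
    have "fps_nth (?F * ?F) j = (\<Sum>i\<in>{1..<j}. fps_nth f (r + i - 1) * fps_nth f (r + (j - i) - 1))"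
      unfolding fps_mult_nth by (rule sum.mono_neutral_cong_right) (auto simp: tail_series_def)
    also have "\<dots> = (\<Sum>x\<in>{r..<r + j - 1}. fps_nth f x * fps_nth f ((r + j - 1) + r - 1 - x))"
      using assms by (intro sum.reindex_bij_witness[of _ "\<lambda>x. x + 1 - r" "\<lambda>i. r + i - 1"])
        (auto intro!: arg_cong2[of _ _ _ _ "(*)"] arg_cong[of _ _ "fps_nth f"])
    also have "\<dots> = fps_nth f (r + j - 1) * fps_nth f r - fps_nth f r * fps_nth f (r + j - 1)"
      using assms False by (subst f_f_nth) auto
    finally show ?thesis using False by (simp add: ad_def tail_series_def)
  qed (simp add: ad_def tail_series_def)
qed

text \<open>The tail reaches the superscripts from r on. Those below r are listed downwards instead,
  and G' = G^2 then holds at the orders below r - 1, where the list runs out.\<close>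

lemma f_head:
  assumes "0 < r"
  defines "G \<equiv> Abs_fps (\<lambda>j. fps_nth f (r - 1 - j))"
  assumes "j < r - 1"
  shows "fps_nth (ad (fps_const (fps_nth f r)) G) j = fps_nth (G * G) j"
proof -
  have "fps_nth (G * G) j = (\<Sum>x\<in>{r - 1 - j..<r}. fps_nth f x * fps_nth f (r + (r - 1 - j) - 1 - x))"
    unfolding fps_mult_nth
    using assms by (intro sum.reindex_bij_witness[of _ "\<lambda>x. r - 1 - x" "\<lambda>i. r - 1 - i"])
      (auto intro!: arg_cong2[of _ _ _ _ "(*)"] arg_cong[of _ _ "fps_nth f"])
  also have "\<dots> = fps_nth f r * fps_nth f (r - 1 - j) - fps_nth f (r - 1 - j) * fps_nth f r"
    using assms by (subst f_f_nth) auto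
  finally show ?thesis by (simp add: ad_def G_def)
qed

lemma f_power_f:
  assumes p: "prime p" "of_nat p = (0 :: 'a)" and "0 < r" "0 < s"
  shows "fps_nth f r ^ p * fps_nth f s = fps_nth f s * fps_nth f r ^ p"
proof -
  let ?c = "fps_nth f r"
  have p0: "of_nat (fact p) = (0 :: 'a)"
    using p by (intro of_nat_fact_prime) (auto simp: prime_gt_0_nat)
  have p0': "of_nat (fact p) = (0 :: 'a fps)"
    using p0 by (metis fps_of_nat fps_const_0_eq_0)
  have "(ad ?c ^^ p) (fps_nth f s) = 0"
  proof (cases "r \<le> s")
    case True
    have "fps_nth ((ad (fps_const ?c) ^^ p) (- tail_series f r)) (s - r + 1) = 0"
      using tail_tail[OF assms(3)]
      by (subst ad_power_riccati(2)[of "s - r + 2"]) (simp_all add: p0')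
    then have "(ad ?c ^^ p) (- fps_nth f s) = 0"
      using True by (simp add: ad_const_nth tail_series_def)
    moreover have "(ad ?c ^^ k) (- x) = - (ad ?c ^^ k) x" for k x
      by (induction k) (simp_all add: ad_simps)
    ultimately show ?thesis by simp
  next
    case False
    define G where "G = Abs_fps (\<lambda>j. fps_nth f (r - 1 - j))"
    have "fps_nth ((ad (fps_const ?c) ^^ p) G) (r - 1 - s) = 0"
      using f_head[OF assms(3)] assms(3,4) False
      by (subst ad_power_riccati(2)[of "r - 1"]) (simp_all add: p0' G_def)
    then show ?thesis
      using False by (simp add: ad_const_nth G_def)
  qed
  then show ?thesis by (simp add: prime_power_ad[OF p])
qed

text \<open>One bracket turns e^(s) into a coefficient of h. With G minus the tail, each further
  bracket sends \<open>d1i * G ^ k * d2\<close> to k + 2 times the same product with G^(k+1): k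
  comes from the power of G and one from each of the outer factors. After p brackets the coefficient
  is p!.\<close>

lemma f_power_e:
  assumes p: "prime p" "of_nat p = (0 :: 'a)" and "0 < r" "0 < s"
  shows "fps_nth f r ^ p * fps_nth e s = fps_nth e s * fps_nth f r ^ p"
proof -
  let ?c = "fps_nth f r"
  let ?C = "fps_const ?c"
  define G where "G = - tail_series f r"
  have G: "ad ?C G = G * G" using tail_tail[OF assms(3)] by (simp add: G_def)
  have Gk: "ad ?C (G ^ k) = of_nat k * G ^ Suc k" for k
  proof (rule fps_ext)
    fix n
    show "fps_nth (ad ?C (G ^ k)) n = fps_nth (of_nat k * G ^ Suc k) n"
      by (rule ad_power_riccati(1)[of "Suc n"]) (simp_all add: G)
  qed
  have d1: "ad ?C d1 = - (G * d1)" and d2: "ad ?C d2 = G * d2"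
    using d1_tail[OF assms(3)] d2_tail[OF assms(3)] by (simp_all add: ad_def G_def algebra_simps)
  have "ad ?C (d1i * d1) = 0" by (simp add: d1i ad_def)
  then have "ad ?C d1i * d1 = d1i * G * d1" by (simp add: ad_simps d1 mult.assoc eq_neg_iff_add_eq_0)
  then have "ad ?C d1i * d1 * d1i = d1i * G * d1 * d1i" by simp
  then have i: "ad ?C d1i = d1i * G" by (simp add: mult.assoc d1i)
  have step: "ad ?C (d1i * G ^ k * d2) = of_nat (k + 2) * (d1i * G ^ Suc k * d2)" for k
  proof -
    have "G ^ k * (G * x) = G * (G ^ k * x)" for x
      by (metis mult.assoc power_commutes)
    then show ?thesis by (simp add: ad_simps i Gk d2 algebra_simps of_nat_left_commute)
  qed
  have pow: "(ad ?C ^^ k) h = of_nat (fact (Suc k)) * (d1i * G ^ k * d2)" for k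
  proof (induction k)
    case 0
    show ?case by (simp add: h_def)
  next
    case (Suc k)
    have "(ad ?C ^^ Suc k) h = of_nat (fact (Suc k)) * (of_nat (k + 2) * (d1i * G ^ Suc k * d2))"
      by (simp only: funpow.simps o_apply Suc ad_of_nat step)
    also have "\<dots> = of_nat (fact (Suc k) * (k + 2)) * (d1i * G ^ Suc k * d2)"
      by (simp only: of_nat_mult mult.assoc)
    also have "fact (Suc k) * (k + 2) = fact (Suc (Suc k))"
      by (simp del: fact_Suc add: fact_Suc[of "Suc k"])
    finally show ?case .
  qed
  obtain q where q: "p = Suc q" using p by (cases p) auto
  have "of_nat (fact p) = (0 :: 'a fps)"
    using of_nat_fact_prime[OF p(2)] p(1) by (metis fps_of_nat fps_const_0_eq_0 prime_gt_0_nat)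
  then have "(ad ?C ^^ q) h = 0" unfolding pow q by simp
  then have "(ad ?c ^^ q) (fps_nth h (s + r - 1)) = 0"
    by (metis ad_const_nth fps_zero_nth)
  moreover have "ad ?c (fps_nth e s) = fps_nth h (s + r - 1)"
    using e_f_nth[OF assms(4,3)] by (simp add: ad_def algebra_simps)
  ultimately have "(ad ?c ^^ p) (fps_nth e s) = 0" by (simp add: q funpow_swap1)
  then show ?thesis by (simp add: prime_power_ad[OF p])
qed

end

section \<open>Shifted products\<close>

definition shift_var :: "nat \<Rightarrow> 'a::ring_1 fps" where
  "shift_var c = Abs_fps (\<lambda>n. if n = 0 then 0 else of_nat c ^ (n - 1))"

lemma fps_shift_arg_nth:
  "fps_nth (fps_shift_arg c g) n = (\<Sum>i\<le>n. fps_nth g i * fps_nth (shift_var c ^ i) n)"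
  by (simp add: fps_shift_arg_def shift_var_def fps_compose_nth atLeast0AtMost)

lemma shift_var_eq: "(1 - of_nat c * fps_X) * shift_var c = (fps_X :: 'a::ring_1 fps)"
proof (rule fps_ext)
  fix n
  have "of_nat c * fps_X * shift_var c = fps_X * (of_nat c * shift_var c :: 'a fps)"
    by (simp add: mult.assoc of_nat_left_commute)
  moreover have "fps_nth (of_nat c * g) k = of_nat c * fps_nth g k" for g :: "'a fps" and k
    by (simp flip: fps_of_nat)
  ultimately show "fps_nth ((1 - of_nat c * fps_X) * shift_var c) n = fps_nth (fps_X :: 'a fps) n"
    by (auto simp: left_diff_distrib shift_var_def power_eq_if[of _ "n - Suc 0"] fps_X_nth)
qed

lemma shift_var_power_nth: "n < i \<Longrightarrow> fps_nth (shift_var c ^ i) n = (0 :: 'a::ring_1)"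
proof (induction i arbitrary: n)
  case (Suc i)
  have "fps_nth (shift_var c) j * fps_nth (shift_var c ^ i) (n - j) = (0 :: 'a)" if "j \<le> n" for j
    using that Suc by (cases "j = 0") (auto simp: shift_var_def)
  then show ?case by (simp add: fps_mult_nth)
qed simp

text \<open>The coefficients of the powers of 1/(u - c) are natural numbers independent of the ring.
  So they are central, and a joint eigenvector of the coefficients of a series remains one after the
  shift, with the series of eigenvalues shifted in the field.\<close>

lemma shift_var_power_of_nat_uniform:
  "\<exists>m. fps_nth (shift_var c ^ i) n = (of_nat m :: 'a::ring_1) \<and> fps_nth (shift_var c ^ i) n = (of_nat m :: 'b::ring_1)"
proof (induction i arbitrary: n)
  case 0
  show ?case by (cases "n = 0") (auto intro: exI[of _ 0] exI[of _ 1])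
next
  case (Suc i)
  have "\<exists>m. fps_nth (shift_var c) j = (of_nat m :: 'a) \<and> fps_nth (shift_var c) j = (of_nat m :: 'b)" for j
    by (cases "j = 0") (auto simp: shift_var_def intro: exI[of _ 0] exI[of _ "c ^ (j - 1)"])
  then obtain a where a: "fps_nth (shift_var c) j = (of_nat (a j) :: 'a)"
      "fps_nth (shift_var c) j = (of_nat (a j) :: 'b)" for j
    by metis
  from Suc obtain b where b: "fps_nth (shift_var c ^ i) j = (of_nat (b j) :: 'a)"
      "fps_nth (shift_var c ^ i) j = (of_nat (b j) :: 'b)" for j
    by metis
  have "fps_nth (shift_var c ^ Suc i) n = (of_nat (\<Sum>j=0..n. a j * b (n - j)) :: 'a)"
    "fps_nth (shift_var c ^ Suc i) n = (of_nat (\<Sum>j=0..n. a j * b (n - j)) :: 'b)"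
    by (simp_all add: fps_mult_nth a b)
  then show ?case by blast
qed

lemma shift_var_power_of_nat: "\<exists>m. fps_nth (shift_var c ^ i) n = (of_nat m :: 'a::ring_1)"
  using shift_var_power_of_nat_uniform[of c i n] by blast

lemma shift_var_central:
  "fps_nth (shift_var c ^ i) n * x = x * (fps_nth (shift_var c ^ i) n :: 'a::ring_1)"
  using shift_var_power_of_nat[of c i n] by (metis mult_of_nat_commute)

lemma fps_shift_arg_nth_le:
  assumes "n \<le> N"
  shows "fps_nth (fps_shift_arg c g) n = (\<Sum>i\<le>N. fps_nth g i * fps_nth (shift_var c ^ i) n)"
  unfolding fps_shift_arg_nth
  using assms by (intro sum.mono_neutral_left) (auto simp: shift_var_power_nth)

text \<open>Substitution is multiplicative over a noncommutative ring because the substituted series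
  has central coefficients.\<close>

lemma fps_shift_arg_mult: "fps_shift_arg c (x * y) = fps_shift_arg c x * fps_shift_arg c (y :: 'a::ring_1 fps)"
proof (rule fps_ext)
  fix n
  let ?s = "\<lambda>i n. fps_nth (shift_var c ^ i) n :: 'a"
  have "fps_nth (fps_shift_arg c x * fps_shift_arg c y) n
     = (\<Sum>m=0..n. (\<Sum>j\<le>n. fps_nth x j * ?s j m) * (\<Sum>l\<le>n. fps_nth y l * ?s l (n - m)))"
    unfolding fps_mult_nth
    by (intro sum.cong refl arg_cong2[of _ _ _ _ "(*)"]) (auto intro: fps_shift_arg_nth_le)
  also have "\<dots> = (\<Sum>m=0..n. \<Sum>j\<le>n. \<Sum>l\<le>n. fps_nth x j * fps_nth y l * (?s j m * ?s l (n - m)))"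
  proof -
    have "fps_nth x j * ?s j m * (fps_nth y l * ?s l k) = fps_nth x j * fps_nth y l * (?s j m * ?s l k)"
      for j m l k by (metis mult.assoc shift_var_central)
    then show ?thesis by (simp add: sum_product)
  qed
  also have "\<dots> = (\<Sum>j\<le>n. \<Sum>m=0..n. \<Sum>l\<le>n. fps_nth x j * fps_nth y l * (?s j m * ?s l (n - m)))"
    by (rule sum.swap)
  also have "\<dots> = (\<Sum>j\<le>n. \<Sum>l\<le>n. \<Sum>m=0..n. fps_nth x j * fps_nth y l * (?s j m * ?s l (n - m)))"
    by (intro sum.cong refl sum.swap)
  also have "\<dots> = (\<Sum>j\<le>n. \<Sum>l\<le>n. fps_nth x j * fps_nth y l * ?s (j + l) n)"
    by (simp add: sum_distrib_left[symmetric] power_add fps_mult_nth)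
  also have "\<dots> = (\<Sum>(j, l)\<in>{..n} \<times> {..n}. fps_nth x j * fps_nth y l * ?s (j + l) n)"
    by (simp add: sum.cartesian_product)
  also have "\<dots> = (\<Sum>(j, l)\<in>{(j, l). j + l \<le> n}. fps_nth x j * fps_nth y l * ?s (j + l) n)"
  proof (rule sum.mono_neutral_right)
    show "\<forall>z\<in>{..n} \<times> {..n} - {(j, l). j + l \<le> n}.
        (case z of (j, l) \<Rightarrow> fps_nth x j * fps_nth y l * ?s (j + l) n) = 0"
    proof
      fix z assume "z \<in> {..n} \<times> {..n} - {(j, l). j + l \<le> n}"
      then obtain j l where "z = (j, l)" "n < j + l" by (cases z) auto
      then show "(case z of (j, l) \<Rightarrow> fps_nth x j * fps_nth y l * ?s (j + l) n) = 0"
        by (simp add: shift_var_power_nth)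
    qed
  qed auto
  also have "\<dots> = (\<Sum>(i, j)\<in>(SIGMA i:{..n}. {..i}). fps_nth x j * fps_nth y (i - j) * ?s i n)"
    by (rule sum.reindex_bij_witness[of _ "\<lambda>(i, j). (j, i - j)" "\<lambda>(j, l). (j + l, j)"]) auto
  also have "\<dots> = fps_nth (fps_shift_arg c (x * y)) n"
    by (simp add: sum.Sigma[symmetric] fps_shift_arg_nth fps_mult_nth sum_distrib_right atLeast0AtMost)
  finally show "fps_nth (fps_shift_arg c (x * y)) n = fps_nth (fps_shift_arg c x * fps_shift_arg c y) n" ..
qed

lemma fps_shift_arg_simps:
  "fps_shift_arg c (x + y) = fps_shift_arg c x + fps_shift_arg c (y :: 'a::ring_1 fps)"
  "fps_shift_arg c (x - y) = fps_shift_arg c x - fps_shift_arg c (y :: 'a::ring_1 fps)"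
  "fps_shift_arg c (- x) = - fps_shift_arg c (x :: 'a::ring_1 fps)"
  by (simp_all add: fps_eq_iff fps_shift_arg_nth distrib_right left_diff_distrib
      sum.distrib sum_subtractf sum_negf)

lemma fps_shift_arg_const: "fps_shift_arg c (fps_const a) = fps_const (a :: 'a::ring_1)"
proof (rule fps_ext)
  fix n
  have "fps_nth (fps_shift_arg c (fps_const a)) n = (\<Sum>i\<in>{0}. fps_nth (fps_const a) i * fps_nth (shift_var c ^ i) n)"
    unfolding fps_shift_arg_nth by (rule sum.mono_neutral_right) auto
  then show "fps_nth (fps_shift_arg c (fps_const a)) n = fps_nth (fps_const a) n" by simp
qed

lemma fps_shift_arg_of_nat: "fps_shift_arg c (of_nat k) = (of_nat k :: 'a::ring_1 fps)"
  by (metis fps_of_nat fps_shift_arg_const)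

lemma fps_shift_arg_1: "fps_shift_arg c 1 = (1 :: 'a::ring_1 fps)"
  using fps_shift_arg_of_nat[of c 1] by simp

lemma fps_shift_arg_X: "fps_shift_arg c fps_X = (shift_var c :: 'a::ring_1 fps)"
proof (rule fps_ext)
  fix n
  have "fps_nth (fps_shift_arg c fps_X) n = (\<Sum>i\<in>{1}. fps_nth fps_X i * fps_nth (shift_var c ^ i) n :: 'a)"
    unfolding fps_shift_arg_nth_le[of n "Suc n", OF le_SucI, OF le_refl]
    by (rule sum.mono_neutral_right) (auto simp: fps_X_nth)
  then show "fps_nth (fps_shift_arg c fps_X) n = fps_nth (shift_var c :: 'a fps) n" by simp
qed

lemma fps_shift_arg_power: "fps_shift_arg c (x ^ n) = fps_shift_arg c (x :: 'a::ring_1 fps) ^ n"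
  by (induction n) (simp_all add: fps_shift_arg_1 fps_shift_arg_mult)

lemma one_minus_X_cancel:
  assumes "(1 - of_nat c * fps_X) * x = (1 - of_nat c * fps_X) * (y :: 'a::ring_1 fps)"
  shows "x = y"
proof -
  have "fps_left_inverse (1 - of_nat c * fps_X :: 'a fps) 1 * (1 - of_nat c * fps_X) = 1"
    by (rule fps_left_inverse) simp
  then show ?thesis using assms by (metis mult.assoc mult_1)
qed

lemma fps_shift_arg_shift_var: "fps_shift_arg c (shift_var 1) = (shift_var (Suc c) :: 'a::ring_1 fps)"
proof -
  define S where "S = fps_shift_arg c (shift_var 1 :: 'a fps)"
  have "fps_shift_arg c ((1 - of_nat 1 * fps_X) * shift_var 1) = (fps_shift_arg c fps_X :: 'a fps)"
    by (simp only: shift_var_eq)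
  then have 1: "(1 - shift_var c) * S = shift_var c"
    by (simp add: fps_shift_arg_mult fps_shift_arg_simps fps_shift_arg_1 fps_shift_arg_X S_def)
  have "(1 - of_nat c * fps_X) * ((1 - shift_var c) * S) = (1 - of_nat (Suc c) * fps_X) * S"
    by (subst mult.assoc[symmetric], subst right_diff_distrib, subst shift_var_eq) (simp add: algebra_simps)
  then have "(1 - of_nat (Suc c) * fps_X) * S = fps_X"
    by (simp only: 1 shift_var_eq)
  then show ?thesis
    using one_minus_X_cancel[of "Suc c" S "shift_var (Suc c)"] by (simp add: S_def shift_var_eq del: of_nat_Suc)
qed

lemma fps_shift_arg_Suc: "fps_shift_arg c (fps_shift_arg 1 x) = fps_shift_arg (Suc c) (x :: 'a::ring_1 fps)"
proof (rule fps_ext)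
  fix n
  have "fps_nth (fps_shift_arg c (fps_shift_arg 1 x)) n
     = (\<Sum>i\<le>n. (\<Sum>j\<le>n. fps_nth x j * fps_nth (shift_var 1 ^ j) i) * fps_nth (shift_var c ^ i) n)"
    unfolding fps_shift_arg_nth[of c]
    by (intro sum.cong refl arg_cong2[of _ _ _ _ "(*)"] fps_shift_arg_nth_le) auto
  also have "\<dots> = (\<Sum>j\<le>n. \<Sum>i\<le>n. fps_nth x j * (fps_nth (shift_var 1 ^ j) i * fps_nth (shift_var c ^ i) n))"
    by (subst sum.swap) (simp add: sum_distrib_right mult.assoc)
  also have "\<dots> = (\<Sum>j\<le>n. fps_nth x j * fps_nth (fps_shift_arg c (shift_var 1 ^ j)) n)"
    by (simp add: sum_distrib_left[symmetric] fps_shift_arg_nth)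
  also have "\<dots> = fps_nth (fps_shift_arg (Suc c) x) n"
    by (simp add: fps_shift_arg_power fps_shift_arg_shift_var[unfolded One_nat_def]) (simp add: fps_shift_arg_nth)
  finally show "fps_nth (fps_shift_arg c (fps_shift_arg 1 x)) n = fps_nth (fps_shift_arg (Suc c) x) n" .
qed

lemma fps_shift_arg_commute:
  fixes x y :: "'a::ring_1 fps"
  assumes "\<And>a b. fps_nth x a * fps_nth y b = fps_nth y b * fps_nth x a"
  shows "fps_shift_arg c x * fps_shift_arg c' y = fps_shift_arg c' y * fps_shift_arg c x"
proof (rule fps_ext)
  fix n
  have comm: "fps_nth (fps_shift_arg c x) a * fps_nth (fps_shift_arg c' y) b
      = fps_nth (fps_shift_arg c' y) b * fps_nth (fps_shift_arg c x) a" for a b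
  proof -
    have "fps_nth x i * fps_nth (shift_var c ^ i) a * (fps_nth y j * fps_nth (shift_var c' ^ j) b)
      = fps_nth y j * fps_nth (shift_var c' ^ j) b * (fps_nth x i * fps_nth (shift_var c ^ i) a)" for i j
      by (metis assms mult.assoc shift_var_central)
    then show ?thesis
      unfolding fps_shift_arg_nth sum_product by (subst sum.swap) simp
  qed
  show "fps_nth (fps_shift_arg c x * fps_shift_arg c' y) n = fps_nth (fps_shift_arg c' y * fps_shift_arg c x) n"
    unfolding fps_mult_nth comm
    by (rule sum.reindex_bij_witness[of _ "\<lambda>i. n - i" "\<lambda>i. n - i"]) auto
qed

lemma X_commute_left: "x * (fps_X * y) = fps_X * (x * (y :: 'a::ring_1 fps))"
  by (metis fps_mult_fps_X_commute mult.assoc)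

lemma tail_series_rec:
  "0 < r \<Longrightarrow> tail_series g r = fps_X * (fps_const (fps_nth g r) + tail_series g (Suc r))"
  by (auto simp: fps_eq_iff tail_series_def le_Suc_eq)

lemma tail_series_shift_rec:
  assumes "0 < r"
  shows "fps_shift_arg 1 (tail_series g r) =
    fps_X * (fps_const (fps_nth g r) + fps_shift_arg 1 (tail_series g r) + fps_shift_arg 1 (tail_series g (Suc r)))"
proof -
  have "(1 - fps_X) * fps_shift_arg 1 (tail_series g r)
     = (1 - of_nat 1 * fps_X) * shift_var 1 * fps_shift_arg 1 (fps_const (fps_nth g r) + tail_series g (Suc r))"
    unfolding tail_series_rec[OF assms, of g] by (simp add: fps_shift_arg_mult fps_shift_arg_X mult.assoc)
  also have "\<dots> = fps_X * (fps_const (fps_nth g r) + fps_shift_arg 1 (tail_series g (Suc r)))"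
    unfolding shift_var_eq by (simp add: fps_shift_arg_simps fps_shift_arg_const)
  finally show ?thesis by (simp add: algebra_simps)
qed

text \<open>This is \<open>d(u) f(u - 1) = f(u) d(u)\<close>, together with its analogue for all tails of \<open>f\<close>.\<close>

lemma tail_series_shift:
  assumes "\<And>r. 0 < r \<Longrightarrow> d * fps_const (fps_nth g r) - fps_const (fps_nth g r) * d = - (tail_series g r * d)"
    and "0 < r"
  shows "d * fps_shift_arg 1 (tail_series g r) = tail_series g r * (d :: 'a::ring_1 fps)"
proof -
  define \<Delta> where "\<Delta> r = d * fps_shift_arg 1 (tail_series g r) - tail_series g r * d" for r
  have rec: "\<Delta> r = fps_X * (\<Delta> r + \<Delta> (Suc r))" if "0 < r" for r
  proof -
    have d: "d * fps_const (fps_nth g r) = fps_const (fps_nth g r) * d - tail_series g r * d"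
      using assms(1)[OF that] by (simp add: algebra_simps)
    have "d * fps_shift_arg 1 (tail_series g r) = fps_X * (fps_const (fps_nth g r) * d - tail_series g r * d
        + d * fps_shift_arg 1 (tail_series g r) + d * fps_shift_arg 1 (tail_series g (Suc r)))"
      by (subst (1) tail_series_shift_rec[OF that]) (simp only: X_commute_left distrib_left d)
    moreover have "tail_series g r * d = fps_X * (fps_const (fps_nth g r) * d + tail_series g (Suc r) * d)"
      by (subst (1) tail_series_rec[OF that]) (simp only: mult.assoc distrib_right)
    ultimately show ?thesis unfolding \<Delta>_def by (simp add: algebra_simps)
  qed
  have "fps_nth (\<Delta> r) n = 0" if "0 < r" for n r
    using that
  proof (induction n arbitrary: r)
    case 0
    show ?case by (subst rec[OF 0]) simp
  next
    case (Suc n)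
    show ?case by (subst rec[OF Suc.prems]) (simp add: Suc)
  qed
  then show ?thesis using assms(2) by (simp add: \<Delta>_def fps_eq_iff)
qed

text \<open>The bracket has the opposite sign here, and the shift falls on the other side: d(u - 1)
  f(u) = f(u - 1) d(u - 1), for all tails of f. The defect for r is 1/u times the defect for r + 1,
  so its coefficients vanish by induction on the order, for all r at once.\<close>

lemma tail_series_shift':
  assumes "\<And>r. 0 < r \<Longrightarrow> d * fps_const (fps_nth g r) - fps_const (fps_nth g r) * d = tail_series g r * d"
    and "0 < r"
  shows "fps_shift_arg 1 d * tail_series g r = fps_shift_arg 1 (tail_series g r * (d :: 'a::ring_1 fps))"
proof -
  let ?E = "fps_shift_arg 1 d"
  define \<Delta> where "\<Delta> r = ?E * tail_series g r - fps_shift_arg 1 (tail_series g r) * ?E" for r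
  have rec: "\<Delta> r = fps_X * \<Delta> (Suc r)" if "0 < r" for r
  proof -
    have "fps_shift_arg 1 (d * fps_const (fps_nth g r) - fps_const (fps_nth g r) * d) = fps_shift_arg 1 (tail_series g r * d)"
      by (simp only: assms(1)[OF that])
    then have d: "?E * fps_const (fps_nth g r) = fps_const (fps_nth g r) * ?E + fps_shift_arg 1 (tail_series g r) * ?E"
      by (simp add: fps_shift_arg_simps fps_shift_arg_mult fps_shift_arg_const algebra_simps)
    have "fps_shift_arg 1 (tail_series g r) * ?E = fps_X * (fps_const (fps_nth g r) * ?E
       + fps_shift_arg 1 (tail_series g r) * ?E + fps_shift_arg 1 (tail_series g (Suc r)) * ?E)"
      by (subst (1) tail_series_shift_rec[OF that]) (simp only: mult.assoc distrib_right)
    moreover have "?E * tail_series g r = fps_X * (?E * fps_const (fps_nth g r) + ?E * tail_series g (Suc r))"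
      by (subst (1) tail_series_rec[OF that]) (simp only: X_commute_left distrib_left)
    ultimately show ?thesis unfolding \<Delta>_def d by (simp add: algebra_simps)
  qed
  have "fps_nth (\<Delta> r) n = 0" if "0 < r" for n r
    using that
  proof (induction n arbitrary: r)
    case 0
    show ?case by (subst rec[OF 0]) simp
  next
    case (Suc n)
    show ?case by (subst rec[OF Suc.prems]) (simp add: Suc)
  qed
  then show ?thesis using assms(2) by (simp add: \<Delta>_def fps_eq_iff fps_shift_arg_mult)
qed

text \<open>The coefficient of g passes the factors from right to left. After k factors the
  accumulated correction is k times a single shifted tail, because \<open>tail_series_shift\<close>
  carries the tail at u - c - 1 to the one at u - c. For k = p the coefficient is 0.\<close>

lemma shifted_product_commute:
  assumes br: "\<And>r. 0 < r \<Longrightarrow> d * fps_const (fps_nth g r) - fps_const (fps_nth g r) * d = - (tail_series g r * d)"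
    and r: "0 < r" and p: "of_nat p = (0 :: 'a::ring_1)"
  shows "shifted_product p d * fps_const (fps_nth g r) = fps_const (fps_nth g r) * shifted_product p (d :: 'a fps)"
proof -
  let ?c = "fps_const (fps_nth g r)" and ?F = "\<lambda>c. fps_shift_arg c (tail_series g r)"
  define Q where "Q k = prod_list (map (\<lambda>c. fps_shift_arg c d) [p - k..<p])" for k
  have "Q k * ?c = (?c - of_nat k * ?F (p - k)) * Q k" if "k \<le> p" for k
    using that
  proof (induction k)
    case (Suc k)
    define c where "c = p - Suc k"
    have c: "p - k = Suc c" using Suc by (simp add: c_def)
    have QS: "Q (Suc k) = fps_shift_arg c d * Q k"
    proof -
      have "[p - Suc k..<p] = c # [p - k..<p]"
        using Suc.prems by (simp add: c_def upt_conv_Cons Suc_diff_Suc)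
      then show ?thesis by (simp add: Q_def)
    qed
    have "fps_shift_arg c (d * ?c - ?c * d) = fps_shift_arg c (- (tail_series g r * d))"
      by (simp only: br[OF r])
    then have d: "fps_shift_arg c d * ?c = (?c - ?F c) * fps_shift_arg c d"
      by (simp add: fps_shift_arg_simps fps_shift_arg_mult fps_shift_arg_const algebra_simps)
    have "fps_shift_arg c (d * fps_shift_arg 1 (tail_series g r)) = fps_shift_arg c (tail_series g r * d)"
      by (simp only: tail_series_shift[OF br r])
    then have F: "fps_shift_arg c d * ?F (Suc c) = ?F c * fps_shift_arg c d"
      by (simp add: fps_shift_arg_mult fps_shift_arg_Suc[unfolded One_nat_def])
    have "Q (Suc k) * ?c = fps_shift_arg c d * (?c - of_nat k * ?F (Suc c)) * Q k"
      using Suc by (simp add: QS mult.assoc c)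
    also have "fps_shift_arg c d * (?c - of_nat k * ?F (Suc c)) = (?c - of_nat (Suc k) * ?F c) * fps_shift_arg c d"
      by (simp add: right_diff_distrib of_nat_left_commute d F) (simp add: algebra_simps)
    finally show ?case by (simp add: QS c_def mult.assoc)
  qed (simp add: Q_def)
  from this[of p] have "Q p * ?c = (?c - of_nat p * ?F 0) * Q p" by simp
  moreover have "of_nat p = (0 :: 'a fps)" using p by (metis fps_of_nat fps_const_0_eq_0)
  ultimately show ?thesis by (simp add: Q_def shifted_product_def)
qed

lemma prod_list_rev_commute:
  assumes "\<And>x y. x \<in> set xs \<Longrightarrow> y \<in> set xs \<Longrightarrow> x * y = y * (x :: 'a::monoid_mult)"
  shows "prod_list (rev xs) = prod_list xs"
  using assms
proof (induction xs)
  case (Cons x xs)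
  note comm = Cons.prems
  have "prod_list ys * x = x * prod_list ys" if "set ys \<subseteq> set (x # xs)" for ys
    using that
  proof (induction ys)
    case (Cons y ys)
    then have "y * x = x * y" "prod_list ys * x = x * prod_list ys"
      using comm[of y x] by auto
    then show ?case by (metis mult.assoc prod_list.Cons)
  qed simp
  from this[of xs] have "prod_list xs * x = x * prod_list xs" by auto
  moreover have "prod_list (rev xs) = prod_list xs" using Cons by auto
  ultimately show ?case by simp
qed simp

text \<open>Now the tail at u - c passes the factor d(u - c - 1), so the shifts have to increase
  from right to left. The commutativity of the coefficients of d restores the order of the factors
  in \<open>shifted_product\<close>.\<close>

lemma shifted_product_commute':
  assumes br: "\<And>r. 0 < r \<Longrightarrow> d * fps_const (fps_nth g r) - fps_const (fps_nth g r) * d = tail_series g r * d"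
    and comm: "\<And>a b. fps_nth d a * fps_nth d b = fps_nth d b * fps_nth d a"
    and r: "0 < r" and p: "of_nat p = (0 :: 'a::ring_1)"
  shows "shifted_product p d * fps_const (fps_nth g r) = fps_const (fps_nth g r) * shifted_product p (d :: 'a fps)"
proof -
  let ?c = "fps_const (fps_nth g r)" and ?F = "\<lambda>c. fps_shift_arg c (tail_series g r)"
  define Q where "Q k = prod_list (rev (map (\<lambda>c. fps_shift_arg c d) [0..<k]))" for k
  have QS: "Q (Suc k) = fps_shift_arg k d * Q k" for k
    by (simp add: Q_def)
  have "Q k * ?c = (?c + of_nat k * ?F (k - Suc 0)) * Q k" for k
  proof (induction k)
    case (Suc k)
    have "fps_shift_arg k (d * ?c - ?c * d) = fps_shift_arg k (tail_series g r * d)"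
      by (simp only: br[OF r])
    then have d: "fps_shift_arg k d * ?c = (?c + ?F k) * fps_shift_arg k d"
      by (simp add: fps_shift_arg_simps fps_shift_arg_mult fps_shift_arg_const algebra_simps)
    have F: "fps_shift_arg k d * (of_nat k * ?F (k - Suc 0)) = of_nat k * ?F k * fps_shift_arg k d"
    proof (cases k)
      case (Suc c)
      have "fps_shift_arg c (fps_shift_arg 1 d * tail_series g r) = fps_shift_arg c (fps_shift_arg 1 (tail_series g r * d))"
        by (simp only: tail_series_shift'[OF br r])
      then show ?thesis
        by (simp add: Suc fps_shift_arg_mult fps_shift_arg_Suc[unfolded One_nat_def] of_nat_left_commute mult.assoc del: of_nat_Suc)
    qed simp
    have "Q (Suc k) * ?c = fps_shift_arg k d * (?c + of_nat k * ?F (k - Suc 0)) * Q k"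
      using Suc by (simp add: QS mult.assoc)
    also have "fps_shift_arg k d * (?c + of_nat k * ?F (k - Suc 0)) = (?c + of_nat (Suc k) * ?F k) * fps_shift_arg k d"
      by (simp only: distrib_left d F) (simp add: algebra_simps)
    finally show ?case by (simp add: QS mult.assoc)
  qed (simp add: Q_def)
  from this[of p] have "Q p * ?c = (?c + of_nat p * ?F (p - Suc 0)) * Q p" .
  moreover have "of_nat p = (0 :: 'a fps)" using p by (metis fps_of_nat fps_const_0_eq_0)
  moreover have "Q p = shifted_product p d"
    unfolding Q_def shifted_product_def
    by (rule prod_list_rev_commute) (auto intro: fps_shift_arg_commute comm)
  ultimately show ?thesis by simp
qed

context rtt
begin

lemma d1_shifted_product_f:
  assumes "0 < r" "of_nat p = (0 :: 'a)"
  shows "fps_nth (shifted_product p d1) n * fps_nth f r = fps_nth f r * fps_nth (shifted_product p d1) n"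
  using arg_cong[OF shifted_product_commute[OF d1_tail assms], of "\<lambda>x. fps_nth x n"] by simp

lemma d2_shifted_product_f:
  assumes "0 < r" "of_nat p = (0 :: 'a)"
  shows "fps_nth (shifted_product p d2) n * fps_nth f r = fps_nth f r * fps_nth (shifted_product p d2) n"
proof -
  have "fps_nth d2 a * fps_nth d2 b = fps_nth d2 b * fps_nth d2 a" for a b
    using d2_d2 by (simp add: uv_commute_iff)
  from arg_cong[OF shifted_product_commute'[OF d2_tail this assms], of "\<lambda>x. fps_nth x n"]
  show ?thesis by simp
qed

end

text \<open>Transposing indices, t_ij to t_ji, reverses products. Read in the opposite ring it gives
  a solution of the same relations in which e and f are exchanged, so statements about powers of f
  carry over to e.\<close>

datatype 'a opp = Opp (unopp: 'a)

instantiation opp :: (ring_1) ring_1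
begin
definition "0 = Opp 0"
definition "1 = Opp 1"
definition "x + y = Opp (unopp x + unopp y)"
definition "x - y = Opp (unopp x - unopp y)"
definition "- x = Opp (- unopp x)"
definition "x * y = Opp (unopp y * unopp x)"
instance
  by standard (auto simp: zero_opp_def one_opp_def plus_opp_def minus_opp_def uminus_opp_def
      times_opp_def algebra_simps intro: opp.expand)
end

lemmas opp_defs = zero_opp_def one_opp_def plus_opp_def minus_opp_def uminus_opp_def times_opp_def

lemma Opp_simps:
  "Opp x * Opp y = Opp (y * x)" "Opp x + Opp y = Opp (x + y)" "Opp x - Opp y = Opp (x - y)"
  "Opp 0 = 0" "Opp 1 = 1" "(Opp x :: 'a::ring_1 opp) = Opp y \<longleftrightarrow> x = y"
  by (simp_all add: opp_defs)

lemma Opp_sum: "(\<Sum>i\<in>A. Opp (g i)) = Opp (\<Sum>i\<in>A. g i :: 'a::ring_1)"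
  by (induction A rule: infinite_finite_induct) (simp_all add: Opp_simps)

lemma Opp_power: "Opp x ^ n = Opp (x ^ n :: 'a::ring_1)"
  by (induction n) (simp_all add: Opp_simps power_commutes)

lemma Opp_of_nat: "of_nat n = Opp (of_nat n :: 'a::ring_1)"
  by (induction n) (simp_all add: opp_defs)

definition fps_opp :: "'a::ring_1 fps \<Rightarrow> 'a opp fps" where
  "fps_opp x = Abs_fps (\<lambda>n. Opp (fps_nth x n))"

lemma fps_opp_mult: "fps_opp (x * y) = fps_opp y * fps_opp (x :: 'a::ring_1 fps)"
proof (rule fps_ext)
  fix n
  show "fps_nth (fps_opp (x * y)) n = fps_nth (fps_opp y * fps_opp x) n"
    unfolding fps_mult_nth fps_opp_def
    by (simp add: fps_mult_nth Opp_sum[symmetric] Opp_simps)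
       (rule sum.reindex_bij_witness[of _ "\<lambda>i. n - i" "\<lambda>i. n - i"], auto)
qed

context rtt
begin

lemma rtt_opp: "rtt (\<lambda>i j r. Opp (t j i r))"
proof
  show "Opp (t j i 0) = (if i = j then 1 else 0)" for i j
    by (simp add: t_0 Opp_simps)
  fix i j k l :: 2 and r s :: nat
  assume rs: "0 < r" "0 < s"
  \<comment> \<open>The right-hand side of the relations depends on r and s only through their
    minimum and their sum.\<close>
  have sym: "t i j r * t k l s - t k l s * t i j r = t i j s * t k l r - t k l r * t i j s" for i j k l r s
  proof (cases "0 < r \<and> 0 < s")
    case True
    then show ?thesis by (simp add: t_rel add.commute min.commute)
  next
    case False
    then show ?thesis by (auto simp: t_0)
  qed
  have "t l k s * t j i r - t j i r * t l k s
      = (\<Sum>q<min r s. t j k q * t l i (r + s - 1 - q) - t j k (r + s - 1 - q) * t l i q)"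
    using t_rel[OF rs(2,1), of l k j i] by (simp add: add.commute min.commute)
  also have "\<dots> = (\<Sum>q<min r s. t l i (r + s - 1 - q) * t j k q - t l i q * t j k (r + s - 1 - q))"
  proof (rule sum.cong[OF refl])
    show "t j k q * t l i w - t j k w * t l i q = t l i w * t j k q - t l i q * t j k w" for q w
      using sym[of j k q l i w] by (simp add: algebra_simps)
  qed
  finally show "Opp (t j i r) * Opp (t l k s) - Opp (t l k s) * Opp (t j i r)
     = (\<Sum>q<min r s. Opp (t j k q) * Opp (t l i (r + s - 1 - q)) - Opp (t j k (r + s - 1 - q)) * Opp (t l i q))"
    by (simp add: Opp_simps Opp_sum)
qed

lemma e_power_f:
  assumes p: "prime p" "of_nat p = (0 :: 'a)" and "0 < r" "0 < s"
  shows "fps_nth e r ^ p * fps_nth f s = fps_nth f s * fps_nth e r ^ p"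
proof -
  interpret op: rtt "\<lambda>i j r. Opp (t j i r)" by (rule rtt_opp)
  have T: "op.T i j = fps_opp (T j i)" for i j
    by (simp add: op.T_def T_def fps_opp_def)
  have one: "fps_opp 1 = (1 :: 'a opp fps)"
    by (simp add: fps_eq_iff fps_opp_def Opp_simps)
  have "op.d1i = op.d1i * (op.d1 * fps_opp d1i)"
    by (simp add: op.d1_def T d1_def[symmetric] fps_opp_mult[symmetric] d1i one)
  then have i: "op.d1i = fps_opp d1i"
    by (simp add: mult.assoc[symmetric] op.d1i)
  have "op.f = fps_opp e" "op.e = fps_opp f"
    by (simp_all add: op.f_def op.e_def f_def e_def T i fps_opp_mult)
  moreover have "of_nat p = (0 :: 'a opp)" using p by (simp add: Opp_of_nat Opp_simps)
  ultimately show ?thesis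
    using op.f_power_e[OF p(1) _ assms(3,4)] by (simp add: fps_opp_def Opp_simps Opp_power)
qed

end

section \<open>Highest weight ideals\<close>

definition left_ideal :: "'a::ring_1 set \<Rightarrow> bool" where
  "left_ideal J \<longleftrightarrow> 0 \<in> J \<and> (\<forall>x\<in>J. \<forall>y\<in>J. x + y \<in> J) \<and> (\<forall>a. \<forall>x\<in>J. a * x \<in> J)"

lemma left_ideal_add: "left_ideal J \<Longrightarrow> x \<in> J \<Longrightarrow> y \<in> J \<Longrightarrow> x + y \<in> J"
  and left_ideal_mult: "left_ideal J \<Longrightarrow> x \<in> J \<Longrightarrow> a * x \<in> J"
  and left_ideal_0: "left_ideal J \<Longrightarrow> 0 \<in> J"
  by (simp_all add: left_ideal_def)

lemma left_ideal_uminus: "left_ideal J \<Longrightarrow> x \<in> J \<Longrightarrow> - x \<in> J"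
  using left_ideal_mult[of J x "- 1"] by simp

lemma left_ideal_diff: "left_ideal J \<Longrightarrow> x \<in> J \<Longrightarrow> y \<in> J \<Longrightarrow> x - y \<in> J"
  using left_ideal_add[of J x "- y"] left_ideal_uminus[of J y] by simp

lemma geometric_left: "(\<Sum>i<n. x ^ i) * (1 - x) = 1 - (x :: 'a::ring_1) ^ n"
proof (induction n)
  case (Suc n)
  have "(\<Sum>i<Suc n. x ^ i) * (1 - x) = (1 - x ^ n) + x ^ n * (1 - x)"
    by (simp only: sum.lessThan_Suc distrib_right Suc)
  then show ?case by (simp add: right_diff_distrib power_Suc2 del: power_Suc)
qed simp

text \<open>By \<open>weaken\<close>, n is a lower bound for the length of the words, and m bounds
  the indices of their letters. Level 1 consists of combinations of nonempty words, which turn out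
  to be nilpotent modulo an ideal containing the p-th powers of the letters.\<close>

inductive in_words :: "('k::field \<Rightarrow> 'a::ring_1) \<Rightarrow> (nat \<Rightarrow> 'a) \<Rightarrow> nat \<Rightarrow> nat \<Rightarrow> 'a \<Rightarrow> bool"
  for sc f m where
  scal: "in_words sc f m 0 (sc c)"
| zero: "in_words sc f m n 0"
| add: "in_words sc f m n x \<Longrightarrow> in_words sc f m n y \<Longrightarrow> in_words sc f m n (x + y)"
| letter: "in_words sc f m n x \<Longrightarrow> 0 < i \<Longrightarrow> i \<le> m \<Longrightarrow> in_words sc f m (Suc n) (f i * x)"
| weaken: "in_words sc f m (Suc n) x \<Longrightarrow> in_words sc f m n x"

definition words :: "('k::field \<Rightarrow> 'a::ring_1) \<Rightarrow> (nat \<Rightarrow> 'a) \<Rightarrow> nat \<Rightarrow> nat \<Rightarrow> 'a set" where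
  "words sc f m n = {x. in_words sc f m n x}"

lemma words_scalI: "sc c \<in> words sc f m 0"
  and words_zeroI: "0 \<in> words sc f m n"
  and words_addI: "x \<in> words sc f m n \<Longrightarrow> y \<in> words sc f m n \<Longrightarrow> x + y \<in> words sc f m n"
  and words_letterI: "x \<in> words sc f m n \<Longrightarrow> 0 < i \<Longrightarrow> i \<le> m \<Longrightarrow> f i * x \<in> words sc f m (Suc n)"
  and words_weakenI: "x \<in> words sc f m (Suc n) \<Longrightarrow> x \<in> words sc f m n"
  by (auto simp: words_def intro: in_words.intros)

lemmas words_intros = words_scalI words_zeroI words_addI words_letterI words_weakenI

lemma words_induct [consumes 1, case_names scal zero add letter weaken]:
  assumes "x \<in> words sc f m n"
    and "\<And>c. P 0 (sc c)" "\<And>n. P n 0"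
    and "\<And>n x y. x \<in> words sc f m n \<Longrightarrow> P n x \<Longrightarrow> y \<in> words sc f m n \<Longrightarrow> P n y \<Longrightarrow> P n (x + y)"
    and "\<And>n x i. x \<in> words sc f m n \<Longrightarrow> P n x \<Longrightarrow> 0 < i \<Longrightarrow> i \<le> m \<Longrightarrow> P (Suc n) (f i * x)"
    and "\<And>n x. x \<in> words sc f m (Suc n) \<Longrightarrow> P (Suc n) x \<Longrightarrow> P n x"
  shows "P n x"
  using assms(1) unfolding words_def mem_Collect_eq
  by (induction rule: in_words.induct) (auto intro: assms(2-) simp: words_def)

lemma words_sum: "(\<And>i. i \<in> A \<Longrightarrow> g i \<in> words sc f m n) \<Longrightarrow> (\<Sum>i\<in>A. g i) \<in> words sc f m n"
  by (induction A rule: infinite_finite_induct) (auto intro: words_zeroI words_addI)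

lemma words_antimono:
  assumes "x \<in> words sc f m n" "k \<le> n"
  shows "x \<in> words sc f m k"
  using assms(2,1) by (induction rule: inc_induct) (auto intro: words_weakenI)

lemma words_mono: "x \<in> words sc f m n \<Longrightarrow> m \<le> m' \<Longrightarrow> x \<in> words sc f m' n"
  by (induction rule: words_induct) (auto intro: words_intros)

locale scalars =
  fixes sc :: "'k::field \<Rightarrow> 'a::ring_1"
  assumes sc_add: "sc (a + b) = sc a + sc b"
    and sc_mult: "sc (a * b) = sc a * sc b"
    and sc_1: "sc 1 = 1"
    and sc_comm: "sc c * x = x * sc c"
begin

lemma sc_0: "sc 0 = 0"
  using sc_add[of 0 0] by simp

lemma sc_uminus: "sc (- c) = - sc c"
  using sc_add[of c "- c"] by (simp add: sc_0 eq_neg_iff_add_eq_0 add.commute)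

lemma words_scal: "x \<in> words sc f m n \<Longrightarrow> sc c * x \<in> words sc f m n"
proof (induction rule: words_induct)
  case (letter n x i)
  have "sc c * (f i * x) = f i * (sc c * x)" by (metis mult.assoc sc_comm)
  then show ?case using letter by (auto intro: words_letterI)
next
  case (scal a)
  show ?case by (metis sc_mult words_scalI)
qed (auto intro: words_intros simp: distrib_left)

lemma words_uminus: "x \<in> words sc f m n \<Longrightarrow> - x \<in> words sc f m n"
  using words_scal[of x f m n "- 1"] by (simp add: sc_uminus sc_1)

lemma words_mult: "x \<in> words sc f m n \<Longrightarrow> y \<in> words sc f m k \<Longrightarrow> x * y \<in> words sc f m (n + k)"
proof (induction rule: words_induct)
  case (scal c)
  then show ?case by (simp add: words_scal)
next
  case (weaken n x)
  then show ?case by (auto intro: words_weakenI)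
qed (auto intro: words_intros simp: distrib_right mult.assoc)

lemma words_power: "x \<in> words sc f m 1 \<Longrightarrow> x ^ n \<in> words sc f m n"
proof (induction n)
  case 0
  show ?case using words_scalI[of sc 1 f m] by (simp add: sc_1)
next
  case (Suc n)
  then show ?case using words_mult[of x f m 1 "x ^ n" n] by simp
qed

lemma words_0_decomp: "x \<in> words sc f m n \<Longrightarrow> \<exists>c. \<exists>y\<in>words sc f m 1. x = sc c + y"
proof (induction rule: words_induct)
  case (scal c)
  show ?case using words_zeroI by (intro exI[of _ c] bexI[of _ 0]) auto
next
  case (zero n)
  show ?case using words_zeroI by (intro exI[of _ 0] bexI[of _ 0]) (auto simp: sc_0)
next
  case (add n x y)
  from add.IH(1) obtain c v where v: "v \<in> words sc f m 1" "x = sc c + v" by blast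
  from add.IH(2) obtain c' v' where v': "v' \<in> words sc f m 1" "y = sc c' + v'" by blast
  show ?case using v v'
    by (intro exI[of _ "c + c'"] bexI[of _ "v + v'"]) (auto simp: sc_add algebra_simps intro: words_addI)
next
  case (letter n x i)
  then have "f i * x \<in> words sc f m 1"
    by (auto intro: words_antimono[of _ _ _ _ "Suc n"] words_letterI)
  then show ?case by (intro exI[of _ 0] bexI[of _ "f i * x"]) (auto simp: sc_0)
qed auto

context
  fixes f :: "nat \<Rightarrow> 'a" and I :: "'a set" and p :: nat
  assumes f_comm: "\<And>a b. 0 < b \<Longrightarrow> b \<le> a \<Longrightarrow> f a * f b - f b * f a = (\<Sum>x\<in>{b..<a}. f x * f (a + b - 1 - x))"
    and I_0: "0 \<in> I"
    and I_add: "\<And>x y. x \<in> I \<Longrightarrow> y \<in> I \<Longrightarrow> x + y \<in> I"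
    and I_mult: "\<And>a x b. x \<in> I \<Longrightarrow> a * x * b \<in> I"
    and f_power: "\<And>i. 0 < i \<Longrightarrow> f i ^ p \<in> I"
begin

text \<open>The bracket of the letter of index m + 1 with one of index i at most m is a sum of
  products of two letters of indices between i and m. So the commutator contains no letter of index
  m + 1, and the total length does not drop.\<close>

lemma words_commute_last:
  assumes "x \<in> words sc f m n"
  shows "f (Suc m) * x - x * f (Suc m) \<in> words sc f m (Suc n)"
  using assms
proof (induction rule: words_induct)
  case (scal c)
  show ?case by (simp add: sc_comm words_zeroI)
next
  case (letter n x i)
  have "f y * f (Suc m + i - 1 - y) * x \<in> words sc f m (Suc (Suc n))" if "y \<in> {i..<Suc m}" for y
    using that letter by (auto intro!: words_letterI simp: mult.assoc)
  then have "(\<Sum>y\<in>{i..<Suc m}. f y * f (Suc m + i - 1 - y) * x) \<in> words sc f m (Suc (Suc n))"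
    by (intro words_sum)
  moreover have "(\<Sum>y\<in>{i..<Suc m}. f y * f (Suc m + i - 1 - y) * x) = (f (Suc m) * f i - f i * f (Suc m)) * x"
    using letter by (subst f_comm) (auto simp: sum_distrib_right simp del: sum.op_ivl_Suc)
  moreover have "f (Suc m) * (f i * x) - f i * x * f (Suc m)
     = (f (Suc m) * f i - f i * f (Suc m)) * x + f i * (f (Suc m) * x - x * f (Suc m))"
    by (simp add: algebra_simps)
  ultimately show ?case using letter by (auto intro: words_intros)
next
  case (add n x y)
  have "f (Suc m) * (x + y) - (x + y) * f (Suc m) = (f (Suc m) * x - x * f (Suc m)) + (f (Suc m) * y - y * f (Suc m))"
    by (simp add: algebra_simps)
  then show ?case using add by (metis words_addI)
qed (auto intro: words_intros)

text \<open>The normal form in which all occurrences of the letter of index m + 1 stand at the right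
  end; n bounds the total length from below.\<close>

inductive_set words_last :: "nat \<Rightarrow> nat \<Rightarrow> 'a set" for m n where
  zero: "0 \<in> words_last m n"
| add: "x \<in> words_last m n \<Longrightarrow> y \<in> words_last m n \<Longrightarrow> x + y \<in> words_last m n"
| prod: "w \<in> words sc f m k \<Longrightarrow> n \<le> k + j \<Longrightarrow> w * f (Suc m) ^ j \<in> words_last m n"

lemma words_last_weaken: "x \<in> words_last m n \<Longrightarrow> k \<le> n \<Longrightarrow> x \<in> words_last m k"
  by (induction rule: words_last.induct) (auto intro: words_last.intros)

lemma words_last_letter:
  assumes "x \<in> words_last m n" "0 < i" "i \<le> Suc m"
  shows "f i * x \<in> words_last m (Suc n)"
  using assms(1)
proof (induction rule: words_last.induct)
  case (prod w k j)
  show ?case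
  proof (cases "i = Suc m")
    case True
    have "f i * (w * f (Suc m) ^ j) = (f (Suc m) * w - w * f (Suc m)) * f (Suc m) ^ j + w * f (Suc m) ^ Suc j"
      by (simp add: True algebra_simps)
    moreover have "(f (Suc m) * w - w * f (Suc m)) * f (Suc m) ^ j \<in> words_last m (Suc n)"
      using words_commute_last[OF prod(1)] prod by (intro words_last.prod) auto
    moreover have "w * f (Suc m) ^ Suc j \<in> words_last m (Suc n)"
      using prod by (intro words_last.prod[of _ _ k]) auto
    ultimately show ?thesis by (auto intro: words_last.add)
  next
    case False
    then have "f i * w \<in> words sc f m (Suc k)" using prod assms by (auto intro: words_letterI)
    then have "f i * w * f (Suc m) ^ j \<in> words_last m (Suc n)" using prod by (intro words_last.prod[of _ _ "Suc k"]) auto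
    then show ?thesis by (simp add: mult.assoc)
  qed
qed (auto intro: words_last.intros simp: distrib_left)

lemma words_subset_words_last: "x \<in> words sc f (Suc m) n \<Longrightarrow> x \<in> words_last m n"
proof (induction rule: words_induct)
  case (scal c)
  show ?case using words_last.prod[OF words_scalI, of 0 0 c m] by simp
qed (auto intro: words_last.intros words_last_letter words_last_weaken)

text \<open>By induction on the number of letters. Once the last letter is collected at the right, a
  word of length at least N + p contains at least N of the other letters or the p-th power of the
  last one, and either puts it in I.\<close>

lemma words_nilpotent: "\<exists>N. words sc f m N \<subseteq> I"
proof (induction m)
  case 0
  have "x = 0 \<or> n = 0" if "x \<in> words sc f 0 n" for x n
    using that by (induction rule: words_induct) auto
  then have "words sc f 0 1 \<subseteq> I" using I_0 by fastforce
  then show ?case by blast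
next
  case (Suc m)
  then obtain N where N: "words sc f m N \<subseteq> I" by blast
  have "x \<in> I" if "x \<in> words_last m (N + p)" for x
    using that
  proof (induction rule: words_last.induct)
    case (prod w k j)
    show ?case
    proof (cases "j < p")
      case True
      then have "w \<in> I" using prod N words_antimono[of w sc f m k N] by auto
      then show ?thesis using I_mult[of w 1] by simp
    next
      case False
      then have "f (Suc m) ^ j = f (Suc m) ^ p * f (Suc m) ^ (j - p)" by (simp flip: power_add)
      then show ?thesis using I_mult[OF f_power, of "Suc m" w] by (simp add: mult.assoc)
    qed
  qed (auto intro: I_0 I_add)
  then show ?case using words_subset_words_last by blast
qed

text \<open>Up to the scalar c the element is 1 - x with x nilpotent modulo I, and multiplying by a
  finite geometric series gives 1 modulo I.\<close>

lemma one_plus_word_in_left_ideal: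
  assumes J: "left_ideal J" and IJ: "I \<subseteq> J" and w: "w \<in> words sc f m 1" and "sc c + w \<in> J" "c \<noteq> 0"
  shows "1 \<in> J"
proof -
  define x where "x = - (sc (inverse c) * w)"
  have "sc (inverse c) * (sc c + w) = 1 - x"
    using assms(5) by (simp add: x_def distrib_left flip: sc_mult) (simp add: sc_1)
  then have x: "1 - x \<in> J" using left_ideal_mult[OF J assms(4)] by metis
  have "x \<in> words sc f m 1" unfolding x_def by (intro words_uminus words_scal w)
  moreover obtain N where "words sc f m N \<subseteq> I" using words_nilpotent by blast
  ultimately have "x ^ N \<in> J" using words_power IJ by blast
  moreover have "1 - x ^ N \<in> J"
    using left_ideal_mult[OF J x, of "\<Sum>i<N. x ^ i"] by (simp add: geometric_left)
  ultimately show ?thesis using left_ideal_add[OF J, of "1 - x ^ N" "x ^ N"] by simp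
qed

end

end

locale rtt_algebra = rtt t + scalars sc
  for t :: "2 \<Rightarrow> 2 \<Rightarrow> nat \<Rightarrow> 'a::ring_1" and sc :: "'k::field \<Rightarrow> 'a" +
  assumes generated: "\<And>Q z. 1 \<in> Q \<Longrightarrow> (\<And>x y. x \<in> Q \<Longrightarrow> y \<in> Q \<Longrightarrow> x + y \<in> Q) \<Longrightarrow>
    (\<And>c x. x \<in> Q \<Longrightarrow> sc c * x \<in> Q) \<Longrightarrow> (\<And>i j r x. x \<in> Q \<Longrightarrow> t i j r * x \<in> Q) \<Longrightarrow> z \<in> Q"
begin

definition highest_weight_ideal :: "'a set \<Rightarrow> (nat \<Rightarrow> 'k) \<Rightarrow> (nat \<Rightarrow> 'k) \<Rightarrow> bool" where
  "highest_weight_ideal J l1 l2 \<longleftrightarrow> left_ideal J \<and> (\<forall>r>0. fps_nth e r \<in> J) \<and>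
     (\<forall>r. fps_nth d1 r - sc (l1 r) \<in> J) \<and> (\<forall>r. fps_nth d2 r - sc (l2 r) \<in> J)"

text \<open>The set Q of elements congruent modulo J to combinations of words in f is stable under
  left multiplication by f, the d_i, the inverse of d_1, h and e, taken in this order: each moves
  past a letter f at the cost of operators already treated, and at the end of the word it meets J or
  acts by a scalar modulo J. The Gauss decomposition then gives stability under all t_ij.\<close>

lemma triangular_decomposition:
  assumes "highest_weight_ideal J l1 l2"
  shows "\<exists>m. \<exists>w\<in>words sc (fps_nth f) m 0. z - w \<in> J"
proof -
  note J = assms[unfolded highest_weight_ideal_def]
  have LJ: "left_ideal J" using J by simp
  define Q where "Q = {z. \<exists>m. \<exists>w\<in>words sc (fps_nth f) m 0. z - w \<in> J}"
  have QI: "z \<in> Q" if "w \<in> words sc (fps_nth f) m 0" "z - w \<in> J" for z w m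
    using that by (auto simp: Q_def)
  have JQ: "z \<in> Q" if "z \<in> J" for z
    using that by (intro QI[OF words_zeroI]) simp
  have Qadd: "x + y \<in> Q" if "x \<in> Q" "y \<in> Q" for x y
  proof -
    from that obtain m w m' w' where w: "w \<in> words sc (fps_nth f) m 0" "x - w \<in> J"
      "w' \<in> words sc (fps_nth f) m' 0" "y - w' \<in> J" by (auto simp: Q_def)
    have "(x - w) + (y - w') \<in> J" using w LJ by (auto intro: left_ideal_add)
    then show ?thesis using w by (intro QI[of "w + w'" "max m m'"])
      (auto intro!: words_addI intro: words_mono simp: algebra_simps)
  qed
  have Qsc: "sc c * x \<in> Q" if "x \<in> Q" for x c
  proof -
    from that obtain m w where w: "w \<in> words sc (fps_nth f) m 0" "x - w \<in> J" by (auto simp: Q_def)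
    then show ?thesis using left_ideal_mult[OF LJ w(2), of "sc c"]
      by (intro QI[OF words_scal[OF w(1)]]) (simp add: right_diff_distrib)
  qed
  have Qneg: "- x \<in> Q" if "x \<in> Q" for x
    using Qsc[OF that, of "- 1"] by (simp add: sc_uminus sc_1)
  have Qdiff: "x - y \<in> Q" if "x \<in> Q" "y \<in> Q" for x y
    using Qadd[OF that(1) Qneg[OF that(2)]] by simp
  have Q0: "0 \<in> Q" using JQ left_ideal_0[OF LJ] by blast
  have Qsum: "(\<Sum>i\<in>A. g i) \<in> Q" if "\<And>i. i \<in> A \<Longrightarrow> g i \<in> Q" for A :: "nat set" and g
    using that by (induction A rule: infinite_finite_induct) (auto intro: Qadd Q0)
  have Qf: "fps_nth f s * x \<in> Q" if "x \<in> Q" for s x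
  proof (cases "s = 0")
    case False
    from that obtain m w where w: "w \<in> words sc (fps_nth f) m 0" "x - w \<in> J" by (auto simp: Q_def)
    have "fps_nth f s * w \<in> words sc (fps_nth f) (max m s) (Suc 0)"
      using False words_mono[OF w(1), of "max m s"] by (intro words_letterI) auto
    from QI[OF words_weakenI[OF this]] show ?thesis
      using left_ideal_mult[OF LJ w(2), of "fps_nth f s"] by (simp add: right_diff_distrib)
  qed (simp add: e_f_0 Q0)
  have on_words: "a * z \<in> Q" if "\<And>m n w. w \<in> words sc (fps_nth f) m n \<Longrightarrow> a * w \<in> Q" "z \<in> Q" for a z
  proof -
    from that(2) obtain m w where w: "w \<in> words sc (fps_nth f) m 0" "z - w \<in> J" by (auto simp: Q_def)
    have "a * w + a * (z - w) \<in> Q"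
      using that(1)[OF w(1)] left_ideal_mult[OF LJ w(2)] by (auto intro: Qadd JQ)
    then show ?thesis by (simp add: algebra_simps)
  qed
  have scQ: "sc c \<in> Q" for c
    by (rule QI[OF words_scalI[of sc c]]) (simp add: left_ideal_0[OF LJ])
  \<comment> \<open>Allowing c to be d or -d treats d_1 and d_2 together. The induction over words
    runs over all r at once because the bracket brings in other coefficients of d.\<close>
  have Qd: "fps_nth d r * x \<in> Q"
    if c: "c = d \<or> c = - d" and wt: "\<And>r. fps_nth d r - sc (l r) \<in> J"
      and br: "\<And>s. 0 < s \<Longrightarrow> d * fps_const (fps_nth f s) - fps_const (fps_nth f s) * d = tail_series f s * c"
      and "x \<in> Q" for d c l r x
  proof (rule on_words[OF _ \<open>x \<in> Q\<close>])
    show "fps_nth d r * w \<in> Q" if "w \<in> words sc (fps_nth f) m n" for m n w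
      using that
    proof (induction arbitrary: r rule: words_induct)
      case (scal b)
      have "fps_nth d r * sc b = sc b * (fps_nth d r - sc (l r)) + sc (b * l r)"
        unfolding sc_comm[of b "fps_nth d r", symmetric] sc_mult by (simp add: right_diff_distrib)
      then show ?case using left_ideal_mult[OF LJ wt] by (metis JQ Qadd scQ)
    next
      case (letter n w s)
      have "fps_nth c q * w \<in> Q" for q
        using letter.IH[of q] c Qneg[OF letter.IH[of q]] by auto
      then have "fps_nth (tail_series f s * c) r * w \<in> Q"
        unfolding fps_mult_nth sum_distrib_right
        by (intro Qsum) (auto simp: mult.assoc tail_series_def intro: Qf Q0)
      moreover have "fps_nth (d * fps_const (fps_nth f s) - fps_const (fps_nth f s) * d) r * w = fps_nth (tail_series f s * c) r * w"
        by (simp only: br[OF letter(2)])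
      then have "fps_nth d r * (fps_nth f s * w) = fps_nth (tail_series f s * c) r * w + fps_nth f s * (fps_nth d r * w)"
        by (simp add: algebra_simps)
      ultimately show ?case using Qadd Qf letter.IH by simp
    qed (auto simp: distrib_left intro: Qadd Q0)
  qed
  have Qd1: "fps_nth d1 r * x \<in> Q" if "x \<in> Q" for r x
    by (rule Qd[of "- d1" d1 l1]) (use J d1_tail that in auto)
  have Qd2: "fps_nth d2 r * x \<in> Q" if "x \<in> Q" for r x
    by (rule Qd[of d2 d2 l2]) (use J d2_tail that in auto)
  have Qd1i: "fps_nth d1i r * x \<in> Q" if "x \<in> Q" for r x
    using that
  proof (induction r arbitrary: x rule: less_induct)
    case (less r)
    show ?case
    proof (cases r)
      case 0
      then show ?thesis using less by (simp add: d1i_def)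
    next
      case (Suc r')
      have "fps_nth (d1 * d1i) r = 0" by (simp add: d1i Suc)
      then have "fps_nth d1i r = - (\<Sum>i=Suc 0..r. fps_nth d1 i * fps_nth d1i (r - i))"
        unfolding fps_mult_nth by (subst (asm) sum.atLeast_Suc_atMost) (auto simp: d_0 eq_neg_iff_add_eq_0)
      then have "fps_nth d1i r * x = - (\<Sum>i=Suc 0..r. fps_nth d1 i * (fps_nth d1i (r - i) * x))"
        by (simp add: sum_distrib_right mult.assoc)
      also have "\<dots> \<in> Q"
        using less by (intro Qneg Qsum Qd1 less.IH) auto
      finally show ?thesis .
    qed
  qed
  have Qh: "fps_nth h r * x \<in> Q" if "x \<in> Q" for r x
    unfolding h_def fps_mult_nth sum_distrib_right mult.assoc
    using that by (intro Qsum Qd1i Qd2)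
  have Qe: "fps_nth e r * x \<in> Q" if "x \<in> Q" for r x
  proof (cases "r = 0")
    case False
    show ?thesis
    proof (rule on_words[OF _ that])
      show "fps_nth e r * w \<in> Q" if "w \<in> words sc (fps_nth f) m n" for m n w
        using that
      proof (induction rule: words_induct)
        case (scal c)
        have "sc c * fps_nth e r \<in> J" using J False left_ideal_mult[OF LJ] by auto
        then show ?case using JQ by (simp add: sc_comm[of c "fps_nth e r"])
      next
        case (letter n w s)
        have "fps_nth e r * (fps_nth f s * w) = fps_nth f s * (fps_nth e r * w) - fps_nth h (r + s - 1) * w"
          using arg_cong[OF e_f_nth[of r s], of "\<lambda>y. y * w"] letter False by (simp add: algebra_simps)
        moreover have "w \<in> Q" using words_antimono[OF letter(1)] by (intro QI) (auto simp: left_ideal_0[OF LJ])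
        ultimately show ?case using letter by (auto intro: Qdiff Qf Qh)
      qed (auto simp: distrib_left intro: Qadd Q0)
    qed
  qed (simp add: e_f_0 Q0)
  have prodQ: "fps_nth (a * b) r * x \<in> Q"
    if "\<And>r x. x \<in> Q \<Longrightarrow> fps_nth a r * x \<in> Q" "\<And>r x. x \<in> Q \<Longrightarrow> fps_nth b r * x \<in> Q" "x \<in> Q" for a b r x
    unfolding fps_mult_nth sum_distrib_right mult.assoc
    using that by (intro Qsum) auto
  have Qt: "t i j r * x \<in> Q" if "x \<in> Q" for i j r x
  proof -
    have "fps_nth (T i j) r * x \<in> Q"
      using exhaust_2[of i] exhaust_2[of j] that
      by (auto simp: T_11 T_12 T_21 T_22 distrib_right intro!: Qadd prodQ intro: Qd1 Qd2 Qe Qf)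
    then show ?thesis by (simp add: T_def)
  qed
  have "z \<in> Q"
    by (rule generated) (use scQ[of 1] in \<open>auto intro: Qadd Qsc Qt simp: sc_1\<close>)
  then show ?thesis by (simp add: Q_def)
qed

text \<open>Modulo the ideal, an element is a scalar plus a nilpotent, so that the highest weight
  module of the Yangian is local over the subalgebra generated by the \<open>f\<^sup>(\<^sup>r\<^sup>)\<close>.\<close>

lemma highest_weight_ideals_sum_proper:
  assumes "highest_weight_ideal J1 l1 l2" "highest_weight_ideal J2 l1 l2"
    and I: "0 \<in> I" "\<And>x y. x \<in> I \<Longrightarrow> y \<in> I \<Longrightarrow> x + y \<in> I" "\<And>a x b. x \<in> I \<Longrightarrow> a * x * b \<in> I"
      "\<And>r. 0 < r \<Longrightarrow> fps_nth f r ^ p \<in> I"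
    and IJ: "I \<subseteq> J1" "I \<subseteq> J2" and one: "1 \<notin> J1" "1 \<notin> J2" and xy: "x \<in> J1" "y \<in> J2"
  shows "x + y \<noteq> 1"
proof
  assume eq: "x + y = 1"
  define J where "J = J1 \<inter> J2"
  have J: "highest_weight_ideal J l1 l2"
    using assms(1,2) by (auto simp: J_def highest_weight_ideal_def left_ideal_def)
  have L: "left_ideal J1" "left_ideal J2" "left_ideal J"
    using assms(1,2) J by (auto simp: highest_weight_ideal_def)
  have IJ': "I \<subseteq> J" using IJ by (auto simp: J_def)
  \<comment> \<open>In a proper ideal the scalar part of the representative vanishes, for otherwise
    scalar plus nilpotent would put 1 into the ideal.\<close>
  have key: "\<exists>m. \<exists>w\<in>words sc (fps_nth f) m 1. x - w \<in> J"
    if "x \<in> J'" "left_ideal J'" "I \<subseteq> J'" "J \<subseteq> J'" "1 \<notin> J'" for x J'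
  proof -
    obtain m w where w: "w \<in> words sc (fps_nth f) m 0" "x - w \<in> J"
      using triangular_decomposition[OF J] by blast
    obtain c v where v: "v \<in> words sc (fps_nth f) m 1" "w = sc c + v"
      using words_0_decomp[OF w(1)] by blast
    have "x - (x - w) \<in> J'" by (rule left_ideal_diff[OF that(2,1)]) (use that w in auto)
    then have "w \<in> J'" by simp
    then have "sc c + v \<in> J'" unfolding v(2) .
    then have "c = 0"
      using one_plus_word_in_left_ideal[OF f_f_nth I that(2,3) v(1)] that(5) by blast
    then show ?thesis using w v by (auto simp: sc_0)
  qed
  obtain m w where w: "w \<in> words sc (fps_nth f) m 1" "x - w \<in> J"
    using key[OF xy(1) L(1) IJ(1)] one by (auto simp: J_def)
  obtain m' w' where w': "w' \<in> words sc (fps_nth f) m' 1" "y - w' \<in> J"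
    using key[OF xy(2) L(2) IJ(2)] one by (auto simp: J_def)
  have "w + w' \<in> words sc (fps_nth f) (max m m') 1"
    using w w' by (auto intro!: words_addI intro: words_mono)
  then have v: "- (w + w') \<in> words sc (fps_nth f) (max m m') 1" by (rule words_uminus)
  have "(x - w) + (y - w') \<in> J" using w w' L by (auto intro: left_ideal_add)
  then have "sc 1 + - (w + w') \<in> J" using eq by (simp add: sc_1 algebra_simps)
  then have "1 \<in> J"
    using one_plus_word_in_left_ideal[OF f_f_nth I L(3) IJ' v] by auto
  then show False using one by (simp add: J_def)
qed

end

section \<open>Chains of sites\<close>

type_synonym 'k state = "(nat \<Rightarrow> nat) \<Rightarrow> 'k"

lemma sum_state_apply: "(\<Sum>i\<in>A. g i) \<kappa> = (\<Sum>i\<in>A. (g i :: 'k::field state) \<kappa>)"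
  by (induction A rule: infinite_finite_induct) auto

definition scale_state :: "'k::field \<Rightarrow> 'k state \<Rightarrow> 'k state" where
  "scale_state x \<psi> = (\<lambda>\<kappa>. x * \<psi> \<kappa>)"

lemma scale_state_apply [simp]: "scale_state x \<psi> \<kappa> = x * \<psi> \<kappa>"
  by (simp add: scale_state_def)

definition box :: "(nat \<Rightarrow> nat) \<Rightarrow> nat list \<Rightarrow> (nat \<Rightarrow> nat) set" where
  "box m ss = {\<kappa>. (\<forall>s\<in>set ss. \<kappa> s \<le> m s) \<and> (\<forall>s. s \<notin> set ss \<longrightarrow> \<kappa> s = 0)}"

definition box_states :: "(nat \<Rightarrow> nat) \<Rightarrow> nat list \<Rightarrow> 'k::field state set" where
  "box_states m ss = {\<psi>. \<forall>\<kappa>. \<kappa> \<notin> box m ss \<longrightarrow> \<psi> \<kappa> = 0}"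

lemma zero_in_box: "(\<lambda>_. 0) \<in> box m ss"
  by (simp add: box_def)

lemma finite_box: "finite (box m ss)"
proof -
  define M where "M = Max (insert 0 (m ` set ss))"
  have "finite {\<kappa>. \<forall>s. (s \<in> set ss \<longrightarrow> \<kappa> s \<in> {..M}) \<and> (s \<notin> set ss \<longrightarrow> \<kappa> s = 0)}"
    by (rule finite_set_of_finite_funs) auto
  then show ?thesis
    by (rule rev_finite_subset)
       (auto simp: box_def M_def intro!: order.trans[OF _ Max_ge[of _ "m _"]])
qed

text \<open>Each site carries operators shaped like those of a highest weight module of \<open>gl\<^sub>2\<close>, with unspecified
  matrix coefficients \<open>c\<close> and \<open>c'\<close> of \<open>e\<^sub>1\<^sub>2\<close> and \<open>e\<^sub>2\<^sub>1\<close>. Both the tensor product of evaluation modules and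
  its dual are of this form.\<close>

locale chain =
  fixes a b :: "nat \<Rightarrow> 'k::field" and c c' :: "nat \<Rightarrow> nat \<Rightarrow> 'k"
begin

text \<open>States are coordinate functions: the value of \<psi> at the exponent raised by one means
  that e_12 lowers the exponent of a basis vector, and e_21 raises it. The exponent \<kappa> s
  measures how far the weight at site s lies below the highest one.\<close>

definition site_op :: "nat \<Rightarrow> 2 \<Rightarrow> 2 \<Rightarrow> 'k state \<Rightarrow> 'k state" where
  "site_op s i j \<psi> = (\<lambda>\<kappa>.
     if i = 1 then
       if j = 1 then (a s - of_nat (\<kappa> s)) * \<psi> \<kappa> else c s (\<kappa> s) * \<psi> (\<kappa>(s := Suc (\<kappa> s)))
     else
       if j = 1 then if \<kappa> s = 0 then 0 else c' s (\<kappa> s) * \<psi> (\<kappa>(s := \<kappa> s - 1))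
       else (b s + of_nat (\<kappa> s)) * \<psi> \<kappa>)"

text \<open>The coefficient of u^(-r) in the entry (i, j) of the ordered product over the sites of
  the matrices 1 + E_s/u, where E_s has the entries \<open>site_op s\<close>. This is the iterated
  comultiplication applied to evaluation representations.\<close>

primrec chain_op :: "nat list \<Rightarrow> 2 \<Rightarrow> 2 \<Rightarrow> nat \<Rightarrow> 'k state \<Rightarrow> 'k state" where
  "chain_op [] i j r \<psi> = (if r = 0 \<and> i = j then \<psi> else 0)"
| "chain_op (s # ss) i j r \<psi> = chain_op ss i j r \<psi> +
     (if r = 0 then 0 else \<Sum>k\<in>UNIV. site_op s i k (chain_op ss k j (r - 1) \<psi>))"

lemma site_op_add: "site_op s i j (\<psi> + \<phi>) = site_op s i j \<psi> + site_op s i j \<phi>"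
  by (auto simp: site_op_def fun_eq_iff algebra_simps)

lemma site_op_scale: "site_op s i j (scale_state x \<psi>) = scale_state x (site_op s i j \<psi>)"
  by (auto simp: site_op_def fun_eq_iff)

lemma site_op_0: "site_op s i j 0 = 0"
  by (auto simp: site_op_def fun_eq_iff)

lemma chain_op_add: "chain_op ss i j r (\<psi> + \<phi>) = chain_op ss i j r \<psi> + chain_op ss i j r \<phi>"
  by (induction ss arbitrary: i j r) (auto simp: site_op_add sum.distrib algebra_simps)

lemma chain_op_scale: "chain_op ss i j r (scale_state x \<psi>) = scale_state x (chain_op ss i j r \<psi>)"
proof (induction ss arbitrary: i j r)
  case Nil
  show ?case by (auto simp: fun_eq_iff)
next
  case (Cons s ss)
  have "scale_state x (u + v) = scale_state x u + scale_state x v" "scale_state x 0 = 0" for u v :: "'k state"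
    by (auto simp: fun_eq_iff algebra_simps)
  then show ?case
    by (simp add: Cons site_op_scale sum_2 del: plus_fun_apply scale_state_apply)
qed

lemma chain_op_0: "chain_op ss i j r 0 = 0"
  by (induction ss arbitrary: i j r) (auto simp: site_op_0 sum_2)

lemma site_op_commute: "s \<noteq> s' \<Longrightarrow> site_op s i j (site_op s' k l \<psi>) = site_op s' k l (site_op s i j \<psi>)"
  by (auto simp: site_op_def fun_eq_iff fun_upd_twist)

lemma site_op_chain_op_commute:
  "s \<notin> set ss \<Longrightarrow> site_op s i j (chain_op ss k l r \<psi>) = chain_op ss k l r (site_op s i j \<psi>)"
proof (induction ss arbitrary: k l r)
  case (Cons s' ss)
  then have "s \<noteq> s'" by auto
  then show ?case using Cons
    by (simp add: site_op_add site_op_0 sum_2 chain_op_add site_op_commute[of s s'] del: plus_fun_apply)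
qed (simp add: site_op_0)

lemma chain_op_eq_0: "length ss < r \<Longrightarrow> chain_op ss i j r \<psi> = 0"
  by (induction ss arbitrary: i j r) (auto simp: site_op_0 sum_2)

text \<open>Operators at the sites in \<open>ss\<close> look only at exponents that agree with
  \<kappa> at all other sites. A state may therefore be replaced by one of its slices, as in
  \<open>singular_support\<close>.\<close>

lemma chain_op_local:
  assumes "\<And>\<kappa>'. (\<And>s. s \<notin> set ss \<Longrightarrow> \<kappa>' s = \<kappa> s) \<Longrightarrow> \<psi> \<kappa>' = \<phi> \<kappa>'"
  shows "chain_op ss i j r \<psi> \<kappa> = chain_op ss i j r \<phi> \<kappa>"
  using assms
proof (induction ss arbitrary: i j r \<kappa>)
  case (Cons s ss)
  have IH: "chain_op ss i j r \<psi> (\<kappa>(s := n)) = chain_op ss i j r \<phi> (\<kappa>(s := n))" for i j r n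
    by (rule Cons.IH) (auto intro!: Cons.prems)
  from this[of _ _ _ "\<kappa> s"] have "chain_op ss i j r \<psi> \<kappa> = chain_op ss i j r \<phi> \<kappa>" for i j r by simp
  with IH show ?case by (simp add: site_op_def sum_2)
qed auto

text \<open>The weight grading: t_ij shifts the total exponent by w i - w j, and D is a strict upper
  bound for the total exponents in the support of \<psi>.\<close>

lemma chain_op_degree:
  assumes "finite S" "set ss \<subseteq> S" and w: "w 1 = 0" "w 2 = (1 :: int)"
    and "\<And>\<kappa>. D \<le> int (sum \<kappa> S) \<Longrightarrow> \<psi> \<kappa> = 0" and "D + w i - w j \<le> int (sum \<kappa> S)"
  shows "chain_op ss i j r \<psi> \<kappa> = 0"
  using assms(2,6)
proof (induction ss arbitrary: i j r \<kappa>)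
  case Nil
  then show ?case using assms(5)[of \<kappa>] by auto
next
  case (Cons s ss)
  have s: "s \<in> S" and ss: "set ss \<subseteq> S" using Cons.prems by auto
  have deg: "int (sum (\<kappa>(s := n)) S) = int (sum \<kappa> S) - int (\<kappa> s) + int n" for n
    using sum.remove[OF assms(1) s, of \<kappa>] sum.remove[OF assms(1) s, of "\<kappa>(s := n)"]
    by (simp add: sum.cong[of "S - {s}" _ "\<kappa>(s := n)" \<kappa>])
  have "site_op s i k (chain_op ss k j q \<psi>) \<kappa> = 0" for k q
    using exhaust_2[of i] exhaust_2[of k] Cons.prems(2) w
    by (auto simp: site_op_def deg simp del: of_nat_sum fun_upd_apply intro!: Cons.IH[OF ss])
  then show ?case using Cons by (simp add: sum_2)
qed

text \<open>The series t_ij(u) \<psi> at \<kappa>, multiplied by the power of u that clears all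
  denominators. As a polynomial in u it can be evaluated at the root of a linear factor.\<close>

definition chain_poly :: "nat list \<Rightarrow> 2 \<Rightarrow> 2 \<Rightarrow> 'k state \<Rightarrow> (nat \<Rightarrow> nat) \<Rightarrow> 'k poly" where
  "chain_poly ss i j \<psi> \<kappa> = (\<Sum>r\<le>length ss. monom (chain_op ss i j r \<psi> \<kappa>) (length ss - r))"

lemma coeff_chain_poly:
  "coeff (chain_poly ss i j \<psi> \<kappa>) n = (if n \<le> length ss then chain_op ss i j (length ss - n) \<psi> \<kappa> else 0)"
proof -
  have "coeff (chain_poly ss i j \<psi> \<kappa>) n = (\<Sum>r\<le>length ss. if length ss - r = n then chain_op ss i j r \<psi> \<kappa> else 0)"
    by (simp add: chain_poly_def coeff_sum)
  also have "\<dots> = (\<Sum>r\<in>(if n \<le> length ss then {length ss - n} else {}). chain_op ss i j r \<psi> \<kappa>)"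
    by (rule sum.mono_neutral_cong_right) (auto split: if_splits)
  finally show ?thesis by simp
qed

lemma chain_poly_eq_0_iff: "chain_poly ss i j \<psi> \<kappa> = 0 \<longleftrightarrow> (\<forall>r. chain_op ss i j r \<psi> \<kappa> = 0)"
proof
  assume 0: "chain_poly ss i j \<psi> \<kappa> = 0"
  show "\<forall>r. chain_op ss i j r \<psi> \<kappa> = 0"
  proof
    fix r
    show "chain_op ss i j r \<psi> \<kappa> = 0"
      using arg_cong[OF 0, of "\<lambda>q. coeff q (length ss - r)"] chain_op_eq_0[of ss r i j \<psi>]
      by (cases "r \<le> length ss") (auto simp: coeff_chain_poly)
  qed
qed (simp add: chain_poly_def)

lemma chain_poly_12:
  "chain_poly (s # ss) 1 2 \<psi> \<kappa> = [:a s - of_nat (\<kappa> s), 1:] * chain_poly ss 1 2 \<psi> \<kappa>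
     + Polynomial.smult (c s (\<kappa> s)) (chain_poly ss 2 2 \<psi> (\<kappa>(s := Suc (\<kappa> s))))"
proof (rule poly_eqI)
  fix n
  show "coeff (chain_poly (s # ss) 1 2 \<psi> \<kappa>) n = coeff ([:a s - of_nat (\<kappa> s), 1:] * chain_poly ss 1 2 \<psi> \<kappa>
     + Polynomial.smult (c s (\<kappa> s)) (chain_poly ss 2 2 \<psi> (\<kappa>(s := Suc (\<kappa> s))))) n"
    by (cases n) (auto simp: coeff_chain_poly sum_2 site_op_def chain_op_eq_0 Suc_diff_le coeff_pCons)
qed

text \<open>At exponent 0 the term containing e_21 is absent, so t_22 factors site by site.\<close>

lemma chain_poly_22:
  assumes "\<kappa> s = 0"
  shows "chain_poly (s # ss) 2 2 \<psi> \<kappa> = [:b s, 1:] * chain_poly ss 2 2 \<psi> \<kappa>"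
proof (rule poly_eqI)
  fix n
  show "coeff (chain_poly (s # ss) 2 2 \<psi> \<kappa>) n = coeff ([:b s, 1:] * chain_poly ss 2 2 \<psi> \<kappa>) n"
    using assms
    by (cases n) (auto simp: coeff_chain_poly sum_2 site_op_def chain_op_eq_0 Suc_diff_le coeff_pCons)
qed

lemma chain_poly_22_prod:
  "\<forall>s\<in>set ss. \<kappa> s = 0 \<Longrightarrow> chain_poly ss 2 2 \<psi> \<kappa> = Polynomial.smult (\<psi> \<kappa>) (\<Prod>s\<leftarrow>ss. [:b s, 1:])"
  by (induction ss) (auto simp: chain_poly_22, simp add: chain_poly_def monom_0)

text \<open>Stripping off the first site \<open>s\<close>, let \<open>q\<close> be the largest value of \<open>\<kappa> s\<close> in the support of a singular vector.
  If \<open>q > 0\<close>, the component of \<open>t\<^sub>1\<^sub>2 \<psi> = 0\<close> at \<open>q - 1\<close>, evaluated at the root of \<open>u + a s - (q - 1)\<close>, gives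
  \<open>\<Prod> (b j - a s + (q - 1)) = 0\<close>, which the assumption on the weights excludes.\<close>

lemma singular_support:
  assumes "distinct ss" and "\<And>\<kappa>. \<psi> \<kappa> \<noteq> 0 \<Longrightarrow> \<forall>s\<in>set ss. \<kappa> s \<le> m s"
    and "\<And>s k. s \<in> set ss \<Longrightarrow> k < m s \<Longrightarrow> c s k \<noteq> 0"
    and "sorted_wrt (\<lambda>s j. \<forall>k<m s. b j \<noteq> a s - of_nat k) ss"
    and "\<And>\<kappa> r. \<forall>s\<in>set ss. \<kappa> s \<le> m s \<Longrightarrow> chain_op ss 1 2 r \<psi> \<kappa> = 0"
    and "\<psi> \<kappa> \<noteq> 0" "i \<in> set ss"
  shows "\<kappa> i = 0"
  using assms
proof (induction ss arbitrary: \<psi> \<kappa> i)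
  case (Cons s ss)
  define q where "q = Max {\<kappa> s | \<kappa>. \<psi> \<kappa> \<noteq> 0}"
  have "{\<kappa> s | \<kappa>. \<psi> \<kappa> \<noteq> 0} \<subseteq> {..m s}" using Cons.prems(2) by auto
  then have fin: "finite {\<kappa> s | \<kappa>. \<psi> \<kappa> \<noteq> 0}" by (rule finite_subset) simp
  have q_max: "\<kappa> s \<le> q" if "\<psi> \<kappa> \<noteq> 0" for \<kappa>
    unfolding q_def using fin that by (intro Max_ge) auto
  have "q \<in> {\<kappa> s | \<kappa>. \<psi> \<kappa> \<noteq> 0}"
    unfolding q_def using fin Cons.prems(6) by (intro Max_in) auto
  then obtain \<kappa>0 where \<kappa>0: "\<psi> \<kappa>0 \<noteq> 0" "\<kappa>0 s = q" by auto
  define \<psi>q where "\<psi>q = (\<lambda>\<kappa>. if \<kappa> s = q then \<psi> \<kappa> else 0)"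
  have s_ss: "s \<notin> set ss" using Cons.prems(1) by simp
  have poly0: "chain_poly (s # ss) 1 2 \<psi> \<kappa> = 0" if "\<forall>s\<in>set (s # ss). \<kappa> s \<le> m s" for \<kappa>
    unfolding chain_poly_eq_0_iff using Cons.prems(5) that by blast
  \<comment> \<open>The slice at the top value q is singular for the remaining sites: at \<kappa> s
    = q the e_12 term refers to the exponent q + 1, where \<psi> vanishes, and the factor u + a s -
    q can be cancelled.\<close>
  have sing: "chain_op ss 1 2 r \<psi>q \<kappa> = 0" if "\<forall>s\<in>set ss. \<kappa> s \<le> m s" for \<kappa> r
  proof (cases "\<kappa> s = q")
    case True
    have "chain_op ss 2 2 r \<psi> (\<kappa>(s := Suc q)) = chain_op ss 2 2 r 0 (\<kappa>(s := Suc q))" for r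
      using q_max s_ss by (intro chain_op_local) fastforce
    then have "chain_poly ss 2 2 \<psi> (\<kappa>(s := Suc q)) = 0"
      by (simp add: chain_poly_def chain_op_0)
    moreover have "chain_poly (s # ss) 1 2 \<psi> \<kappa> = 0"
      using that True \<kappa>0 Cons.prems(2)[of \<kappa>0] by (intro poly0) auto
    ultimately have "chain_poly ss 1 2 \<psi> \<kappa> = 0"
      unfolding chain_poly_12 True by (auto simp del: mult_pCons_left)
    moreover have "chain_op ss 1 2 r \<psi>q \<kappa> = chain_op ss 1 2 r \<psi> \<kappa>"
      using True s_ss by (intro chain_op_local) (auto simp: \<psi>q_def)
    ultimately show ?thesis by (simp add: chain_poly_eq_0_iff)
  next
    case False
    then have "chain_op ss 1 2 r \<psi>q \<kappa> = chain_op ss 1 2 r 0 \<kappa>"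
      using s_ss by (intro chain_op_local) (auto simp: \<psi>q_def)
    then show ?thesis by (simp add: chain_op_0)
  qed
  have slice: "\<kappa> j = 0" if "\<psi> \<kappa> \<noteq> 0" "\<kappa> s = q" "j \<in> set ss" for \<kappa> j
    by (rule Cons.IH[where \<psi> = \<psi>q])
       (use Cons.prems(1-4) sing that in \<open>auto simp: \<psi>q_def split: if_splits\<close>)
  have "q = 0"
  proof (rule ccontr)
    assume "q \<noteq> 0"
    define k where "k = q - 1"
    have q: "q = Suc k" using \<open>q \<noteq> 0\<close> by (simp add: k_def)
    have zero: "\<forall>j\<in>set ss. \<kappa>0 j = 0" using slice \<kappa>0 by blast
    have k: "k < m s" using Cons.prems(2)[OF \<kappa>0(1)] \<kappa>0(2) by (simp add: q)
    have "chain_poly (s # ss) 1 2 \<psi> (\<kappa>0(s := k)) = 0"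
      using zero k s_ss by (intro poly0) auto
    then have "[:a s - of_nat k, 1:] * chain_poly ss 1 2 \<psi> (\<kappa>0(s := k))
       + Polynomial.smult (c s k) (chain_poly ss 2 2 \<psi> \<kappa>0) = 0"
      using \<kappa>0(2) q by (simp add: chain_poly_12)
         (metis fun_upd_triv)
    then have "poly ([:a s - of_nat k, 1:] * chain_poly ss 1 2 \<psi> (\<kappa>0(s := k))
       + Polynomial.smult (c s k) (chain_poly ss 2 2 \<psi> \<kappa>0)) (of_nat k - a s) = 0" by simp
    then have "c s k * (\<psi> \<kappa>0 * poly (\<Prod>s\<leftarrow>ss. [:b s, 1:]) (of_nat k - a s)) = 0"
      by (simp add: chain_poly_22_prod[OF zero] del: mult_pCons_left)
    moreover have "poly (\<Prod>s\<leftarrow>ss. [:b s, 1:]) z = (\<Prod>j\<leftarrow>ss. b j + z)" for z ss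
      by (induction ss) (simp_all add: algebra_simps)
    ultimately have "(\<Prod>j\<leftarrow>ss. b j + (of_nat k - a s)) = 0"
      using Cons.prems(3)[of s k] k \<kappa>0(1) by simp
    then obtain j where "j \<in> set ss" "b j + (of_nat k - a s) = 0"
      by (auto simp: prod_list_zero_iff)
    then show False using Cons.prems(4) k by (auto simp: algebra_simps)
  qed
  then show ?case using slice[OF Cons.prems(6)] q_max[OF Cons.prems(6)] Cons.prems(7) by auto
qed simp

text \<open>Take a nonzero element of K whose support has the least bound on the total exponent.
  Since t_12 lowers this bound and preserves K, it kills the element, and
  \<open>singular_support\<close> applies. The truncation to the box is there for the dual chain,
  whose e_21 may lead out of the box.\<close>

lemma singular_vector_exists:
  fixes K :: "'k state set"
  assumes "distinct ss" and "K \<subseteq> box_states m ss"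
    and "\<And>s k. s \<in> set ss \<Longrightarrow> k < m s \<Longrightarrow> c s k \<noteq> 0"
    and "sorted_wrt (\<lambda>s j. \<forall>k<m s. b j \<noteq> a s - of_nat k) ss"
    and stable: "\<And>\<psi> r. \<psi> \<in> K \<Longrightarrow> (\<lambda>\<kappa>. if \<kappa> \<in> box m ss then chain_op ss 1 2 r \<psi> \<kappa> else 0) \<in> K"
    and "\<phi> \<in> K" "\<phi> \<noteq> 0"
  obtains \<psi> where "\<psi> \<in> K" "\<psi> (\<lambda>_. 0) \<noteq> 0" "\<And>\<kappa>. \<kappa> \<noteq> (\<lambda>_. 0) \<Longrightarrow> \<psi> \<kappa> = 0"
proof -
  define S where "S = set ss"
  have vanish: "\<psi> \<kappa> = 0" if "\<psi> \<in> K" "\<kappa> \<notin> box m ss" for \<psi> \<kappa>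
    using assms(2) that by (auto simp: box_states_def)
  define bd where "bd \<psi> n \<longleftrightarrow> (\<forall>\<kappa>. n \<le> sum \<kappa> S \<longrightarrow> \<psi> \<kappa> = 0)" for \<psi> :: "'k state" and n
  have bd_ex: "\<exists>n. bd \<psi> n" if "\<psi> \<in> K" for \<psi>
  proof
    show "bd \<psi> (Suc (sum m S))"
      unfolding bd_def
    proof (intro allI impI)
      fix \<kappa> assume "Suc (sum m S) \<le> sum \<kappa> S"
      moreover have "sum \<kappa> S \<le> sum m S" if "\<kappa> \<in> box m ss"
        using that by (intro sum_mono) (auto simp: box_def S_def)
      ultimately show "\<psi> \<kappa> = 0" using vanish[OF that] by fastforce
    qed
  qed
  have "\<exists>n \<psi>. \<psi> \<in> K \<and> \<psi> \<noteq> 0 \<and> bd \<psi> n" using assms(6,7) bd_ex by blast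
  define N where "N = (LEAST n. \<exists>\<psi>. \<psi> \<in> K \<and> \<psi> \<noteq> 0 \<and> bd \<psi> n)"
  from LeastI_ex[OF \<open>\<exists>n \<psi>. \<psi> \<in> K \<and> \<psi> \<noteq> 0 \<and> bd \<psi> n\<close>] obtain \<psi>
    where \<psi>: "\<psi> \<in> K" "\<psi> \<noteq> 0" "bd \<psi> N" unfolding N_def by blast
  have least: "N \<le> n" if "\<phi> \<in> K" "\<phi> \<noteq> 0" "bd \<phi> n" for \<phi> n
    unfolding N_def using that by (intro Least_le) blast
  have "N \<noteq> 0" using \<psi> by (auto simp: bd_def fun_eq_iff)
  have 0: "chain_op ss 1 2 r \<psi> \<kappa> = 0" if le: "\<forall>s\<in>set ss. \<kappa> s \<le> m s" for \<kappa> r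
  proof (cases "\<kappa> \<in> box m ss")
    case True
    define \<phi> where "\<phi> = (\<lambda>\<kappa>. if \<kappa> \<in> box m ss then chain_op ss 1 2 r \<psi> \<kappa> else 0)"
    have "chain_op ss 1 2 r \<psi> \<kappa> = 0" if "N - 1 \<le> sum \<kappa> S" for \<kappa>
      using \<psi>(3) that \<open>N \<noteq> 0\<close>
      by (intro chain_op_degree[of S _ "\<lambda>i. if i = 1 then 0 else 1" "int N"]) (auto simp: S_def bd_def simp del: of_nat_sum)
    then have "bd \<phi> (N - 1)" by (auto simp: bd_def \<phi>_def)
    then have "\<phi> = 0" using least[of \<phi> "N - 1"] stable[OF \<psi>(1), of r] \<open>N \<noteq> 0\<close> by (force simp: \<phi>_def)
    then have "\<phi> \<kappa> = 0" by simp
    then show ?thesis using True by (simp add: \<phi>_def)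
  next
    case False
    then obtain s where s: "s \<notin> set ss" "\<kappa> s \<noteq> 0" using le by (auto simp: box_def)
    have "chain_op ss 1 2 r \<psi> \<kappa> = chain_op ss 1 2 r 0 \<kappa>"
    proof (rule chain_op_local)
      fix \<kappa>' assume "\<And>s. s \<notin> set ss \<Longrightarrow> \<kappa>' s = \<kappa> s"
      then have "\<kappa>' \<notin> box m ss" using s by (auto simp: box_def)
      then show "\<psi> \<kappa>' = 0 \<kappa>'" using vanish[OF \<psi>(1)] by simp
    qed
    then show ?thesis by (simp add: chain_op_0)
  qed
  have supp: "\<kappa> = (\<lambda>_. 0)" if "\<psi> \<kappa> \<noteq> 0" for \<kappa>
  proof
    fix s
    have \<kappa>: "\<kappa> \<in> box m ss" using vanish[OF \<psi>(1)] that by blast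
    show "\<kappa> s = 0"
    proof (cases "s \<in> set ss")
      case True
      show ?thesis
      proof (rule singular_support[where ss = ss and m = m and \<psi> = \<psi> and \<kappa> = \<kappa> and i = s])
        show "\<forall>s\<in>set ss. \<kappa> s \<le> m s" if "\<psi> \<kappa> \<noteq> 0" for \<kappa>
          using vanish[OF \<psi>(1), of \<kappa>] that by (auto simp: box_def)
      qed (fact assms 0 that True)+
    qed (use \<kappa> in \<open>simp add: box_def\<close>)
  qed
  moreover have "\<psi> (\<lambda>_. 0) \<noteq> 0" using \<psi>(2) supp by (metis ext zero_fun_apply)
  ultimately show ?thesis using that \<psi>(1) by blast
qed

end

declare plus_fun_apply [simp del] zero_fun_apply [simp del] minus_apply [simp del]
  uminus_apply [simp del] scale_state_apply [simp del]

lemmas state_apply = plus_fun_apply zero_fun_apply minus_apply uminus_apply scale_state_apply sum_state_apply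

text \<open>The compatibility of the comultiplication with the relations: for two mutually commuting
  solutions X and Y, the matrix product X Y is a solution. The two mixed sums that are left over
  differ by an exchange of the summation indices and cancel.\<close>

lemma rtt_tensor:
  fixes x y :: "2 \<Rightarrow> 2 \<Rightarrow> nat \<Rightarrow> 'a::ring_1"
  assumes "rtt x" "rtt y" and comm: "\<And>i j k l r s. x i j r * y k l s = y k l s * x i j r"
  shows "rtt (\<lambda>i j r. \<Sum>k\<in>UNIV. \<Sum>q\<le>r. x i k q * y k j (r - q))" (is "rtt ?z")
proof -
  define xu xv yu yv zu zv where
    "xu = (\<lambda>i j. in_u (Abs_fps (x i j)))" and "xv = (\<lambda>i j. in_v (Abs_fps (x i j)))" and
    "yu = (\<lambda>i j. in_u (Abs_fps (y i j)))" and "yv = (\<lambda>i j. in_v (Abs_fps (y i j)))" and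
    "zu = (\<lambda>i j. in_u (Abs_fps (?z i j)))" and "zv = (\<lambda>i j. in_v (Abs_fps (?z i j)))"
  have Z: "Abs_fps (?z i j) = Abs_fps (x i 1) * Abs_fps (y 1 j) + Abs_fps (x i 2) * Abs_fps (y 2 j)" for i j
    by (simp add: fps_eq_iff sum_2 fps_mult_nth atLeast0AtMost)
  have z: "zu i j = (\<Sum>a\<in>UNIV. xu i a * yu a j)" "zv i j = (\<Sum>a\<in>UNIV. xv i a * yv a j)" for i j
    unfolding zu_def zv_def Z by (simp_all add: xu_def xv_def yu_def yv_def in_u_simps in_v_simps sum_2)
  have c: "yu i j * xv k l = xv k l * yu i j" "yv i j * xu k l = xu k l * yv i j" for i j k l
    by (simp_all add: xu_def xv_def yu_def yv_def uv_eq_iff uv_nth comm)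
  have bx: "uv_diff * (xu i j * xv k l - xv k l * xu i j) = uv_prod * (xu k j * xv i l - xv k j * xu i l)" for i j k l
    unfolding xu_def xv_def by (rule rtt_bracket_uv[OF assms(1)])
  have b_y: "uv_diff * (yu i j * yv k l - yv k l * yu i j) = uv_prod * (yu k j * yv i l - yv k j * yu i l)" for i j k l
    unfolding yu_def yv_def by (rule rtt_bracket_uv[OF assms(2)])
  have zz: "zu i j * zv k l = (\<Sum>a\<in>UNIV. \<Sum>b\<in>UNIV. xu i a * xv k b * (yu a j * yv b l))" for i j k l
  proof -
    have "xu i a * yu a j * (xv k b * yv b l) = xu i a * xv k b * (yu a j * yv b l)" for a b
      by (metis c(1) mult.assoc)
    then show ?thesis by (simp add: z sum_product)
  qed
  have zz': "zv k l * zu i j = (\<Sum>a\<in>UNIV. \<Sum>b\<in>UNIV. xv k a * xu i b * (yv a l * yu b j))" for i j k l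
  proof -
    have "xv k a * yv a l * (xu i b * yu b j) = xv k a * xu i b * (yv a l * yu b j)" for a b
      by (metis c(2) mult.assoc)
    then show ?thesis by (simp add: z sum_product)
  qed
  have "uv_diff * (zu i j * zv k l - zv k l * zu i j) = uv_prod * (zu k j * zv i l - zv k j * zu i l)" for i j k l
  proof -
    have "uv_diff * (xu i a * xv k b * (yu a j * yv b l) - xv k b * xu i a * (yv b l * yu a j))
        = uv_diff * (xu i a * xv k b - xv k b * xu i a) * (yu a j * yv b l)
          + xv k b * xu i a * (uv_diff * (yu a j * yv b l - yv b l * yu a j))" for a b
      by (simp add: uv.D_left algebra_simps)
    then have 1: "uv_diff * (xu i a * xv k b * (yu a j * yv b l) - xv k b * xu i a * (yv b l * yu a j))
        = uv_prod * (xu k a * xv i b * (yu a j * yv b l) - xv k a * xu i b * (yu a j * yv b l)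
          + xv k b * xu i a * (yu b j * yv a l) - xv k b * xu i a * (yv b j * yu a l))" for a b
      unfolding bx b_y by (simp add: uv.P_left algebra_simps)
    have "zv k l * zu i j = (\<Sum>a\<in>UNIV. \<Sum>b\<in>UNIV. xv k b * xu i a * (yv b l * yu a j))"
      unfolding zz' by (rule sum.swap)
    then have "uv_diff * (zu i j * zv k l - zv k l * zu i j)
      = (\<Sum>a\<in>UNIV. \<Sum>b\<in>UNIV. uv_diff * (xu i a * xv k b * (yu a j * yv b l) - xv k b * xu i a * (yv b l * yu a j)))"
      unfolding zz by (simp add: sum_subtractf[symmetric] sum_distrib_left right_diff_distrib)
    also have "\<dots> = uv_prod * (zu k j * zv i l - (\<Sum>a\<in>UNIV. \<Sum>b\<in>UNIV. xv k a * xu i b * (yu a j * yv b l))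
      + (\<Sum>a\<in>UNIV. \<Sum>b\<in>UNIV. xv k b * xu i a * (yu b j * yv a l))
      - (\<Sum>a\<in>UNIV. \<Sum>b\<in>UNIV. xv k b * xu i a * (yv b j * yu a l)))"
      unfolding 1 zz by (simp add: sum_subtractf sum.distrib sum_distrib_left distrib_left right_diff_distrib)
    also have "(\<Sum>a\<in>UNIV. \<Sum>b\<in>UNIV. xv k b * xu i a * (yu b j * yv a l))
       = (\<Sum>a\<in>UNIV. \<Sum>b\<in>UNIV. xv k a * xu i b * (yu a j * yv b l))"
      by (rule sum.swap)
    also have "(\<Sum>a\<in>UNIV. \<Sum>b\<in>UNIV. xv k b * xu i a * (yv b j * yu a l)) = zv k j * zu i l"
      unfolding zz' by (rule sum.swap)
    finally show ?thesis by simp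
  qed
  moreover have "?z i j 0 = (if i = j then 1 else 0)" for i j
    using exhaust_2[of i] exhaust_2[of j] by (auto simp: sum_2 rtt.t_0[OF assms(1)] rtt.t_0[OF assms(2)])
  ultimately show ?thesis
    unfolding zu_def zv_def by (subst rtt_uv_iff) auto
qed

text \<open>A type of linear operators, so that the results about solutions of the relations in a
  ring apply to operators on states.\<close>

typedef (overloaded) 'k lop = "{A :: 'k::field state \<Rightarrow> 'k state.
    (\<forall>x y. A (x + y) = A x + A y) \<and> (\<forall>c x. A (scale_state c x) = scale_state c (A x))}"
  morphisms app_lop Abs_lop
  by (rule exI[of _ "\<lambda>x. x"]) simp

setup_lifting type_definition_lop

lemma scale_state_simps:
  "scale_state c (x + y) = scale_state c x + scale_state c y"
  "scale_state (c + d) x = scale_state c x + scale_state d x"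
  "scale_state c (x - y) = scale_state c x - scale_state c y"
  "scale_state c (- x) = - scale_state c x"
  "scale_state c (scale_state d x) = scale_state (c * d) x"
  "scale_state 1 x = x" "scale_state 0 x = 0" "scale_state c 0 = 0"
  by (auto simp: fun_eq_iff state_apply algebra_simps)

instantiation lop :: (field) ring_1
begin
lift_definition zero_lop :: "'a lop" is "\<lambda>_. 0"
  by (simp add: scale_state_simps del: scale_state_apply)
lift_definition one_lop :: "'a lop" is "\<lambda>x. x" by simp
lift_definition plus_lop :: "'a lop \<Rightarrow> 'a lop \<Rightarrow> 'a lop" is "\<lambda>A B x. A x + B x"
  by (simp add: scale_state_simps algebra_simps)
lift_definition minus_lop :: "'a lop \<Rightarrow> 'a lop \<Rightarrow> 'a lop" is "\<lambda>A B x. A x - B x"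
  by (simp add: scale_state_simps algebra_simps)
lift_definition uminus_lop :: "'a lop \<Rightarrow> 'a lop" is "\<lambda>A x. - A x"
  by (simp add: scale_state_simps)
lift_definition times_lop :: "'a lop \<Rightarrow> 'a lop \<Rightarrow> 'a lop" is "\<lambda>A B x. A (B x)"
  by simp
instance
proof
  show "(0 :: 'a lop) \<noteq> 1"
  proof transfer
    show "(\<lambda>_. 0 :: 'a state) \<noteq> (\<lambda>x. x)"
      by (auto simp: fun_eq_iff state_apply intro!: exI[of _ "\<lambda>_. 1"])
  qed
qed (transfer; simp add: algebra_simps)+
end

lift_definition lop_scalar :: "'k::field \<Rightarrow> 'k lop" is scale_state
  by (simp add: scale_state_simps algebra_simps)

lemma app_lop_add: "app_lop A (x + y) = app_lop A x + app_lop A y"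
  and app_lop_scale: "app_lop A (scale_state c x) = scale_state c (app_lop A x)"
  by (transfer, blast)+

lemma app_lop_zero: "app_lop A 0 = 0"
  using app_lop_add[of A 0 0] by (simp)

lemma app_lop_simps:
  "app_lop (A + B) x = app_lop A x + app_lop B x" "app_lop (A - B) x = app_lop A x - app_lop B x"
  "app_lop (- A) x = - app_lop A x" "app_lop (A * B) x = app_lop A (app_lop B x)"
  "app_lop 0 x = 0" "app_lop 1 x = x" "app_lop (lop_scalar c) x = scale_state c x"
  by (transfer, simp)+

lemma lop_eqI: "(\<And>x. app_lop A x = app_lop B x) \<Longrightarrow> A = B"
  by transfer blast

lemma app_lop_sum: "app_lop (\<Sum>i\<in>S. A i) x = (\<Sum>i\<in>S. app_lop (A i) x)"
  by (induction S rule: infinite_finite_induct) (auto simp: app_lop_simps)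

interpretation lop: scalars lop_scalar
proof
  fix c and x :: "'a lop"
  show "lop_scalar c * x = x * lop_scalar c"
    by (rule lop_eqI) (simp add: app_lop_simps app_lop_scale)
qed (auto intro!: lop_eqI simp: app_lop_simps scale_state_simps)

lemma of_nat_lop: "of_nat n = lop_scalar (of_nat n)"
  by (induction n) (simp_all add: lop.sc_0 lop.sc_1 lop.sc_add)

section \<open>Tensor products of evaluation modules and their duals as chains\<close>

definition swap_index :: "2 \<Rightarrow> 2" where
  "swap_index i = (if i = 1 then 2 else 1)"

text \<open>If the exponent k stands for the monomial x^(m-k) y^k, then \<open>up_coeff\<close> and
  \<open>down_coeff\<close> are the matrix coefficients of e_12 = x d/dy and e_21 = y d/dx on binary
  forms of degree m.\<close>

definition up_coeff :: "nat \<Rightarrow> nat \<Rightarrow> 'k::field" where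
  "up_coeff s k = of_nat (Suc k)"

definition down_coeff :: "(nat \<Rightarrow> nat) \<Rightarrow> nat \<Rightarrow> nat \<Rightarrow> 'k::field" where
  "down_coeff m s k = of_nat (m s) - of_nat k + 1"

text \<open>The negative transposes of e_21 and e_12, in this order. Exchanging the indices 1 and 2
  turns the dual of a highest weight module, whose natural extremal vector is a lowest weight
  vector, again into a highest weight module, with weights -b and -a.\<close>

definition dual_up_coeff :: "(nat \<Rightarrow> nat) \<Rightarrow> nat \<Rightarrow> nat \<Rightarrow> 'k::field" where
  "dual_up_coeff m s k = - (of_nat (m s) - of_nat k)"

definition dual_down_coeff :: "nat \<Rightarrow> nat \<Rightarrow> 'k::field" where
  "dual_down_coeff s k = - of_nat k"

lemmas coeff_defs = up_coeff_def down_coeff_def dual_up_coeff_def dual_down_coeff_def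

locale weights =
  fixes a b :: "nat \<Rightarrow> 'k::field" and m :: "nat \<Rightarrow> nat"
  assumes weight_diff: "a s - b s = of_nat (m s)"
    and m_less: "m s < CHAR('k)"
begin

sublocale chain a b up_coeff "down_coeff m" .

sublocale dual: chain "\<lambda>s. - b s" "\<lambda>s. - a s" "dual_up_coeff m" dual_down_coeff .

lemma coefficients_nonzero:
  assumes "k < m s"
  shows "up_coeff s k \<noteq> (0 :: 'k)" "dual_up_coeff m s k \<noteq> (0 :: 'k)"
proof -
  have "of_nat n \<noteq> (0 :: 'k)" if "0 < n" "n \<le> m s" for n
    using that m_less[of s] by (auto simp: of_nat_eq_0_iff_char_dvd dest: dvd_imp_le)
  from this[of "Suc k"] this[of "m s - k"] assms
  show "up_coeff s k \<noteq> (0 :: 'k)" "dual_up_coeff m s k \<noteq> (0 :: 'k)"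
    by (auto simp: coeff_defs of_nat_diff)
qed

definition site_lop :: "nat \<Rightarrow> 2 \<Rightarrow> 2 \<Rightarrow> 'k lop" where
  "site_lop s i j = Abs_lop (site_op s i j)"

definition chain_lop :: "nat list \<Rightarrow> 2 \<Rightarrow> 2 \<Rightarrow> nat \<Rightarrow> 'k lop" where
  "chain_lop ss i j r = Abs_lop (chain_op ss i j r)"

lemma app_site_lop: "app_lop (site_lop s i j) = site_op s i j"
  unfolding site_lop_def by (rule Abs_lop_inverse) (simp add: site_op_add site_op_scale)

lemma app_chain_lop: "app_lop (chain_lop ss i j r) = chain_op ss i j r"
  unfolding chain_lop_def by (rule Abs_lop_inverse) (simp add: chain_op_add chain_op_scale)

lemma site_op_bracket:
  "site_op s i j (site_op s k l \<psi>) - site_op s k l (site_op s i j \<psi>)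
     = (if k = j then site_op s i l \<psi> else 0) - (if i = l then site_op s k j \<psi> else 0)"
proof -
  have ab: "a s = b s + of_nat (m s)" using weight_diff[of s] by (simp add: algebra_simps)
  have nz: "of_nat (x - Suc 0) = (of_nat x - 1 :: 'k)" if "0 < x" for x
    using that by (simp add: of_nat_diff)
  show ?thesis
    using exhaust_2[of i] exhaust_2[of j] exhaust_2[of k] exhaust_2[of l]
    by (elim disjE; hypsubst) (auto simp: fun_eq_iff state_apply site_op_def coeff_defs ab nz algebra_simps)
qed

lemma rtt_site: "rtt (\<lambda>i j r. if r = 0 then if i = j then 1 else 0 else if r = 1 then site_lop s i j else 0)"
proof (subst rtt_iff, goal_cases)
  case 2
  have br: "site_lop s i j * site_lop s k l - site_lop s k l * site_lop s i j
     = (if k = j then site_lop s i l else 0) - (if i = l then site_lop s k j else 0)" for i j k l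
    by (rule lop_eqI) (simp add: app_lop_simps app_site_lop site_op_bracket)
  show ?case
  proof (intro allI, goal_cases)
    case (1 i j k l r q)
    show ?case
      using br[of i j k l] by (cases "r = 0"; cases "q = 0"; cases "r = 1"; cases "q = 1") (auto simp: algebra_simps)
  qed
qed simp

lemma chain_lop_Cons:
  "chain_lop (s # ss) i j r = (\<Sum>k\<in>UNIV. \<Sum>q\<le>r.
     (if q = 0 then if i = k then 1 else 0 else if q = 1 then site_lop s i k else 0) * chain_lop ss k j (r - q))"
proof -
  have "(\<Sum>q\<le>r. (if q = 0 then if i = k then 1 else 0 else if q = 1 then site_lop s i k else 0) * chain_lop ss k j (r - q))
     = (if i = k then chain_lop ss k j r else 0) + (if r = 0 then 0 else site_lop s i k * chain_lop ss k j (r - 1))" for k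
  proof -
    have "(\<Sum>q\<le>r. (if q = 0 then if i = k then 1 else 0 else if q = 1 then site_lop s i k else 0) * chain_lop ss k j (r - q))
      = (\<Sum>q\<in>(if r = 0 then {0} else {0, 1}). (if q = 0 then if i = k then 1 else 0 else if q = 1 then site_lop s i k else 0) * chain_lop ss k j (r - q))"
      by (rule sum.mono_neutral_right) auto
    then show ?thesis by auto
  qed
  moreover have "chain_lop (s # ss) i j r = chain_lop ss i j r + (if r = 0 then 0 else \<Sum>k\<in>UNIV. site_lop s i k * chain_lop ss k j (r - 1))"
    by (rule lop_eqI) (simp add: app_lop_simps app_lop_sum app_chain_lop app_site_lop)
  ultimately show ?thesis by (simp add: sum.distrib)
qed

lemma rtt_chain: "distinct ss \<Longrightarrow> rtt (chain_lop ss)"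
proof (induction ss)
  case Nil
  have 1: "chain_lop [] i j r = (if r = 0 \<and> i = j then 1 else 0)" for i j r
    by (rule lop_eqI) (simp add: app_lop_simps app_chain_lop)
  show ?case by unfold_locales (auto simp: 1 intro!: sum.neutral)
next
  case (Cons s ss)
  have c: "site_lop s i j * chain_lop ss k l r = chain_lop ss k l r * site_lop s i j" for i j k l r
    using Cons.prems by (intro lop_eqI) (simp add: app_lop_simps app_chain_lop app_site_lop site_op_chain_op_commute)
  have "rtt (\<lambda>i j r. \<Sum>k\<in>UNIV. \<Sum>q\<le>r.
     (if q = 0 then if i = k then 1 else 0 else if q = 1 then site_lop s i k else 0) * chain_lop ss k j (r - q))"
    using Cons by (intro rtt_tensor[OF rtt_site]) (auto simp: c)
  then show ?case unfolding chain_lop_Cons[symmetric] .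
qed

lemma box_states_add: "x \<in> box_states m' ss \<Longrightarrow> y \<in> box_states m' ss \<Longrightarrow> x + y \<in> box_states m' ss"
  and box_states_scale: "x \<in> box_states m' ss \<Longrightarrow> scale_state c x \<in> box_states m' ss"
  and box_states_0: "0 \<in> box_states m' ss"
  by (auto simp: box_states_def state_apply)

lemma box_upd_iff:
  assumes "s \<in> set S"
  shows "\<kappa>(s := n) \<in> box m' S \<longleftrightarrow> n \<le> m' s \<and> (\<forall>j. j \<noteq> s \<longrightarrow> \<kappa> j \<le> (if j \<in> set S then m' j else 0))"
    and "\<kappa> \<in> box m' S \<longleftrightarrow> \<kappa> s \<le> m' s \<and> (\<forall>j. j \<noteq> s \<longrightarrow> \<kappa> j \<le> (if j \<in> set S then m' j else 0))"
proof -
  define B where "B j = (if j \<in> set S then m' j else 0)" for j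
  have iff: "\<kappa> \<in> box m' S \<longleftrightarrow> (\<forall>j. \<kappa> j \<le> B j)" for \<kappa>
    by (auto simp: box_def B_def)
  have s: "B s = m' s" using assms by (simp add: B_def)
  show "\<kappa>(s := n) \<in> box m' S \<longleftrightarrow> n \<le> m' s \<and> (\<forall>j. j \<noteq> s \<longrightarrow> \<kappa> j \<le> (if j \<in> set S then m' j else 0))"
    and "\<kappa> \<in> box m' S \<longleftrightarrow> \<kappa> s \<le> m' s \<and> (\<forall>j. j \<noteq> s \<longrightarrow> \<kappa> j \<le> (if j \<in> set S then m' j else 0))"
    unfolding iff B_def[symmetric] by (metis s fun_upd_apply, metis s)
qed

lemma site_op_box_states:
  assumes "\<psi> \<in> box_states m S" "s \<in> set S"
  shows "site_op s i j \<psi> \<in> box_states m S"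
proof -
  have up: "\<psi> (\<kappa>(s := Suc (\<kappa> s))) = 0" if "\<kappa> \<notin> box m S" for \<kappa>
  proof -
    have "\<kappa>(s := Suc (\<kappa> s)) \<notin> box m S"
      using that unfolding box_upd_iff[OF assms(2)] by auto
    then show ?thesis using assms(1) by (simp add: box_states_def)
  qed
  \<comment> \<open>The box could only be left upwards at \<kappa> s = m s + 1, and there the
    coefficient m s - \<kappa> s + 1 vanishes.\<close>
  have down: "down_coeff m s (\<kappa> s) * \<psi> (\<kappa>(s := \<kappa> s - 1)) = 0" if "\<kappa> \<notin> box m S" "\<kappa> s \<noteq> 0" for \<kappa>
  proof (cases "\<kappa>(s := \<kappa> s - 1) \<in> box m S")
    case True
    then have "\<kappa> s = Suc (m s)"
      using that unfolding box_upd_iff[OF assms(2)] by auto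
    then show ?thesis by (simp add: down_coeff_def)
  next
    case False
    then show ?thesis using assms(1) by (simp add: box_states_def)
  qed
  show ?thesis
    using assms(1) up down by (simp add: box_states_def site_op_def)
qed

lemma chain_op_box_states:
  assumes "\<psi> \<in> box_states m S" "set ss \<subseteq> set S"
  shows "chain_op ss i j r \<psi> \<in> box_states m S"
  using assms(2)
  by (induction ss arbitrary: i j r)
     (auto simp: assms(1) box_states_0 sum_2 intro!: box_states_add site_op_box_states)

definition pairing :: "nat list \<Rightarrow> 'k state \<Rightarrow> 'k state \<Rightarrow> 'k" where
  "pairing S \<phi> \<psi> = (\<Sum>\<kappa>\<in>box m S. \<phi> \<kappa> * \<psi> \<kappa>)"

lemma pairing_simps:
  "pairing S \<phi> (x + y) = pairing S \<phi> x + pairing S \<phi> y"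
  "pairing S (x + y) \<psi> = pairing S x \<psi> + pairing S y \<psi>"
  "pairing S \<phi> 0 = 0" "pairing S 0 \<psi> = 0"
  by (auto simp: pairing_def state_apply algebra_simps sum.distrib)

text \<open>Summation by parts over the box. Shifting \<kappa> s by one matches the terms except on
  the upper face \<kappa> s = m s, where either the shifted state or the coefficient m s - \<kappa>
  s is 0.\<close>

lemma pairing_site_op:
  assumes \<psi>: "\<psi> \<in> box_states m S" and s: "s \<in> set S"
  shows "pairing S \<phi> (site_op s (swap_index i) (swap_index j) \<psi>) = - pairing S (dual.site_op s i j \<phi>) \<psi>"
proof -
  have supp: "\<psi> \<kappa> = 0" if "\<kappa> \<notin> box m S" for \<kappa> using \<psi> that by (auto simp: box_states_def)
  let ?up = "\<lambda>\<kappa>. \<kappa>(s := Suc (\<kappa> s))" and ?dn = "\<lambda>\<kappa>. \<kappa>(s := \<kappa> s - 1)"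
  have up: "(\<Sum>\<kappa>\<in>box m S. \<phi> \<kappa> * (of_nat (Suc (\<kappa> s)) * \<psi> (?up \<kappa>)))
     = (\<Sum>\<kappa>\<in>box m S. if \<kappa> s = 0 then 0 else of_nat (\<kappa> s) * \<phi> (?dn \<kappa>) * \<psi> \<kappa>)"
  proof -
    have "(\<Sum>\<kappa>\<in>box m S. \<phi> \<kappa> * (of_nat (Suc (\<kappa> s)) * \<psi> (?up \<kappa>)))
       = (\<Sum>\<kappa>\<in>{\<kappa>\<in>box m S. \<kappa> s < m s}. \<phi> \<kappa> * (of_nat (Suc (\<kappa> s)) * \<psi> (?up \<kappa>)))"
    proof (intro sum.mono_neutral_right finite_box ballI)
      fix \<kappa> assume "\<kappa> \<in> box m S - {\<kappa> \<in> box m S. \<kappa> s < m s}"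
      then have "?up \<kappa> \<notin> box m S" unfolding box_upd_iff[OF s] by auto
      then show "\<phi> \<kappa> * (of_nat (Suc (\<kappa> s)) * \<psi> (?up \<kappa>)) = 0" by (simp add: supp)
    qed auto
    also have "\<dots> = (\<Sum>\<kappa>\<in>{\<kappa>\<in>box m S. \<kappa> s \<noteq> 0}. of_nat (\<kappa> s) * \<phi> (?dn \<kappa>) * \<psi> \<kappa>)"
      unfolding box_upd_iff[OF s] by (intro sum.reindex_bij_witness[of _ ?dn ?up]) auto
    also have "\<dots> = (\<Sum>\<kappa>\<in>box m S. if \<kappa> s = 0 then 0 else of_nat (\<kappa> s) * \<phi> (?dn \<kappa>) * \<psi> \<kappa>)"
      by (rule sum.mono_neutral_cong_left) (auto simp: finite_box)
    finally show ?thesis .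
  qed
  have down: "(\<Sum>\<kappa>\<in>box m S. \<phi> \<kappa> * (if \<kappa> s = 0 then 0 else (of_nat (m s) - of_nat (\<kappa> s) + 1) * \<psi> (?dn \<kappa>)))
     = (\<Sum>\<kappa>\<in>box m S. (of_nat (m s) - of_nat (\<kappa> s)) * \<phi> (?up \<kappa>) * \<psi> \<kappa>)"
  proof -
    have "(\<Sum>\<kappa>\<in>box m S. \<phi> \<kappa> * (if \<kappa> s = 0 then 0 else (of_nat (m s) - of_nat (\<kappa> s) + 1) * \<psi> (?dn \<kappa>)))
       = (\<Sum>\<kappa>\<in>{\<kappa>\<in>box m S. \<kappa> s \<noteq> 0}. \<phi> \<kappa> * ((of_nat (m s) - of_nat (\<kappa> s) + 1) * \<psi> (?dn \<kappa>)))"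
      by (rule sum.mono_neutral_cong_right) (auto simp: finite_box)
    also have "\<dots> = (\<Sum>\<kappa>\<in>{\<kappa>\<in>box m S. \<kappa> s < m s}. (of_nat (m s) - of_nat (\<kappa> s)) * \<phi> (?up \<kappa>) * \<psi> \<kappa>)"
      unfolding box_upd_iff[OF s] by (intro sum.reindex_bij_witness[of _ ?up ?dn]) (auto simp: of_nat_diff)
    also have "\<dots> = (\<Sum>\<kappa>\<in>box m S. (of_nat (m s) - of_nat (\<kappa> s)) * \<phi> (?up \<kappa>) * \<psi> \<kappa>)"
    proof (intro sum.mono_neutral_left finite_box ballI)
      fix \<kappa> assume "\<kappa> \<in> box m S - {\<kappa> \<in> box m S. \<kappa> s < m s}"
      then have "\<kappa> s = m s" using s by (auto simp: box_def)
      then show "(of_nat (m s) - of_nat (\<kappa> s)) * \<phi> (?up \<kappa>) * \<psi> \<kappa> = 0" by simp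
    qed auto
    finally show ?thesis .
  qed
  have neg: "- pairing S x \<psi> = (\<Sum>\<kappa>\<in>box m S. - (x \<kappa> * \<psi> \<kappa>))" for x
    by (simp add: pairing_def sum_negf)
  have [simp]: "swap_index 1 = 2" "swap_index 2 = 1"
    by (simp_all add: swap_index_def)
  consider "i = 1" "j = 1" | "i = 1" "j = 2" | "i = 2" "j = 1" | "i = 2" "j = 2"
    using exhaust_2[of i] exhaust_2[of j] by blast
  then show ?thesis
  proof cases
    case 1
    show ?thesis unfolding neg unfolding pairing_def
      by (intro sum.cong refl) (simp add: 1 site_op_def dual.site_op_def algebra_simps)
  next
    case 2
    have "pairing S \<phi> (site_op s (swap_index i) (swap_index j) \<psi>)
       = (\<Sum>\<kappa>\<in>box m S. \<phi> \<kappa> * (if \<kappa> s = 0 then 0 else (of_nat (m s) - of_nat (\<kappa> s) + 1) * \<psi> (?dn \<kappa>)))"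
      unfolding pairing_def by (intro sum.cong refl) (simp add: 2 site_op_def coeff_defs)
    also have "\<dots> = - pairing S (dual.site_op s i j \<phi>) \<psi>"
      unfolding down neg by (intro sum.cong refl) (simp add: 2 dual.site_op_def coeff_defs algebra_simps)
    finally show ?thesis .
  next
    case 3
    have "pairing S \<phi> (site_op s (swap_index i) (swap_index j) \<psi>)
       = (\<Sum>\<kappa>\<in>box m S. \<phi> \<kappa> * (of_nat (Suc (\<kappa> s)) * \<psi> (?up \<kappa>)))"
      unfolding pairing_def by (intro sum.cong refl) (simp add: 3 site_op_def coeff_defs)
    also have "\<dots> = - pairing S (dual.site_op s i j \<phi>) \<psi>"
      unfolding up neg by (intro sum.cong refl) (simp add: 3 dual.site_op_def coeff_defs)
    finally show ?thesis .
  next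
    case 4
    show ?thesis unfolding neg unfolding pairing_def
      by (intro sum.cong refl) (simp add: 4 site_op_def dual.site_op_def algebra_simps)
  qed
qed

text \<open>The r-th coefficient is a sum of products of r site operators, each transposed with a
  sign. Transposition reverses the products, and the commutativity of operators at different sites
  puts them back in order.\<close>

lemma pairing_chain_op:
  assumes \<psi>: "\<psi> \<in> box_states m S" and "set ss \<subseteq> set S" "distinct ss"
  shows "pairing S \<phi> (chain_op ss (swap_index i) (swap_index j) r \<psi>) = (- 1) ^ r * pairing S (dual.chain_op ss i j r \<phi>) \<psi>"
  using assms(2,3)
proof (induction ss arbitrary: i j r \<phi>)
  case Nil
  have "swap_index i = swap_index j \<longleftrightarrow> i = j"
    using exhaust_2[of i] exhaust_2[of j] by (auto simp: swap_index_def)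
  then show ?case by (simp add: pairing_simps)
next
  case (Cons s ss)
  have site: "pairing S \<phi> (site_op s (swap_index i) (swap_index k) (chain_op ss (swap_index k) (swap_index j) q \<psi>))
     = (- 1) ^ Suc q * pairing S (dual.site_op s i k (dual.chain_op ss k j q \<phi>)) \<psi>" for k q
    using Cons.prems
    by (subst pairing_site_op) (auto simp: chain_op_box_states[OF \<psi>] Cons.IH dual.site_op_chain_op_commute)
  have sw: "(\<Sum>k\<in>UNIV. g k) = (\<Sum>k\<in>UNIV. g (swap_index k))" for g :: "2 \<Rightarrow> 'k state"
    by (simp add: sum_2 swap_index_def add.commute)
  have "set ss \<subseteq> set S" "distinct ss" using Cons.prems by auto
  note IH = Cons.IH[OF this]
  show ?case
  proof (cases r)
    case 0
    then show ?thesis using IH by (simp add: pairing_simps)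
  next
    case (Suc q)
    have "pairing S \<phi> (chain_op (s # ss) (swap_index i) (swap_index j) r \<psi>)
       = pairing S \<phi> (chain_op ss (swap_index i) (swap_index j) r \<psi>)
         + (\<Sum>k\<in>UNIV. pairing S \<phi> (site_op s (swap_index i) (swap_index k) (chain_op ss (swap_index k) (swap_index j) q \<psi>)))"
      by (simp add: Suc sw[of "\<lambda>k. site_op s (swap_index i) k (chain_op ss k (swap_index j) q \<psi>)"] pairing_simps sum_2)
    then show ?thesis
      unfolding site IH by (simp add: Suc pairing_simps sum_2 algebra_simps)
  qed
qed

end

section \<open>Simplicity of chains\<close>

lemma separating_functional:
  fixes K :: "'k::field state set"
  assumes "0 \<in> K" "\<And>x y. x \<in> K \<Longrightarrow> y \<in> K \<Longrightarrow> x + y \<in> K" "\<And>c x. x \<in> K \<Longrightarrow> scale_state c x \<in> K" "z \<notin> K"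
  obtains g where "\<And>x y. g (x + y) = g x + (g y :: 'k)" "\<And>c x. g (scale_state c x) = c * g x"
    "\<And>x. x \<in> K \<Longrightarrow> g x = 0" "g z \<noteq> 0"
proof -
  interpret vector_space_pair "scale_state :: 'k \<Rightarrow> 'k state \<Rightarrow> 'k state" "(*) :: 'k \<Rightarrow> 'k \<Rightarrow> 'k"
    by unfold_locales (simp_all add: scale_state_simps algebra_simps)
  have sub: "vs1.subspace K" using assms by (simp add: vs1.subspace_def)
  obtain B where B: "B \<subseteq> K" "vs1.independent B" "K \<subseteq> vs1.span B"
    using vs1.maximal_independent_subset[of K] by blast
  have "vs1.span B \<subseteq> K" using vs1.span_minimal[OF B(1) sub] .
  then have "z \<notin> vs1.span B" using assms(4) by blast
  then have "vs1.independent (insert z B)"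
    using B(2) by (simp add: vs1.independent_insert)
  from linear_independent_extend[OF this, of "\<lambda>x. if x = z then 1 else 0"]
  obtain g where g: "Vector_Spaces.linear scale_state (*) g" "\<forall>x\<in>insert z B. g x = (if x = z then 1 else 0)"
    by blast
  interpret g: Vector_Spaces.linear scale_state "(*)" g by (rule g(1))
  have "z \<notin> B" using assms(4) B(1) by blast
  then have gB: "g x = 0" if "x \<in> B" for x using g(2) that by auto
  have "g x = 0" if "x \<in> K" for x
  proof -
    have "x \<in> vs1.span B" using that B(3) by blast
    from linear_eq_0_on_span[OF g(1) gB this] show ?thesis .
  qed
  with that[of g] g(2) show ?thesis by (auto simp: g.add g.scale)
qed

definition basis_state :: "(nat \<Rightarrow> nat) \<Rightarrow> 'k::field state" where
  "basis_state \<kappa> = (\<lambda>\<kappa>'. if \<kappa>' = \<kappa> then 1 else 0)"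

lemma basis_state_expansion:
  assumes "\<psi> \<in> box_states m ss"
  shows "\<psi> = (\<Sum>\<kappa>\<in>box m ss. scale_state (\<psi> \<kappa>) (basis_state \<kappa>))"
proof
  fix \<kappa>
  have "(\<Sum>\<kappa>\<in>box m ss. scale_state (\<psi> \<kappa>) (basis_state \<kappa>)) \<kappa> = (\<Sum>\<kappa>'\<in>box m ss. if \<kappa>' = \<kappa> then \<psi> \<kappa> else 0)"
    by (auto simp: state_apply basis_state_def intro!: sum.cong)
  then show "\<psi> \<kappa> = (\<Sum>\<kappa>\<in>box m ss. scale_state (\<psi> \<kappa>) (basis_state \<kappa>)) \<kappa>"
    using assms by (auto simp: finite_box box_states_def)
qed

abbreviation vacuum :: "'k::field state" where
  "vacuum \<equiv> basis_state (\<lambda>_. 0)"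

context weights
begin

text \<open>The first inequality is what \<open>singular_support\<close> asks of the chain, the
  second what it asks of the dual chain with weights -b s and -a s. Each site is compared with later
  ones only, which is what a successive choice of minimal pairs can ensure.\<close>

definition compatible :: "nat list \<Rightarrow> bool" where
  "compatible ss \<longleftrightarrow> distinct ss \<and>
     sorted_wrt (\<lambda>s j. \<forall>k<m s. b j \<noteq> a s - of_nat k \<and> a j \<noteq> b s + of_nat k) ss"

lemma basis_state_in_box: "\<kappa> \<in> box m ss \<Longrightarrow> basis_state \<kappa> \<in> box_states m ss"
  by (auto simp: box_states_def basis_state_def)

lemma vacuum_in_box: "vacuum \<in> box_states m ss"
  by (rule basis_state_in_box[OF zero_in_box])

text \<open>A nonzero stable K contains a singular vector, hence the vacuum. If K were proper, its
  annihilator in the dual would be nonzero and stable under the dual t_12, so it would contain a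
  functional supported at the origin; but such a functional does not vanish on the vacuum.\<close>

lemma chain_simple:
  assumes ss: "compatible ss" and K: "K \<subseteq> box_states m ss" "0 \<in> K"
    and add: "\<And>x y. x \<in> K \<Longrightarrow> y \<in> K \<Longrightarrow> x + y \<in> K"
    and scale: "\<And>c x. x \<in> K \<Longrightarrow> scale_state c x \<in> K"
    and op: "\<And>i j r x. x \<in> K \<Longrightarrow> chain_op ss i j r x \<in> K"
    and nonzero: "\<phi> \<in> K" "\<phi> \<noteq> 0"
  shows "K = box_states m ss"
proof (rule ccontr)
  assume "K \<noteq> box_states m ss"
  then obtain z where z: "z \<in> box_states m ss" "z \<notin> K" using K by blast
  have d: "distinct ss" and s1: "sorted_wrt (\<lambda>s j. \<forall>k<m s. b j \<noteq> a s - of_nat k) ss"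
    and s2: "sorted_wrt (\<lambda>s j. \<forall>k<m s. - a j \<noteq> - b s - of_nat k) ss"
  proof -
    show "distinct ss" using ss by (simp add: compatible_def)
    show "sorted_wrt (\<lambda>s j. \<forall>k<m s. b j \<noteq> a s - of_nat k) ss"
      by (rule sorted_wrt_mono_rel[rotated], rule ss[unfolded compatible_def, THEN conjunct2]) simp
    show "sorted_wrt (\<lambda>s j. \<forall>k<m s. - a j \<noteq> - b s - of_nat k) ss"
    proof (rule sorted_wrt_mono_rel[rotated], rule ss[unfolded compatible_def, THEN conjunct2])
      fix s j assume "\<forall>k<m s. b j \<noteq> a s - of_nat k \<and> a j \<noteq> b s + of_nat k"
      then show "\<forall>k<m s. - a j \<noteq> - b s - of_nat k" by (metis minus_add_distrib minus_equation_iff uminus_add_conv_diff add.commute diff_conv_add_uminus)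
    qed
  qed
  have trunc: "(\<lambda>\<kappa>. if \<kappa> \<in> box m ss then chain_op ss 1 2 r \<psi> \<kappa> else 0) = chain_op ss 1 2 r \<psi>"
    if "\<psi> \<in> K" for \<psi> r
    using chain_op_box_states[of \<psi> ss ss 1 2 r] that K(1) by (auto simp: box_states_def fun_eq_iff)
  have "vacuum \<in> K"
  proof (rule singular_vector_exists[where ss = ss and K = K and m = m and \<phi> = \<phi>])
    fix \<psi> :: "'k state" assume \<psi>: "\<psi> \<in> K" "\<psi> (\<lambda>_. 0) \<noteq> 0" "\<And>\<kappa>. \<kappa> \<noteq> (\<lambda>_. 0) \<Longrightarrow> \<psi> \<kappa> = 0"
    have "scale_state (inverse (\<psi> (\<lambda>_. 0))) \<psi> = vacuum"
    proof
      fix \<kappa>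
      show "scale_state (inverse (\<psi> (\<lambda>_. 0))) \<psi> \<kappa> = vacuum \<kappa>"
        using \<psi>(2,3) by (cases "\<kappa> = (\<lambda>_. 0)") (simp_all add: state_apply basis_state_def)
    qed
    then show "vacuum \<in> K" using scale[OF \<psi>(1)] by metis
  next
    fix \<psi> r assume "\<psi> \<in> K"
    then show "(\<lambda>\<kappa>. if \<kappa> \<in> box m ss then chain_op ss 1 2 r \<psi> \<kappa> else 0) \<in> K"
      unfolding trunc[OF \<open>\<psi> \<in> K\<close>] by (rule op)
  qed (use d s1 K nonzero coefficients_nonzero in auto)
  obtain g where g: "\<And>x y. g (x + y) = g x + g y" "\<And>c x. g (scale_state c x) = c * g x"
    "\<And>x. x \<in> K \<Longrightarrow> g x = 0" "g z \<noteq> 0"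
    using separating_functional[OF K(2) add scale z(2)] by metis
  \<comment> \<open>The functional separating z from K, written as a state through its values on the
    basis, so that the dual operators act on it.\<close>
  define \<phi>0 where "\<phi>0 = (\<lambda>\<kappa>. if \<kappa> \<in> box m ss then g (basis_state \<kappa>) else 0)"
  have g0: "g 0 = 0" using K(2) g(3) by blast
  have gsum: "g (\<Sum>i\<in>A. x i) = (\<Sum>i\<in>A. g (x i))" for A and x :: "(nat \<Rightarrow> nat) \<Rightarrow> 'k state"
    by (induction A rule: infinite_finite_induct) (simp_all add: g0 g(1))
  have pg: "pairing ss \<phi>0 \<psi> = g \<psi>" if "\<psi> \<in> box_states m ss" for \<psi>
  proof -
    have "g \<psi> = (\<Sum>\<kappa>\<in>box m ss. \<psi> \<kappa> * g (basis_state \<kappa>))"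
      by (subst basis_state_expansion[OF that]) (simp add: gsum g(2))
    then show ?thesis by (simp add: pairing_def \<phi>0_def mult.commute)
  qed
  define L where "L = {\<phi> \<in> box_states m ss. \<forall>\<psi>\<in>K. pairing ss \<phi> \<psi> = 0}"
  have "\<phi>0 \<in> L" using pg g(3) K(1) by (auto simp: L_def \<phi>0_def box_states_def)
  moreover have "\<phi>0 \<noteq> 0" using pg[OF z(1)] g(4) by (auto simp: pairing_simps)
  ultimately show False
  proof (rule dual.singular_vector_exists[where ss = ss and K = L and m = m and \<phi> = \<phi>0, rotated 5])
    fix \<phi> :: "'k state" assume "\<phi> \<in> L" "\<phi> (\<lambda>_. 0) \<noteq> 0"
    moreover have "pairing ss \<phi> vacuum = \<phi> (\<lambda>_. 0)"
      by (simp add: pairing_def basis_state_def if_distrib finite_box zero_in_box cong: if_cong)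
    ultimately show False using \<open>vacuum \<in> K\<close> by (auto simp: L_def)
  next
    fix \<phi> r assume "\<phi> \<in> L"
    have "pairing ss (\<lambda>\<kappa>. if \<kappa> \<in> box m ss then dual.chain_op ss 1 2 r \<phi> \<kappa> else 0) \<psi> = 0" if "\<psi> \<in> K" for \<psi>
    proof -
      have "pairing ss \<phi> (chain_op ss (swap_index 1) (swap_index 2) r \<psi>) = 0"
        using \<open>\<phi> \<in> L\<close> op[OF that] by (auto simp: L_def)
      then have "pairing ss (dual.chain_op ss 1 2 r \<phi>) \<psi> = 0"
        using that K(1) d by (subst (asm) pairing_chain_op) auto
      then show ?thesis by (simp add: pairing_def)
    qed
    then show "(\<lambda>\<kappa>. if \<kappa> \<in> box m ss then dual.chain_op ss 1 2 r \<phi> \<kappa> else 0) \<in> L"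
      by (simp add: L_def box_states_def)
  qed (use d s2 coefficients_nonzero in \<open>auto simp: L_def\<close>)
qed

lemma chain_op_21_origin: "\<forall>s\<in>set ss. \<kappa> s = 0 \<Longrightarrow> chain_op ss 2 1 r \<psi> \<kappa> = 0"
proof (induction ss arbitrary: r)
  case (Cons s ss)
  then show ?case by (simp add: sum_2 site_op_def state_apply)
qed (simp add: state_apply)

lemma chain_op_22_origin:
  "\<forall>s\<in>set ss. \<kappa> s = 0 \<Longrightarrow> chain_op ss 2 2 r \<psi> \<kappa> = coeff (\<Prod>s\<leftarrow>ss. [:1, b s:]) r * \<psi> \<kappa>"
proof (induction ss arbitrary: r)
  case (Cons s ss)
  then show ?case by (cases r) (simp_all add: sum_2 site_op_def state_apply algebra_simps coeff_pCons)
qed (simp add: state_apply)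

lemma chain_op_11_vacuum:
  assumes "distinct ss"
  shows "chain_op ss 1 1 r vacuum (\<lambda>_. 0) = coeff (\<Prod>s\<leftarrow>ss. [:1, a s:]) r"
  using assms
proof (induction ss arbitrary: r)
  case (Cons s ss)
  have "chain_op ss 2 1 q vacuum ((\<lambda>_. 0)(s := Suc 0)) = (0 :: 'k)" for q
    using Cons.prems by (intro chain_op_21_origin) auto
  then show ?case using Cons
    by (cases r) (simp_all add: sum_2 site_op_def state_apply algebra_simps coeff_pCons)
qed (simp add: state_apply basis_state_def)

text \<open>By the weight grading t_11 and t_22 keep the total exponent at 0, so their values on the
  vacuum are read off at the origin, and t_12 has nowhere to send it.\<close>

lemma chain_op_vacuum:
  assumes "distinct ss"
  shows "chain_op ss 1 2 r vacuum = 0"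
    and "chain_op ss 1 1 r vacuum = scale_state (coeff (\<Prod>s\<leftarrow>ss. [:1, a s:]) r) vacuum"
    and "chain_op ss 2 2 r vacuum = scale_state (coeff (\<Prod>s\<leftarrow>ss. [:1, b s:]) r) vacuum"
proof -
  let ?w = "\<lambda>i :: 2. if i = 1 then 0 else 1 :: int"
  have vac: "(vacuum :: 'k state) \<kappa> = 0" if "1 \<le> int (sum \<kappa> (set ss))" for \<kappa>
    using that by (auto simp: basis_state_def)
  have deg: "\<kappa> = (\<lambda>_. 0) \<or> 1 \<le> int (sum \<kappa> (set ss))" if "\<kappa> \<in> box m ss" for \<kappa>
  proof (rule disjCI)
    assume "\<not> 1 \<le> int (sum \<kappa> (set ss))"
    then have "sum \<kappa> (set ss) = 0" by linarith
    then have "\<forall>s\<in>set ss. \<kappa> s = 0" by simp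
    then show "\<kappa> = (\<lambda>_. 0)" using that by (auto simp: box_def fun_eq_iff)
  qed
  have out: "chain_op ss i j r vacuum \<kappa> = (0 :: 'k)" if "\<kappa> \<notin> box m ss" for i j \<kappa>
    using chain_op_box_states[OF vacuum_in_box, of ss ss i j r] that by (auto simp: box_states_def)
  have 0: "chain_op ss i j r vacuum \<kappa> = (0 :: 'k)" if "1 + ?w i - ?w j \<le> int (sum \<kappa> (set ss))" for i j \<kappa>
    by (rule chain_op_degree[of "set ss" _ ?w 1]) (use vac that in auto)
  show "chain_op ss 1 2 r vacuum = 0"
    by (rule ext) (use 0[of 1 2] in \<open>simp add: state_apply sum_nonneg\<close>)
  have diag: "chain_op ss i i r vacuum \<kappa> = (0 :: 'k)" if "\<kappa> \<noteq> (\<lambda>_. 0)" for i \<kappa>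
    using deg[of \<kappa>] 0[of i i \<kappa>] out[of \<kappa>] that by fastforce
  show "chain_op ss 1 1 r vacuum = scale_state (coeff (\<Prod>s\<leftarrow>ss. [:1, a s:]) r) vacuum"
  proof
    fix \<kappa>
    show "chain_op ss 1 1 r vacuum \<kappa> = scale_state (coeff (\<Prod>s\<leftarrow>ss. [:1, a s:]) r) vacuum \<kappa>"
      using chain_op_11_vacuum[OF assms, of r] diag[of \<kappa> 1]
      by (cases "\<kappa> = (\<lambda>_. 0)") (auto simp: state_apply basis_state_def)
  qed
  show "chain_op ss 2 2 r vacuum = scale_state (coeff (\<Prod>s\<leftarrow>ss. [:1, b s:]) r) vacuum"
  proof
    fix \<kappa>
    show "chain_op ss 2 2 r vacuum \<kappa> = scale_state (coeff (\<Prod>s\<leftarrow>ss. [:1, b s:]) r) vacuum \<kappa>"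
      using chain_op_22_origin[of ss "\<lambda>_. 0" r vacuum] diag[of \<kappa> 2]
      by (cases "\<kappa> = (\<lambda>_. 0)") (auto simp: state_apply basis_state_def)
  qed
qed

end

section \<open>Evaluation of free algebras and of the Yangian\<close>

lemma poly_mapping_sum_single: "x = (\<Sum>w\<in>Poly_Mapping.keys x. Poly_Mapping.single w (Poly_Mapping.lookup x w))"
proof (rule poly_mapping_eqI)
  fix k
  have "Poly_Mapping.lookup (\<Sum>w\<in>Poly_Mapping.keys x. Poly_Mapping.single w (Poly_Mapping.lookup x w)) k
     = (\<Sum>w\<in>Poly_Mapping.keys x. if w = k then Poly_Mapping.lookup x k else 0)"
    by (auto simp: lookup_sum lookup_single when_def intro!: sum.cong)
  then show "Poly_Mapping.lookup x k = Poly_Mapping.lookup (\<Sum>w\<in>Poly_Mapping.keys x. Poly_Mapping.single w (Poly_Mapping.lookup x w)) k"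
    by (auto simp: in_keys_iff)
qed

lemma poly_mapping_additive_induct [case_names zero single add]:
  assumes "P 0" "\<And>w c. P (Poly_Mapping.single w c)" "\<And>x y. P x \<Longrightarrow> P y \<Longrightarrow> P (x + y)"
  shows "P (x :: 'a \<Rightarrow>\<^sub>0 'b::comm_monoid_add)"
proof -
  have "P (\<Sum>w\<in>A. Poly_Mapping.single w (Poly_Mapping.lookup x w))" for A
    by (induction A rule: infinite_finite_induct) (auto intro: assms)
  then show ?thesis by (subst poly_mapping_sum_single)
qed

lemma fscal_commute: "fscal c * x = x * fscal c"
  by (induction x rule: poly_mapping_additive_induct)
     (simp_all add: fscal_def mult_single distrib_left distrib_right mult.commute)

lemma fscal_simps: "fscal (c + d) = fscal c + fscal d" "fscal (c * d) = fscal c * fscal d" "fscal 1 = 1"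
  by (simp_all add: fscal_def single_add mult_single)

lemma single_Word_Cons: "Poly_Mapping.single (Word (g # gs)) c = fgen g * Poly_Mapping.single (Word gs) (c :: 'k::field)"
  by (simp add: fgen_def mult_single)

lemma single_Word_Nil: "Poly_Mapping.single (Word []) c = fscal (c :: 'k::field)"
  by (simp add: fscal_def zero_word_def)

context scalars
begin

primrec word_eval :: "('g \<Rightarrow> 'a) \<Rightarrow> 'g word \<Rightarrow> 'a" where
  "word_eval \<gamma> (Word gs) = prod_list (map \<gamma> gs)"

definition free_eval :: "('g \<Rightarrow> 'a) \<Rightarrow> ('g, 'k) free_algebra \<Rightarrow> 'a" where
  "free_eval \<gamma> x = (\<Sum>w\<in>Poly_Mapping.keys x. sc (Poly_Mapping.lookup x w) * word_eval \<gamma> w)"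

lemma free_eval_superset:
  "finite A \<Longrightarrow> Poly_Mapping.keys x \<subseteq> A \<Longrightarrow> free_eval \<gamma> x = (\<Sum>w\<in>A. sc (Poly_Mapping.lookup x w) * word_eval \<gamma> w)"
  unfolding free_eval_def by (rule sum.mono_neutral_left) (auto simp: in_keys_iff sc_0)

lemma free_eval_add: "free_eval \<gamma> (x + y) = free_eval \<gamma> x + free_eval \<gamma> y"
proof -
  let ?A = "Poly_Mapping.keys x \<union> Poly_Mapping.keys y"
  have "free_eval \<gamma> (x + y) = (\<Sum>w\<in>?A. sc (Poly_Mapping.lookup (x + y) w) * word_eval \<gamma> w)"
    by (rule free_eval_superset) (use Poly_Mapping.keys_add[of x y] in auto)
  also have "\<dots> = free_eval \<gamma> x + free_eval \<gamma> y"
    using free_eval_superset[of ?A x] free_eval_superset[of ?A y]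
    by (simp add: lookup_add sc_add distrib_right sum.distrib)
  finally show ?thesis .
qed

lemma free_eval_single: "free_eval \<gamma> (Poly_Mapping.single w c) = sc c * word_eval \<gamma> w"
  using free_eval_superset[of "{w}" "Poly_Mapping.single w c" \<gamma>] by (simp add: sc_0)

lemma free_eval_0: "free_eval \<gamma> 0 = 0"
  by (simp add: free_eval_def)

lemma word_eval_plus: "word_eval \<gamma> (v + w) = word_eval \<gamma> v * word_eval \<gamma> w"
  by (cases v; cases w) simp

lemma free_eval_mult: "free_eval \<gamma> (x * y) = free_eval \<gamma> x * free_eval \<gamma> y"
proof (induction x rule: poly_mapping_additive_induct)
  case (single v c)
  show ?case
  proof (induction y rule: poly_mapping_additive_induct)
    case (single w d)
    have "sc c * sc d * (word_eval \<gamma> v * word_eval \<gamma> w) = sc c * word_eval \<gamma> v * (sc d * word_eval \<gamma> w)"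
      by (metis mult.assoc sc_comm)
    then show ?case by (simp add: mult_single free_eval_single sc_mult word_eval_plus)
  qed (simp_all add: free_eval_0 free_eval_add distrib_left)
qed (simp_all add: free_eval_0 free_eval_add distrib_right)

lemma free_eval_uminus: "free_eval \<gamma> (- x) = - free_eval \<gamma> x"
  using free_eval_add[of \<gamma> x "- x"] by (simp add: free_eval_0 eq_neg_iff_add_eq_0 add.commute)

lemma free_eval_diff: "free_eval \<gamma> (x - y) = free_eval \<gamma> x - free_eval \<gamma> y"
  using free_eval_add[of \<gamma> x "- y"] by (simp add: free_eval_uminus)

lemma free_eval_fgen: "free_eval \<gamma> (fgen g) = \<gamma> g"
  by (simp add: fgen_def free_eval_single sc_1)

lemma free_eval_fscal: "free_eval \<gamma> (fscal c) = sc c"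
  by (simp add: fscal_def free_eval_single zero_word_def)

lemma free_eval_1: "free_eval \<gamma> 1 = 1"
  using free_eval_fscal[of \<gamma> 1] by (simp add: fscal_simps sc_1)

lemma free_eval_sum: "free_eval \<gamma> (\<Sum>i\<in>A. x i) = (\<Sum>i\<in>A. free_eval \<gamma> (x i))"
  by (induction A rule: infinite_finite_induct) (simp_all add: free_eval_0 free_eval_add)

lemma free_eval_ideal:
  "(\<And>s. s \<in> S \<Longrightarrow> free_eval \<gamma> s = 0) \<Longrightarrow> x \<in> two_sided_ideal S \<Longrightarrow> free_eval \<gamma> x = 0"
  by (erule two_sided_ideal.induct) (simp_all add: free_eval_0 free_eval_mult free_eval_add)

definition yangian_eval :: "(2 \<Rightarrow> 2 \<Rightarrow> nat \<Rightarrow> 'a) \<Rightarrow> 'k yangian \<Rightarrow> 'a" where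
  "yangian_eval t y = free_eval (\<lambda>(i, j, n). t i j (Suc n)) (rep_yangian y)"

lemma yangian_eval_abs:
  assumes "rtt t"
  shows "yangian_eval t (abs_yangian x) = free_eval (\<lambda>(i, j, n). t i j (Suc n)) x"
proof -
  interpret rtt t by (rule assms)
  have ts: "free_eval (\<lambda>(i, j, n). t i j (Suc n)) (tsym i j r) = t i j r" for i j r
    by (cases r) (auto simp: tsym_def t_0 free_eval_1 free_eval_0 free_eval_fgen)
  have "free_eval (\<lambda>(i, j, n). t i j (Suc n)) s = 0" if "s \<in> yangian_relations" for s
    using that by (auto simp: yangian_relations_def free_eval_diff free_eval_mult free_eval_sum ts t_rel)
  moreover have "rep_yangian (abs_yangian x) - x \<in> two_sided_ideal yangian_relations"
    using yangian.abs_eq_iff[of "rep_yangian (abs_yangian x)" x]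
      Quotient3_abs_rep[OF Quotient3_yangian, of "abs_yangian x"] by simp
  ultimately have "free_eval (\<lambda>(i, j, n). t i j (Suc n)) (rep_yangian (abs_yangian x) - x) = 0"
    by (rule free_eval_ideal)
  then show ?thesis by (simp add: yangian_eval_def free_eval_diff)
qed

lemma yangian_eval_hom:
  assumes "rtt t"
  shows "yangian_eval t (x + y) = yangian_eval t x + yangian_eval t y"
    "yangian_eval t (x * y) = yangian_eval t x * yangian_eval t y"
    "yangian_eval t (- x) = - yangian_eval t x"
    "yangian_eval t (x - y) = yangian_eval t x - yangian_eval t y"
    "yangian_eval t 0 = 0" "yangian_eval t 1 = 1"
    "yangian_eval t (yscal c) = sc c" "yangian_eval t (yt i j r) = t i j r"
proof -
  note abs = yangian_eval_abs[OF assms]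
  obtain x' y' where xy: "x = abs_yangian x'" "y = abs_yangian y'"
    by (metis Quotient3_abs_rep[OF Quotient3_yangian])
  show "yangian_eval t (x + y) = yangian_eval t x + yangian_eval t y"
    "yangian_eval t (x * y) = yangian_eval t x * yangian_eval t y"
    "yangian_eval t (- x) = - yangian_eval t x"
    "yangian_eval t (x - y) = yangian_eval t x - yangian_eval t y"
    by (simp_all add: xy abs plus_yangian.abs_eq times_yangian.abs_eq uminus_yangian.abs_eq minus_yangian.abs_eq
        free_eval_add free_eval_mult free_eval_uminus free_eval_diff)
  show "yangian_eval t 0 = 0" "yangian_eval t 1 = 1" "yangian_eval t (yscal c) = sc c"
    by (simp_all add: zero_yangian_def one_yangian_def yscal.abs_eq abs free_eval_0 free_eval_1 free_eval_fscal)
  show "yangian_eval t (yt i j r) = t i j r"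
    by (cases r) (auto simp: yt.abs_eq abs tsym_def rtt.t_0[OF assms] free_eval_1 free_eval_0 free_eval_fgen)
qed

end

lemma yt_0: "yt i j 0 = (if i = j then 1 else 0)"
  by transfer (simp add: tsym_def two_sided_ideal.zero)

lemma rtt_yt: "rtt (yt :: 2 \<Rightarrow> 2 \<Rightarrow> nat \<Rightarrow> 'k::field yangian)"
proof
  fix i j k l :: 2 and r s :: nat
  assume "0 < r" "0 < s"
  define R :: "(ygen, 'k) free_algebra" where "R = (tsym i j r * tsym k l s - tsym k l s * tsym i j r)
        - (\<Sum>t<min r s. tsym k j t * tsym i l (r + s - 1 - t) - tsym k j (r + s - 1 - t) * tsym i l t)"
  have "R \<in> yangian_relations" using \<open>0 < r\<close> \<open>0 < s\<close> unfolding yangian_relations_def R_def by blast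
  then have "1 * R * 1 \<in> two_sided_ideal yangian_relations" by (rule two_sided_ideal.gen)
  then have "R - 0 \<in> two_sided_ideal yangian_relations" by simp
  then have "abs_yangian R = 0" unfolding zero_yangian_def yangian.abs_eq_iff .
  moreover have abs_sum: "abs_yangian (\<Sum>i\<in>A. x i) = (\<Sum>i\<in>A. abs_yangian (x i))" for A :: "nat set" and x
    by (induction A rule: infinite_finite_induct) (simp_all add: zero_yangian_def plus_yangian.abs_eq[symmetric])
  ultimately show "yt i j r * yt k l s - yt k l s * yt i j r =
      (\<Sum>q<min r s. yt k j q * yt i l (r + s - 1 - q) - yt k j (r + s - 1 - q) * yt i l q :: 'k yangian)"
    unfolding R_def
    by (simp add: yt.abs_eq times_yangian.abs_eq[symmetric] minus_yangian.abs_eq[symmetric] abs_sum)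
qed (rule yt_0)

interpretation yscal: scalars "yscal :: 'k::field \<Rightarrow> 'k yangian"
proof
  show "yscal c * x = x * yscal c" for c and x :: "'k yangian"
    by transfer (simp add: fscal_commute two_sided_ideal.zero)
qed (transfer; simp add: fscal_simps two_sided_ideal.zero)+

interpretation Y: rtt_algebra yt "yscal :: 'k::field \<Rightarrow> 'k yangian"
proof (intro rtt_algebra.intro rtt_yt yscal.scalars_axioms rtt_algebra_axioms.intro)
  fix Q :: "'k yangian set" and z :: "'k yangian"
  assume 1: "1 \<in> Q" and add: "\<And>x y. x \<in> Q \<Longrightarrow> y \<in> Q \<Longrightarrow> x + y \<in> Q"
    and scal: "\<And>c x. x \<in> Q \<Longrightarrow> yscal c * x \<in> Q" and t: "\<And>i j r x. x \<in> Q \<Longrightarrow> yt i j r * x \<in> Q"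
  have word: "abs_yangian (Poly_Mapping.single (Word gs) c) \<in> Q" for gs c
  proof (induction gs)
    case Nil
    show ?case using scal[OF 1, of c] by (simp add: single_Word_Nil yscal.abs_eq)
  next
    case (Cons g gs)
    obtain i j n where g: "g = (i, j, n)" by (cases g) auto
    have "abs_yangian (fgen g) = (yt i j (Suc n) :: 'k yangian)" by (simp add: yt.abs_eq tsym_def g)
    then show ?case using t[OF Cons, of i j "Suc n"]
      unfolding single_Word_Cons times_yangian.abs_eq[symmetric] by metis
  qed
  have "abs_yangian x \<in> Q" for x
  proof (induction x rule: poly_mapping_additive_induct)
    case zero
    show ?case using scal[OF 1, of 0] by (simp add: yscal.sc_0 zero_yangian_def)
  next
    case (single w c)
    show ?case using word by (cases w) simp
  qed (auto simp: plus_yangian.abs_eq[symmetric] intro: add)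
  then show "z \<in> Q" by (metis Quotient3_abs_rep[OF Quotient3_yangian])
qed

lemma Y_series:
  "Y.T i j = yt_series i j" "Y.d1 = d_series 1" "Y.d2 = d_series 2" "Y.e = e_series" "Y.f = f_series"
  "Y.d1i = d1_inv_series"
  by (simp_all add: Y.T_def Y.d1_def Y.d1i_def Y.e_def Y.f_def Y.d2_def yt_series_def d_series_def
      d1_inv_series_def e_series_def f_series_def)

section \<open>The action of the restricted Yangian\<close>

lemma shifted_product_eq_prod:
  "shifted_product p g = (\<Prod>c<p. fps_shift_arg c (g :: 'a::comm_ring_1 fps))"
  by (simp add: shifted_product_def prod.list_conv_set_nth atLeast0LessThan)

lemma shifted_product_mult:
  "shifted_product p (g * h) = shifted_product p g * shifted_product p (h :: 'a::comm_ring_1 fps)"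
  by (simp add: shifted_product_eq_prod fps_shift_arg_mult prod.distrib)

lemma shifted_product_1: "shifted_product p 1 = (1 :: 'a::comm_ring_1 fps)"
  by (simp add: shifted_product_eq_prod fps_shift_arg_1)

text \<open>Each factor 1 + x/(u - c) equals (u - c + x)/(u - c), and the product of the 1 - c/u
  clears the denominators.\<close>

lemma shifted_product_linear:
  fixes x :: "'k::field"
  shows "fps_of_poly (\<Prod>c<p. [:1, - of_nat c:]) * shifted_product p (fps_of_poly [:1, x:])
     = fps_of_poly (\<Prod>c<p. [:1, x - of_nat c:])"
proof -
  have lin: "fps_of_poly [:1, y:] = 1 + fps_const y * fps_X" for y :: 'k
    by (simp add: fps_of_poly_pCons mult.commute)
  have "fps_of_poly [:1, - of_nat c:] * fps_shift_arg c (fps_of_poly [:1, x:]) = fps_of_poly [:1, x - of_nat c:]" for c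
  proof -
    have "fps_of_poly [:1, - of_nat c:] * fps_shift_arg c (fps_of_poly [:1, x:])
       = (1 - of_nat c * fps_X) + fps_const x * ((1 - of_nat c * fps_X) * shift_var c)"
      by (simp add: lin fps_shift_arg_simps fps_shift_arg_1 fps_shift_arg_mult fps_shift_arg_const
          fps_shift_arg_X fps_of_nat[symmetric] algebra_simps fps_const_neg[symmetric] del: fps_const_neg)
    also have "\<dots> = fps_of_poly [:1, x - of_nat c:]"
      unfolding shift_var_eq lin by (simp add: fps_of_nat[symmetric] algebra_simps fps_const_sub[symmetric] del: fps_const_sub)
    finally show ?thesis .
  qed
  then show ?thesis
    by (simp add: fps_of_poly_prod shifted_product_eq_prod prod.distrib[symmetric])
qed

lemma fps_of_poly_denominator_nonzero: "fps_of_poly (\<Prod>c<p. [:1, - of_nat c:]) \<noteq> (0 :: 'k::field fps)"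
proof -
  have "poly (\<Prod>c<p. [:1, - of_nat c:]) 0 = (1 :: 'k)"
    by (simp add: poly_prod)
  then show ?thesis by (metis fps_of_poly_eq_iff fps_of_poly_0 poly_0 zero_neq_one)
qed

lemma of_nat_mod_CHAR: "of_nat (n mod CHAR('k)) = (of_nat n :: 'k::semiring_1)"
proof -
  have "of_nat n = of_nat (n div CHAR('k)) * of_nat CHAR('k) + (of_nat (n mod CHAR('k)) :: 'k)"
    by (metis div_mult_mod_eq of_nat_add of_nat_mult)
  then show ?thesis by simp
qed

text \<open>Translation by an element of the prime field permutes the residues c, so after clearing
  denominators numerator and denominator are the same product.\<close>

lemma restricted_linear:
  assumes "x \<in> (prime_subfield :: 'k::field set)"
  shows "restricted_series (fps_of_poly [:1, x:])"
proof -
  let ?p = "CHAR('k)"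
  obtain n where n: "x = of_nat n" "n < ?p" using assms by (auto simp: prime_subfield_def)
  define k where "k = ?p - n"
  have k: "n + k = ?p" using n(2) by (simp add: k_def)
  have p0: "of_nat k = (- of_nat n :: 'k)"
    using n(2) by (simp add: k_def of_nat_diff)
  have "(\<Prod>c<?p. [:1, x - of_nat c:]) = (\<Prod>c<?p. [:1, - of_nat c:])"
  proof (rule prod.reindex_bij_witness[of _ "\<lambda>c. (c + n) mod ?p" "\<lambda>c. (c + k) mod ?p"])
    fix c assume "c \<in> {..<?p}"
    moreover have "c + k + n = c + ?p" "c + n + k = c + ?p" using k by simp_all
    ultimately show "((c + k) mod ?p + n) mod ?p = c" "((c + n) mod ?p + k) mod ?p = c"
      by (simp_all only: mod_add_left_eq) simp_all
    show "[:1, - of_nat ((c + k) mod ?p):] = [:1, x - of_nat c:]"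
      by (simp add: of_nat_mod_CHAR p0 n(1))
  qed (use n(2) in auto)
  then have "fps_of_poly (\<Prod>c<?p. [:1, - of_nat c:]) * shifted_product ?p (fps_of_poly [:1, x:])
     = fps_of_poly (\<Prod>c<?p. [:1, - of_nat c:]) * 1"
    by (simp add: shifted_product_linear)
  then show ?thesis
    unfolding restricted_series_def using fps_of_poly_denominator_nonzero by (metis mult_cancel_left)
qed

lemma restricted_prod_linear:
  assumes "\<And>s. s \<in> set ss \<Longrightarrow> x s \<in> (prime_subfield :: 'k::field set)"
  shows "restricted_series (fps_of_poly (\<Prod>s\<leftarrow>ss. [:1, x s:]))"
  using assms
proof (induction ss)
  case Nil
  show ?case by (simp add: restricted_series_def shifted_product_1)
next
  case (Cons s ss)
  then show ?case
    using restricted_linear[of "x s"] by (simp add: restricted_series_def fps_of_poly_mult shifted_product_mult del: mult_pCons_left)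
qed

lemma words_commute:
  assumes "x \<in> words yscal f k n" and "\<And>i. 0 < i \<Longrightarrow> z * f i = f i * z"
  shows "z * x = x * (z :: 'k::field yangian)"
  using assms(1)
proof (induction rule: words_induct)
  case (scal c)
  show ?case by (rule yscal.sc_comm[symmetric])
next
  case (letter n x i)
  then show ?case using assms(2)[of i] by (metis mult.assoc)
qed (auto simp: distrib_left distrib_right)

lemma of_nat_yangian: "of_nat n = (yscal (of_nat n) :: 'k::field yangian)"
  by (induction n) (simp_all add: yscal.sc_0 yscal.sc_1 yscal.sc_add)

lemma yangian_CHAR: "of_nat CHAR('k) = (0 :: 'k::field yangian)"
  by (simp add: of_nat_yangian yscal.sc_0)

definition restricted_ideal :: "'k::field yangian set" where
  "restricted_ideal = two_sided_ideal {y * z | y z. z \<in> p_center_plus}"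

lemma p_center_gens_restricted_ideal: "g \<in> p_center_gens \<Longrightarrow> g \<in> (restricted_ideal :: 'k::field yangian set)"
proof -
  assume "g \<in> p_center_gens"
  have "yscal 1 * g \<in> p_center_plus"
    using p_center_plus.gen[OF p_center.scal \<open>g \<in> p_center_gens\<close>] .
  then have "g \<in> p_center_plus" by (simp add: yscal.sc_1)
  then have "1 * (1 * g) * 1 \<in> restricted_ideal"
    unfolding restricted_ideal_def by (intro two_sided_ideal.gen) blast
  then show ?thesis by simp
qed

lemma restricted_yangian_abs_eq_iff:
  "abs_restricted_yangian x = abs_restricted_yangian y \<longleftrightarrow> x - y \<in> restricted_ideal"
  unfolding restricted_ideal_def by (rule restricted_yangian.abs_eq_iff)

lemma abs_rep_restricted_yangian: "abs_restricted_yangian (rep_restricted_yangian x) = x"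
  by (rule Quotient3_abs_rep[OF Quotient3_restricted_yangian])

locale restricted_weights = weights a b m for a b :: "nat \<Rightarrow> 'k::field" and m +
  assumes a_prime: "a s \<in> prime_subfield" and b_prime: "b s \<in> prime_subfield"
begin

lemma CHAR_prime: "prime CHAR('k)"
  using m_less[of 0] by (intro prime_CHAR_semidom) simp

definition act :: "nat list \<Rightarrow> 'k yangian \<Rightarrow> 'k state \<Rightarrow> 'k state" where
  "act ss y = app_lop (lop.yangian_eval (chain_lop ss) y)"

definition vacuum_ideal :: "nat list \<Rightarrow> 'k yangian set" where
  "vacuum_ideal ss = {y. act ss y vacuum = 0}"

definition hw1 :: "nat list \<Rightarrow> 'k poly" where "hw1 ss = (\<Prod>s\<leftarrow>ss. [:1, a s:])"
definition hw2 :: "nat list \<Rightarrow> 'k poly" where "hw2 ss = (\<Prod>s\<leftarrow>ss. [:1, b s:])"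

context
  fixes ss :: "nat list"
  assumes ss: "compatible ss"
begin

lemma ss_distinct: "distinct ss"
  using ss by (simp add: compatible_def)

lemmas eval_hom = lop.yangian_eval_hom[OF rtt_chain[OF ss_distinct]]

lemma act_simps:
  "act ss (x + y) \<psi> = act ss x \<psi> + act ss y \<psi>" "act ss (x * y) \<psi> = act ss x (act ss y \<psi>)"
  "act ss (x - y) \<psi> = act ss x \<psi> - act ss y \<psi>" "act ss (- x) \<psi> = - act ss x \<psi>"
  "act ss 0 \<psi> = 0" "act ss 1 \<psi> = \<psi>" "act ss (yscal c) \<psi> = scale_state c \<psi>"
  "act ss (yt i j r) \<psi> = chain_op ss i j r \<psi>"
  "act ss x (\<psi> + \<phi>) = act ss x \<psi> + act ss x \<phi>" "act ss x (scale_state c \<psi>) = scale_state c (act ss x \<psi>)"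
  "act ss x 0 = 0"
  by (simp_all add: act_def eval_hom app_lop_simps app_chain_lop app_lop_add app_lop_scale app_lop_zero)

lemma act_sum: "act ss (\<Sum>i\<in>A. x i) \<psi> = (\<Sum>i\<in>A. act ss (x i) \<psi>)"
  by (induction A rule: infinite_finite_induct) (simp_all add: act_simps)

lemma act_box: "\<psi> \<in> box_states m ss \<Longrightarrow> act ss y \<psi> \<in> box_states m ss"
proof -
  have "y \<in> {y. \<forall>\<psi>\<in>box_states m ss. act ss y \<psi> \<in> box_states m ss}"
    by (rule Y.generated) (auto simp: act_simps box_states_add box_states_scale chain_op_box_states)
  then show "\<psi> \<in> box_states m ss \<Longrightarrow> act ss y \<psi> \<in> box_states m ss" by blast
qed

lemma left_ideal_vacuum: "left_ideal (vacuum_ideal ss)"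
  by (auto simp: left_ideal_def vacuum_ideal_def act_simps)

lemma e_vacuum_ideal:
  "\<forall>r. act ss (yt 1 2 r) \<psi> = 0 \<Longrightarrow> act ss (fps_nth e_series r) \<psi> = 0"
  by (simp add: e_series_def fps_mult_nth act_sum act_simps(2) act_simps(11) yt_series_def)

lemma d1_vacuum: "act ss (fps_nth (d_series 1) r) vacuum = scale_state (coeff (hw1 ss) r) vacuum"
  by (simp add: d_series_def yt_series_def act_simps chain_op_vacuum[OF ss_distinct] hw1_def)

lemma e_vacuum: "act ss (fps_nth e_series r) vacuum = 0"
  by (rule e_vacuum_ideal) (simp add: act_simps chain_op_vacuum[OF ss_distinct])

lemma d2_vacuum: "act ss (fps_nth (d_series 2) r) vacuum = scale_state (coeff (hw2 ss) r) vacuum"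
proof -
  have "act ss (fps_nth (f_series * yt_series 1 1 * e_series) r) vacuum = 0"
    by (simp add: fps_mult_nth[of "f_series * yt_series 1 1"] act_sum act_simps(2,11) e_vacuum)
  then show ?thesis
    by (simp add: d_series_def act_simps yt_series_def chain_op_vacuum[OF ss_distinct] hw2_def)
qed

lemma highest_weight_vacuum: "Y.highest_weight_ideal (vacuum_ideal ss) (coeff (hw1 ss)) (coeff (hw2 ss))"
  unfolding Y.highest_weight_ideal_def Y_series
  by (simp add: left_ideal_vacuum) (simp add: vacuum_ideal_def act_simps d1_vacuum d2_vacuum e_vacuum)

lemma cyclic: "\<psi> \<in> box_states m ss \<Longrightarrow> \<exists>y. \<psi> = act ss y vacuum"
proof -
  define K where "K = {act ss y vacuum | y. True}"
  have KI: "act ss y vacuum \<in> K" for y by (auto simp: K_def)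
  have "K = box_states m ss"
  proof (rule chain_simple[OF ss])
    show "K \<subseteq> box_states m ss" using act_box[OF vacuum_in_box] by (auto simp: K_def)
    show "0 \<in> K" using KI[of 0] by (simp add: act_simps)
    show "x + y \<in> K" if "x \<in> K" "y \<in> K" for x y
      using that KI by (auto simp: K_def act_simps(1)[symmetric])
    show "scale_state c x \<in> K" if "x \<in> K" for c x
      using that KI by (auto simp: K_def act_simps(7,2)[symmetric] simp del: act_simps)
    show "chain_op ss i j r x \<in> K" if "x \<in> K" for i j r x
      using that KI by (auto simp: K_def act_simps(8,2)[symmetric] simp del: act_simps)
    show "vacuum \<in> K" using KI[of 1] by (simp add: act_simps)
    show "(vacuum :: 'k state) \<noteq> 0" by (auto simp: basis_state_def fun_eq_iff state_apply)
  qed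
  then show "\<psi> \<in> box_states m ss \<Longrightarrow> \<exists>y. \<psi> = act ss y vacuum" by (auto simp: K_def)
qed

lemma act_zero_of_commute:
  assumes "\<And>i. 0 < i \<Longrightarrow> z * fps_nth f_series i = fps_nth f_series i * z"
    and "act ss z vacuum = 0" and \<psi>: "\<psi> \<in> box_states m ss"
  shows "act ss z \<psi> = 0"
proof -
  obtain y where y: "\<psi> = act ss y vacuum" using cyclic[OF \<psi>] by blast
  obtain k w where w: "w \<in> words yscal (fps_nth f_series) k 0" "y - w \<in> vacuum_ideal ss"
    using Y.triangular_decomposition[OF highest_weight_vacuum, of y] unfolding Y_series by blast
  have "act ss y vacuum = act ss w vacuum"
    using w(2) by (simp add: vacuum_ideal_def act_simps)
  then have "act ss z \<psi> = act ss (z * w) vacuum" by (simp add: y act_simps)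
  also have "z * w = w * z" by (rule words_commute[OF w(1) assms(1)])
  finally show ?thesis by (simp add: act_simps assms(2))
qed

lemma eigen_shifted_product:
  assumes "\<And>r. act ss (fps_nth x r) vacuum = scale_state (fps_nth l r) vacuum"
  shows "act ss (fps_nth (shifted_product p x) r) vacuum = scale_state (fps_nth (shifted_product p l) r) vacuum"
proof -
  define eigen where "eigen x l \<longleftrightarrow> (\<forall>r. act ss (fps_nth x r) vacuum = scale_state (fps_nth l r) vacuum)" for x l
  have sum: "(\<Sum>i\<in>A. scale_state (c i) v) = scale_state (\<Sum>i\<in>A. c i) v" for A :: "nat set" and c and v :: "'k state"
    by (induction A rule: infinite_finite_induct) (simp_all add: scale_state_simps)
  have mult: "eigen (x * y) (l * k)" if "eigen x l" "eigen y k" for x y l k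
    using that unfolding eigen_def
    by (simp add: fps_mult_nth act_sum act_simps scale_state_simps sum mult.commute[of "fps_nth k _"])
  have shift: "eigen (fps_shift_arg c x) (fps_shift_arg c l)" for c
    unfolding eigen_def
  proof
    fix r
    have "\<forall>i. \<exists>m. fps_nth (shift_var c ^ i) r = (of_nat m :: 'k yangian) \<and> fps_nth (shift_var c ^ i) r = (of_nat m :: 'k)"
      by (intro allI shift_var_power_of_nat_uniform)
    from choice[OF this] obtain n where n: "\<And>i. fps_nth (shift_var c ^ i) r = (of_nat (n i) :: 'k yangian)"
      "\<And>i. fps_nth (shift_var c ^ i) r = (of_nat (n i) :: 'k)" by blast
    have "act ss (of_nat k) \<psi> = scale_state (of_nat k) \<psi>" for k \<psi>
      by (simp add: of_nat_yangian act_simps)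
    then show "act ss (fps_nth (fps_shift_arg c x) r) vacuum = scale_state (fps_nth (fps_shift_arg c l) r) vacuum"
      by (simp add: fps_shift_arg_nth n act_sum act_simps assms scale_state_simps sum mult.commute)
  qed
  have "eigen (prod_list (map (\<lambda>c. fps_shift_arg c x) cs)) (prod_list (map (\<lambda>c. fps_shift_arg c l) cs))" for cs
  proof (induction cs)
    case Nil
    show ?case by (auto simp: eigen_def act_simps scale_state_simps)
  qed (simp add: mult shift)
  then show ?thesis by (simp add: eigen_def shifted_product_def)
qed

text \<open>In f(u) = t_21(u) d_1(u)^(-1) the outer factor t_21 raises the total exponent.\<close>

lemma f_series_origin: "act ss (fps_nth f_series r) \<psi> (\<lambda>_. 0) = 0"
  by (simp add: f_series_def fps_mult_nth act_sum act_simps yt_series_def state_apply chain_op_21_origin)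

text \<open>The p-th power commutes with e(u), so it sends the vacuum to a singular vector, which
  \<open>singular_support\<close> confines to the origin. Its value there is 0 because the image of
  f^(r) has no component at the origin.\<close>

lemma f_power_vacuum:
  assumes "0 < r"
  shows "act ss (fps_nth f_series r ^ CHAR('k)) vacuum = 0"
proof -
  let ?p = "CHAR('k)"
  define z where "z = fps_nth (f_series :: 'k yangian fps) r ^ ?p"
  define \<phi> where "\<phi> = act ss z vacuum"
  have e: "act ss (fps_nth e_series s) \<phi> = 0" for s
  proof (cases "s = 0")
    case False
    then have "z * fps_nth e_series s = fps_nth e_series s * z"
      using Y.f_power_e[OF CHAR_prime yangian_CHAR assms] unfolding Y_series z_def by simp
    then have "act ss (fps_nth e_series s) \<phi> = act ss z (act ss (fps_nth e_series s) vacuum)"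
      unfolding \<phi>_def by (metis act_simps(2))
    then show ?thesis by (simp add: e_vacuum act_simps)
  qed (simp add: Y.e_f_0[unfolded Y_series] act_simps)
  have 12: "chain_op ss 1 2 s \<phi> = 0" for s
  proof -
    have "(yt 1 2 s :: 'k yangian) = fps_nth (d_series 1 * e_series) s"
      using Y.T_12 unfolding Y_series by (metis Abs_fps_inverse UNIV_I fps_nth_Abs_fps yt_series_def)
    then have "act ss (yt 1 2 s) \<phi> = 0"
      by (simp add: fps_mult_nth act_sum act_simps(2) e act_simps(11))
    then show ?thesis by (simp add: act_simps)
  qed
  have box: "\<phi> \<in> box_states m ss" unfolding \<phi>_def by (rule act_box[OF vacuum_in_box])
  have "\<phi> \<kappa> = 0" for \<kappa>
  proof (rule ccontr)
    assume nz: "\<phi> \<kappa> \<noteq> 0"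
    then have \<kappa>: "\<kappa> \<in> box m ss" using box by (auto simp: box_states_def)
    have "\<kappa> s = 0" if "s \<in> set ss" for s
    proof (rule singular_support[where ss = ss and m = m and \<psi> = \<phi> and \<kappa> = \<kappa> and i = s])
      show "\<forall>s\<in>set ss. \<kappa> s \<le> m s" if "\<phi> \<kappa> \<noteq> 0" for \<kappa>
        using that box by (auto simp: box_states_def box_def)
      show "sorted_wrt (\<lambda>s j. \<forall>k<m s. b j \<noteq> a s - of_nat k) ss"
        by (rule sorted_wrt_mono_rel[rotated], rule ss[unfolded compatible_def, THEN conjunct2]) simp
    qed (use ss_distinct nz that coefficients_nonzero in \<open>auto simp: 12 state_apply\<close>)
    then have "\<kappa> = (\<lambda>_. 0)" using \<kappa> by (auto simp: box_def fun_eq_iff)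
    moreover have "\<phi> (\<lambda>_. 0) = 0"
    proof -
      obtain q where "?p = Suc q" using CHAR_prime by (cases ?p) auto
      then show ?thesis by (simp add: \<phi>_def z_def act_simps f_series_origin)
    qed
    ultimately show False using nz by simp
  qed
  then show ?thesis by (simp add: \<phi>_def z_def fun_eq_iff state_apply)
qed

lemma act_p_center_gens:
  assumes "g \<in> p_center_gens" "\<psi> \<in> box_states m ss"
  shows "act ss g \<psi> = 0"
proof -
  let ?p = "CHAR('k)"
  have p: "?p > 0" using CHAR_prime prime_gt_0_nat by blast
  consider i r where "g = fps_nth (b_series i) (r * ?p)" "0 < r"
    | r where "g = fps_nth e_series r ^ ?p" "0 < r" | r where "g = fps_nth f_series r ^ ?p" "0 < r"
    using assms(1) by (auto simp: p_center_gens_def)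
  then show ?thesis
  proof cases
    case (1 i r)
    have nz: "r * ?p \<noteq> 0" using 1 p by simp
    have "z = 0 \<Longrightarrow> scale_state z (v :: 'k state) = 0" for z v by (simp add: scale_state_simps)
    have "act ss (fps_nth (shifted_product ?p (d_series 1)) (r * ?p)) vacuum = 0"
      "act ss (fps_nth (shifted_product ?p (d_series 2)) (r * ?p)) vacuum = 0"
      using restricted_prod_linear[of ss a] restricted_prod_linear[of ss b] a_prime b_prime nz
      by (subst eigen_shifted_product[where l = "fps_of_poly (hw1 ss)"],
          simp_all add: d1_vacuum restricted_series_def hw1_def[symmetric] scale_state_simps)
         (subst eigen_shifted_product[where l = "fps_of_poly (hw2 ss)"],
          simp_all add: d2_vacuum restricted_series_def hw2_def[symmetric] scale_state_simps)
    moreover have "i = 1 \<or> i = 2" using exhaust_2 by blast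
    ultimately show ?thesis
      using Y.d1_shifted_product_f[OF _ yangian_CHAR, of _ "r * ?p"] Y.d2_shifted_product_f[OF _ yangian_CHAR, of _ "r * ?p"]
      unfolding Y_series 1 b_series_def by (intro act_zero_of_commute[OF _ _ assms(2)]) auto
  next
    case (2 r)
    obtain q where q: "?p = Suc q" using p by (cases ?p) auto
    have "act ss g vacuum = 0"
      unfolding 2 q power_Suc2 by (simp add: act_simps e_vacuum)
    then show ?thesis
      using Y.e_power_f[OF CHAR_prime yangian_CHAR 2(2)] unfolding Y_series 2
      by (intro act_zero_of_commute[OF _ _ assms(2)]) auto
  next
    case (3 r)
    show ?thesis
      using Y.f_power_f[OF CHAR_prime yangian_CHAR 3(2)] f_power_vacuum[OF 3(2)] unfolding Y_series 3
      by (intro act_zero_of_commute[OF _ _ assms(2)]) auto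
  qed
qed

lemma act_restricted_ideal:
  assumes "x \<in> restricted_ideal" "\<psi> \<in> box_states m ss"
  shows "act ss x \<psi> = 0"
proof -
  have plus: "act ss z \<psi> = 0" if "z \<in> p_center_plus" "\<psi> \<in> box_states m ss" for z \<psi>
    using that by (induction rule: p_center_plus.induct) (auto simp: act_simps act_p_center_gens)
  show ?thesis
    using assms(1) unfolding restricted_ideal_def
    by (induction rule: two_sided_ideal.induct) (auto simp: act_simps plus act_box assms(2))
qed

end

definition ract :: "nat list \<Rightarrow> 'k restricted_yangian \<Rightarrow> 'k state \<Rightarrow> 'k state" where
  "ract ss x = act ss (rep_restricted_yangian x)"

lemma ract_abs:
  assumes "compatible ss" "\<psi> \<in> box_states m ss"
  shows "ract ss (abs_restricted_yangian y) \<psi> = act ss y \<psi>"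
proof -
  have "rep_restricted_yangian (abs_restricted_yangian y) - y \<in> restricted_ideal"
    by (simp add: restricted_yangian_abs_eq_iff[symmetric] abs_rep_restricted_yangian)
  from act_restricted_ideal[OF assms(1) this assms(2)] show ?thesis
    by (simp add: ract_def act_simps[OF assms(1)])
qed

lemma ract_simps:
  assumes "compatible ss" "\<psi> \<in> box_states m ss"
  shows "ract ss (x + y) \<psi> = ract ss x \<psi> + ract ss y \<psi>" "ract ss (x * y) \<psi> = ract ss x (ract ss y \<psi>)"
    "ract ss 1 \<psi> = \<psi>" "ract ss 0 \<psi> = 0" "ract ss (rscal c) \<psi> = scale_state c \<psi>"
    "ract ss (rt i j r) \<psi> = chain_op ss i j r \<psi>" "ract ss x \<psi> \<in> box_states m ss"
    "ract ss (- x) \<psi> = - ract ss x \<psi>" "ract ss (x - y) \<psi> = ract ss x \<psi> - ract ss y \<psi>"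
proof -
  note abs = ract_abs[OF assms(1)] and box = act_box[OF assms(1)]
  obtain x' y' where xy: "x = abs_restricted_yangian x'" "y = abs_restricted_yangian y'"
    by (metis abs_rep_restricted_yangian)
  show "ract ss (x + y) \<psi> = ract ss x \<psi> + ract ss y \<psi>" "ract ss (x * y) \<psi> = ract ss x (ract ss y \<psi>)"
    "ract ss x \<psi> \<in> box_states m ss" "ract ss (- x) \<psi> = - ract ss x \<psi>"
    "ract ss (x - y) \<psi> = ract ss x \<psi> - ract ss y \<psi>"
    using assms(2) by (simp_all add: xy plus_restricted_yangian.abs_eq times_restricted_yangian.abs_eq
        minus_restricted_yangian.abs_eq uminus_restricted_yangian.abs_eq abs box act_simps[OF assms(1)])
  show "ract ss 1 \<psi> = \<psi>" "ract ss 0 \<psi> = 0" "ract ss (rscal c) \<psi> = scale_state c \<psi>"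
    "ract ss (rt i j r) \<psi> = chain_op ss i j r \<psi>"
    using assms(2) by (simp_all add: one_restricted_yangian_def zero_restricted_yangian_def rscal.abs_eq rt.abs_eq
        abs act_simps[OF assms(1)])
qed

lemma ract_right:
  assumes "compatible ss"
  shows "ract ss x (\<psi> + \<phi>) = ract ss x \<psi> + ract ss x \<phi>" "ract ss x 0 = 0"
    "ract ss x (scale_state c \<psi>) = scale_state c (ract ss x \<psi>)"
  by (simp_all add: ract_def act_simps[OF assms])

end

section \<open>Modules and simple quotients\<close>

lemma left_submodule_simps:
  assumes "left_submodule N M"
  shows "N \<subseteq> carrier M" "\<zero>\<^bsub>M\<^esub> \<in> N" "x \<in> N \<Longrightarrow> y \<in> N \<Longrightarrow> x \<oplus>\<^bsub>M\<^esub> y \<in> N" "x \<in> N \<Longrightarrow> a \<odot>\<^bsub>M\<^esub> x \<in> N"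
  using assms by (auto simp: left_submodule_def additive_subgroup.zero_closed additive_subgroup.a_closed
      dest: additive_subgroup.a_subset)

context left_module
begin

lemma smult_zero_left: "x \<in> carrier M \<Longrightarrow> 0 \<odot> x = \<zero>"
proof -
  assume x: "x \<in> carrier M"
  have "0 \<odot> x \<oplus> 0 \<odot> x = 0 \<odot> x" using smult_l_distr[OF x, of 0 0] by simp
  then show ?thesis using add.l_cancel_one'[of "0 \<odot> x" "0 \<odot> x"] smult_closed[OF x] by metis
qed

lemma smult_minus_one: "x \<in> carrier M \<Longrightarrow> (- 1) \<odot> x = \<ominus> x"
proof -
  assume x: "x \<in> carrier M"
  have "(- 1) \<odot> x \<oplus> 1 \<odot> x = \<zero>" using smult_l_distr[OF x, of "- 1" 1] smult_zero_left[OF x] by simp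
  then show ?thesis using x by (simp add: smult_one smult_closed minus_equality)
qed

lemma left_submoduleI:
  assumes "N \<subseteq> carrier M" "\<zero> \<in> N" "\<And>x y. x \<in> N \<Longrightarrow> y \<in> N \<Longrightarrow> x \<oplus> y \<in> N"
    "\<And>a x. x \<in> N \<Longrightarrow> a \<odot> x \<in> N"
  shows "left_submodule N M"
proof -
  have "\<ominus> x \<in> N" if "x \<in> N" for x
    using smult_minus_one[of x] that assms(1) assms(4)[of x "- 1"] by auto
  then have "additive_subgroup N M"
    using assms by (intro additive_subgroup.intro) (unfold_locales, auto simp: a_inv_def)
  then show ?thesis using assms by (simp add: left_submodule_def)
qed

lemma carrier_submodule: "left_submodule (carrier M) M"
  by (rule left_submoduleI) (auto simp: smult_closed)

lemma generated_submodule_submodule: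
  assumes "S \<subseteq> carrier M"
  shows "left_submodule (generated_submodule M S) M" "S \<subseteq> generated_submodule M S"
    "left_submodule N M \<Longrightarrow> S \<subseteq> N \<Longrightarrow> generated_submodule M S \<subseteq> N"
proof -
  show "left_submodule (generated_submodule M S) M"
  proof (rule left_submoduleI)
    show "generated_submodule M S \<subseteq> carrier M"
      unfolding generated_submodule_def using carrier_submodule assms by (intro Inter_lower) simp
  qed (auto simp: generated_submodule_def left_submodule_simps)
qed (auto simp: generated_submodule_def)

end

text \<open>Additive inverses are obtained from the scalar -1, which is why the action of 0 appears
  among the premises.\<close>

lemma left_moduleI:
  fixes M :: "('r::{ring, monoid_mult}, 'v) module" (structure)
  assumes "\<And>x y. x \<in> carrier M \<Longrightarrow> y \<in> carrier M \<Longrightarrow> x \<oplus> y \<in> carrier M" "\<zero> \<in> carrier M"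
    "\<And>x y z. x \<in> carrier M \<Longrightarrow> y \<in> carrier M \<Longrightarrow> z \<in> carrier M \<Longrightarrow> (x \<oplus> y) \<oplus> z = x \<oplus> (y \<oplus> z)"
    "\<And>x y. x \<in> carrier M \<Longrightarrow> y \<in> carrier M \<Longrightarrow> x \<oplus> y = y \<oplus> x"
    "\<And>x. x \<in> carrier M \<Longrightarrow> \<zero> \<oplus> x = x"
    "\<And>x a. x \<in> carrier M \<Longrightarrow> a \<odot> x \<in> carrier M"
    "\<And>x a b. x \<in> carrier M \<Longrightarrow> (a + b) \<odot> x = a \<odot> x \<oplus> b \<odot> x"
    "\<And>x y a. x \<in> carrier M \<Longrightarrow> y \<in> carrier M \<Longrightarrow> a \<odot> (x \<oplus> y) = a \<odot> x \<oplus> a \<odot> y"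
    "\<And>x a b. x \<in> carrier M \<Longrightarrow> (a * b) \<odot> x = a \<odot> (b \<odot> x)" "\<And>x. x \<in> carrier M \<Longrightarrow> 1 \<odot> x = x"
    and zero: "\<And>x. x \<in> carrier M \<Longrightarrow> 0 \<odot> x = \<zero>"
  shows "left_module M"
proof (intro left_module.intro left_module_axioms.intro)
  show "abelian_group M"
  proof (rule abelian_groupI)
    fix x assume x: "x \<in> carrier M"
    have "(- 1) \<odot> x \<oplus> x = \<zero>"
      using assms(7)[OF x, of "- 1" 1] assms(10)[OF x] zero[OF x] by simp
    then show "\<exists>y\<in>carrier M. y \<oplus> x = \<zero>" using assms(6)[OF x] by blast
  qed (use assms in auto)
qed (use assms in auto)

lemma left_module_transport:
  assumes P: "left_module P" and bij: "bij_betw \<theta> (carrier M) (carrier P)"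
    and add: "\<And>x y. x \<in> carrier M \<Longrightarrow> y \<in> carrier M \<Longrightarrow> x \<oplus>\<^bsub>M\<^esub> y \<in> carrier M \<and> \<theta> (x \<oplus>\<^bsub>M\<^esub> y) = \<theta> x \<oplus>\<^bsub>P\<^esub> \<theta> y"
    and zero: "\<zero>\<^bsub>M\<^esub> \<in> carrier M" "\<theta> \<zero>\<^bsub>M\<^esub> = \<zero>\<^bsub>P\<^esub>"
    and smult: "\<And>a x. x \<in> carrier M \<Longrightarrow> a \<odot>\<^bsub>M\<^esub> x \<in> carrier M \<and> \<theta> (a \<odot>\<^bsub>M\<^esub> x) = a \<odot>\<^bsub>P\<^esub> \<theta> x"
  shows "left_module M"
proof -
  interpret P: left_module P by (rule P)
  have eq: "x = y" if "x \<in> carrier M" "y \<in> carrier M" "\<theta> x = \<theta> y" for x y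
    using bij that by (auto simp: bij_betw_def inj_on_def)
  have c: "\<theta> x \<in> carrier P" if "x \<in> carrier M" for x using bij that by (auto simp: bij_betw_def)
  show ?thesis
    by (rule left_moduleI; (rule eq)?)
       (auto simp: add zero smult c P.a_ac P.smult_l_distr P.smult_r_distr P.smult_assoc P.smult_one P.smult_zero_left)
qed

lemma a_r_coset_simps:
  assumes "left_module M" "left_submodule N M" "x \<in> carrier M" "y \<in> carrier M"
  shows "(N +>\<^bsub>M\<^esub> x) <+>\<^bsub>M\<^esub> (N +>\<^bsub>M\<^esub> y) = N +>\<^bsub>M\<^esub> (x \<oplus>\<^bsub>M\<^esub> y)"
    and "N +>\<^bsub>M\<^esub> x = N +>\<^bsub>M\<^esub> y \<longleftrightarrow> x \<ominus>\<^bsub>M\<^esub> y \<in> N"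
    and "x \<in> N +>\<^bsub>M\<^esub> x" and "z \<in> N +>\<^bsub>M\<^esub> x \<Longrightarrow> z \<in> carrier M \<and> N +>\<^bsub>M\<^esub> z = N +>\<^bsub>M\<^esub> x"
proof -
  interpret left_module M by (rule assms(1))
  interpret N: additive_subgroup N M using assms(2) by (simp add: left_submodule_def)
  interpret S: abelian_subgroup N M by (rule abelian_subgroupI3) unfold_locales
  show "(N +>\<^bsub>M\<^esub> x) <+>\<^bsub>M\<^esub> (N +>\<^bsub>M\<^esub> y) = N +>\<^bsub>M\<^esub> (x \<oplus>\<^bsub>M\<^esub> y)"
    by (rule S.a_rcos_sum[OF assms(3,4)])
  show self: "x \<in> N +>\<^bsub>M\<^esub> x" by (rule S.a_rcos_self[OF assms(3)])
  show rep: "z \<in> N +>\<^bsub>M\<^esub> x \<Longrightarrow> z \<in> carrier M \<and> N +>\<^bsub>M\<^esub> z = N +>\<^bsub>M\<^esub> x" for z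
    using S.a_repr_independence'[OF _ assms(3)] S.a_elemrcos_carrier[OF assms(3)] by blast
  show "N +>\<^bsub>M\<^esub> x = N +>\<^bsub>M\<^esub> y \<longleftrightarrow> x \<ominus>\<^bsub>M\<^esub> y \<in> N"
  proof
    assume "N +>\<^bsub>M\<^esub> x = N +>\<^bsub>M\<^esub> y"
    then have "x \<in> N +>\<^bsub>M\<^esub> y" using self by simp
    then show "x \<ominus>\<^bsub>M\<^esub> y \<in> N" using S.a_rcos_module_imp[OF assms(4)] by (simp add: a_minus_def)
  next
    assume "x \<ominus>\<^bsub>M\<^esub> y \<in> N"
    then have "x \<in> N +>\<^bsub>M\<^esub> y" using S.a_rcos_module_rev[OF assms(4,3)] by (simp add: a_minus_def)
    then show "N +>\<^bsub>M\<^esub> x = N +>\<^bsub>M\<^esub> y" using S.a_repr_independence'[OF _ assms(4)] by simp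
  qed
qed

lemma quotient_module_simps:
  assumes "left_module M" "left_submodule N M"
  shows "carrier (quotient_module M N) = (\<lambda>x. N +>\<^bsub>M\<^esub> x) ` carrier M"
    and "\<zero>\<^bsub>quotient_module M N\<^esub> = N +>\<^bsub>M\<^esub> \<zero>\<^bsub>M\<^esub>"
    and "x \<in> carrier M \<Longrightarrow> y \<in> carrier M \<Longrightarrow> (N +>\<^bsub>M\<^esub> x) \<oplus>\<^bsub>quotient_module M N\<^esub> (N +>\<^bsub>M\<^esub> y) = N +>\<^bsub>M\<^esub> (x \<oplus>\<^bsub>M\<^esub> y)"
    and "x \<in> carrier M \<Longrightarrow> a \<odot>\<^bsub>quotient_module M N\<^esub> (N +>\<^bsub>M\<^esub> x) = N +>\<^bsub>M\<^esub> (a \<odot>\<^bsub>M\<^esub> x)"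
proof -
  interpret left_module M by (rule assms(1))
  note N = left_submodule_simps[OF assms(2)]
  show "carrier (quotient_module M N) = (\<lambda>x. N +>\<^bsub>M\<^esub> x) ` carrier M"
    by (auto simp: quotient_module_def A_RCOSETS_def')
  show "\<zero>\<^bsub>quotient_module M N\<^esub> = N +>\<^bsub>M\<^esub> \<zero>\<^bsub>M\<^esub>"
    using N(1) by (simp add: quotient_module_def a_coset_add_zero)
  show "x \<in> carrier M \<Longrightarrow> y \<in> carrier M \<Longrightarrow> (N +>\<^bsub>M\<^esub> x) \<oplus>\<^bsub>quotient_module M N\<^esub> (N +>\<^bsub>M\<^esub> y) = N +>\<^bsub>M\<^esub> (x \<oplus>\<^bsub>M\<^esub> y)"
    using a_r_coset_simps(1)[OF assms] by (simp add: quotient_module_def)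
  assume x: "x \<in> carrier M"
  have "N +>\<^bsub>M\<^esub> (a \<odot>\<^bsub>M\<^esub> y) = N +>\<^bsub>M\<^esub> (a \<odot>\<^bsub>M\<^esub> x)" if "y \<in> N +>\<^bsub>M\<^esub> x" for y
  proof -
    have y: "y \<in> carrier M" "y \<ominus>\<^bsub>M\<^esub> x \<in> N"
      using a_r_coset_simps(4)[OF assms x x that] a_r_coset_simps(2)[OF assms _ x, of y] by auto
    have "a \<odot>\<^bsub>M\<^esub> (y \<ominus>\<^bsub>M\<^esub> x) = a \<odot>\<^bsub>M\<^esub> y \<ominus>\<^bsub>M\<^esub> a \<odot>\<^bsub>M\<^esub> x"
    proof -
      have "a \<odot>\<^bsub>M\<^esub> (\<ominus>\<^bsub>M\<^esub> x) = \<ominus>\<^bsub>M\<^esub> (a \<odot>\<^bsub>M\<^esub> x)"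
        using smult_assoc[OF x, of a "- 1"] smult_assoc[OF x, of "- 1" a]
          smult_minus_one[OF x] smult_minus_one[OF smult_closed[OF x]] by simp
      then show ?thesis using smult_r_distr[OF y(1) a_inv_closed[OF x], of a] by (simp only: a_minus_def)
    qed
    then have "a \<odot>\<^bsub>M\<^esub> y \<ominus>\<^bsub>M\<^esub> a \<odot>\<^bsub>M\<^esub> x \<in> N" using N(4)[OF y(2), of a] by simp
    then show ?thesis using a_r_coset_simps(2)[OF assms smult_closed[OF y(1)] smult_closed[OF x]] by simp
  qed
  then have "(\<Union>y\<in>N +>\<^bsub>M\<^esub> x. N +>\<^bsub>M\<^esub> (a \<odot>\<^bsub>M\<^esub> y)) = (\<Union>y\<in>N +>\<^bsub>M\<^esub> x. N +>\<^bsub>M\<^esub> (a \<odot>\<^bsub>M\<^esub> x))"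
    by (intro SUP_cong) simp_all
  also have "\<dots> = N +>\<^bsub>M\<^esub> (a \<odot>\<^bsub>M\<^esub> x)" using a_r_coset_simps(3)[OF assms x x] by (intro SUP_const) blast
  finally show "a \<odot>\<^bsub>quotient_module M N\<^esub> (N +>\<^bsub>M\<^esub> x) = N +>\<^bsub>M\<^esub> (a \<odot>\<^bsub>M\<^esub> x)"
    by (simp add: quotient_module_def)
qed

lemma quotient_module_left_module:
  assumes "left_module M" "left_submodule N M"
  shows "left_module (quotient_module M N)"
proof -
  interpret left_module M by (rule assms(1))
  note q = quotient_module_simps[OF assms]
  show ?thesis
    by (rule left_moduleI; unfold q(1,2); (elim imageE)?)
       (auto simp: q(3,4) a_ac smult_closed smult_l_distr smult_r_distr smult_assoc smult_one smult_zero_left)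
qed

lemma quotient_module_isomorphism:
  assumes M: "left_module M" and N: "left_submodule N M" and P: "left_module P"
    and surj: "\<phi> ` carrier M = carrier P"
    and add: "\<And>x y. x \<in> carrier M \<Longrightarrow> y \<in> carrier M \<Longrightarrow> \<phi> (x \<oplus>\<^bsub>M\<^esub> y) = \<phi> x \<oplus>\<^bsub>P\<^esub> \<phi> y"
    and smult: "\<And>a x. x \<in> carrier M \<Longrightarrow> \<phi> (a \<odot>\<^bsub>M\<^esub> x) = a \<odot>\<^bsub>P\<^esub> \<phi> x"
    and ker: "\<And>x. x \<in> carrier M \<Longrightarrow> \<phi> x = \<zero>\<^bsub>P\<^esub> \<longleftrightarrow> x \<in> N"
  obtains \<psi> where "\<And>x. x \<in> carrier M \<Longrightarrow> \<psi> (N +>\<^bsub>M\<^esub> x) = \<phi> x"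
    "bij_betw \<psi> (carrier (quotient_module M N)) (carrier P)"
    "\<And>X Y. X \<in> carrier (quotient_module M N) \<Longrightarrow> Y \<in> carrier (quotient_module M N) \<Longrightarrow>
       \<psi> (X \<oplus>\<^bsub>quotient_module M N\<^esub> Y) = \<psi> X \<oplus>\<^bsub>P\<^esub> \<psi> Y"
    "\<And>a X. X \<in> carrier (quotient_module M N) \<Longrightarrow> \<psi> (a \<odot>\<^bsub>quotient_module M N\<^esub> X) = a \<odot>\<^bsub>P\<^esub> \<psi> X"
proof -
  interpret left_module M by (rule M)
  interpret P: left_module P by (rule P)
  note q = quotient_module_simps[OF M N]
  have c: "\<phi> x \<in> carrier P" if "x \<in> carrier M" for x using surj that by auto
  have eq: "\<phi> x = \<phi> y \<longleftrightarrow> N +>\<^bsub>M\<^esub> x = N +>\<^bsub>M\<^esub> y" if "x \<in> carrier M" "y \<in> carrier M" for x y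
  proof -
    have "\<phi> (x \<ominus>\<^bsub>M\<^esub> y) = \<phi> x \<ominus>\<^bsub>P\<^esub> \<phi> y"
      using that by (simp add: a_minus_def P.smult_minus_one[symmetric] smult_minus_one[symmetric] add smult smult_closed c)
    moreover have "\<phi> x \<ominus>\<^bsub>P\<^esub> \<phi> y = \<zero>\<^bsub>P\<^esub> \<longleftrightarrow> \<phi> x = \<phi> y"
      using c that by (metis P.minus_eq P.r_neg P.minus_equality P.minus_minus P.a_inv_closed)
    ultimately show ?thesis
      using ker[of "x \<ominus>\<^bsub>M\<^esub> y"] a_r_coset_simps(2)[OF M N that] that by simp
  qed
  define \<psi> where "\<psi> X = \<phi> (SOME x. x \<in> carrier M \<and> X = N +>\<^bsub>M\<^esub> x)" for X
  have \<psi>: "\<psi> (N +>\<^bsub>M\<^esub> x) = \<phi> x" if "x \<in> carrier M" for x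
  proof -
    have "\<exists>y. y \<in> carrier M \<and> N +>\<^bsub>M\<^esub> x = N +>\<^bsub>M\<^esub> y" using that by blast
    from someI_ex[OF this] show ?thesis using eq that unfolding \<psi>_def by metis
  qed
  have "bij_betw \<psi> (carrier (quotient_module M N)) (carrier P)"
  proof -
    have "\<psi> ` (\<lambda>x. N +>\<^bsub>M\<^esub> x) ` carrier M = \<phi> ` carrier M"
      by (auto simp: image_image \<psi> cong: image_cong)
    then show ?thesis unfolding bij_betw_def inj_on_def q(1) using eq surj by (auto simp: \<psi>)
  qed
  moreover have "\<psi> (X \<oplus>\<^bsub>quotient_module M N\<^esub> Y) = \<psi> X \<oplus>\<^bsub>P\<^esub> \<psi> Y"
    if "X \<in> carrier (quotient_module M N)" "Y \<in> carrier (quotient_module M N)" for X Y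
    using that unfolding q(1) by (auto simp: q(3) \<psi> add)
  moreover have "\<psi> (a \<odot>\<^bsub>quotient_module M N\<^esub> X) = a \<odot>\<^bsub>P\<^esub> \<psi> X" if "X \<in> carrier (quotient_module M N)" for a X
    using that unfolding q(1) by (auto simp: q(4) \<psi> smult smult_closed)
  ultimately show ?thesis using that \<psi> by blast
qed

lemma regular_module_simps:
  "carrier regular_module = UNIV" "x \<oplus>\<^bsub>regular_module\<^esub> y = x + y" "\<zero>\<^bsub>regular_module\<^esub> = 0"
  "a \<odot>\<^bsub>regular_module\<^esub> x = a * x"
  by (simp_all add: regular_module_def)

lemma regular_left_module: "left_module (regular_module :: ('r::{ring, monoid_mult}, 'r) module)"
  by (rule left_moduleI) (simp_all add: regular_module_simps algebra_simps)

lemma regular_minus: "x \<ominus>\<^bsub>regular_module\<^esub> y = x - (y :: 'r::{ring, monoid_mult})"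
proof -
  interpret left_module "regular_module :: ('r, 'r) module" by (rule regular_left_module)
  have "\<ominus>\<^bsub>regular_module\<^esub> y = - y"
    using smult_minus_one[of y] by (simp add: regular_module_simps)
  then show ?thesis by (simp add: a_minus_def regular_module_simps)
qed

text \<open>The correspondence theorem for R/J. Through it the maximality of a submodule of the baby
  Verma module is tested on left ideals, by whether they contain 1.\<close>

lemma regular_quotient_submodules:
  fixes J :: "'r::{ring, monoid_mult} set"
  assumes J: "left_submodule J regular_module"
  defines "Z \<equiv> quotient_module regular_module J" and "co \<equiv> \<lambda>x. J +>\<^bsub>regular_module\<^esub> x"
  shows "left_submodule L regular_module \<Longrightarrow> left_submodule (co ` L) Z"
    and "left_submodule N Z \<Longrightarrow> left_submodule {x. co x \<in> N} regular_module \<and> J \<subseteq> {x. co x \<in> N} \<and> co ` {x. co x \<in> N} = N"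
    and "left_submodule L regular_module \<Longrightarrow> J \<subseteq> L \<Longrightarrow> co x \<in> co ` L \<longleftrightarrow> x \<in> L"
proof -
  note q = quotient_module_simps[OF regular_left_module J, unfolded regular_module_simps, folded Z_def co_def, simplified]
  have co: "co x = co y \<longleftrightarrow> x - y \<in> J" for x y
    using a_r_coset_simps(2)[OF regular_left_module J, of x y] by (simp add: co_def regular_module_simps regular_minus)
  interpret Z: left_module Z unfolding Z_def by (rule quotient_module_left_module[OF regular_left_module J])
  interpret R: left_module "regular_module :: ('r, 'r) module" by (rule regular_left_module)
  note s = left_submodule_simps[of _ "regular_module :: ('r, 'r) module", unfolded regular_module_simps]
  show "left_submodule (co ` L) Z" if L: "left_submodule L regular_module" for L
    by (rule Z.left_submoduleI) (use s[OF L] in \<open>auto simp: q\<close>)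
  show "left_submodule {x. co x \<in> N} regular_module \<and> J \<subseteq> {x. co x \<in> N} \<and> co ` {x. co x \<in> N} = N"
    if N: "left_submodule N Z" for N
  proof (intro conjI)
    note n = left_submodule_simps[OF N]
    show "left_submodule {x. co x \<in> N} regular_module"
      by (rule R.left_submoduleI) (use n in \<open>auto simp: regular_module_simps q(2-4)[symmetric]\<close>)
    show "J \<subseteq> {x. co x \<in> N}"
    proof
      fix x assume "x \<in> J"
      then have "co x = co 0" by (simp add: co)
      then show "x \<in> {x. co x \<in> N}" using n(2) by (simp add: q(2))
    qed
    show "co ` {x. co x \<in> N} = N" using n(1) by (auto simp: q(1))
  qed
  show "co x \<in> co ` L \<longleftrightarrow> x \<in> L" if L: "left_submodule L regular_module" and JL: "J \<subseteq> L" for L x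
  proof
    assume "co x \<in> co ` L"
    then obtain y where y: "co x = co y" "y \<in> L" by (rule imageE)
    then have "x - y \<in> L" using co[of x y] JL by auto
    with y(2)
    have "(x - y) + y \<in> L" by (intro s(3)[OF L]) auto
    then show "x \<in> L" by simp
  qed auto
qed

lemma module_isomorphic_trans:
  assumes "module_isomorphic L M" "module_isomorphic M N"
  shows "module_isomorphic L N"
proof -
  obtain \<phi> where \<phi>: "bij_betw \<phi> (carrier L) (carrier M)"
    "\<And>x y. x \<in> carrier L \<Longrightarrow> y \<in> carrier L \<Longrightarrow> \<phi> (x \<oplus>\<^bsub>L\<^esub> y) = \<phi> x \<oplus>\<^bsub>M\<^esub> \<phi> y"
    "\<And>a x. x \<in> carrier L \<Longrightarrow> \<phi> (a \<odot>\<^bsub>L\<^esub> x) = a \<odot>\<^bsub>M\<^esub> \<phi> x"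
    using assms(1) unfolding module_isomorphic_def by blast
  obtain \<psi> where \<psi>: "bij_betw \<psi> (carrier M) (carrier N)"
    "\<And>x y. x \<in> carrier M \<Longrightarrow> y \<in> carrier M \<Longrightarrow> \<psi> (x \<oplus>\<^bsub>M\<^esub> y) = \<psi> x \<oplus>\<^bsub>N\<^esub> \<psi> y"
    "\<And>a x. x \<in> carrier M \<Longrightarrow> \<psi> (a \<odot>\<^bsub>M\<^esub> x) = a \<odot>\<^bsub>N\<^esub> \<psi> x"
    using assms(2) unfolding module_isomorphic_def by blast
  have c: "\<phi> x \<in> carrier M" if "x \<in> carrier L" for x using \<phi>(1) that by (auto simp: bij_betw_def)
  show ?thesis unfolding module_isomorphic_def
    by (rule exI[of _ "\<psi> \<circ> \<phi>"]) (auto simp: \<phi> \<psi> c intro: bij_betw_trans[OF \<phi>(1) \<psi>(1)])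
qed

context restricted_weights
begin

definition chain_module :: "nat list \<Rightarrow> ('k restricted_yangian, 'k state) module" where
  "chain_module ss = \<lparr>carrier = box_states m ss, mult = undefined, one = undefined,
      zero = 0, add = (+), smult = ract ss\<rparr>"

lemma chain_module_simps:
  "carrier (chain_module ss) = box_states m ss" "x \<oplus>\<^bsub>chain_module ss\<^esub> y = x + y"
  "\<zero>\<^bsub>chain_module ss\<^esub> = 0" "c \<odot>\<^bsub>chain_module ss\<^esub> x = ract ss c x"
  by (simp_all add: chain_module_def)

lemma chain_left_module: "compatible ss \<Longrightarrow> left_module (chain_module ss)"
  by (rule left_moduleI)
     (simp_all add: chain_module_simps box_states_add box_states_0 ract_simps ract_right algebra_simps)

context
  fixes ss :: "nat list"
  assumes ss: "compatible ss"
begin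

lemma simple_quotient_chain:
  shows "module_isomorphic (simple_quotient (fps_of_poly (hw1 ss)) (fps_of_poly (hw2 ss))) (chain_module ss)"
    and "left_module (simple_quotient (fps_of_poly (hw1 ss)) (fps_of_poly (hw2 ss)))"
proof -
  let ?R = "regular_module :: ('k restricted_yangian, 'k restricted_yangian) module"
  define S where "S = {re r | r. 0 < r}
         \<union> {rd 1 r - rscal (fps_nth (fps_of_poly (hw1 ss)) r) | r. 0 < r}
         \<union> {rd 2 r - rscal (fps_nth (fps_of_poly (hw2 ss)) r) | r. 0 < r}"
  define J where "J = generated_submodule ?R S"
  define Z where "Z = quotient_module ?R J"
  define co where "co = (\<lambda>x. J +>\<^bsub>?R\<^esub> x)"
  have Z: "baby_verma (fps_of_poly (hw1 ss)) (fps_of_poly (hw2 ss)) = Z"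
    by (simp add: baby_verma_def Z_def J_def S_def)
  interpret R: left_module ?R by (rule regular_left_module)
  have J: "left_submodule J ?R" "S \<subseteq> J"
    using R.generated_submodule_submodule[of S] by (auto simp: J_def regular_module_simps)
  note q = quotient_module_simps[OF regular_left_module J(1), unfolded regular_module_simps, folded Z_def co_def, simplified]
  note corr = regular_quotient_submodules[OF J(1), folded Z_def co_def]
  note s = left_submodule_simps[of _ ?R, unfolded regular_module_simps]
  note sI = R.left_submoduleI[unfolded regular_module_simps, simplified]
  have vac: "vacuum \<in> box_states m ss" by (rule vacuum_in_box)
  note rs = ract_simps[OF ss vac]
  define L where "L = {x. ract ss x vacuum = 0}"
  have L: "left_submodule L ?R"
    by (rule sI) (auto simp: L_def rs ract_right[OF ss])
  have SL: "S \<subseteq> L"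
  proof -
    have "re r = (abs_restricted_yangian (fps_nth e_series r) :: 'k restricted_yangian)"
      "rd i r = (abs_restricted_yangian (fps_nth (d_series i) r) :: 'k restricted_yangian)" for i r
      by (simp_all add: re.abs_eq rd.abs_eq)
    then show ?thesis
      by (auto simp: S_def L_def minus_restricted_yangian.abs_eq rscal.abs_eq ract_abs[OF ss vac] act_simps[OF ss]
          e_vacuum[OF ss] d1_vacuum[OF ss] d2_vacuum[OF ss])
  qed
  have JL: "J \<subseteq> L"
    unfolding J_def using R.generated_submodule_submodule(3)[OF _ L SL] by (simp add: regular_module_simps)
  have surj: "\<exists>x. ract ss x vacuum = \<psi>" if "\<psi> \<in> box_states m ss" for \<psi>
    using cyclic[OF ss that] ract_abs[OF ss vac] by metis
  have vac0: "(vacuum :: 'k state) \<noteq> 0" by (auto simp: basis_state_def fun_eq_iff state_apply)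
  have one_L: "1 \<notin> L" using vac0 by (simp add: L_def rs)
  \<comment> \<open>If some element of K moves the vacuum to a nonzero vector, the image of the
    vacuum under K is a nonzero submodule, hence everything. So some y in K fixes the vacuum, and 1
    - y lies in L.\<close>
  have max: "K = L \<or> 1 \<in> K" if K: "left_submodule K ?R" "L \<subseteq> K" for K
  proof (cases "K \<subseteq> L")
    case False
    then obtain x where x: "x \<in> K" "ract ss x vacuum \<noteq> 0" by (auto simp: L_def)
    define V where "V = (\<lambda>x. ract ss x vacuum) ` K"
    have V: "ract ss y \<psi> \<in> V" if "\<psi> \<in> V" for y \<psi>
      using that s(4)[OF K(1)] by (auto simp: V_def rs(2)[symmetric])
    have "V = box_states m ss"
    proof (rule chain_simple[OF ss])
      show "V \<subseteq> box_states m ss" by (auto simp: V_def rs)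
      then have Vb: "\<psi> \<in> box_states m ss" if "\<psi> \<in> V" for \<psi> using that by blast
      show "0 \<in> V" using s(2)[OF K(1)] rs(4) by (force simp: V_def)
      show "\<psi> + \<phi> \<in> V" if "\<psi> \<in> V" "\<phi> \<in> V" for \<psi> \<phi>
        using that s(3)[OF K(1)] by (auto simp: V_def rs(1)[symmetric])
      show "scale_state c \<psi> \<in> V" if "\<psi> \<in> V" for c \<psi>
        using V[OF that, of "rscal c"] ract_simps(5)[OF ss Vb[OF that]] by simp
      show "chain_op ss i j r \<psi> \<in> V" if "\<psi> \<in> V" for i j r \<psi>
        using V[OF that, of "rt i j r"] ract_simps(6)[OF ss Vb[OF that]] by simp
      show "ract ss x vacuum \<in> V" "ract ss x vacuum \<noteq> 0" using x by (auto simp: V_def)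
    qed
    then have "vacuum \<in> V" using vac by simp
    then obtain y where y0: "vacuum = ract ss y vacuum" "y \<in> K" unfolding V_def by (rule imageE)
    note y = y0(2) y0(1)[symmetric]
    have "1 - y \<in> L" using y(2) by (simp add: L_def rs)
    then have "(1 - y) + y \<in> K" using K(2) y(1) by (intro s(3)[OF K(1), of "1 - y" y]) auto
    then show ?thesis by simp
  qed (use K in auto)
  have proper: "x + y \<noteq> 1" if K: "left_submodule K ?R" "J \<subseteq> K" "1 \<notin> K" and "x \<in> L" "y \<in> K" for K x y
  proof
    assume "x + y = 1"
    \<comment> \<open>The argument that sums of proper ideals are proper takes place in the Yangian,
      so ideals are pulled back along the quotient map.\<close>
    define pre where "pre K = {z. abs_restricted_yangian z \<in> K}" for K :: "'k restricted_yangian set"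
    have hw: "Y.highest_weight_ideal (pre K) (coeff (hw1 ss)) (coeff (hw2 ss)) \<and> restricted_ideal \<subseteq> pre K \<and> (1 \<notin> pre K \<longleftrightarrow> 1 \<notin> K)"
      if K: "left_submodule K ?R" "J \<subseteq> K" for K
    proof (intro conjI)
      have "left_ideal (pre K)"
        unfolding left_ideal_def pre_def using s[OF K(1)]
        by (auto simp: zero_restricted_yangian_def[symmetric] plus_restricted_yangian.abs_eq[symmetric]
            times_restricted_yangian.abs_eq[symmetric])
      moreover have e: "fps_nth e_series r \<in> pre K" if "0 < r" for r
      proof -
        have "re r \<in> K" using that J(2) K(2) by (auto simp: S_def)
        then show ?thesis by (simp add: pre_def re.abs_eq)
      qed
      moreover have d: "fps_nth (d_series i) r - yscal (coeff h r) \<in> pre K"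
        if "\<And>r. 0 < r \<Longrightarrow> rd i r - rscal (fps_nth (fps_of_poly h) r) \<in> S" "coeff h 0 = 1"
          "fps_nth (d_series i :: 'k yangian fps) 0 = 1" for i h r
      proof (cases "r = 0")
        case True
        then show ?thesis using that(2,3) s(2)[OF K(1)] by (simp add: yscal.sc_1 pre_def zero_restricted_yangian_def[symmetric])
      next
        case False
        then have "rd i r - rscal (coeff h r) \<in> K" using that(1)[of r] J(2) K(2) by auto
        then show ?thesis by (simp add: pre_def rd.abs_eq rscal.abs_eq minus_restricted_yangian.abs_eq)
      qed
      moreover have "coeff (hw1 ss) 0 = 1" "coeff (hw2 ss) 0 = 1"
        unfolding hw1_def hw2_def by (induction ss) (simp_all add: coeff_mult)
      ultimately show "Y.highest_weight_ideal (pre K) (coeff (hw1 ss)) (coeff (hw2 ss))"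
        unfolding Y.highest_weight_ideal_def Y_series
        using d[of 1 "hw1 ss"] d[of 2 "hw2 ss"] Y.d_0[unfolded Y_series] by (simp add: S_def) blast
      show "restricted_ideal \<subseteq> pre K"
      proof
        fix z :: "'k yangian" assume "z \<in> restricted_ideal"
        then have "abs_restricted_yangian z = 0"
          using restricted_yangian_abs_eq_iff[of z 0] by (simp add: zero_restricted_yangian_def)
        then show "z \<in> pre K" using s(2)[OF K(1)] by (simp add: pre_def)
      qed
    qed (simp add: pre_def one_restricted_yangian_def)
    obtain x' y' where xy: "x = abs_restricted_yangian x'" "y = abs_restricted_yangian y'"
      by (metis abs_rep_restricted_yangian)
    have "abs_restricted_yangian (x' + y') = abs_restricted_yangian 1"
      using \<open>x + y = 1\<close> by (simp add: xy plus_restricted_yangian.abs_eq one_restricted_yangian_def)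
    then have "1 - (x' + y') \<in> restricted_ideal" by (simp add: restricted_yangian_abs_eq_iff[symmetric])
    \<comment> \<open>Representatives of x and y add up to 1 only modulo the restricted ideal. The
      defect is added to y', which stays in the pulled-back ideal of K.\<close>
    then have "y' + (1 - (x' + y')) \<in> pre K"
      using hw[OF K(1,2)] \<open>y \<in> K\<close> by (intro left_ideal_add) (auto simp: Y.highest_weight_ideal_def pre_def xy)
    moreover have "x' \<in> pre L" using \<open>x \<in> L\<close> by (simp add: pre_def xy)
    ultimately have "x' + (y' + (1 - (x' + y'))) \<noteq> 1"
    proof (intro Y.highest_weight_ideals_sum_proper[where I = restricted_ideal and p = "CHAR('k)"
          and ?J1.0 = "pre L" and ?J2.0 = "pre K" and ?l1.0 = "coeff (hw1 ss)" and ?l2.0 = "coeff (hw2 ss)"])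
      show "fps_nth (rtt.f yt) r ^ CHAR('k) \<in> (restricted_ideal :: 'k yangian set)" if "0 < r" for r
        unfolding Y_series by (rule p_center_gens_restricted_ideal) (use that in \<open>auto simp: p_center_gens_def\<close>)
    qed (use hw[OF K(1,2)] hw[OF L JL] K(3) one_L in
        \<open>simp_all add: restricted_ideal_def two_sided_ideal.zero two_sided_ideal.add two_sided_ideal_mult\<close>)
    then show False by simp
  qed
  have one: "co ` K = carrier Z \<longleftrightarrow> 1 \<in> K" if K: "left_submodule K ?R" "J \<subseteq> K" for K
  proof
    assume "co ` K = carrier Z"
    then have "co 1 \<in> co ` K" by (auto simp: q(1))
    then show "1 \<in> K" using corr(3)[OF K] by simp
  next
    assume "1 \<in> K"
    then have "x \<in> K" for x using s(4)[OF K(1), of 1 x] by simp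
    then show "co ` K = carrier Z" by (auto simp: q(1))
  qed
  have maxL: "maximal_submodule (co ` L) Z"
    unfolding maximal_submodule_def
  proof (intro conjI allI impI)
    show "left_submodule (co ` L) Z" by (rule corr(1)[OF L])
    show "co ` L \<noteq> carrier Z" using one[OF L JL] one_L by simp
    fix N' assume N': "left_submodule N' Z" "co ` L \<subseteq> N'"
    define K where "K = {x. co x \<in> N'}"
    have K: "left_submodule K ?R" "J \<subseteq> K" "co ` K = N'" using corr(2)[OF N'(1)] by (auto simp: K_def)
    have "L \<subseteq> K" using N'(2) by (auto simp: K_def)
    from max[OF K(1) this] show "N' = co ` L \<or> N' = carrier Z"
      using one[OF K(1,2)] K(3) by auto
  qed
  have uniq: "N' = co ` L" if "maximal_submodule N' Z" for N'
  proof -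
    have N': "left_submodule N' Z" "N' \<noteq> carrier Z"
      and N'max: "\<And>M. left_submodule M Z \<Longrightarrow> N' \<subseteq> M \<Longrightarrow> M = N' \<or> M = carrier Z"
      using that by (auto simp: maximal_submodule_def)
    define K where "K = {x. co x \<in> N'}"
    have K: "left_submodule K ?R" "J \<subseteq> K" "co ` K = N'" using corr(2)[OF N'(1)] by (auto simp: K_def)
    have oneK: "1 \<notin> K" using one[OF K(1,2)] K(3) N'(2) by simp
    \<comment> \<open>By \<open>proper\<close> the sum of the two ideals does not contain 1; the
      maximality of N' then makes it equal to K, so K contains L.\<close>
    define LK where "LK = {x + y | x y. x \<in> L \<and> y \<in> K}"
    have LK: "left_submodule LK ?R"
    proof (rule sI)
      show "0 \<in> LK" using s(2)[OF L] s(2)[OF K(1)] by (force simp: LK_def)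
      show "x + y \<in> LK" if xy: "x \<in> LK" "y \<in> LK" for x y
      proof -
        from xy obtain a b c d where "a \<in> L" "b \<in> K" "c \<in> L" "d \<in> K" "x = a + b" "y = c + d" by (auto simp: LK_def)
        then have "x + y = (a + c) + (b + d)" "a + c \<in> L" "b + d \<in> K"
          using s(3)[OF L] s(3)[OF K(1)] by (auto simp: algebra_simps)
        then show ?thesis unfolding LK_def by blast
      qed
      show "a * x \<in> LK" if "x \<in> LK" for a x
        using that s(4)[OF L] s(4)[OF K(1)] by (fastforce simp: LK_def distrib_left)
    qed
    have sub: "L \<subseteq> LK" "K \<subseteq> LK"
      using s(2)[OF L] s(2)[OF K(1)] by (force simp: LK_def)+
    have "1 \<notin> LK" using proper[OF K(1,2) oneK] by (auto simp: LK_def)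
    moreover have "J \<subseteq> LK" using JL sub by blast
    ultimately have "co ` LK \<noteq> carrier Z" using one[OF LK] by simp
    moreover have "N' \<subseteq> co ` LK" using K(3) sub by blast
    ultimately have "co ` LK = N'" using N'max[OF corr(1)[OF LK]] by blast
    then have "LK \<subseteq> K" by (auto simp: K_def)
    then have "L \<subseteq> K" using sub by blast
    from max[OF K(1) this] show ?thesis using oneK K(3) by auto
  qed
  have THE: "(THE N. maximal_submodule N Z) = co ` L"
    using maxL uniq by (rule the_equality)
  have Zmod: "left_module Z" unfolding Z_def by (rule quotient_module_left_module[OF regular_left_module J(1)])
  define \<phi> where "\<phi> X = ract ss (SOME x. X = co x) vacuum" for X
  have co_eq: "ract ss x vacuum = ract ss y vacuum" if "co x = co y" for x y
  proof -
    have "x - y \<in> L"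
      using that a_r_coset_simps(2)[OF regular_left_module J(1), of x y] JL
      by (auto simp: co_def regular_module_simps regular_minus)
    then have "ract ss x vacuum - ract ss y vacuum = 0" by (simp add: L_def rs)
    then show ?thesis by simp
  qed
  have \<phi>: "\<phi> (co x) = ract ss x vacuum" for x
  proof -
    have "co x = co (SOME y. co x = co y)" by (rule someI[of _ x]) simp
    then show ?thesis unfolding \<phi>_def using co_eq by metis
  qed
  obtain \<psi> where \<psi>: "bij_betw \<psi> (carrier (quotient_module Z (co ` L))) (carrier (chain_module ss))"
    "\<And>X Y. X \<in> carrier (quotient_module Z (co ` L)) \<Longrightarrow> Y \<in> carrier (quotient_module Z (co ` L)) \<Longrightarrow>
       \<psi> (X \<oplus>\<^bsub>quotient_module Z (co ` L)\<^esub> Y) = \<psi> X \<oplus>\<^bsub>chain_module ss\<^esub> \<psi> Y"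
    "\<And>a X. X \<in> carrier (quotient_module Z (co ` L)) \<Longrightarrow>
       \<psi> (a \<odot>\<^bsub>quotient_module Z (co ` L)\<^esub> X) = a \<odot>\<^bsub>chain_module ss\<^esub> \<psi> X"
  proof (rule quotient_module_isomorphism[OF Zmod corr(1)[OF L] chain_left_module[OF ss], of \<phi>])
    show "\<phi> ` carrier Z = carrier (chain_module ss)"
      using surj by (force simp: q(1) \<phi> chain_module_simps rs image_iff)
    show "\<phi> (X \<oplus>\<^bsub>Z\<^esub> Y) = \<phi> X \<oplus>\<^bsub>chain_module ss\<^esub> \<phi> Y" if "X \<in> carrier Z" "Y \<in> carrier Z" for X Y
      using that by (auto simp: q(1,3) \<phi> chain_module_simps rs)
    show "\<phi> (a \<odot>\<^bsub>Z\<^esub> X) = a \<odot>\<^bsub>chain_module ss\<^esub> \<phi> X" if "X \<in> carrier Z" for a X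
      using that by (auto simp: q(1,4) \<phi> chain_module_simps rs)
    show "\<phi> X = \<zero>\<^bsub>chain_module ss\<^esub> \<longleftrightarrow> X \<in> co ` L" if "X \<in> carrier Z" for X
      using that corr(3)[OF L JL] by (auto simp: q(1) \<phi> chain_module_simps L_def)
  qed blast
  then show "module_isomorphic (simple_quotient (fps_of_poly (hw1 ss)) (fps_of_poly (hw2 ss))) (chain_module ss)"
    unfolding simple_quotient_def Z THE module_isomorphic_def by blast
  show "left_module (simple_quotient (fps_of_poly (hw1 ss)) (fps_of_poly (hw2 ss)))"
    unfolding simple_quotient_def Z THE by (rule quotient_module_left_module[OF Zmod corr(1)[OF L]])
qed

end

end

section \<open>Evaluation modules\<close>

text \<open>Moves a module onto a prescribed carrier. It is applied twice: to place the factors on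
  the type of sets of ring elements, and to place the chain on the carrier of the tensor
  space.\<close>

definition transport_module :: "('v \<Rightarrow> 'w) \<Rightarrow> ('r, 'v) module \<Rightarrow> ('r, 'w) module" where
  "transport_module \<theta> P = (let g = the_inv_into (carrier P) \<theta> in
     \<lparr>carrier = \<theta> ` carrier P, mult = undefined, one = undefined, zero = \<theta> \<zero>\<^bsub>P\<^esub>,
      add = (\<lambda>x y. \<theta> (g x \<oplus>\<^bsub>P\<^esub> g y)), smult = (\<lambda>a x. \<theta> (a \<odot>\<^bsub>P\<^esub> g x))\<rparr>)"

lemma transport_module_carrier_zero:
  "carrier (transport_module \<theta> P) = \<theta> ` carrier P" "\<zero>\<^bsub>transport_module \<theta> P\<^esub> = \<theta> \<zero>\<^bsub>P\<^esub>"
  by (simp_all add: transport_module_def Let_def)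

context
  fixes \<theta> :: "'v \<Rightarrow> 'w" and P :: "('r::{ring, monoid_mult}, 'v) module"
  assumes inj: "inj_on \<theta> (carrier P)"
begin

lemma transport_module_simps:
  "x \<in> carrier P \<Longrightarrow> y \<in> carrier P \<Longrightarrow> \<theta> x \<oplus>\<^bsub>transport_module \<theta> P\<^esub> \<theta> y = \<theta> (x \<oplus>\<^bsub>P\<^esub> y)"
  "x \<in> carrier P \<Longrightarrow> a \<odot>\<^bsub>transport_module \<theta> P\<^esub> \<theta> x = \<theta> (a \<odot>\<^bsub>P\<^esub> x)"
  by (simp_all add: transport_module_def Let_def the_inv_into_f_f[OF inj])

lemma transport_module_isomorphic: "module_isomorphic P (transport_module \<theta> P)"
  unfolding module_isomorphic_def
  by (rule exI[of _ \<theta>]) (simp add: transport_module_simps transport_module_carrier_zero bij_betw_def inj)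

lemma transport_left_module:
  assumes "left_module P"
  shows "left_module (transport_module \<theta> P)"
proof -
  interpret left_module P by (rule assms)
  note s = transport_module_simps transport_module_carrier_zero the_inv_into_f_f[OF inj]
  show ?thesis
    by (rule left_module_transport[OF assms bij_betw_the_inv_into])
       (auto simp: s smult_closed bij_betw_def inj)
qed

lemma transport_simple_module:
  assumes "simple_module P"
  shows "simple_module (transport_module \<theta> P)"
proof -
  interpret left_module P using assms by (simp add: simple_module_def)
  note s = transport_module_simps transport_module_carrier_zero
  have "N = {\<theta> \<zero>\<^bsub>P\<^esub>} \<or> N = \<theta> ` carrier P" if N: "left_submodule N (transport_module \<theta> P)" for N
  proof -
    note n = left_submodule_simps[OF N, unfolded s]
    define K where "K = {x \<in> carrier P. \<theta> x \<in> N}"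
    have "left_submodule K P"
    proof (rule left_submoduleI)
      show "x \<oplus>\<^bsub>P\<^esub> y \<in> K" if "x \<in> K" "y \<in> K" for x y
        using n(3)[of "\<theta> x" "\<theta> y"] that by (simp add: K_def s)
      show "a \<odot>\<^bsub>P\<^esub> x \<in> K" if "x \<in> K" for a x
        using n(4)[of "\<theta> x" a] that by (simp add: K_def s smult_closed)
    qed (use n(2) in \<open>auto simp: K_def\<close>)
    then have "K = {\<zero>\<^bsub>P\<^esub>} \<or> K = carrier P" using assms by (simp add: simple_module_def)
    moreover have "N = \<theta> ` K" using n(1) by (auto simp: K_def)
    ultimately show ?thesis by auto
  qed
  moreover have "\<theta> ` carrier P \<noteq> {\<theta> \<zero>\<^bsub>P\<^esub>}"
  proof
    assume eq: "\<theta> ` carrier P = {\<theta> \<zero>\<^bsub>P\<^esub>}"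
    have "x = \<zero>\<^bsub>P\<^esub>" if "x \<in> carrier P" for x
    proof -
      have "\<theta> x \<in> {\<theta> \<zero>\<^bsub>P\<^esub>}" using that eq by blast
      then show ?thesis using inj that by (auto dest: inj_onD)
    qed
    then have "carrier P = {\<zero>\<^bsub>P\<^esub>}" using zero_closed by auto
    then show False using assms by (simp add: simple_module_def)
  qed
  ultimately show ?thesis
    using transport_left_module[OF left_module_axioms] by (simp add: simple_module_def s)
qed

end

lemma simple_module_generated:
  assumes "simple_module M" "\<xi> \<in> carrier M" "\<xi> \<noteq> \<zero>\<^bsub>M\<^esub>"
  shows "generated_submodule M {\<xi>} = carrier M"
proof -
  interpret left_module M using assms(1) by (simp add: simple_module_def)
  have "left_submodule (generated_submodule M {\<xi>}) M" "{\<xi>} \<subseteq> generated_submodule M {\<xi>}"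
    using generated_submodule_submodule[of "{\<xi>}"] assms(2) by auto
  then show ?thesis using assms unfolding simple_module_def by blast
qed

section \<open>The p-th power relations of the restricted enveloping algebra\<close>

lemma matrix_add_right_distrib: "(A + B) ** C = A ** C + B ** (C :: 'a::semiring_1^'n^'m)"
  by (simp add: matrix_matrix_mult_def vec_eq_iff sum.distrib distrib_right)

text \<open>A copy of the matrices whose ring product is the matrix product, so that
  \<open>prime_power_ad\<close> applies to them.\<close>

typedef (overloaded) 'k mat2 = "UNIV :: ('k::field^2^2) set"
  morphisms entries Mat2 by simp

setup_lifting type_definition_mat2

instantiation mat2 :: (field) ring_1
begin
lift_definition zero_mat2 :: "'a mat2" is 0 .
lift_definition one_mat2 :: "'a mat2" is "mat 1" .
lift_definition plus_mat2 :: "'a mat2 \<Rightarrow> 'a mat2 \<Rightarrow> 'a mat2" is "(+)" .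
lift_definition minus_mat2 :: "'a mat2 \<Rightarrow> 'a mat2 \<Rightarrow> 'a mat2" is "(-)" .
lift_definition uminus_mat2 :: "'a mat2 \<Rightarrow> 'a mat2" is uminus .
lift_definition times_mat2 :: "'a mat2 \<Rightarrow> 'a mat2 \<Rightarrow> 'a mat2" is "(**)" .
instance
proof
  show "(0 :: 'a mat2) \<noteq> 1" by transfer (auto simp: vec_eq_iff mat_def)
qed (transfer; simp add: matrix_mul_assoc matrix_add_ldistrib matrix_add_right_distrib algebra_simps)+
end

abbreviation mat_power :: "'k::field^2^2 \<Rightarrow> nat \<Rightarrow> 'k^2^2" where
  "mat_power A n \<equiv> ((\<lambda>X. A ** X) ^^ n) (mat 1)"

lemma Mat2_power: "Mat2 A ^ n = Mat2 (mat_power A n)"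
  by (induction n) (simp_all add: one_mat2_def times_mat2.abs_eq)

lemma mat_power_bracket:
  fixes A B :: "'k::field^2^2"
  assumes "prime CHAR('k)"
  shows "((\<lambda>X. A ** X - X ** A) ^^ CHAR('k)) B = mat_power A CHAR('k) ** B - B ** mat_power A CHAR('k)"
proof -
  have ad: "(ad (Mat2 A) ^^ n) (Mat2 B) = Mat2 (((\<lambda>X. A ** X - X ** A) ^^ n) B)" for n
    by (induction n) (simp_all add: ad_def times_mat2.abs_eq minus_mat2.abs_eq)
  have "of_nat n = Mat2 (mat (of_nat n) :: 'k^2^2)" for n
    by (induction n) (auto simp: zero_mat2_def one_mat2_def plus_mat2.abs_eq mat_def vec_eq_iff Mat2_inject)
  then have "of_nat CHAR('k) = (0 :: 'k mat2)"
    by (simp add: zero_mat2_def mat_def Mat2_inject vec_eq_iff)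
  from prime_power_ad[OF assms this, of "Mat2 A" "Mat2 B"] show ?thesis
    by (simp add: ad Mat2_power times_mat2.abs_eq plus_mat2.abs_eq Mat2_inject)
qed

text \<open>Both sides satisfy the linear recurrence given by the characteristic polynomial of A,
  whose roots are x and y.\<close>

lemma mat_power_trace:
  fixes A :: "'k::comm_ring_1^2^2"
  assumes "x + y = A $ 1 $ 1 + A $ 2 $ 2" "x * y = A $ 1 $ 1 * A $ 2 $ 2 - A $ 1 $ 2 * A $ 2 $ 1"
  defines "P \<equiv> \<lambda>n. ((\<lambda>X. A ** X) ^^ n) (mat 1)"
  shows "P n $ 1 $ 1 + P n $ 2 $ 2 = x ^ n + y ^ n"
proof (induction n rule: less_induct)
  case (less n)
  consider "n = 0" | "n = 1" | k where "n = Suc (Suc k)" by (metis One_nat_def not0_implies_Suc)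
  then show ?case
  proof cases
    case (3 k)
    have "P n $ 1 $ 1 + P n $ 2 $ 2 = (x + y) * (P (Suc k) $ 1 $ 1 + P (Suc k) $ 2 $ 2) - x * y * (P k $ 1 $ 1 + P k $ 2 $ 2)"
      unfolding 3 assms(1,2) by (simp add: P_def matrix_matrix_mult_def sum_2 algebra_simps)
    also have "\<dots> = x ^ n + y ^ n" using less[of "Suc k"] less[of k] 3 by (simp add: algebra_simps)
    finally show ?thesis .
  qed (simp_all add: P_def mat_def assms(1) matrix_matrix_mult_def sum_2)
qed

text \<open>x is a root of the characteristic polynomial and y is the other one. If A_12 is nonzero,
  the vector (A_12, x - A_11) satisfies the first equation by construction and the second because x
  is a root.\<close>

lemma mat2_eigenvector:
  fixes A :: "'k::alg_closed_field^2^2"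
  obtains x y v w where "v \<noteq> 0 \<or> w \<noteq> 0" "A $ 1 $ 1 * v + A $ 1 $ 2 * w = x * v" "A $ 2 $ 1 * v + A $ 2 $ 2 * w = x * w"
    "x + y = A $ 1 $ 1 + A $ 2 $ 2" "x * y = A $ 1 $ 1 * A $ 2 $ 2 - A $ 1 $ 2 * A $ 2 $ 1"
proof (cases "A $ 1 $ 2 = 0")
  case True
  then show ?thesis using that[of 0 1 "A $ 2 $ 2" "A $ 1 $ 1"] by (simp add: mult.commute add.commute)
next
  case False
  let ?t = "A $ 1 $ 1 + A $ 2 $ 2" and ?d = "A $ 1 $ 1 * A $ 2 $ 2 - A $ 1 $ 2 * A $ 2 $ 1"
  obtain x where "poly [:?d, - ?t, 1:] x = 0" using alg_closed_imp_poly_has_root[of "[:?d, - ?t, 1:]"] by auto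
  then have x: "?d = x * (?t - x)" by (simp add: algebra_simps)
  then have "A $ 2 $ 1 * A $ 1 $ 2 + A $ 2 $ 2 * (x - A $ 1 $ 1) = x * (x - A $ 1 $ 1)" by (simp add: algebra_simps)
  with x False show ?thesis
    by (intro that[of "A $ 1 $ 2" "x - A $ 1 $ 1" x "?t - x"]) (simp_all add: algebra_simps)
qed

lemma prime_subfield_power:
  assumes "prime CHAR('k)" "x \<in> (prime_subfield :: 'k::field set)"
  shows "x ^ CHAR('k) = x"
proof -
  have "of_nat n ^ CHAR('k) = (of_nat n :: 'k)" for n
    using assms(1) by (induction n) (simp_all add: freshmans_dream prime_gt_0_nat)
  then show ?thesis using assms(2) by (auto simp: prime_subfield_def)
qed

context weights
begin

definition site_gl2 :: "nat \<Rightarrow> 'k^2^2 \<Rightarrow> 'k lop" where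
  "site_gl2 s A = (\<Sum>i\<in>UNIV. \<Sum>j\<in>UNIV. lop_scalar (A $ i $ j) * site_lop s i j)"

lemma app_site_gl2: "app_lop (site_gl2 s A) \<psi> = (\<Sum>i\<in>UNIV. \<Sum>j\<in>UNIV. scale_state (A $ i $ j) (site_op s i j \<psi>))"
  by (simp add: site_gl2_def app_lop_sum app_lop_simps app_site_lop)

lemma site_gl2_bracket: "site_gl2 s A * site_gl2 s B - site_gl2 s B * site_gl2 s A = site_gl2 s (A ** B - B ** A)"
proof -
  let ?e = "site_lop s" and ?c = lop_scalar
  have br: "?e i j * ?e k l - ?e k l * ?e i j
     = (if k = j then ?e i l else 0) - (if i = l then ?e k j else 0)" for i j k l
    by (rule lop_eqI) (simp add: app_lop_simps app_site_lop site_op_bracket)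
  have "?c x * ?e i j * (?c y * ?e k l) - ?c y * ?e k l * (?c x * ?e i j)
      = ?c (x * y) * (?e i j * ?e k l - ?e k l * ?e i j)" for x y i j k l
    by (rule lop_eqI) (simp add: app_lop_simps app_lop_scale scale_state_simps mult.commute)
  then have 1: "?c x * ?e i j * (?c y * ?e k l) - ?c y * ?e k l * (?c x * ?e i j)
      = ?c (x * y) * ((if k = j then ?e i l else 0) - (if i = l then ?e k j else 0))" for x y i j k l
    by (simp only: br)
  have "site_gl2 s A * site_gl2 s B - site_gl2 s B * site_gl2 s A
     = (\<Sum>i\<in>UNIV. \<Sum>j\<in>UNIV. \<Sum>k\<in>UNIV. \<Sum>l\<in>UNIV. ?c (A $ i $ j) * ?e i j * (?c (B $ k $ l) * ?e k l)
          - ?c (B $ k $ l) * ?e k l * (?c (A $ i $ j) * ?e i j))"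
    unfolding site_gl2_def by (simp add: sum_2 algebra_simps)
  also have "\<dots> = site_gl2 s (A ** B - B ** A)"
    unfolding 1 by (rule lop_eqI, rule ext)
      (simp add: sum_2 site_gl2_def matrix_matrix_mult_def app_lop_simps state_apply algebra_simps)
  finally show ?thesis .
qed

lemma site_gl2_box: "\<psi> \<in> box_states m S \<Longrightarrow> s \<in> set S \<Longrightarrow> app_lop (site_gl2 s A) \<psi> \<in> box_states m S"
  by (simp add: app_site_gl2 sum_2 box_states_add box_states_scale site_op_box_states)

definition power_state :: "nat \<Rightarrow> 'k \<Rightarrow> 'k \<Rightarrow> 'k state" where
  "power_state s v w = (\<lambda>\<kappa>. if \<kappa> \<in> box m [s] then of_nat (m s choose \<kappa> s) * v ^ (m s - \<kappa> s) * w ^ \<kappa> s else 0)"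

lemma power_state_box: "power_state s v w \<in> box_states m [s]"
  by (simp add: power_state_def box_states_def)

lemma power_state_nonzero:
  assumes "v \<noteq> 0 \<or> w \<noteq> 0"
  shows "power_state s v w \<noteq> 0"
proof -
  have "power_state s v w (\<lambda>_. 0) = v ^ m s" "power_state s v w ((\<lambda>_. 0)(s := m s)) = w ^ m s"
    by (simp_all add: power_state_def box_def)
  then show ?thesis using assms by (metis power_not_zero zero_fun_apply)
qed

text \<open>Identifying \<open>L(a, b)\<close> with forms of degree \<open>m\<close> in two variables, twisted by \<open>b\<close> times the trace, this is
  the \<open>m\<close>-th power of a linear form that is an eigenvector of \<open>A\<close>.\<close>

lemma site_gl2_power_state:
  assumes "A $ 1 $ 1 * v + A $ 1 $ 2 * w = x * v" "A $ 2 $ 1 * v + A $ 2 $ 2 * w = x * w"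
  shows "app_lop (site_gl2 s A) (power_state s v w)
     = scale_state (of_nat (m s) * x + b s * (A $ 1 $ 1 + A $ 2 $ 2)) (power_state s v w)"
proof
  fix \<kappa> :: "nat \<Rightarrow> nat"
  let ?\<psi> = "power_state s v w" and ?n = "m s" and ?k = "\<kappa> s"
  define c :: "nat \<Rightarrow> 'k" where "c k = of_nat (?n choose k)" for k
  show "app_lop (site_gl2 s A) ?\<psi> \<kappa> = scale_state (of_nat ?n * x + b s * (A $ 1 $ 1 + A $ 2 $ 2)) ?\<psi> \<kappa>"
  proof (cases "\<kappa> \<in> box m [s]")
    case False
    then show ?thesis using site_gl2_box[OF power_state_box, of s s A] power_state_box[of s v w]
      by (simp add: box_states_def state_apply)
  next
    case True
    have k: "?k \<le> ?n" using True by (simp add: box_def)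
    have upd: "\<kappa>(s := k) \<in> box m [s] \<longleftrightarrow> k \<le> ?n" for k
      using True unfolding box_upd_iff[of s "[s]", simplified] by simp
    have \<psi>: "?\<psi> (\<kappa>(s := k)) = c k * v ^ (?n - k) * w ^ k" for k
      by (simp add: power_state_def upd c_def binomial_eq_0)
    have ab: "a s = b s + of_nat ?n" using weight_diff[of s] by (simp add: algebra_simps)
    have up: "of_nat (Suc ?k) * c (Suc ?k) = of_nat (?n - ?k) * c ?k"
      unfolding c_def of_nat_mult[symmetric] by (metis binomial_absorb_comp mult.commute Suc_times_binomial_eq binomial_absorption)
    have E11: "(b s + of_nat ?n - of_nat ?k) * ?\<psi> \<kappa> = b s * ?\<psi> \<kappa> + of_nat (?n - ?k) * c ?k * v ^ (?n - ?k) * w ^ ?k"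
      using \<psi>[of ?k] k by (simp add: of_nat_diff algebra_simps)
    have E12: "of_nat (Suc ?k) * ?\<psi> (\<kappa>(s := Suc ?k)) = of_nat (?n - ?k) * c ?k * v ^ (?n - Suc ?k) * w ^ Suc ?k"
      unfolding \<psi> by (simp only: mult.assoc[symmetric] up)
    have E21: "(if ?k = 0 then 0 else (of_nat ?n - of_nat ?k + 1) * ?\<psi> (\<kappa>(s := ?k - 1)))
       = of_nat ?k * c ?k * v ^ Suc (?n - ?k) * w ^ (?k - 1)"
    proof (cases ?k)
      case (Suc j)
      have "of_nat (?n - j) * c j = of_nat (Suc j) * c (Suc j)"
        unfolding c_def of_nat_mult[symmetric] by (metis binomial_absorb_comp mult.commute Suc_times_binomial_eq binomial_absorption)
      moreover have "?n - j = Suc (?n - Suc j)" "of_nat ?n - of_nat ?k + 1 = (of_nat (?n - j) :: 'k)"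
        using k Suc by (simp_all add: of_nat_diff)
      ultimately show ?thesis unfolding \<psi> using Suc by (simp add: mult.assoc[symmetric] del: of_nat_Suc)
    qed simp
    have low: "of_nat (?n - ?k) * v ^ (?n - ?k) = (of_nat (?n - ?k) * v ^ (?n - Suc ?k) * v :: 'k)"
      by (cases "?n - ?k") (simp_all add: Suc_diff_Suc diff_Suc)
    have low': "of_nat ?k * w ^ ?k = (of_nat ?k * w ^ (?k - 1) * w :: 'k)"
      by (cases ?k) simp_all
    have "app_lop (site_gl2 s A) ?\<psi> \<kappa>
       = A $ 1 $ 1 * ((b s + of_nat ?n - of_nat ?k) * ?\<psi> \<kappa>) + A $ 1 $ 2 * (of_nat (Suc ?k) * ?\<psi> (\<kappa>(s := Suc ?k)))
         + (A $ 2 $ 1 * (if ?k = 0 then 0 else (of_nat ?n - of_nat ?k + 1) * ?\<psi> (\<kappa>(s := ?k - 1)))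
         + A $ 2 $ 2 * ((b s + of_nat ?k) * ?\<psi> \<kappa>))"
      by (simp add: app_site_gl2 sum_2 state_apply site_op_def coeff_defs ab)
    also have "\<dots> = b s * (A $ 1 $ 1 + A $ 2 $ 2) * ?\<psi> \<kappa>
        + c ?k * (of_nat (?n - ?k) * v ^ (?n - Suc ?k)) * w ^ ?k * (A $ 1 $ 1 * v + A $ 1 $ 2 * w)
        + c ?k * v ^ (?n - ?k) * (of_nat ?k * w ^ (?k - 1)) * (A $ 2 $ 1 * v + A $ 2 $ 2 * w)"
    proof -
      have e1: "of_nat (?n - ?k) * c ?k * v ^ (?n - ?k) * w ^ ?k = c ?k * (of_nat (?n - ?k) * v ^ (?n - Suc ?k)) * w ^ ?k * v"
        using low by (simp add: mult_ac)
      have e2: "(b s + of_nat ?k) * ?\<psi> \<kappa> = b s * ?\<psi> \<kappa> + c ?k * v ^ (?n - ?k) * (of_nat ?k * w ^ (?k - 1)) * w"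
        using \<psi>[of ?k] unfolding mult.assoc[of "c ?k * v ^ (?n - ?k)"] low'[symmetric]
        by (simp add: algebra_simps)
      show ?thesis unfolding E11 E12 E21 e1 e2 by (simp add: algebra_simps)
    qed
    also have "\<dots> = b s * (A $ 1 $ 1 + A $ 2 $ 2) * ?\<psi> \<kappa> + c ?k * (of_nat (?n - ?k) * v ^ (?n - ?k)) * w ^ ?k * x
        + c ?k * v ^ (?n - ?k) * (of_nat ?k * w ^ ?k) * x"
      unfolding assms low low' by (simp add: mult_ac)
    also have "\<dots> = b s * (A $ 1 $ 1 + A $ 2 $ 2) * ?\<psi> \<kappa> + of_nat (?n - ?k + ?k) * x * ?\<psi> \<kappa>"
      using \<psi>[of ?k] unfolding of_nat_add by (simp add: algebra_simps)
    also have "\<dots> = scale_state (of_nat ?n * x + b s * (A $ 1 $ 1 + A $ 2 $ 2)) ?\<psi> \<kappa>"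
      using k by (simp add: state_apply algebra_simps)
    finally show ?thesis .
  qed
qed

end

locale closed_weights = restricted_weights a b m for a b :: "nat \<Rightarrow> 'k::alg_closed_field" and m
begin

lemma compatible_singleton: "compatible [s]"
  by (simp add: compatible_def)

lemma chain_op_singleton:
  "chain_op [s] i j r \<psi> = (if r = 0 then if i = j then \<psi> else 0 else if r = 1 then site_op s i j \<psi> else 0)"
  using exhaust_2[of j] by (auto simp: sum_2 site_op_0)

lemma site_simple:
  assumes K: "K \<subseteq> box_states m [s]" "0 \<in> K" "\<And>x y. x \<in> K \<Longrightarrow> y \<in> K \<Longrightarrow> x + y \<in> K"
    "\<And>c x. x \<in> K \<Longrightarrow> scale_state c x \<in> K" "\<And>i j x. x \<in> K \<Longrightarrow> site_op s i j x \<in> K" "\<phi> \<in> K" "\<phi> \<noteq> 0"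
  shows "K = box_states m [s]"
  using K by (intro chain_simple[OF compatible_singleton _ _ _ _ _ K(6,7)]) (auto simp: chain_op_singleton simp del: chain_op.simps)

lemma app_lop_eigen_power:
  "app_lop X \<psi> = scale_state c \<psi> \<Longrightarrow> app_lop (X ^ n) \<psi> = scale_state (c ^ n) \<psi>"
  by (induction n) (simp_all add: app_lop_simps app_lop_scale scale_state_simps mult.commute)

text \<open>The difference C between the p-th power of the action of A and the action of the p-th
  matrix power commutes with all of gl_2, as both have the same bracket with every element. By
  simplicity of the site it is enough that C kills one nonzero vector, and a power of a linear form
  that is an eigenvector of A is such a vector.\<close>

lemma site_gl2_power:
  assumes "\<psi> \<in> box_states m [s]"
  shows "app_lop (site_gl2 s A ^ CHAR('k)) \<psi> = app_lop (site_gl2 s (mat_power A CHAR('k))) \<psi>"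
proof -
  let ?p = "CHAR('k)"
  define C where "C = site_gl2 s A ^ ?p - site_gl2 s (mat_power A ?p)"
  have lop_CHAR: "of_nat ?p = (0 :: 'k lop)" by (simp add: of_nat_lop lop.sc_0)
  have ad: "(ad (site_gl2 s A) ^^ n) (site_gl2 s B) = site_gl2 s (((\<lambda>X. A ** X - X ** A) ^^ n) B)" for n B
    by (induction n) (simp_all add: ad_def site_gl2_bracket)
  have "C * site_gl2 s B = site_gl2 s B * C" for B
    using prime_power_ad[OF CHAR_prime lop_CHAR, of "site_gl2 s A" "site_gl2 s B"]
      site_gl2_bracket[of s "mat_power A ?p" B]
    unfolding ad mat_power_bracket[OF CHAR_prime] C_def by (simp add: algebra_simps)
  moreover have "site_gl2 s (\<chi> k l. if k = i \<and> l = j then 1 else 0) = site_lop s i j" for i j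
    using exhaust_2[of i] exhaust_2[of j] by (auto simp: site_gl2_def sum_2 lop.sc_0 lop.sc_1)
  ultimately have comm: "C * site_lop s i j = site_lop s i j * C" for i j by metis
  obtain x y v w where ev: "v \<noteq> 0 \<or> w \<noteq> 0" "A $ 1 $ 1 * v + A $ 1 $ 2 * w = x * v"
    "A $ 2 $ 1 * v + A $ 2 $ 2 * w = x * w" "x + y = A $ 1 $ 1 + A $ 2 $ 2"
    "x * y = A $ 1 $ 1 * A $ 2 $ 2 - A $ 1 $ 2 * A $ 2 $ 1"
    by (rule mat2_eigenvector[of A]) blast
  define P where "P = mat_power A"
  have P: "P n $ 1 $ 1 * v + P n $ 1 $ 2 * w = x ^ n * v \<and> P n $ 2 $ 1 * v + P n $ 2 $ 2 * w = x ^ n * w" for n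
  proof (induction n)
    case (Suc n)
    have "P (Suc n) $ i $ 1 * v + P (Suc n) $ i $ 2 * w
      = A $ i $ 1 * (P n $ 1 $ 1 * v + P n $ 1 $ 2 * w) + A $ i $ 2 * (P n $ 2 $ 1 * v + P n $ 2 $ 2 * w)" for i
      by (simp add: P_def matrix_matrix_mult_def sum_2 algebra_simps)
    then have "P (Suc n) $ i $ 1 * v + P (Suc n) $ i $ 2 * w = x ^ n * (A $ i $ 1 * v + A $ i $ 2 * w)" for i
      by (simp only: Suc[THEN conjunct1] Suc[THEN conjunct2]) (simp add: algebra_simps)
    then show ?case using ev(2,3) by (simp add: mult_ac)
  qed (simp add: P_def mat_def)
  let ?\<psi> = "power_state s v w"
  have "app_lop (site_gl2 s A ^ ?p) ?\<psi> = scale_state ((of_nat (m s) * x + b s * (x + y)) ^ ?p) ?\<psi>"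
    using site_gl2_power_state[OF ev(2,3)] ev(4) by (intro app_lop_eigen_power) simp
  \<comment> \<open>The p-th power map is additive and fixes m s and b s, which lie in the prime
    field.\<close>
  also have "(of_nat (m s) * x + b s * (x + y)) ^ ?p = of_nat (m s) * x ^ ?p + b s * (x ^ ?p + y ^ ?p)"
  proof -
    have "of_nat (m s) \<in> (prime_subfield :: 'k set)" using m_less[of s] by (auto simp: prime_subfield_def)
    then show ?thesis
      using prime_subfield_power[OF CHAR_prime] b_prime[of s]
      by (simp add: freshmans_dream CHAR_prime power_mult_distrib)
  qed
  also have "x ^ ?p + y ^ ?p = P ?p $ 1 $ 1 + P ?p $ 2 $ 2"
    using mat_power_trace[OF ev(4,5)] by (simp add: P_def)
  also have "scale_state (of_nat (m s) * x ^ ?p + b s * (P ?p $ 1 $ 1 + P ?p $ 2 $ 2)) ?\<psi> = app_lop (site_gl2 s (P ?p)) ?\<psi>"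
    using site_gl2_power_state[of "P ?p" v w "x ^ ?p" s] P by simp
  finally have C\<psi>: "app_lop C ?\<psi> = 0" by (simp add: C_def app_lop_simps P_def)
  have "{\<phi> \<in> box_states m [s]. app_lop C \<phi> = 0} = box_states m [s]"
  proof (rule site_simple)
    show "?\<psi> \<in> {\<phi> \<in> box_states m [s]. app_lop C \<phi> = 0}" using C\<psi> power_state_box by simp
    show "?\<psi> \<noteq> 0" by (rule power_state_nonzero[OF ev(1)])
    fix i j \<phi> assume \<phi>: "\<phi> \<in> {\<phi> \<in> box_states m [s]. app_lop C \<phi> = 0}"
    have "app_lop C (site_op s i j \<phi>) = app_lop (C * site_lop s i j) \<phi>" by (simp add: app_lop_simps app_site_lop)
    also have "\<dots> = 0" using \<phi> unfolding comm by (simp add: app_lop_simps app_site_lop site_op_0)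
    finally show "site_op s i j \<phi> \<in> {\<phi> \<in> box_states m [s]. app_lop C \<phi> = 0}"
      using \<phi> by (simp add: site_op_box_states)
  qed (auto simp: box_states_0 box_states_add box_states_scale app_lop_zero app_lop_add app_lop_scale scale_state_simps)
  then show ?thesis using assms by (auto simp: C_def app_lop_simps)
qed

abbreviation gl2_eval :: "nat \<Rightarrow> (2 \<times> 2, 'k) free_algebra \<Rightarrow> 'k lop" where
  "gl2_eval s \<equiv> lop.free_eval (\<lambda>(i, j). site_lop s i j)"

lemma gl2_eval_elem: "gl2_eval s (gl2_elem A) = site_gl2 s A"
  by (simp add: gl2_elem_def site_gl2_def lop.free_eval_sum lop.free_eval_mult lop.free_eval_fscal lop.free_eval_fgen)

lemma gl2_eval_power: "gl2_eval s (x ^ n) = gl2_eval s x ^ n"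
  by (induction n) (simp_all add: lop.free_eval_1 lop.free_eval_mult)

lemma gl2_eval_box: "\<psi> \<in> box_states m [s] \<Longrightarrow> app_lop (gl2_eval s x) \<psi> \<in> box_states m [s]"
proof (induction x arbitrary: \<psi> rule: poly_mapping_additive_induct)
  case (single w c)
  obtain gs where w: "w = Word gs" by (cases w)
  show ?case using single unfolding w
    by (induction gs) (auto simp: single_Word_Nil single_Word_Cons lop.free_eval_fscal lop.free_eval_mult lop.free_eval_fgen
      app_lop_simps app_site_lop box_states_scale site_op_box_states)
qed (simp_all add: lop.free_eval_0 lop.free_eval_add app_lop_simps box_states_0 box_states_add)

lemma gl2_relations_kill:
  assumes "x \<in> two_sided_ideal gl2_relations" "\<psi> \<in> box_states m [s]"
  shows "app_lop (gl2_eval s x) \<psi> = 0"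
  using assms
proof (induction arbitrary: \<psi> rule: two_sided_ideal.induct)
  case (gen r u v)
  have "app_lop (gl2_eval s r) \<phi> = 0" if "\<phi> \<in> box_states m [s]" for \<phi>
    using gen(1) that unfolding gl2_relations_def
    by (auto simp: lop.free_eval_diff lop.free_eval_mult gl2_eval_power gl2_eval_elem site_gl2_bracket
        app_lop_simps site_gl2_power)
  then show ?case using gl2_eval_box[OF gen(2)] by (simp add: lop.free_eval_mult app_lop_simps app_lop_zero)
qed (simp_all add: lop.free_eval_0 lop.free_eval_add app_lop_simps)

definition gact :: "nat \<Rightarrow> 'k restricted_gl2 \<Rightarrow> 'k state \<Rightarrow> 'k state" where
  "gact s x = app_lop (gl2_eval s (rep_restricted_gl2 x))"

lemma gact_abs:
  assumes "\<psi> \<in> box_states m [s]"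
  shows "gact s (abs_restricted_gl2 x) \<psi> = app_lop (gl2_eval s x) \<psi>"
proof -
  have "rep_restricted_gl2 (abs_restricted_gl2 x) - x \<in> two_sided_ideal gl2_relations"
    by (simp add: restricted_gl2.abs_eq_iff[symmetric] Quotient3_abs_rep[OF Quotient3_restricted_gl2])
  from gl2_relations_kill[OF this assms] show ?thesis
    by (simp add: gact_def lop.free_eval_diff app_lop_simps)
qed

lemma gact_simps:
  assumes "\<psi> \<in> box_states m [s]"
  shows "gact s (x + y) \<psi> = gact s x \<psi> + gact s y \<psi>" "gact s (x * y) \<psi> = gact s x (gact s y \<psi>)"
    "gact s 1 \<psi> = \<psi>" "gact s 0 \<psi> = 0" "gact s (gscal c) \<psi> = scale_state c \<psi>"
    "gact s (ge i j) \<psi> = site_op s i j \<psi>" "gact s x \<psi> \<in> box_states m [s]"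
proof -
  obtain x' y' where xy: "x = abs_restricted_gl2 x'" "y = abs_restricted_gl2 y'"
    by (metis Quotient3_abs_rep[OF Quotient3_restricted_gl2])
  show "gact s (x + y) \<psi> = gact s x \<psi> + gact s y \<psi>" "gact s (x * y) \<psi> = gact s x (gact s y \<psi>)"
    "gact s x \<psi> \<in> box_states m [s]"
    using assms by (simp_all add: xy plus_restricted_gl2.abs_eq times_restricted_gl2.abs_eq gact_abs gl2_eval_box
        lop.free_eval_add lop.free_eval_mult app_lop_simps)
  show "gact s 1 \<psi> = \<psi>" "gact s 0 \<psi> = 0" "gact s (gscal c) \<psi> = scale_state c \<psi>"
    "gact s (ge i j) \<psi> = site_op s i j \<psi>"
    using assms by (simp_all add: one_restricted_gl2_def zero_restricted_gl2_def gscal.abs_eq ge.abs_eq gact_abs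
        lop.free_eval_1 lop.free_eval_0 lop.free_eval_fscal lop.free_eval_fgen app_lop_simps app_site_lop)
qed

lemma gact_right: "gact s x (\<psi> + \<phi>) = gact s x \<psi> + gact s x \<phi>" "gact s x 0 = 0"
  "gact s x (scale_state c \<psi>) = scale_state c (gact s x \<psi>)"
  by (simp_all add: gact_def app_lop_add app_lop_zero app_lop_scale)

definition gl2_module :: "nat \<Rightarrow> ('k restricted_gl2, 'k state) module" where
  "gl2_module s = \<lparr>carrier = box_states m [s], mult = undefined, one = undefined,
      zero = 0, add = (+), smult = gact s\<rparr>"

lemma gl2_module_simps:
  "carrier (gl2_module s) = box_states m [s]" "x \<oplus>\<^bsub>gl2_module s\<^esub> y = x + y"
  "\<zero>\<^bsub>gl2_module s\<^esub> = 0" "c \<odot>\<^bsub>gl2_module s\<^esub> x = gact s c x"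
  by (simp_all add: gl2_module_def)

lemma gl2_left_module: "left_module (gl2_module s)"
  by (rule left_moduleI)
     (simp_all add: gl2_module_simps box_states_add box_states_0 gact_simps gact_right algebra_simps)

lemma vacuum_nonzero: "(vacuum :: 'k state) \<noteq> 0"
  by (auto simp: basis_state_def fun_eq_iff state_apply)

lemma gl2_stable_subset:
  assumes "K \<subseteq> box_states m [s]" "0 \<in> K" "\<And>x y. x \<in> K \<Longrightarrow> y \<in> K \<Longrightarrow> x + y \<in> K"
    "\<And>x y. y \<in> K \<Longrightarrow> gact s x y \<in> K" "\<phi> \<in> K" "\<phi> \<noteq> 0"
  shows "K = box_states m [s]"
proof (rule site_simple[OF assms(1,2,3) _ _ assms(5,6)])
  fix x assume x: "x \<in> K"
  then have xb: "x \<in> box_states m [s]" using assms(1) by blast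
  show "scale_state c x \<in> K" "site_op s i j x \<in> K" for c i j
    using assms(4)[OF x, of "gscal c"] assms(4)[OF x, of "ge i j"] by (simp_all add: gact_simps[OF xb])
qed

lemma gl2_simple_module: "simple_module (gl2_module s)"
  unfolding simple_module_def
proof (intro conjI allI impI)
  show "left_module (gl2_module s)" by (rule gl2_left_module)
  show "carrier (gl2_module s) \<noteq> {\<zero>\<^bsub>gl2_module s\<^esub>}"
    using vacuum_nonzero vacuum_in_box[of "[s]"] by (auto simp: gl2_module_simps)
  fix N assume N: "left_submodule N (gl2_module s)"
  note n = left_submodule_simps[OF N, unfolded gl2_module_simps]
  show "N = {\<zero>\<^bsub>gl2_module s\<^esub>} \<or> N = carrier (gl2_module s)"
  proof (cases "N \<subseteq> {0}")
    case True
    then show ?thesis using n(2) by (auto simp: gl2_module_simps)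
  next
    case False
    then obtain \<phi> where "\<phi> \<in> N" "\<phi> \<noteq> 0" by blast
    then have "N = box_states m [s]" using n by (intro gl2_stable_subset) auto
    then show ?thesis by (simp add: gl2_module_simps)
  qed
qed

text \<open>A vector is encoded by the set of all ring elements mapping the highest weight vector to it, so that
  modules can live on the type of sets of ring elements.\<close>

definition encode :: "nat \<Rightarrow> 'k state \<Rightarrow> 'k restricted_gl2 set" where
  "encode s v = {x. gact s x vacuum = v}"

text \<open>Since the vacuum generates the module, every code of a vector is nonempty, and any of
  its elements recovers the vector.\<close>

lemma inj_encode: "inj_on (encode s) (box_states m [s])"
proof (rule inj_onI)
  fix v w assume v: "v \<in> box_states m [s]" and eq: "encode s v = encode s w"
  have vac: "vacuum \<in> box_states m [s]" by (rule vacuum_in_box)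
  define K where "K = range (\<lambda>x. gact s x vacuum)"
  have "K = box_states m [s]"
  proof (rule gl2_stable_subset)
    show "K \<subseteq> box_states m [s]" using gact_simps(7)[OF vac] by (auto simp: K_def)
    show "0 \<in> K" unfolding K_def by (rule range_eqI[of _ _ 0]) (simp add: gact_simps(4)[OF vac])
    show "vacuum \<in> K" unfolding K_def by (rule range_eqI[of _ _ 1]) (simp add: gact_simps(3)[OF vac])
    show "x + y \<in> K" if "x \<in> K" "y \<in> K" for x y
      using that by (auto simp: K_def gact_simps(1)[OF vac, symmetric])
    show "gact s x y \<in> K" if "y \<in> K" for x y
      using that by (auto simp: K_def gact_simps(2)[OF vac, symmetric])
  qed (rule vacuum_nonzero)
  then obtain x where "v = gact s x vacuum" using v by (auto simp: K_def)
  then have "x \<in> encode s v" by (simp add: encode_def)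
  then have "x \<in> encode s w" using eq by simp
  with \<open>v = _\<close> show "v = w" by (simp add: encode_def)
qed

definition site_module :: "nat \<Rightarrow> ('k restricted_yangian, 'k restricted_gl2 set) module" where
  "site_module s = transport_module (encode s) (chain_module [s])"

lemma inj_encode_carrier:
  "inj_on (encode s) (carrier (gl2_module s))" "inj_on (encode s) (carrier (chain_module [s]))"
  by (simp_all add: gl2_module_simps chain_module_simps inj_encode)

lemma site_module_simps:
  "carrier (site_module s) = encode s ` box_states m [s]"
  "\<psi> \<in> box_states m [s] \<Longrightarrow> \<phi> \<in> box_states m [s] \<Longrightarrow> encode s \<psi> \<oplus>\<^bsub>site_module s\<^esub> encode s \<phi> = encode s (\<psi> + \<phi>)"
  "\<psi> \<in> box_states m [s] \<Longrightarrow> x \<odot>\<^bsub>site_module s\<^esub> encode s \<psi> = encode s (ract [s] x \<psi>)"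
  using transport_module_simps[OF inj_encode_carrier(2)]
  by (simp_all add: site_module_def transport_module_carrier_zero chain_module_simps)

lemma site_evaluation_module: "is_evaluation_module (a s) (b s) (site_module s)"
proof -
  let ?U = "transport_module (encode s) (gl2_module s)"
  note t = transport_module_simps[OF inj_encode_carrier(1), unfolded gl2_module_simps]
    and c = transport_module_carrier_zero[of "encode s" "gl2_module s", unfolded gl2_module_simps]
  have vac: "vacuum \<in> box_states m [s]" by (rule vacuum_in_box)
  have U: "simple_module ?U" by (rule transport_simple_module[OF inj_encode_carrier(1) gl2_simple_module])
  have op: "site_op s i j \<psi> = chain_op [s] i j 1 \<psi>" for i j \<psi> by (simp only: chain_op_singleton) simp
  have "is_gl2_simple (a s) (b s) ?U"
    unfolding is_gl2_simple_def
  proof (intro conjI bexI[of _ "encode s vacuum"])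
    show "generated_submodule ?U {encode s vacuum} = carrier ?U"
    proof (rule simple_module_generated[OF U])
      show "encode s vacuum \<noteq> \<zero>\<^bsub>?U\<^esub>"
        using inj_onD[OF inj_encode _ vac box_states_0] vacuum_nonzero by (auto simp: c)
    qed (simp add: c vac)
    show "ge 1 1 \<odot>\<^bsub>?U\<^esub> encode s vacuum = gscal (a s) \<odot>\<^bsub>?U\<^esub> encode s vacuum"
      "ge 2 2 \<odot>\<^bsub>?U\<^esub> encode s vacuum = gscal (b s) \<odot>\<^bsub>?U\<^esub> encode s vacuum"
      "ge 1 2 \<odot>\<^bsub>?U\<^esub> encode s vacuum = \<zero>\<^bsub>?U\<^esub>"
      by (simp_all add: t vac c gact_simps[OF vac] op chain_op_vacuum[of "[s]"] del: chain_op.simps)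
  qed (simp_all add: U c vac)
  moreover have "left_module (site_module s)"
    unfolding site_module_def by (rule transport_left_module[OF inj_encode_carrier(2) chain_left_module[OF compatible_singleton]])
  moreover have "\<zero>\<^bsub>site_module s\<^esub> = encode s 0"
    by (simp add: site_module_def transport_module_carrier_zero chain_module_simps)
  ultimately show ?thesis
    unfolding is_evaluation_module_def
    by (intro conjI exI[of _ ?U])
       (auto simp: site_module_simps c t ract_simps[OF compatible_singleton] gact_simps chain_op_singleton
         simp del: chain_op.simps)
qed

end

section \<open>Tensor products\<close>

lemma lookup_map_times: "Poly_Mapping.lookup (Poly_Mapping.map ((*) c) f) k = (c :: 'k::field) * Poly_Mapping.lookup f k"
  by (simp add: Poly_Mapping.map.rep_eq when_def)

lemma map_times_simps:
  fixes c :: "'k::field"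
  shows "Poly_Mapping.map ((*) c) (f + g) = Poly_Mapping.map ((*) c) f + Poly_Mapping.map ((*) c) g"
    "Poly_Mapping.map ((*) c) (f - g) = Poly_Mapping.map ((*) c) f - Poly_Mapping.map ((*) c) g"
    "Poly_Mapping.map ((*) (c + d)) f = Poly_Mapping.map ((*) c) f + Poly_Mapping.map ((*) d) f"
    "Poly_Mapping.map ((*) (c * d)) f = Poly_Mapping.map ((*) c) (Poly_Mapping.map ((*) d) f)"
    "Poly_Mapping.map ((*) 1) f = f" "Poly_Mapping.map ((*) 0) f = 0" "Poly_Mapping.map ((*) c) 0 = 0"
    "Poly_Mapping.map ((*) c) (Poly_Mapping.single k d) = Poly_Mapping.single k (c * d)"
  by (rule poly_mapping_eqI; simp add: lookup_map_times lookup_add lookup_minus lookup_single algebra_simps when_def)+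

lemma free_space_simps:
  "carrier (free_space Ms) = {f. Poly_Mapping.keys f \<subseteq> tuples Ms}" "f \<oplus>\<^bsub>free_space Ms\<^esub> g = f + g"
  "\<zero>\<^bsub>free_space Ms\<^esub> = 0" "c \<odot>\<^bsub>free_space Ms\<^esub> f = Poly_Mapping.map ((*) c) f"
  by (simp_all add: free_space_def)

lemma free_space_left_module: "left_module (free_space Ms :: ('k::field, 'v list \<Rightarrow>\<^sub>0 'k) module)"
proof (rule left_moduleI)
  fix f g :: "'v list \<Rightarrow>\<^sub>0 'k" and c
  assume f: "f \<in> carrier (free_space Ms)"
  have "Poly_Mapping.keys (Poly_Mapping.map ((*) c) f) \<subseteq> Poly_Mapping.keys f"
    by (auto simp: in_keys_iff lookup_map_times)
  then show "c \<odot>\<^bsub>free_space Ms\<^esub> f \<in> carrier (free_space Ms)" using f by (auto simp: free_space_simps)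
  assume "g \<in> carrier (free_space Ms)"
  then show "f \<oplus>\<^bsub>free_space Ms\<^esub> g \<in> carrier (free_space Ms)"
    using f Poly_Mapping.keys_add[of f g] by (auto simp: free_space_simps)
qed (simp_all add: free_space_simps map_times_simps add_ac)

definition linear_extension :: "('v \<Rightarrow> 'k state) \<Rightarrow> ('v \<Rightarrow>\<^sub>0 'k::field) \<Rightarrow> 'k state" where
  "linear_extension g f = (\<Sum>v\<in>Poly_Mapping.keys f. scale_state (Poly_Mapping.lookup f v) (g v))"

lemma linear_extension_superset:
  "finite A \<Longrightarrow> Poly_Mapping.keys f \<subseteq> A \<Longrightarrow> linear_extension g f = (\<Sum>v\<in>A. scale_state (Poly_Mapping.lookup f v) (g v))"
  unfolding linear_extension_def by (rule sum.mono_neutral_left) (auto simp: in_keys_iff scale_state_simps)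

lemma linear_extension_add: "linear_extension g (x + y) = linear_extension g x + linear_extension g y"
proof -
  let ?A = "Poly_Mapping.keys x \<union> Poly_Mapping.keys y"
  have "linear_extension g (x + y) = (\<Sum>v\<in>?A. scale_state (Poly_Mapping.lookup (x + y) v) (g v))"
    by (rule linear_extension_superset) (use Poly_Mapping.keys_add[of x y] in auto)
  also have "\<dots> = linear_extension g x + linear_extension g y"
    using linear_extension_superset[of ?A x] linear_extension_superset[of ?A y]
    by (simp add: lookup_add scale_state_simps sum.distrib)
  finally show ?thesis .
qed

lemma linear_extension_single: "linear_extension g (Poly_Mapping.single v c) = scale_state c (g v)"
  using linear_extension_superset[of "{v}" "Poly_Mapping.single v c" g] by simp

lemma linear_extension_0: "linear_extension g 0 = 0"
  by (simp add: linear_extension_def)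

lemma linear_extension_diff: "linear_extension g (x - y) = linear_extension g x - linear_extension g y"
  using linear_extension_add[of g "x - y" y] by simp

lemma linear_extension_sum: "linear_extension g (\<Sum>i\<in>A. x i) = (\<Sum>i\<in>A. linear_extension g (x i))"
  by (induction A rule: infinite_finite_induct) (simp_all add: linear_extension_0 linear_extension_add)

lemma linear_extension_map_times: "linear_extension g (Poly_Mapping.map ((*) c) x) = scale_state c (linear_extension g x)"
  by (induction x rule: poly_mapping_additive_induct)
     (simp_all add: map_times_simps linear_extension_0 linear_extension_add linear_extension_single scale_state_simps)

section \<open>The comultiplication on pure tensors\<close>

lemma sum_index_paths_Cons:
  "(\<Sum>ks\<in>{ks :: 2 list. length ks = Suc (Suc n) \<and> hd ks = i \<and> last ks = j}. G ks)
     = (\<Sum>k\<in>UNIV. \<Sum>ks\<in>{ks. length ks = Suc n \<and> hd ks = k \<and> last ks = j}. G (i # ks))"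
proof -
  have fin: "finite {ks :: 2 list. length ks = Suc n \<and> hd ks = k \<and> last ks = j}" for k
    by (rule finite_subset[OF _ finite_lists_length_eq[of UNIV "Suc n"]]) auto
  show ?thesis
    by (subst sum.Sigma[OF _ ballI[OF fin]], simp)
       (rule sum.reindex_bij_witness[of _ "\<lambda>(k, ks). i # ks" "\<lambda>ks. (hd (tl ks), tl ks)"],
         auto simp: length_Suc_conv)
qed

lemma sum_compositions_Cons:
  "(\<Sum>rs\<in>{rs :: nat list. length rs = Suc n \<and> sum_list rs = r}. G rs)
     = (\<Sum>q\<le>r. \<Sum>rs\<in>{rs. length rs = n \<and> sum_list rs = r - q}. G (q # rs))"
proof -
  have fin: "\<forall>q\<in>{..r}. finite {rs :: nat list. length rs = n \<and> sum_list rs = r - q}"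
  proof
    fix q
    show "finite {rs :: nat list. length rs = n \<and> sum_list rs = r - q}"
      by (rule finite_subset[OF _ finite_lists_length_eq[of "{..r - q}" n]]) (auto dest: member_le_sum_list)
  qed
  show ?thesis
    by (subst sum.Sigma[OF _ fin], simp)
       (rule sum.reindex_bij_witness[of _ "\<lambda>(q, rs). q # rs" "\<lambda>rs. (hd rs, tl rs)"],
         auto simp: length_Suc_conv)
qed

text \<open>The elementary tensor of a vector x at site s with a state \<phi> on the remaining
  sites.\<close>

definition extend_state :: "nat \<Rightarrow> 'k::field state \<Rightarrow> 'k state \<Rightarrow> 'k state" where
  "extend_state s x \<phi> = (\<lambda>\<kappa>. x ((\<lambda>_. 0)(s := \<kappa> s)) * \<phi> (\<kappa>(s := 0)))"

lemma extend_state_simps: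
  "extend_state s (x + y) \<phi> = extend_state s x \<phi> + extend_state s y \<phi>"
  "extend_state s x (\<phi> + \<psi>) = extend_state s x \<phi> + extend_state s x \<psi>"
  "extend_state s (scale_state c x) \<phi> = scale_state c (extend_state s x \<phi>)"
  "extend_state s x (scale_state c \<phi>) = scale_state c (extend_state s x \<phi>)"
  "extend_state s 0 \<phi> = 0" "extend_state s x 0 = 0"
  by (auto simp: extend_state_def fun_eq_iff state_apply algebra_simps)

lemma extend_state_sum: "extend_state s x (\<Sum>i\<in>A. \<phi> i) = (\<Sum>i\<in>A. extend_state s x (\<phi> i))"
  by (induction A rule: infinite_finite_induct) (simp_all add: extend_state_simps)

primrec tensor_state :: "nat list \<Rightarrow> 'k::field state list \<Rightarrow> 'k state" where
  "tensor_state [] xs = vacuum"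
| "tensor_state (s # ss) xs = extend_state s (hd xs) (tensor_state ss (tl xs))"

lemma tensor_state_update:
  assumes "k < length ss" "length xs = length ss"
  shows "tensor_state ss (xs[k := x + y]) = tensor_state ss (xs[k := x]) + tensor_state ss (xs[k := y])"
    and "tensor_state ss (xs[k := scale_state c x]) = scale_state c (tensor_state ss (xs[k := x]))"
  using assms
proof (induction ss arbitrary: xs k)
  case (Cons s ss)
  {
    case 1
    then show ?case using Cons(1)[of "k - 1" "tl xs"]
      by (cases k; cases xs) (simp_all add: extend_state_simps)
  next
    case 2
    then show ?case using Cons(2)[of "k - 1" "tl xs"]
      by (cases k; cases xs) (simp_all add: extend_state_simps)
  }
qed simp_all

context closed_weights
begin

abbreviation site_states :: "nat list \<Rightarrow> 'k state list \<Rightarrow> bool" where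
  "site_states \<equiv> list_all2 (\<lambda>s x. x \<in> box_states m [s])"

abbreviation basis_tuple :: "nat list \<Rightarrow> (nat \<Rightarrow> nat) \<Rightarrow> 'k state list" where
  "basis_tuple ss \<kappa> \<equiv> map (\<lambda>s. basis_state ((\<lambda>_. 0)(s := \<kappa> s))) ss"

lemma tensor_state_box: "site_states ss xs \<Longrightarrow> tensor_state ss xs \<in> box_states m ss"
proof (induction ss xs rule: list_all2_induct)
  case Nil
  show ?case using vacuum_in_box[of "[]"] by simp
next
  case (Cons s ss x xs)
  have "\<kappa> \<in> box m (s # ss)" if "extend_state s x (tensor_state ss xs) \<kappa> \<noteq> 0" for \<kappa>
  proof -
    have "(\<lambda>_. 0)(s := \<kappa> s) \<in> box m [s]" "\<kappa>(s := 0) \<in> box m ss"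
      using that Cons(1,3) by (auto simp: extend_state_def box_states_def)
    then show ?thesis by (auto simp: box_def split: if_splits)
  qed
  then show ?case by (auto simp: box_states_def)
qed

lemma tensor_state_basis:
  "distinct ss \<Longrightarrow> \<kappa> \<in> box m ss \<Longrightarrow> tensor_state ss (basis_tuple ss \<kappa>) = basis_state \<kappa>"
proof (induction ss arbitrary: \<kappa>)
  case Nil
  have "\<kappa> = (\<lambda>_. 0)" using Nil by (auto simp: box_def)
  then show ?case by simp
next
  case (Cons s ss)
  have "\<kappa>(s := 0) \<in> box m ss" using Cons.prems by (auto simp: box_def)
  then have IH: "tensor_state ss (basis_tuple ss (\<kappa>(s := 0))) = basis_state (\<kappa>(s := 0))"
    by (rule Cons.IH[rotated]) (use Cons.prems in simp)
  have "basis_tuple ss (\<kappa>(s := 0)) = basis_tuple ss \<kappa>"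
    by (intro map_cong refl arg_cong[where f = basis_state] ext) (use Cons.prems in auto)
  moreover have "extend_state s (basis_state ((\<lambda>_. 0)(s := \<kappa> s))) (basis_state (\<kappa>(s := 0))) = (basis_state \<kappa> :: 'k state)"
  proof
    fix \<kappa>' :: "nat \<Rightarrow> nat"
    have "(\<lambda>_. 0)(s := \<kappa>' s) = (\<lambda>_. 0)(s := \<kappa> s) \<and> \<kappa>'(s := 0) = \<kappa>(s := 0) \<longleftrightarrow> \<kappa>' = \<kappa>"
      by (metis fun_upd_same fun_upd_triv fun_upd_upd)
    then show "extend_state s (basis_state ((\<lambda>_. 0)(s := \<kappa> s))) (basis_state (\<kappa>(s := 0))) \<kappa>' = (basis_state \<kappa> \<kappa>' :: 'k)"
      by (auto simp: extend_state_def basis_state_def)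
  qed
  ultimately show ?case using IH by (simp only: list.map tensor_state.simps list.sel)
qed

lemma site_op_extend: "site_op s i j (extend_state s x \<phi>) = extend_state s (site_op s i j x) \<phi>"
  by (auto simp: fun_eq_iff site_op_def extend_state_def)

lemma site_op_extend_other: "s' \<noteq> s \<Longrightarrow> site_op s' i j (extend_state s x \<phi>) = extend_state s x (site_op s' i j \<phi>)"
  by (auto simp: fun_eq_iff site_op_def extend_state_def fun_upd_twist[of s' s])

lemma chain_op_extend:
  "s \<notin> set ss \<Longrightarrow> chain_op ss i j r (extend_state s x \<phi>) = extend_state s x (chain_op ss i j r \<phi>)"
  by (induction ss arbitrary: i j r)
     (auto simp: extend_state_simps extend_state_sum site_op_extend_other intro!: arg_cong2[where f = "(+)"] sum.cong)

lemma chain_op_Cons_extend: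
  assumes "s \<notin> set ss"
  shows "chain_op (s # ss) i j r (extend_state s x \<phi>)
     = (\<Sum>k\<in>UNIV. \<Sum>q\<le>r. extend_state s (chain_op [s] i k q x) (chain_op ss k j (r - q) \<phi>))"
proof -
  have "(\<Sum>q\<le>r. extend_state s (chain_op [s] i k q x) (chain_op ss k j (r - q) \<phi>))
     = (if i = k then extend_state s x (chain_op ss k j r \<phi>) else 0)
       + (if r = 0 then 0 else extend_state s (site_op s i k x) (chain_op ss k j (r - 1) \<phi>))" for k
  proof -
    have "(\<Sum>q\<le>r. extend_state s (chain_op [s] i k q x) (chain_op ss k j (r - q) \<phi>))
      = (\<Sum>q\<in>(if r = 0 then {0} else {0, 1}). extend_state s (chain_op [s] i k q x) (chain_op ss k j (r - q) \<phi>))"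
      by (rule sum.mono_neutral_right) (auto simp: chain_op_singleton extend_state_simps simp del: chain_op.simps)
    then show ?thesis by (auto simp: chain_op_singleton extend_state_simps simp del: chain_op.simps)
  qed
  then show ?thesis
    using assms by (simp add: sum.distrib chain_op_extend site_op_extend del: One_nat_def)
qed

text \<open>Splitting off the first site splits off the first step of the index path and the first
  superscript. This is what identifies the recursively defined chain operators with the iterated
  comultiplication.\<close>

lemma chain_op_tensor_state:
  "distinct ss \<Longrightarrow> length xs = length ss \<Longrightarrow> chain_op ss i j r (tensor_state ss xs)
     = (\<Sum>ks\<in>{ks. length ks = Suc (length ss) \<and> hd ks = i \<and> last ks = j}.
        \<Sum>rs\<in>{rs. length rs = length ss \<and> sum_list rs = r}.
          tensor_state ss (map (\<lambda>n. chain_op [ss ! n] (ks ! n) (ks ! Suc n) (rs ! n) (xs ! n)) [0..<length ss]))"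
proof (induction ss arbitrary: i r xs)
  case Nil
  have 1: "{ks :: 2 list. length ks = Suc 0 \<and> hd ks = i \<and> last ks = j} = (if i = j then {[i]} else {})"
    by (auto simp: length_Suc_conv)
  have 2: "{rs :: nat list. length rs = 0 \<and> sum_list rs = r} = (if r = 0 then {[]} else {})"
    by auto
  show ?case by (simp add: 1 2[simplified] fun_eq_iff state_apply)
next
  case (Cons s ss)
  have nth0: "ks ! 0 = hd ks" if "length ks = Suc (length ss)" for ks :: "2 list"
    using that by (cases ks) auto
  obtain x ys where xs: "xs = x # ys" "length ys = length ss" using Cons.prems(2) by (cases xs) auto
  have "chain_op (s # ss) i j r (tensor_state (s # ss) xs)
     = (\<Sum>k\<in>UNIV. \<Sum>q\<le>r. extend_state s (chain_op [s] i k q x) (chain_op ss k j (r - q) (tensor_state ss ys)))"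
    using Cons.prems(1) xs by (simp del: chain_op.simps add: chain_op_Cons_extend)
  also have "\<dots> = (\<Sum>k\<in>UNIV. \<Sum>q\<le>r. \<Sum>ks\<in>{ks. length ks = Suc (length ss) \<and> hd ks = k \<and> last ks = j}.
        \<Sum>rs\<in>{rs. length rs = length ss \<and> sum_list rs = r - q}.
          extend_state s (chain_op [s] i k q x)
            (tensor_state ss (map (\<lambda>n. chain_op [ss ! n] (ks ! n) (ks ! Suc n) (rs ! n) (ys ! n)) [0..<length ss])))"
    using Cons.prems(1) xs(2) by (simp only: Cons.IH distinct.simps extend_state_sum)
  also have "\<dots> = (\<Sum>k\<in>UNIV. \<Sum>ks\<in>{ks. length ks = Suc (length ss) \<and> hd ks = k \<and> last ks = j}. \<Sum>q\<le>r.
        \<Sum>rs\<in>{rs. length rs = length ss \<and> sum_list rs = r - q}.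
          extend_state s (chain_op [s] i k q x)
            (tensor_state ss (map (\<lambda>n. chain_op [ss ! n] (ks ! n) (ks ! Suc n) (rs ! n) (ys ! n)) [0..<length ss])))"
    by (intro sum.cong sum.swap refl)
  also have "\<dots> = (\<Sum>k\<in>UNIV. \<Sum>ks\<in>{ks. length ks = Suc (length ss) \<and> hd ks = k \<and> last ks = j}. \<Sum>q\<le>r.
        \<Sum>rs\<in>{rs. length rs = length ss \<and> sum_list rs = r - q}.
          tensor_state (s # ss) (map (\<lambda>n. chain_op [(s # ss) ! n] ((i # ks) ! n) ((i # ks) ! Suc n) ((q # rs) ! n) (xs ! n))
            [0..<length (s # ss)]))"
    by (intro sum.cong refl)
       (auto simp: xs map_upt_Suc nth0 simp del: chain_op.simps upt_Suc)
  finally show ?case by (simp only: list.size(4) add_0_right add_Suc_right sum_index_paths_Cons sum_compositions_Cons)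
qed

definition decode :: "nat \<Rightarrow> 'k restricted_gl2 set \<Rightarrow> 'k state" where
  "decode s = the_inv_into (box_states m [s]) (encode s)"

lemma decode_encode: "x \<in> box_states m [s] \<Longrightarrow> decode s (encode s x) = x"
  unfolding decode_def by (rule the_inv_into_f_f[OF inj_encode])

abbreviation encodes :: "nat list \<Rightarrow> 'k state list \<Rightarrow> 'k restricted_gl2 set list" where
  "encodes \<equiv> map2 encode"

lemma decodes_encodes: "site_states ss xs \<Longrightarrow> map2 decode ss (encodes ss xs) = xs"
  by (induction ss xs rule: list_all2_induct) (simp_all add: decode_encode)

lemma tuples_site_modules: "vs \<in> tuples (map site_module ss) \<longleftrightarrow> (\<exists>xs. site_states ss xs \<and> vs = encodes ss xs)"
proof
  assume "vs \<in> tuples (map site_module ss)"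
  then have "list_all2 (\<lambda>s v. v \<in> encode s ` box_states m [s]) ss vs"
    by (auto simp: tuples_def list_all2_conv_all_nth site_module_simps)
  then show "\<exists>xs. site_states ss xs \<and> vs = encodes ss xs"
  proof (induction ss vs rule: list_all2_induct)
    case (Cons s ss v vs)
    then obtain x xs where "x \<in> box_states m [s]" "v = encode s x" "site_states ss xs" "vs = encodes ss xs" by blast
    then show ?case by (intro exI[of _ "x # xs"]) simp
  qed simp
qed (auto simp: tuples_def list_all2_conv_all_nth site_module_simps)

lemma encodes_update:
  "length xs = length ss \<Longrightarrow> k < length ss \<Longrightarrow> (encodes ss xs)[k := encode (ss ! k) x] = encodes ss (xs[k := x])"
  by (rule nth_equalityI) (auto simp: nth_list_update)

context
  fixes ss :: "nat list"
  assumes ss: "compatible ss"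
begin

abbreviation tensor_relations :: "('k restricted_gl2 set list \<Rightarrow>\<^sub>0 'k) set" where
  "tensor_relations \<equiv> tensor_null (map site_module ss)"

abbreviation tensor_map :: "('k restricted_gl2 set list \<Rightarrow>\<^sub>0 'k) \<Rightarrow> 'k state" where
  "tensor_map \<equiv> linear_extension (\<lambda>vs. tensor_state ss (map2 decode ss vs))"

text \<open>A section of \<open>tensor_map\<close>, built from the tensors of basis vectors.\<close>

definition basis_combination :: "'k state \<Rightarrow> ('k restricted_gl2 set list \<Rightarrow>\<^sub>0 'k)" where
  "basis_combination \<psi> = (\<Sum>\<kappa>\<in>box m ss. Poly_Mapping.single (encodes ss (basis_tuple ss \<kappa>)) (\<psi> \<kappa>))"

lemma basis_combination_simps:
  "basis_combination (x + y) = basis_combination x + basis_combination y"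
  "basis_combination (scale_state c x) = Poly_Mapping.map ((*) c) (basis_combination x)"
  "basis_combination 0 = 0"
proof -
  have "Poly_Mapping.map ((*) c) (\<Sum>i\<in>A. f i) = (\<Sum>i\<in>A. Poly_Mapping.map ((*) c) (f i))"
    for A :: "(nat \<Rightarrow> nat) set" and f :: "_ \<Rightarrow> 'k restricted_gl2 set list \<Rightarrow>\<^sub>0 'k"
    by (induction A rule: infinite_finite_induct) (simp_all add: map_times_simps)
  then show "basis_combination (scale_state c x) = Poly_Mapping.map ((*) c) (basis_combination x)"
    by (simp add: basis_combination_def state_apply map_times_simps)
qed (simp_all add: basis_combination_def state_apply single_add sum.distrib)

lemma basis_tuple_states: "\<kappa> \<in> box m ss \<Longrightarrow> site_states ss (basis_tuple ss \<kappa>)"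
  by (auto simp: list_all2_conv_all_nth box_def intro!: basis_state_in_box)

lemma tensor_relations_submodule: "left_submodule tensor_relations (free_space (map site_module ss))"
  and multilinear_relations_tensor: "multilinear_relations (map site_module ss) \<subseteq> tensor_relations"
  and tensor_relations_least: "left_submodule N (free_space (map site_module ss)) \<Longrightarrow>
    multilinear_relations (map site_module ss) \<subseteq> N \<Longrightarrow> tensor_relations \<subseteq> N"
proof -
  interpret F: left_module "free_space (map site_module ss) :: ('k, _) module" by (rule free_space_left_module)
  have single: "Poly_Mapping.single v c \<in> carrier (free_space (map site_module ss))"
    if "v \<in> tuples (map site_module ss)" for v :: "'k restricted_gl2 set list" and c :: 'k
    using that by (auto simp: free_space_simps)
  have diff: "f - g \<in> carrier (free_space (map site_module ss))"
    if "f \<in> carrier (free_space (map site_module ss))" "g \<in> carrier (free_space (map site_module ss))"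
    for f g :: "'k restricted_gl2 set list \<Rightarrow>\<^sub>0 'k"
    using that Poly_Mapping.keys_diff[of f g] by (auto simp: free_space_simps)
  have upd: "vs[k := v] \<in> tuples (map site_module ss)"
    if "vs \<in> tuples (map site_module ss)" "v \<in> carrier (map site_module ss ! k)" for vs k v
    using that by (cases "k < length vs") (auto simp: tuples_def nth_list_update)
  have mod: "left_module (site_module s)" for s
    using site_evaluation_module[of s] by (simp add: is_evaluation_module_def)
  have closed: "x \<oplus>\<^bsub>map site_module ss ! k\<^esub> y \<in> carrier (map site_module ss ! k)"
    "c \<odot>\<^bsub>map site_module ss ! k\<^esub> x \<in> carrier (map site_module ss ! k)"
    if "k < length (map site_module ss)" "x \<in> carrier (map site_module ss ! k)" "y \<in> carrier (map site_module ss ! k)" for k x y c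
    using that left_submodule_simps(3,4)[OF left_module.carrier_submodule[OF mod]] by simp_all
  have "multilinear_relations (map site_module ss) \<subseteq> carrier (free_space (map site_module ss))"
    unfolding multilinear_relations_def by (auto intro!: diff single upd closed simp del: length_map)
  from F.generated_submodule_submodule[OF this]
  show "left_submodule tensor_relations (free_space (map site_module ss))"
    "multilinear_relations (map site_module ss) \<subseteq> tensor_relations"
    "left_submodule N (free_space (map site_module ss)) \<Longrightarrow>
      multilinear_relations (map site_module ss) \<subseteq> N \<Longrightarrow> tensor_relations \<subseteq> N"
    by (simp_all add: tensor_null_def)
qed

lemmas tensor_relations_simps = left_submodule_simps[OF tensor_relations_submodule, unfolded free_space_simps]

lemma tensor_map_encodes: "site_states ss xs \<Longrightarrow> tensor_map (Poly_Mapping.single (encodes ss xs) c) = scale_state c (tensor_state ss xs)"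
  by (simp add: linear_extension_single decodes_encodes)

lemma ss_lengths: "site_states ss xs \<Longrightarrow> length xs = length ss"
  by (simp add: list_all2_lengthD)

lemma site_states_update:
  "site_states ss xs \<Longrightarrow> x \<in> box_states m [ss ! k] \<Longrightarrow> site_states ss (xs[k := x])"
  by (cases "k < length ss") (auto simp: list_all2_conv_all_nth nth_list_update)

lemma tensor_relation_elements:
  assumes "site_states ss xs" "k < length ss" "x \<in> box_states m [ss ! k]"
  shows "y \<in> box_states m [ss ! k] \<Longrightarrow> Poly_Mapping.single (encodes ss (xs[k := x + y])) 1
      - Poly_Mapping.single (encodes ss (xs[k := x])) 1 - Poly_Mapping.single (encodes ss (xs[k := y])) 1 \<in> tensor_relations"
    and "Poly_Mapping.single (encodes ss (xs[k := scale_state c x])) 1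
      - Poly_Mapping.single (encodes ss (xs[k := x])) c \<in> tensor_relations"
proof -
  have vs: "encodes ss xs \<in> tuples (map site_module ss)" using assms(1) tuples_site_modules by blast
  have u: "encodes ss (xs[k := z]) = (encodes ss xs)[k := encode (ss ! k) z]" for z
    using encodes_update[of xs ss k z] assms(2) ss_lengths[OF assms(1)] by simp
  have c: "encode (ss ! k) z \<in> carrier (map site_module ss ! k)" if "z \<in> box_states m [ss ! k]" for z
    using that assms(2) by (simp add: site_module_simps)
  have k: "k < length (map site_module ss)" using assms(2) by simp
  have M: "map site_module ss ! k = site_module (ss ! k)" using assms(2) by simp
  {
    assume y: "y \<in> box_states m [ss ! k]"
    have e: "encode (ss ! k) (x + y) = encode (ss ! k) x \<oplus>\<^bsub>map site_module ss ! k\<^esub> encode (ss ! k) y"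
      using assms(3) y by (simp add: M site_module_simps)
    show "Poly_Mapping.single (encodes ss (xs[k := x + y])) 1 - Poly_Mapping.single (encodes ss (xs[k := x])) 1
        - Poly_Mapping.single (encodes ss (xs[k := y])) 1 \<in> tensor_relations"
      unfolding u e using vs k c[OF assms(3)] c[OF y]
      by (intro subsetD[OF multilinear_relations_tensor]) (unfold multilinear_relations_def, blast)
  }
  have e: "encode (ss ! k) (scale_state c x) = rscal c \<odot>\<^bsub>map site_module ss ! k\<^esub> encode (ss ! k) x"
    using assms(3) by (simp add: M site_module_simps ract_simps[OF compatible_singleton])
  show "Poly_Mapping.single (encodes ss (xs[k := scale_state c x])) 1
      - Poly_Mapping.single (encodes ss (xs[k := x])) c \<in> tensor_relations"
    unfolding u e using vs k c[OF assms(3)]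
    by (intro subsetD[OF multilinear_relations_tensor]) (unfold multilinear_relations_def, blast)
qed

lemma tensor_map_relations:
  assumes "f \<in> tensor_relations"
  shows "tensor_map f = 0"
proof -
  interpret F: left_module "free_space (map site_module ss) :: ('k, _) module" by (rule free_space_left_module)
  let ?N = "{f \<in> carrier (free_space (map site_module ss)). tensor_map f = 0}"
  have "left_submodule ?N (free_space (map site_module ss))"
  proof (rule F.left_submoduleI)
    show "f \<oplus>\<^bsub>free_space (map site_module ss)\<^esub> g \<in> ?N" if "f \<in> ?N" "g \<in> ?N" for f g
      using that F.add.m_closed[of f g] by (simp add: free_space_simps linear_extension_add)
    show "c \<odot>\<^bsub>free_space (map site_module ss)\<^esub> f \<in> ?N" if "f \<in> ?N" for c f
      using that F.smult_closed[of f c] by (simp add: free_space_simps linear_extension_map_times scale_state_simps)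
  qed (auto simp: free_space_simps linear_extension_0)
  moreover have "multilinear_relations (map site_module ss) \<subseteq> ?N"
  proof
    fix f assume f: "f \<in> multilinear_relations (map site_module ss)"
    then have fc: "f \<in> carrier (free_space (map site_module ss))"
      using multilinear_relations_tensor tensor_relations_simps(1) by (auto simp: free_space_simps)
    have upd: "(encodes ss xs)[k := encode (ss ! k) x] = encodes ss (xs[k := x])"
      if "site_states ss xs" "k < length ss" for xs k x
      using that by (intro encodes_update) (auto simp: ss_lengths)
    from f consider vs k x y where "f = Poly_Mapping.single (vs[k := x \<oplus>\<^bsub>map site_module ss ! k\<^esub> y]) 1
          - Poly_Mapping.single (vs[k := x]) 1 - Poly_Mapping.single (vs[k := y]) 1" "vs \<in> tuples (map site_module ss)" "k < length ss"
          "x \<in> carrier (site_module (ss ! k))" "y \<in> carrier (site_module (ss ! k))"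
      | vs k c x where "f = Poly_Mapping.single (vs[k := rscal c \<odot>\<^bsub>map site_module ss ! k\<^esub> x]) 1 - Poly_Mapping.single (vs[k := x]) c"
          "vs \<in> tuples (map site_module ss)" "k < length ss" "x \<in> carrier (site_module (ss ! k))"
      unfolding multilinear_relations_def by auto
    then have "tensor_map f = 0"
    proof cases
      case (1 vs k x y)
      then obtain xs x' y' where xs: "site_states ss xs" "vs = encodes ss xs" "x' \<in> box_states m [ss ! k]" "x = encode (ss ! k) x'"
        "y' \<in> box_states m [ss ! k]" "y = encode (ss ! k) y'"
        by (auto simp: tuples_site_modules site_module_simps)
      have e: "encode (ss ! k) x' \<oplus>\<^bsub>map site_module ss ! k\<^esub> encode (ss ! k) y' = encode (ss ! k) (x' + y')"
        using 1(3) xs by (simp add: site_module_simps)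
      show ?thesis unfolding 1(1) xs e upd[OF xs(1) 1(3)]
        using 1(3) xs by (simp add: linear_extension_diff tensor_map_encodes site_states_update box_states_add
            tensor_state_update ss_lengths scale_state_simps)
    next
      case (2 vs k c x)
      then obtain xs x' where xs: "site_states ss xs" "vs = encodes ss xs" "x' \<in> box_states m [ss ! k]" "x = encode (ss ! k) x'"
        by (auto simp: tuples_site_modules site_module_simps)
      have e: "rscal c \<odot>\<^bsub>map site_module ss ! k\<^esub> encode (ss ! k) x' = encode (ss ! k) (scale_state c x')"
        using 2(3) xs by (simp add: site_module_simps ract_simps[OF compatible_singleton])
      show ?thesis unfolding 2(1) xs e upd[OF xs(1) 2(3)]
        using 2(3) xs by (simp add: linear_extension_diff tensor_map_encodes site_states_update box_states_scale
            tensor_state_update ss_lengths scale_state_simps)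
    qed
    with fc show "f \<in> ?N" by simp
  qed
  ultimately show ?thesis using assms tensor_relations_least by blast
qed

text \<open>Modulo the relations, a pure tensor is the combination of tensors of basis vectors predicted by
  multilinearity; the entries of the tuple are replaced by basis vectors one position at a time.\<close>

lemma pure_tensor_expansion:
  assumes "site_states ss xs"
  shows "Poly_Mapping.single (encodes ss xs) 1 - basis_combination (tensor_state ss xs) \<in> tensor_relations"
proof -
  define R where "R xs = Poly_Mapping.single (encodes ss xs) 1 - basis_combination (tensor_state ss xs)" for xs
  note N = tensor_relations_simps
  \<comment> \<open>n counts the leading positions whose entries are still arbitrary; from position
    n on they are basis vectors. For n = 0 the whole tuple consists of basis vectors and R is
    0.\<close>
  have "R xs \<in> tensor_relations"
    if "site_states ss xs" "n \<le> length ss" "\<And>k. n \<le> k \<Longrightarrow> k < length ss \<Longrightarrow> \<exists>q\<le>m (ss ! k). xs ! k = basis_state ((\<lambda>_. 0)(ss ! k := q))"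
    for n xs
    using that
  proof (induction n arbitrary: xs)
    case 0
    have d: "distinct ss" using ss by (simp add: compatible_def)
    from 0(3) have "\<forall>k. \<exists>q. k < length ss \<longrightarrow> q \<le> m (ss ! k) \<and> xs ! k = basis_state ((\<lambda>_. 0)(ss ! k := q))" by blast
    from choice[OF this] obtain q where q: "\<And>k. k < length ss \<Longrightarrow> q k \<le> m (ss ! k) \<and> xs ! k = basis_state ((\<lambda>_. 0)(ss ! k := q k))"
      by blast
    \<comment> \<open>The exponents of the single entries are assembled into one exponent vector;
      each site has a unique position because \<open>ss\<close> is distinct.\<close>
    define \<kappa> where "\<kappa> s = (if s \<in> set ss then q (THE k. k < length ss \<and> ss ! k = s) else 0)" for s
    have \<kappa>: "\<kappa> (ss ! k) = q k" if "k < length ss" for k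
    proof -
      have "(THE k'. k' < length ss \<and> ss ! k' = ss ! k) = k"
        using that d by (intro the_equality) (auto simp: nth_eq_iff_index_eq)
      then show ?thesis using that by (simp add: \<kappa>_def)
    qed
    have box: "\<kappa> \<in> box m ss"
    proof -
      have "\<kappa> s \<le> m s" if "s \<in> set ss" for s using that \<kappa> q by (metis in_set_conv_nth)
      then show ?thesis by (auto simp: box_def \<kappa>_def)
    qed
    have xs: "xs = basis_tuple ss \<kappa>"
      using 0(1) q by (intro nth_equalityI) (auto simp: \<kappa> ss_lengths)
    have "basis_combination (tensor_state ss xs) = Poly_Mapping.single (encodes ss xs) 1"
    proof -
      have "basis_combination (basis_state \<kappa>) = (\<Sum>\<kappa>'\<in>box m ss. if \<kappa>' = \<kappa> then Poly_Mapping.single (encodes ss (basis_tuple ss \<kappa>)) 1 else 0)"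
        unfolding basis_combination_def by (intro sum.cong) (auto simp: basis_state_def)
      then show ?thesis unfolding xs tensor_state_basis[OF d box] using box by (simp add: finite_box)
    qed
    then show ?case using N(2) by (simp add: R_def)
  next
    case (Suc n)
    \<comment> \<open>The vectors that may stand at position n form a subspace. By the induction
      hypothesis it contains the basis vectors, hence also the given entry.\<close>
    define S where "S = {x \<in> box_states m [ss ! n]. R (xs[n := x]) \<in> tensor_relations}"
    have n: "n < length ss" "n < length xs" using Suc.prems by (auto simp: ss_lengths)
    have len: "length xs = length ss" using Suc.prems(1) by (rule ss_lengths)
    have add: "x + y \<in> S" if "x \<in> S" "y \<in> S" for x y
    proof -
      have "R (xs[n := x + y]) = (Poly_Mapping.single (encodes ss (xs[n := x + y])) 1
        - Poly_Mapping.single (encodes ss (xs[n := x])) 1 - Poly_Mapping.single (encodes ss (xs[n := y])) 1)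
        + (R (xs[n := x]) + R (xs[n := y]))"
        unfolding R_def by (simp add: tensor_state_update[OF n(1) len] basis_combination_simps algebra_simps)
      also have "\<dots> \<in> tensor_relations"
        using that by (intro N(3) tensor_relation_elements[OF Suc.prems(1) n(1)]) (auto simp: S_def)
      finally show ?thesis using that by (simp add: S_def box_states_add)
    qed
    have scale: "scale_state c x \<in> S" if "x \<in> S" for c x
    proof -
      have "R (xs[n := scale_state c x]) = (Poly_Mapping.single (encodes ss (xs[n := scale_state c x])) 1
        - Poly_Mapping.single (encodes ss (xs[n := x])) c) + Poly_Mapping.map ((*) c) (R (xs[n := x]))"
        unfolding R_def by (simp add: tensor_state_update[OF n(1) len] basis_combination_simps map_times_simps)
      also have "\<dots> \<in> tensor_relations"
        using that by (intro N(3) N(4) tensor_relation_elements[OF Suc.prems(1) n(1)]) (auto simp: S_def)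
      finally show ?thesis using that by (simp add: S_def box_states_scale)
    qed
    have basis: "basis_state \<kappa> \<in> S" if "\<kappa> \<in> box m [ss ! n]" for \<kappa>
    proof -
      have \<kappa>: "\<kappa> = (\<lambda>_. 0)(ss ! n := \<kappa> (ss ! n))" "\<kappa> (ss ! n) \<le> m (ss ! n)" using that by (auto simp: box_def)
      have b: "basis_state \<kappa> \<in> box_states m [ss ! n]" by (rule basis_state_in_box[OF that])
      have "R (xs[n := basis_state \<kappa>]) \<in> tensor_relations"
      proof (rule Suc.IH[OF site_states_update[OF Suc.prems(1) b]])
        fix k assume k: "n \<le> k" "k < length ss"
        show "\<exists>q\<le>m (ss ! k). xs[n := basis_state \<kappa>] ! k = basis_state ((\<lambda>_. 0)(ss ! k := q))"
        proof (cases "k = n")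
          case True
          have "xs[n := basis_state \<kappa>] ! n = basis_state ((\<lambda>_. 0)(ss ! n := \<kappa> (ss ! n)))"
            using n(2) \<kappa>(1) by simp
          then show ?thesis unfolding True using \<kappa>(2) by blast
        next
          case False
          then have "Suc n \<le> k" using k(1) by simp
          from Suc.prems(3)[OF this k(2)] show ?thesis unfolding nth_list_update_neq[OF False[symmetric]] .
        qed
      qed (use n in simp)
      then show ?thesis using b by (simp add: S_def)
    qed
    have "0 \<in> S" using scale[OF basis[OF zero_in_box], of 0] by (simp add: scale_state_simps)
    have sum: "(\<Sum>\<kappa>\<in>A. scale_state (c \<kappa>) (basis_state \<kappa>)) \<in> S" if "A \<subseteq> box m [ss ! n]" for A c
      using that by (induction A rule: infinite_finite_induct) (auto simp: \<open>0 \<in> S\<close> intro!: add scale basis)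
    have "xs ! n \<in> box_states m [ss ! n]" using Suc.prems(1) n by (auto simp: list_all2_conv_all_nth)
    from basis_state_expansion[OF this] sum[OF order.refl, of "xs ! n"] have "xs ! n \<in> S" by metis
    then show ?case by (simp add: S_def)
  qed
  from this[of xs "length ss"] assms show ?thesis by (simp add: R_def)
qed

text \<open>It follows that an element killed by \<open>tensor_map\<close> lies in the relations;
  together with \<open>tensor_map_relations\<close> this determines the kernel.\<close>

lemma tensor_expansion:
  assumes "f \<in> carrier (free_space (map site_module ss))"
  shows "f - basis_combination (tensor_map f) \<in> tensor_relations"
proof -
  note N = tensor_relations_simps
  define g where "g vs = Poly_Mapping.single vs (Poly_Mapping.lookup f vs)" for vs
  have "(\<Sum>vs\<in>A. g vs) - basis_combination (tensor_map (\<Sum>vs\<in>A. g vs)) \<in> tensor_relations" if "A \<subseteq> tuples (map site_module ss)" for A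
    using that
  proof (induction A rule: infinite_finite_induct)
    case (insert vs A)
    obtain xs where xs: "site_states ss xs" "vs = encodes ss xs" using insert.prems tuples_site_modules by blast
    let ?c = "Poly_Mapping.lookup f vs"
    have "g vs - basis_combination (tensor_map (g vs))
      = Poly_Mapping.map ((*) ?c) (Poly_Mapping.single (encodes ss xs) 1 - basis_combination (tensor_state ss xs))"
      by (simp add: g_def xs tensor_map_encodes map_times_simps basis_combination_simps)
    then have "g vs - basis_combination (tensor_map (g vs)) \<in> tensor_relations"
      using N(4)[OF pure_tensor_expansion[OF xs(1)]] by simp
    from N(3)[OF this insert.IH] insert show ?case
      by (simp add: linear_extension_add basis_combination_simps algebra_simps)
  qed (use N(2) in \<open>simp_all add: linear_extension_0 basis_combination_simps\<close>)
  from this[of "Poly_Mapping.keys f"] assms show ?thesis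
    by (simp add: g_def poly_mapping_sum_single[symmetric] free_space_simps)
qed

lemma tensor_map_basis_combination:
  assumes "\<psi> \<in> box_states m ss"
  shows "tensor_map (basis_combination \<psi>) = \<psi>" "basis_combination \<psi> \<in> carrier (free_space (map site_module ss))"
proof -
  have d: "distinct ss" using ss by (simp add: compatible_def)
  have "tensor_map (basis_combination \<psi>) = (\<Sum>\<kappa>\<in>box m ss. scale_state (\<psi> \<kappa>) (basis_state \<kappa>))"
    unfolding basis_combination_def linear_extension_sum
    by (intro sum.cong) (simp_all add: tensor_map_encodes basis_tuple_states tensor_state_basis[OF d])
  then show "tensor_map (basis_combination \<psi>) = \<psi>" using basis_state_expansion[OF assms] by simp
  interpret F: left_module "free_space (map site_module ss) :: ('k, _) module" by (rule free_space_left_module)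
  have "(\<Sum>\<kappa>\<in>A. Poly_Mapping.single (encodes ss (basis_tuple ss \<kappa>)) (\<psi> \<kappa>)) \<in> carrier (free_space (map site_module ss))"
    if "A \<subseteq> box m ss" for A
    using that
  proof (induction A rule: infinite_finite_induct)
    case (insert \<kappa> A)
    have "encodes ss (basis_tuple ss \<kappa>) \<in> tuples (map site_module ss)"
      using insert.prems basis_tuple_states tuples_site_modules by blast
    then have "Poly_Mapping.single (encodes ss (basis_tuple ss \<kappa>)) (\<psi> \<kappa>) \<in> carrier (free_space (map site_module ss))"
      by (auto simp: free_space_simps)
    then show ?case
      using F.add.m_closed insert.IH insert.prems
      by (simp only: sum.insert[OF insert.hyps] free_space_simps(2) insert_subset simp_thms)
  qed (simp_all add: free_space_simps)
  then show "basis_combination \<psi> \<in> carrier (free_space (map site_module ss))" by (simp add: basis_combination_def)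
qed

lemma tensor_map_box:
  assumes "f \<in> carrier (free_space (map site_module ss))"
  shows "tensor_map f \<in> box_states m ss"
proof -
  have "(\<Sum>vs\<in>A. scale_state (c vs) (tensor_state ss (map2 decode ss vs))) \<in> box_states m ss"
    if "A \<subseteq> tuples (map site_module ss)" for A c
    using that
  proof (induction A rule: infinite_finite_induct)
    case (insert vs A)
    obtain xs where "site_states ss xs" "vs = encodes ss xs" using insert.prems tuples_site_modules by blast
    then have "tensor_state ss (map2 decode ss vs) \<in> box_states m ss" by (simp add: decodes_encodes tensor_state_box)
    then show ?case using insert by (simp add: box_states_add box_states_scale)
  qed (simp_all add: box_states_0)
  then show ?thesis using assms by (simp add: linear_extension_def free_space_simps)
qed

lemma comult_action_encodes:
  assumes xs: "site_states ss xs"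
  shows "comult_action (map site_module ss) i j r (encodes ss xs) =
     (\<Sum>ks\<in>{ks. length ks = Suc (length ss) \<and> hd ks = i \<and> last ks = j}.
      \<Sum>rs\<in>{rs. length rs = length ss \<and> sum_list rs = r}.
        Poly_Mapping.single (encodes ss
          (map (\<lambda>n. chain_op [ss ! n] (ks ! n) (ks ! Suc n) (rs ! n) (xs ! n)) [0..<length ss])) 1)"
proof -
  have len: "length xs = length ss" using xs by (rule ss_lengths)
  have "map (\<lambda>n. rt (ks ! n) (ks ! Suc n) (rs ! n) \<odot>\<^bsub>map site_module ss ! n\<^esub> (encodes ss xs ! n)) [0..<length (map site_module ss)]
    = encodes ss (map (\<lambda>n. chain_op [ss ! n] (ks ! n) (ks ! Suc n) (rs ! n) (xs ! n)) [0..<length ss])" for ks rs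
    using xs len by (intro nth_equalityI)
      (simp_all add: list_all2_conv_all_nth site_module_simps ract_simps[OF compatible_singleton] del: chain_op.simps)
  then show ?thesis unfolding comult_action_def by simp
qed

lemma chain_op_tuple_states:
  "site_states ss xs \<Longrightarrow> site_states ss (map (\<lambda>n. chain_op [ss ! n] (i n) (j n) (r n) (xs ! n)) [0..<length ss])"
  by (auto simp: list_all2_conv_all_nth intro!: chain_op_box_states simp del: chain_op.simps)

text \<open>\<open>tensor_map\<close> induces an isomorphism of vector spaces from the tensor space
  onto the box states. Transporting the chain module along its inverse gives the action on the
  carrier that \<open>is_tensor_product\<close> prescribes.\<close>

lemma tensor_product_exists:
  "\<exists>T. is_tensor_product (map site_module ss) T \<and> module_isomorphic (chain_module ss) T"
proof -
  let ?Ms = "map site_module ss"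
  let ?F = "free_space ?Ms :: ('k, 'k restricted_gl2 set list \<Rightarrow>\<^sub>0 'k) module"
  let ?S = "tensor_space ?Ms"
  \<comment> \<open>The box states as a module over the field only, since the tensor space carries
    no action of the restricted Yangian yet.\<close>
  define B :: "('k, 'k state) module"
    where "B = \<lparr>carrier = box_states m ss, mult = undefined, one = undefined, zero = 0, add = (+), smult = scale_state\<rparr>"
  have Bs: "carrier B = box_states m ss" "x \<oplus>\<^bsub>B\<^esub> y = x + y" "\<zero>\<^bsub>B\<^esub> = 0" "c \<odot>\<^bsub>B\<^esub> x = scale_state c x" for x y c
    by (simp_all add: B_def)
  have B: "left_module B"
    by (rule left_moduleI) (simp_all add: Bs box_states_add box_states_0 box_states_scale scale_state_simps algebra_simps)
  interpret F: left_module ?F by (rule free_space_left_module)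
  note Q = quotient_module_simps[OF free_space_left_module tensor_relations_submodule, folded tensor_space_def]
  have S: "left_module ?S"
    unfolding tensor_space_def by (rule quotient_module_left_module[OF free_space_left_module tensor_relations_submodule])
  interpret S: left_module ?S by (rule S)
  obtain \<psi> where \<psi>: "\<And>x. x \<in> carrier ?F \<Longrightarrow> \<psi> (tensor_relations +>\<^bsub>?F\<^esub> x) = tensor_map x"
    "bij_betw \<psi> (carrier ?S) (carrier B)"
    "\<And>X Y. X \<in> carrier ?S \<Longrightarrow> Y \<in> carrier ?S \<Longrightarrow> \<psi> (X \<oplus>\<^bsub>?S\<^esub> Y) = \<psi> X \<oplus>\<^bsub>B\<^esub> \<psi> Y"
    "\<And>a X. X \<in> carrier ?S \<Longrightarrow> \<psi> (a \<odot>\<^bsub>?S\<^esub> X) = a \<odot>\<^bsub>B\<^esub> \<psi> X"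
  proof (rule quotient_module_isomorphism[OF free_space_left_module tensor_relations_submodule B, of tensor_map, folded tensor_space_def])
    show "tensor_map ` carrier ?F = carrier B"
      using tensor_map_box tensor_map_basis_combination by (force simp: Bs image_iff)
    show "tensor_map x = \<zero>\<^bsub>B\<^esub> \<longleftrightarrow> x \<in> tensor_relations" if "x \<in> carrier ?F" for x
      using tensor_expansion[OF that] tensor_map_relations[of x] by (auto simp: Bs basis_combination_simps)
    show "tensor_map (x \<oplus>\<^bsub>?F\<^esub> y) = tensor_map x \<oplus>\<^bsub>B\<^esub> tensor_map y"
      "tensor_map (c \<odot>\<^bsub>?F\<^esub> x) = c \<odot>\<^bsub>B\<^esub> tensor_map x" for x y c
      by (simp_all add: free_space_simps Bs linear_extension_add linear_extension_map_times)
  qed blast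
  define \<theta> where "\<theta> = the_inv_into (carrier ?S) \<psi>"
  have inj: "inj_on \<psi> (carrier ?S)" and im: "\<psi> ` carrier ?S = box_states m ss"
    using \<psi>(2) by (simp_all add: bij_betw_def Bs)
  have \<theta>\<psi>: "\<theta> (\<psi> X) = X" if "X \<in> carrier ?S" for X
    unfolding \<theta>_def by (rule the_inv_into_f_f[OF inj that])
  have inj\<theta>: "inj_on \<theta> (carrier (chain_module ss))" and im\<theta>: "\<theta> ` box_states m ss = carrier ?S"
    using \<theta>\<psi> unfolding im[symmetric] chain_module_simps by (auto intro!: inj_onI simp: image_image)
  have \<theta>_map: "\<theta> (tensor_map f) = tensor_class ?Ms f" if "f \<in> carrier ?F" for f
    using \<theta>\<psi>[of "tensor_relations +>\<^bsub>?F\<^esub> f"] \<psi>(1)[OF that] that by (simp add: Q tensor_class_def)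
  define T where "T = transport_module \<theta> (chain_module ss)"
  note c = transport_module_carrier_zero[of \<theta> "chain_module ss", folded T_def, unfolded chain_module_simps]
  note t = transport_module_simps[OF inj\<theta>, folded T_def, unfolded chain_module_simps]
  have "is_tensor_product ?Ms T"
    unfolding is_tensor_product_def
  proof (intro conjI ballI allI)
    show "left_module T" unfolding T_def by (rule transport_left_module[OF inj\<theta> chain_left_module[OF ss]])
    show cT: "carrier T = carrier ?S" by (simp add: c im\<theta>)
    have 0: "0 \<in> carrier ?F" by (simp add: free_space_simps)
    show "\<zero>\<^bsub>T\<^esub> = \<zero>\<^bsub>?S\<^esub>"
      using \<theta>_map[OF 0] by (simp add: c Q(2) tensor_class_def free_space_simps linear_extension_0)
    show "X \<oplus>\<^bsub>T\<^esub> Y = X \<oplus>\<^bsub>?S\<^esub> Y" if "X \<in> carrier T" "Y \<in> carrier T" for X Y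
    proof -
      have XY: "X \<in> carrier ?S" "Y \<in> carrier ?S" using that cT by simp_all
      then have "\<psi> X \<in> box_states m ss" "\<psi> Y \<in> box_states m ss" using im by blast+
      then have "\<theta> (\<psi> X) \<oplus>\<^bsub>T\<^esub> \<theta> (\<psi> Y) = \<theta> (\<psi> X + \<psi> Y)" by (rule t(1))
      also have "\<psi> X + \<psi> Y = \<psi> (X \<oplus>\<^bsub>?S\<^esub> Y)" using \<psi>(3)[OF XY] by (simp add: Bs)
      finally show ?thesis using XY by (simp add: \<theta>\<psi>)
    qed
    show "rscal d \<odot>\<^bsub>T\<^esub> X = d \<odot>\<^bsub>?S\<^esub> X" if "X \<in> carrier T" for d X
    proof -
      have X: "X \<in> carrier ?S" using that cT by simp
      then have \<psi>X: "\<psi> X \<in> box_states m ss" using im by blast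
      then have "rscal d \<odot>\<^bsub>T\<^esub> \<theta> (\<psi> X) = \<theta> (scale_state d (\<psi> X))" using t(2) by (simp add: ract_simps[OF ss])
      also have "scale_state d (\<psi> X) = \<psi> (d \<odot>\<^bsub>?S\<^esub> X)" using \<psi>(4)[OF X] by (simp add: Bs)
      finally show ?thesis using X S.smult_closed[OF X] by (simp add: \<theta>\<psi>)
    qed
    show "rt i j r \<odot>\<^bsub>T\<^esub> tensor_class ?Ms (Poly_Mapping.single vs 1) = tensor_class ?Ms (comult_action ?Ms i j r vs)"
      if "vs \<in> tuples ?Ms" for i j r vs
    proof -
      obtain xs where xs: "site_states ss xs" "vs = encodes ss xs" using \<open>vs \<in> tuples ?Ms\<close> tuples_site_modules by blast
      have single: "Poly_Mapping.single vs (1 :: 'k) \<in> carrier ?F" using that by (simp add: free_space_simps)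
      have box: "tensor_state ss xs \<in> box_states m ss" by (rule tensor_state_box[OF xs(1)])
      have com: "comult_action ?Ms i j r vs \<in> carrier ?F"
      proof -
        have cl: "(\<Sum>k\<in>A. g k) \<in> carrier ?F" if "\<And>k. k \<in> A \<Longrightarrow> g k \<in> carrier ?F" for A :: "'x set" and g
          using that
        proof (induction A rule: infinite_finite_induct)
          case (insert x A)
          then have "g x \<oplus>\<^bsub>?F\<^esub> (\<Sum>k\<in>A. g k) \<in> carrier ?F" by (intro F.add.m_closed) auto
          then show ?case using insert.hyps by (simp add: free_space_simps(2))
        qed (use 0 in simp_all)
        have "Poly_Mapping.single (encodes ss (map (\<lambda>n. chain_op [ss ! n] (ks ! n) (ks ! Suc n) (rs ! n) (xs ! n)) [0..<length ss])) (1 :: 'k)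
            \<in> carrier ?F" for ks rs
        proof -
          have "encodes ss (map (\<lambda>n. chain_op [ss ! n] (ks ! n) (ks ! Suc n) (rs ! n) (xs ! n)) [0..<length ss]) \<in> tuples ?Ms"
            unfolding tuples_site_modules
            using chain_op_tuple_states[OF xs(1), of "\<lambda>n. ks ! n" "\<lambda>n. ks ! Suc n" "\<lambda>n. rs ! n"] by blast
          then show ?thesis by (simp add: free_space_simps del: chain_op.simps)
        qed
        then show ?thesis unfolding xs(2) comult_action_encodes[OF xs(1)] by (intro cl)
      qed
      have d: "distinct ss" using ss by (simp add: compatible_def)
      have "tensor_class ?Ms (Poly_Mapping.single vs 1) = \<theta> (tensor_state ss xs)"
        using \<theta>_map[OF single] by (simp add: xs tensor_map_encodes scale_state_simps)
      then have "rt i j r \<odot>\<^bsub>T\<^esub> tensor_class ?Ms (Poly_Mapping.single vs 1) = \<theta> (chain_op ss i j r (tensor_state ss xs))"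
        using t(2)[OF box] by (simp add: ract_simps[OF ss box])
      also have "chain_op ss i j r (tensor_state ss xs) = tensor_map (comult_action ?Ms i j r vs)"
        unfolding xs(2) comult_action_encodes[OF xs(1)] chain_op_tensor_state[OF d ss_lengths[OF xs(1)]]
        by (simp only: linear_extension_sum tensor_map_encodes[OF chain_op_tuple_states[OF xs(1)]] scale_state_simps)
      finally show ?thesis by (simp add: \<theta>_map[OF com])
    qed
  qed
  then show ?thesis using transport_module_isomorphic[OF inj\<theta>] unfolding T_def by blast
qed

end

end

section \<open>Restricted polynomials\<close>

lemma finite_dimensional_isomorphic:
  assumes M: "left_module M" and N: "left_module N" and iso: "module_isomorphic M N" and fin: "finite_dimensional N"
  shows "finite_dimensional M"
proof -
  interpret M: left_module M by (rule M)
  interpret N: left_module N by (rule N)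
  obtain \<phi> where \<phi>: "bij_betw \<phi> (carrier M) (carrier N)"
    "\<And>x y. x \<in> carrier M \<Longrightarrow> y \<in> carrier M \<Longrightarrow> \<phi> (x \<oplus>\<^bsub>M\<^esub> y) = \<phi> x \<oplus>\<^bsub>N\<^esub> \<phi> y"
    "\<And>a x. x \<in> carrier M \<Longrightarrow> \<phi> (a \<odot>\<^bsub>M\<^esub> x) = a \<odot>\<^bsub>N\<^esub> \<phi> x"
    using iso unfolding module_isomorphic_def by blast
  have inj: "inj_on \<phi> (carrier M)" and im: "\<phi> ` carrier M = carrier N" using \<phi>(1) by (auto simp: bij_betw_def)
  have closed: "\<phi> x \<in> carrier N" if "x \<in> carrier M" for x using im that by blast
  have zero: "\<phi> \<zero>\<^bsub>M\<^esub> = \<zero>\<^bsub>N\<^esub>"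
    using \<phi>(3)[OF M.zero_closed, of 0] M.smult_zero_left[OF M.zero_closed] N.smult_zero_left[OF closed[OF M.zero_closed]] by simp
  have sum: "\<phi> (\<Oplus>\<^bsub>M\<^esub>b\<in>A. h b) = (\<Oplus>\<^bsub>N\<^esub>b\<in>A. \<phi> (h b))" if "finite A" "h \<in> A \<rightarrow> carrier M" for A h
    using that
  proof (induction A rule: finite_induct)
    case (insert x A)
    then have "h \<in> A \<rightarrow> carrier M" "h x \<in> carrier M" "(\<lambda>b. \<phi> (h b)) \<in> A \<rightarrow> carrier N" by (auto intro: closed)
    with insert show ?case by (simp add: M.finsum_insert N.finsum_insert \<phi>(2) M.finsum_closed closed)
  qed (simp add: zero)
  obtain B where B: "finite B" "B \<subseteq> carrier N"
    "\<And>x. x \<in> carrier N \<Longrightarrow> \<exists>c. x = (\<Oplus>\<^bsub>N\<^esub>b\<in>B. rscal (c b) \<odot>\<^bsub>N\<^esub> b)"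
    using fin unfolding finite_dimensional_def by blast
  define B' where "B' = {x \<in> carrier M. \<phi> x \<in> B}"
  have B': "\<phi> ` B' = B" "inj_on \<phi> B'" "B' \<subseteq> carrier M"
    using B(2) im inj by (auto simp: B'_def image_iff inj_on_def)
  then have fB': "finite B'" using B(1) finite_imageD by blast
  have "\<exists>c. x = (\<Oplus>\<^bsub>M\<^esub>b\<in>B'. rscal (c b) \<odot>\<^bsub>M\<^esub> b)" if x: "x \<in> carrier M" for x
  proof -
    obtain c where c: "\<phi> x = (\<Oplus>\<^bsub>N\<^esub>b\<in>B. rscal (c b) \<odot>\<^bsub>N\<^esub> b)" using B(3)[OF closed[OF x]] by blast
    let ?s = "\<Oplus>\<^bsub>M\<^esub>b\<in>B'. rscal (c (\<phi> b)) \<odot>\<^bsub>M\<^esub> b"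
    have mem: "(\<lambda>b. rscal (c (\<phi> b)) \<odot>\<^bsub>M\<^esub> b) \<in> B' \<rightarrow> carrier M" using B'(3) by (auto intro: M.smult_closed)
    have "\<phi> ?s = (\<Oplus>\<^bsub>N\<^esub>b\<in>B'. rscal (c (\<phi> b)) \<odot>\<^bsub>N\<^esub> \<phi> b)"
      unfolding sum[OF fB' mem] using B'(3) closed by (intro N.finsum_cong') (auto simp: \<phi>(3) intro: N.smult_closed)
    also have "\<dots> = (\<Oplus>\<^bsub>N\<^esub>b\<in>\<phi> ` B'. rscal (c b) \<odot>\<^bsub>N\<^esub> b)"
      using B'(3) closed by (intro N.finsum_reindex[OF _ B'(2), symmetric]) (auto intro: N.smult_closed)
    finally have "\<phi> ?s = \<phi> x" using c B'(1) by simp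
    then show ?thesis using inj_onD[OF inj _ M.finsum_closed[OF mem] x] by metis
  qed
  then show ?thesis using fB' B'(3) unfolding finite_dimensional_def by blast
qed

lemma inj_basis_state: "inj (basis_state :: _ \<Rightarrow> 'k::field state)"
proof (rule injI)
  fix \<kappa> \<kappa>' assume "basis_state \<kappa> = (basis_state \<kappa>' :: 'k state)"
  then have "basis_state \<kappa> \<kappa> = (basis_state \<kappa>' \<kappa> :: 'k)" by simp
  then show "\<kappa> = \<kappa>'" by (simp add: basis_state_def split: if_splits)
qed

lemma (in restricted_weights) chain_module_finite_dimensional:
  assumes ss: "compatible ss"
  shows "finite_dimensional (chain_module ss)"
proof -
  interpret left_module "chain_module ss" by (rule chain_left_module[OF ss])
  have sum: "finsum (chain_module ss) h A = sum h A" if "finite A" "h \<in> A \<rightarrow> box_states m ss" for A :: "'k state set" and h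
    using that by (induction A rule: finite_induct) (simp_all add: finsum_insert chain_module_simps Pi_iff)
  let ?B = "basis_state ` box m ss :: 'k state set"
  have B: "?B \<subseteq> box_states m ss" by (auto intro: basis_state_in_box)
  have "\<exists>c. x = (\<Oplus>\<^bsub>chain_module ss\<^esub>b\<in>?B. rscal (c b) \<odot>\<^bsub>chain_module ss\<^esub> b)" if "x \<in> box_states m ss" for x
  proof (rule exI[of _ "x \<circ> the_inv basis_state"])
    have "(\<Oplus>\<^bsub>chain_module ss\<^esub>b\<in>?B. rscal ((x \<circ> the_inv basis_state) b) \<odot>\<^bsub>chain_module ss\<^esub> b)
       = (\<Sum>b\<in>?B. rscal ((x \<circ> the_inv basis_state) b) \<odot>\<^bsub>chain_module ss\<^esub> b)"
      using B by (intro sum finite_imageI finite_box) (auto simp: chain_module_simps intro!: ract_simps(7)[OF ss] basis_state_in_box)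
    also have "\<dots> = (\<Sum>\<kappa>\<in>box m ss. scale_state (x \<kappa>) (basis_state \<kappa>))"
      by (subst sum.reindex[OF inj_on_subset[OF inj_basis_state]])
         (auto simp: chain_module_simps ract_simps[OF ss] basis_state_in_box the_inv_f_f[OF inj_basis_state] intro!: sum.cong)
    also have "\<dots> = x" using basis_state_expansion[OF that] by simp
    finally show "x = (\<Oplus>\<^bsub>chain_module ss\<^esub>b\<in>?B. rscal ((x \<circ> the_inv basis_state) b) \<odot>\<^bsub>chain_module ss\<^esub> b)" by simp
  qed
  then show ?thesis
    unfolding finite_dimensional_def using B by (intro exI[of _ ?B]) (simp add: chain_module_simps finite_box)
qed

text \<open>As the constant term is 1, no root is 0, and the linear factor belonging to a root z can
  be normalised to 1 - X/z.\<close>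

lemma polynomial_linear_factors:
  fixes l :: "'k::alg_closed_field poly"
  assumes "coeff l 0 = 1"
  shows "\<exists>xs. l = (\<Prod>x\<leftarrow>xs. [:1, x:])"
  using assms
proof (induction "degree l" arbitrary: l rule: less_induct)
  case less
  show ?case
  proof (cases "degree l = 0")
    case True
    then have "l = 1" using less.prems by (metis degree_eq_zeroE coeff_pCons_0 one_pCons)
    then show ?thesis by (intro exI[of _ "[]"]) simp
  next
    case False
    then obtain z where z: "poly l z = 0" using alg_closed_imp_poly_has_root[of l] by auto
    then obtain q where q: "l = [:- z, 1:] * q" by (auto simp: poly_eq_0_iff_dvd dvd_def)
    have z0: "- z * coeff q 0 = 1" using less.prems by (simp add: q)
    then have "z \<noteq> 0" by auto
    then have l: "l = [:1, - inverse z:] * Polynomial.smult (- z) q" by (simp add: q Polynomial.smult_add_right)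
    have "degree l = Suc (degree (Polynomial.smult (- z) q))"
      using less.prems \<open>z \<noteq> 0\<close> unfolding l by (subst degree_mult_eq) auto
    then obtain xs where "Polynomial.smult (- z) q = (\<Prod>x\<leftarrow>xs. [:1, x:])" using less.hyps[of "Polynomial.smult (- z) q"] z0 by auto
    then show ?thesis using l by (intro exI[of _ "- inverse z # xs"]) simp
  qed
qed

lemma prime_subfield_diff:
  assumes "CHAR('k) > 0" "x \<in> prime_subfield" "y \<in> prime_subfield"
  shows "x - y \<in> (prime_subfield :: 'k::field set)"
proof -
  let ?p = "CHAR('k)"
  obtain i j where ij: "x = of_nat i" "y = of_nat j" "i < ?p" "j < ?p" using assms by (auto simp: prime_subfield_def)
  have "of_nat (i + (?p - j)) = (of_nat i - of_nat j :: 'k)" using ij(4) by (simp add: of_nat_diff)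
  then have "x - y = of_nat ((i + (?p - j)) mod ?p)" by (simp add: ij of_nat_mod_CHAR)
  then show ?thesis using assms(1) by (auto simp: prime_subfield_def)
qed

lemma zero_prime_subfield: "CHAR('k) > 0 \<Longrightarrow> 0 \<in> (prime_subfield :: 'k::field set)"
  by (auto simp: prime_subfield_def intro: image_eqI[of _ _ 0])

text \<open>Clearing denominators in \<open>l(u) l(u - 1) \<cdots> l(u - p + 1) = 1\<close> gives an identity of polynomials, whose
  left hand side vanishes at \<open>-1/x\<close> for every factor \<open>1 + x u\<^sup>-\<^sup>1\<close> of \<open>l\<close>.\<close>

lemma restricted_polynomial_factors:
  fixes l :: "'k::alg_closed_field poly"
  assumes p: "CHAR('k) > 0" and l: "coeff l 0 = 1" "restricted_series (fps_of_poly l)"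
  obtains xs where "set xs \<subseteq> prime_subfield" "l = (\<Prod>x\<leftarrow>xs. [:1, x:])"
proof -
  let ?p = "CHAR('k)"
  define D where "D = (\<Prod>c<?p. [:1, - of_nat c :: 'k:])"
  define E where "E x = (\<Prod>c<?p. [:1, x - of_nat c:])" for x :: 'k
  obtain xs where xs: "l = (\<Prod>x\<leftarrow>xs. [:1, x:])" using polynomial_linear_factors[OF l(1)] by blast
  have "fps_of_poly D ^ length ys * shifted_product ?p (fps_of_poly (\<Prod>x\<leftarrow>ys. [:1, x:])) = fps_of_poly (\<Prod>x\<leftarrow>ys. E x)" for ys
  proof (induction ys)
    case (Cons y ys)
    have "fps_of_poly D ^ length (y # ys) * shifted_product ?p (fps_of_poly (\<Prod>x\<leftarrow>y # ys. [:1, x:]))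
      = (fps_of_poly D * shifted_product ?p (fps_of_poly [:1, y:]))
        * (fps_of_poly D ^ length ys * shifted_product ?p (fps_of_poly (\<Prod>x\<leftarrow>ys. [:1, x:])))"
      by (simp add: fps_of_poly_mult shifted_product_mult mult_ac del: mult_pCons_left)
    then show ?case unfolding Cons shifted_product_linear[of ?p y, folded D_def E_def] by (simp add: fps_of_poly_mult)
  qed (simp add: shifted_product_1)
  from this[of xs] have "fps_of_poly (D ^ length xs) = fps_of_poly (\<Prod>x\<leftarrow>xs. E x)"
    using l(2) by (simp add: xs[symmetric] restricted_series_def fps_of_poly_power)
  then have DE: "D ^ length xs = (\<Prod>x\<leftarrow>xs. E x)" by (simp add: fps_of_poly_eq_iff)
  have "x \<in> prime_subfield" if "x \<in> set xs" for x
  proof (cases "x = 0")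
    case True
    then show ?thesis using zero_prime_subfield[OF p] by simp
  next
    case False
    have "E x dvd (\<Prod>x\<leftarrow>xs. E x)" using that by (intro prod_list_dvd) simp
    moreover have "poly (E x) (- inverse x) = 0"
      unfolding E_def poly_prod using p False by (intro prod_zero bexI[of _ 0]) auto
    ultimately have "poly (D ^ length xs) (- inverse x) = 0" unfolding DE by (auto elim!: dvdE)
    then have "poly D (- inverse x) = 0" by simp
    then obtain c where c: "1 + inverse x * of_nat c = 0" by (auto simp: D_def poly_prod)
    have "x + of_nat c = x * (1 + inverse x * of_nat c)" using False by (simp add: algebra_simps)
    then have "x = 0 - of_nat (c mod ?p)" unfolding c by (simp add: of_nat_mod_CHAR eq_neg_iff_add_eq_0)
    moreover have "of_nat (c mod ?p) \<in> (prime_subfield :: 'k set)"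
      unfolding prime_subfield_def using p by (intro imageI) simp
    ultimately show ?thesis using prime_subfield_diff[OF p zero_prime_subfield[OF p]] by metis
  qed
  then show ?thesis using that xs by blast
qed

text \<open>Pairing each time a minimal remaining residue makes the chain compatible.\<close>

lemma greedy_pairing:
  fixes r :: "'x \<Rightarrow> 'y \<Rightarrow> nat"
  assumes "size A = size B"
  shows "\<exists>ps. mset (map fst ps) = A \<and> mset (map snd ps) = B
    \<and> sorted_wrt (\<lambda>p q. r (fst p) (snd p) \<le> r (fst p) (snd q) \<and> r (fst p) (snd p) \<le> r (fst q) (snd p)) ps"
  using assms
proof (induction "size A" arbitrary: A B)
  case 0
  then show ?case by (intro exI[of _ "[]"]) simp
next
  case (Suc n)
  then have "A \<noteq> {#}" "B \<noteq> {#}" by auto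
  then obtain x0 y0 where "x0 \<in># A" "y0 \<in># B" by (meson multiset_nonemptyE)
  then obtain z where z: "fst z \<in># A" "snd z \<in># B" "\<And>w. fst w \<in># A \<Longrightarrow> snd w \<in># B \<Longrightarrow> r (fst z) (snd z) \<le> r (fst w) (snd w)"
    using ex_has_least_nat[of "\<lambda>w. fst w \<in># A \<and> snd w \<in># B" "(x0, y0)" "\<lambda>w. r (fst w) (snd w)"] by auto
  obtain A' B' where AB: "A = add_mset (fst z) A'" "B = add_mset (snd z) B'" using z(1,2) by (meson multi_member_split)
  obtain ps where ps: "mset (map fst ps) = A'" "mset (map snd ps) = B'"
    "sorted_wrt (\<lambda>p q. r (fst p) (snd p) \<le> r (fst p) (snd q) \<and> r (fst p) (snd p) \<le> r (fst q) (snd p)) ps"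
    using Suc.hyps(1)[of A' B'] Suc.hyps(2) Suc.prems AB by auto
  have "fst q \<in># A \<and> snd q \<in># B" if "q \<in> set ps" for q
  proof -
    have "fst q \<in># mset (map fst ps)" "snd q \<in># mset (map snd ps)" using that by auto
    then show ?thesis unfolding ps AB by simp
  qed
  then have "\<forall>q\<in>set ps. r (fst z) (snd z) \<le> r (fst z) (snd q) \<and> r (fst z) (snd z) \<le> r (fst q) (snd z)"
    using z(1,2) z(3)[of "(fst z, _)"] z(3)[of "(_, snd z)"] by simp
  then show ?case using ps AB by (intro exI[of _ "z # ps"]) simp
qed

lemma prod_linear_replicate_0: "(\<Prod>x\<leftarrow>xs @ replicate n 0. [:1, x:]) = (\<Prod>x\<leftarrow>xs. [:1, x :: 'k::field:])"
  by (induction n) (simp_all add: replicate_app_Cons_same one_pCons[symmetric])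

theorem theorem3p9:
  fixes l1 l2 :: "'k::alg_closed_field poly"
  assumes "CHAR('k) > 0"
    and "restricted_weight (fps_of_poly l1) (fps_of_poly l2)"
  shows "(\<exists>(Ms :: ('k restricted_yangian, 'k restricted_gl2 set) module list) T.
            Ms \<noteq> [] \<and>
            (\<forall>M\<in>set Ms. \<exists>a\<in>prime_subfield. \<exists>b\<in>prime_subfield. is_evaluation_module a b M) \<and>
            is_tensor_product Ms T \<and>
            module_isomorphic (simple_quotient (fps_of_poly l1) (fps_of_poly l2)) T) \<and>
         finite_dimensional (simple_quotient (fps_of_poly l1) (fps_of_poly l2))"
proof -
  let ?P = "prime_subfield :: 'k set"
  let ?lin = "\<lambda>x :: 'k. [:1, x:]"
  have w: "coeff l1 0 = 1" "coeff l2 0 = 1" "restricted_series (fps_of_poly l1)" "restricted_series (fps_of_poly l2)"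
    using assms(2) by (simp_all add: restricted_weight_def)
  obtain xs where xs: "set xs \<subseteq> ?P" "l1 = (\<Prod>x\<leftarrow>xs. ?lin x)"
    by (rule restricted_polynomial_factors[OF assms(1) w(1,3)])
  obtain ys where ys: "set ys \<subseteq> ?P" "l2 = (\<Prod>x\<leftarrow>ys. ?lin x)"
    by (rule restricted_polynomial_factors[OF assms(1) w(2,4)])
  \<comment> \<open>Padding with zeros adds trivial factors 1 and brings both lists to the same
    length, so that they can be paired. The successor keeps the list of tensor factors nonempty even
    if both polynomials are 1.\<close>
  define n where "n = Suc (length xs + length ys)"
  define xs' ys' where "xs' = xs @ replicate (n - length xs) 0" and "ys' = ys @ replicate (n - length ys) 0"
  have zero: "0 \<in> ?P" by (rule zero_prime_subfield[OF assms(1)])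
  have xs': "length xs' = n" "set xs' \<subseteq> ?P" "l1 = (\<Prod>x\<leftarrow>xs'. ?lin x)"
    unfolding xs'_def ys'_def prod_linear_replicate_0 using xs zero by (auto simp: n_def)
  have ys': "length ys' = n" "set ys' \<subseteq> ?P" "l2 = (\<Prod>x\<leftarrow>ys'. ?lin x)"
    unfolding xs'_def ys'_def prod_linear_replicate_0 using ys zero by (auto simp: n_def)
  \<comment> \<open>On the prime field this is the representative in 0, ..., p - 1. Being the least
    one, it gives the bound \<open>res_le\<close>, by which minimality is exploited.\<close>
  define res where "res x = (LEAST k. of_nat k = x)" for x :: 'k
  have res: "of_nat (res x) = x" "res x < CHAR('k)" if x: "x \<in> ?P" for x
  proof -
    obtain k where k: "of_nat k = x" "k < CHAR('k)" using x by (auto simp: prime_subfield_def)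
    show "of_nat (res x) = x" unfolding res_def using k(1) by (rule LeastI)
    have "res x \<le> k" unfolding res_def using k(1) by (rule Least_le)
    then show "res x < CHAR('k)" using k(2) by simp
  qed
  have res_le: "res x \<le> k" if "x = of_nat k" for x k
    unfolding res_def using that by (intro Least_le) simp
  obtain ps where ps: "mset (map fst ps) = mset xs'" "mset (map snd ps) = mset ys'"
    and sorted: "sorted_wrt (\<lambda>p q. res (fst p - snd p) \<le> res (fst p - snd q) \<and> res (fst p - snd p) \<le> res (fst q - snd p)) ps"
    using greedy_pairing[of "mset xs'" "mset ys'" "\<lambda>x y. res (x - y)"] xs'(1) ys'(1) by auto
  have len: "length ps = n" using arg_cong[OF ps(1), of size] xs'(1) by simp
  \<comment> \<open>Weights are functions on all natural numbers; outside the n sites both are 0,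
    which lies in the prime field and gives m s = 0.\<close>
  define a b where "a s = (if s < n then fst (ps ! s) else 0)" and "b s = (if s < n then snd (ps ! s) else 0)" for s
  define m where "m s = res (a s - b s)" for s
  have "fst ` set ps = set xs'" "snd ` set ps = set ys'"
    using arg_cong[OF ps(1), of set_mset] arg_cong[OF ps(2), of set_mset] by simp_all
  then have ab: "a s \<in> ?P" "b s \<in> ?P" for s
    using xs'(2) ys'(2) zero len nth_mem[of s ps] by (auto simp: a_def b_def)
  interpret closed_weights a b m
  proof
    show "a s - b s = of_nat (m s)" "m s < CHAR('k)" for s
      using res[OF prime_subfield_diff[OF assms(1) ab]] by (simp_all add: m_def)
  qed (rule ab)+
  define ss where "ss = [0..<n]"
  have map_ss: "map a ss = map fst ps" "map b ss = map snd ps"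
    by (rule nth_equalityI; simp add: ss_def len a_def b_def)+
  have comp: "compatible ss"
    unfolding compatible_def
  proof
    show "sorted_wrt (\<lambda>s j. \<forall>k<m s. b j \<noteq> a s - of_nat k \<and> a j \<noteq> b s + of_nat k) ss"
      unfolding sorted_wrt_iff_nth_less
    proof (intro allI impI)
      fix i j k assume ij: "i < j" "j < length ss" and k: "k < m (ss ! i)"
      then have ss_ij: "ss ! i = i" "ss ! j = j" "i < n" "j < n" by (auto simp: ss_def)
      then have le: "m i \<le> res (a i - b j)" "m i \<le> res (a j - b i)"
        using sorted ij len by (auto simp: sorted_wrt_iff_nth_less m_def a_def b_def)
      \<comment> \<open>Equality would give a i - b j a residue of at most k, below the minimal
        residue m i.\<close>
      have "b j \<noteq> a i - of_nat k" using le(1) k res_le[of "a i - b j" k] by (auto simp: ss_ij)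
      moreover have "a j \<noteq> b i + of_nat k" using le(2) k res_le[of "a j - b i" k] by (auto simp: ss_ij)
      ultimately show "b (ss ! j) \<noteq> a (ss ! i) - of_nat k \<and> a (ss ! j) \<noteq> b (ss ! i) + of_nat k" by (simp add: ss_ij)
    qed
  qed (simp add: ss_def)
  have prod_mset_eq: "(\<Prod>x\<leftarrow>us. ?lin x) = (\<Prod>x\<leftarrow>vs. ?lin x)" if "mset us = mset vs" for us vs
    using that by (metis mset_map prod_mset_prod_list)
  have hw: "hw1 ss = l1" "hw2 ss = l2"
    using prod_mset_eq[OF ps(1)] prod_mset_eq[OF ps(2)] unfolding hw1_def hw2_def xs'(3) ys'(3)
    by (simp_all add: map_ss[symmetric] comp_def del: mult_pCons_left)
  note iso = simple_quotient_chain[OF comp, unfolded hw]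
  obtain T where T: "is_tensor_product (map site_module ss) T" "module_isomorphic (chain_module ss) T"
    using tensor_product_exists[OF comp] by blast
  show ?thesis
  proof (intro conjI exI)
    show "map site_module ss \<noteq> []" by (simp add: ss_def n_def)
    show "\<forall>M\<in>set (map site_module ss). \<exists>a\<in>prime_subfield. \<exists>b\<in>prime_subfield. is_evaluation_module a b M"
    proof
      fix M assume "M \<in> set (map site_module ss)"
      then obtain s where M: "M = site_module s" by auto
      show "\<exists>a\<in>prime_subfield. \<exists>b\<in>prime_subfield. is_evaluation_module a b M"
        unfolding M by (rule bexI[of _ "a s"], rule bexI[of _ "b s"]) (rule site_evaluation_module ab)+
    qed
    show "is_tensor_product (map site_module ss) T" by (rule T(1))
    show "module_isomorphic (simple_quotient (fps_of_poly l1) (fps_of_poly l2)) T"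
      by (rule module_isomorphic_trans[OF iso(1) T(2)])
    show "finite_dimensional (simple_quotient (fps_of_poly l1) (fps_of_poly l2))"
      by (rule finite_dimensional_isomorphic[OF iso(2) chain_left_module[OF comp] iso(1) chain_module_finite_dimensional[OF comp]])
  qed
qed

end
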